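(* Let $u, B \in C^\infty(\mathbb{R}^3;\mathbb{R}^3)$ and $P \in C^\infty(\mathbb{R}^3)$ be a smooth solution of the stationary Hall-MHD system \[ -\Delta u + (u\cdot\nabla)u = -\nabla P + (B\cdot\nabla)B,\qquad -\Delta B + (u\cdot\nabla)B = (B\cdot\nabla)u + \nabla\times\big((\nabla\times B)\times B\big),\qquad \operatorname{div} u = \operatorname{div} B = 0 \quad\text{in } \mathbb{R}^3 . \] Assume there exist $\Phi, \Psi \in C^\infty(\mathbb{R}^3;\mathbb{R}^{3\times 3})$ with $\nabla\cdot\Phi = u$, $\nabla\cdot\Psi = B$, and a number $s$ with $3 < s \le 6$ and a constant $C>0$ such that \[ \Big(\frac{1}{|B(r)|}\int_{B(r)} |\Phi - \Phi_{B(r)}|^s\,dx\Big)^{1/s} + \Big(\frac{1}{|B(r)|}\int_{B(r)} |\Psi - \Psi_{B(r)}|^s\,dx\Big)^{1/s} \le C\, r^{\frac13 - \frac1s} \qquad \text{for all } r>1. \] Assume in addition that for some $p>3$, \[ \Big(\frac{1}{|B(r)|}\int_{B(r)} |B - B_{B(r)}|^p\,dx\Big)^{1/p} = o\Big(r^{(\frac{2s}{3}+1)(\frac13 - \frac1p)}\Big) \qquad \text{as } r\to\infty . \] Then $u \equiv B \equiv 0$.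
   Context: $B(r)$ denotes the open ball of radius $r$ centered at the origin in $\mathbb{R}^3$ (not to be confused with the magnetic field $B$), $|B(r)|$ its volume, and $f_{E} = \frac{1}{|E|}\int_E f\,dx$ the mean value of $f$ over a measurable set $E$. For a matrix field $\Phi=(\Phi_{ij})$, $\nabla\cdot\Phi$ denotes the vector field obtained by taking the divergence row-wise, $(\nabla\cdot\Phi)_i = \sum_j \partial_j \Phi_{ij}$. *)

theory Defs
  imports "HOL-Analysis.Analysis" "HOL-Library.Landau_Symbols"
begin

definition pd :: "3 \<Rightarrow> (real^3 \<Rightarrow> 'b::real_normed_vector) \<Rightarrow> real^3 \<Rightarrow> 'b" where
  "pd i f x = frechet_derivative f (at x) (axis i 1)"

fun iter_pd :: "3 list \<Rightarrow> (real^3 \<Rightarrow> 'b::real_normed_vector) \<Rightarrow> real^3 \<Rightarrow> 'b" where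
  "iter_pd [] f = f"
| "iter_pd (i # is) f = pd i (iter_pd is f)"

definition smooth3 :: "(real^3 \<Rightarrow> 'b::real_normed_vector) \<Rightarrow> bool" where
  "smooth3 f \<longleftrightarrow> (\<forall>is x. iter_pd is f differentiable (at x))"

definition divg :: "(real^3 \<Rightarrow> real^3) \<Rightarrow> real^3 \<Rightarrow> real" where
  "divg f x = (\<Sum>i\<in>UNIV. pd i (\<lambda>y. f y $ i) x)"

definition grad :: "(real^3 \<Rightarrow> real) \<Rightarrow> real^3 \<Rightarrow> real^3" where
  "grad P x = (\<chi> i. pd i P x)"

definition lap :: "(real^3 \<Rightarrow> real^3) \<Rightarrow> real^3 \<Rightarrow> real^3" where
  "lap f x = (\<chi> k. \<Sum>i\<in>UNIV. pd i (pd i (\<lambda>y. f y $ k)) x)"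

definition adv :: "(real^3 \<Rightarrow> real^3) \<Rightarrow> (real^3 \<Rightarrow> real^3) \<Rightarrow> real^3 \<Rightarrow> real^3" where
  "adv v w x = (\<chi> k. \<Sum>i\<in>UNIV. v x $ i * pd i (\<lambda>y. w y $ k) x)"

definition curl :: "(real^3 \<Rightarrow> real^3) \<Rightarrow> real^3 \<Rightarrow> real^3" where
  "curl f x = vector [pd 2 (\<lambda>y. f y $ 3) x - pd 3 (\<lambda>y. f y $ 2) x,
                      pd 3 (\<lambda>y. f y $ 1) x - pd 1 (\<lambda>y. f y $ 3) x,
                      pd 1 (\<lambda>y. f y $ 2) x - pd 2 (\<lambda>y. f y $ 1) x]"

definition rowdiv :: "(real^3 \<Rightarrow> real^3^3) \<Rightarrow> real^3 \<Rightarrow> real^3" where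
  "rowdiv F x = (\<chi> i. \<Sum>j\<in>UNIV. pd j (\<lambda>y. F y $ i $ j) x)"

text \<open>Mean value over the ball B(r) and the L^q mean oscillation
  ((1/|B(r)|) int_{B(r)} |f - f_{B(r)}|^q)^{1/q}.  Norm on matrices is Frobenius.\<close>
definition ball_mean :: "(real^3 \<Rightarrow> 'b::euclidean_space) \<Rightarrow> real \<Rightarrow> 'b" where
  "ball_mean f r = (1 / measure lebesgue (ball (0::real^3) r)) *\<^sub>R integral (ball 0 r) f"

definition mean_osc :: "(real^3 \<Rightarrow> 'b::euclidean_space) \<Rightarrow> real \<Rightarrow> real \<Rightarrow> real" where
  "mean_osc f r q =
     ((1 / measure lebesgue (ball (0::real^3) r)) *
        integral (ball 0 r) (\<lambda>x. norm (f x - ball_mean f r) powr q)) powr (1 / q)"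

end

theory Submission
  imports Defs
begin

text \<open>Everything is done at unit scale: \<open>U(x) = u(R x)\<close>, \<open>b(x) = B(R x)\<close> solve the system with viscosity
  \<open>\<nu> = 1/R = n^6\<close>, and the potentials, recentred and divided by \<open>R\<close>, have \<open>L^s\<close> norm \<open>O(\<nu>^(2/3+1/s))\<close>.
  One tests the momentum equation with \<open>\<eta> U - v\<close>, \<open>div v = U \<cdot> \<nabla>\<eta>\<close>; the corrector \<open>v\<close> is built from the mollified
  potential plus an explicit Bogovskii-type remainder, so the pressure never has to be estimated.
  With \<open>E(R)\<close> the Dirichlet energy of \<open>(u, B)\<close> on the ball of radius \<open>R\<close> and \<open>\<gamma> = 2(s+6)/9\<close>, the resulting local
  energy inequality is used three times. The oscillation hypothesis on \<open>B\<close> controls the Hall term only above the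
  threshold \<open>E \<ge> \<sigma> R^\<gamma>\<close>; absorption there gives \<open>E(R) = o(R^\<gamma>)\<close>. Below the threshold the Hall term is
  perturbative, so \<open>E(R) \<le> C + E(2R)/16\<close> and \<open>E\<close> is bounded. Boundedness makes the tail energy small, hence the
  scaled \<open>L^3\<close> norm of \<open>(u, B)\<close> tends to \<open>0\<close>, and the inequality gives \<open>E(R) \<rightarrow> 0\<close>, that is \<open>E = 0\<close>.\<close>

section \<open>Partial derivatives\<close>

text \<open>Write the scaled gradient norm as n^3 e, so that e^2 is an energy, and the cut-off L^3
  norm of the fields as n^4 y. Viscosity times energy is then n^12 e^2, and every term but the Hall
  term is bounded with the same factor n^12. Replacing one factor of |U|^3 by the divergence of the
  potential gives y \<le> K e^b with b = 6/(s+6). The non-Hall terms add up to e^(3b): s > 3 means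
  3b < 2, so they can be absorbed, and s \<le> 6 means b \<ge> 1/2, which bounds e^(1+b) by e^(3b).
  Interpolation alone bounds the Hall term by a multiple of n^4 e^b e^2, and n^4 e^b = 1 is e^2 =
  R^\<gamma>; this is the origin of \<gamma>. The obstacle is that the potentials have a controlled
  divergence but no controlled gradient, whereas the viscous term needs the gradient of the
  corrector in L^2. Mollifying at scale \<delta> costs 1/\<delta> there and leaves an error of size
  \<delta> times the gradient of U in the convective term; \<delta> = l n^2 puts both at n^12, and l
  is then tuned to e.\<close>

lemma smooth3_differentiable: "smooth3 f \<Longrightarrow> f differentiable (at x)"
  using iter_pd.simps(1) unfolding smooth3_def by metis

lemma iter_pd_append: "iter_pd (is @ js) f = iter_pd is (iter_pd js f)"
  by (induction "is") auto

lemma smooth3_pd [intro]: "smooth3 f \<Longrightarrow> smooth3 (pd i f)"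
  using iter_pd_append[of _ "[i]" f] unfolding smooth3_def by (metis iter_pd.simps)

lemma smooth3_cont: "smooth3 f \<Longrightarrow> continuous_on S f"
  by (meson continuous_at_imp_continuous_on differentiable_imp_continuous_within smooth3_differentiable)

text \<open>Finite-order smoothness that takes the innermost derivative first.
  \<open>iter_pd\<close> unfolds from the outside, which gives no usable induction hypothesis for
  products and compositions; with \<open>ck\<close> the closure properties are inductions on the
  order with \<open>f\<close> generalised.\<close>

fun ck :: "nat \<Rightarrow> (real^3 \<Rightarrow> 'b::real_normed_vector) \<Rightarrow> bool" where
  "ck 0 f \<longleftrightarrow> (\<forall>x. f differentiable (at x))"
| "ck (Suc n) f \<longleftrightarrow> (\<forall>x. f differentiable (at x)) \<and> (\<forall>i. ck n (pd i f))"

lemma ck_smooth3: "smooth3 f \<Longrightarrow> ck n f"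
  by (induction n arbitrary: f) (auto simp: smooth3_differentiable)

lemma ck_iter: "ck n f \<Longrightarrow> length is \<le> n \<Longrightarrow> iter_pd is f differentiable (at x)"
proof (induction "is" arbitrary: n f rule: rev_induct)
  case Nil then show ?case by (cases n) auto
next
  case (snoc i "is")
  then obtain m where "n = Suc m" by (cases n) auto
  with snoc show ?case by (auto simp: iter_pd_append)
qed

lemma smooth3_iff_ck: "smooth3 f \<longleftrightarrow> (\<forall>n. ck n f)"
  using ck_smooth3 ck_iter unfolding smooth3_def by blast

lemma ck_Suc_D: "ck (Suc n) f \<Longrightarrow> ck n f"
  by (induction n arbitrary: f) auto

lemma ck_diff: "ck n f \<Longrightarrow> f differentiable (at x)"
  by (cases n) auto

lemma pd_eq: "(f has_derivative f') (at x) \<Longrightarrow> pd i f x = f' (axis i 1)"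
  by (metis frechet_derivative_at pd_def)

lemma differentiable_has_fd: "f differentiable (at x) \<Longrightarrow> (f has_derivative frechet_derivative f (at x)) (at x)"
  by (simp add: frechet_derivative_works)

lemma pd_const [simp]: "pd i (\<lambda>x. c) = (\<lambda>x. 0)"
  by (rule ext) (auto simp: pd_eq[OF has_derivative_const])

lemma pd_add: "f differentiable (at x) \<Longrightarrow> g differentiable (at x) \<Longrightarrow>
    pd i (\<lambda>x. f x + g x) x = pd i f x + pd i g x"
  by (subst pd_eq[OF has_derivative_add[OF differentiable_has_fd differentiable_has_fd]]) (auto simp: pd_def)

lemma pd_diff: "f differentiable (at x) \<Longrightarrow> g differentiable (at x) \<Longrightarrow>
    pd i (\<lambda>x. f x - g x) x = pd i f x - pd i g x"
  by (subst pd_eq[OF has_derivative_diff[OF differentiable_has_fd differentiable_has_fd]]) (auto simp: pd_def)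

lemma pd_minus: "f differentiable (at x) \<Longrightarrow> pd i (\<lambda>x. - f x) x = - pd i f x"
  by (subst pd_eq[OF has_derivative_minus[OF differentiable_has_fd]]) (auto simp: pd_def)

lemma pd_mult: "f differentiable (at x) \<Longrightarrow> g differentiable (at x) \<Longrightarrow>
    pd i (\<lambda>x. f x * g x :: real) x = f x * pd i g x + pd i f x * g x"
  by (subst pd_eq[OF has_derivative_mult[OF differentiable_has_fd differentiable_has_fd]]) (auto simp: pd_def)

lemma pd_sum: "(\<And>k. k \<in> K \<Longrightarrow> f k differentiable (at x)) \<Longrightarrow>
    pd i (\<lambda>x. \<Sum>k\<in>K. f k x) x = (\<Sum>k\<in>K. pd i (f k) x)"
  by (subst pd_eq[OF has_derivative_sum[OF differentiable_has_fd]]) (auto simp: pd_def)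

lemma pd_cmult: "f differentiable (at x) \<Longrightarrow> pd i (\<lambda>x. c * f x :: real) x = c * pd i f x"
  by (subst pd_mult) auto

lemma ck_const [simp]: "ck n (\<lambda>x. c)"
  by (induction n arbitrary: c) (auto simp: )

lemma ck_add: "ck n f \<Longrightarrow> ck n g \<Longrightarrow> ck n (\<lambda>x. f x + g x)"
proof (induction n arbitrary: f g)
  case (Suc n)
  then have "pd i (\<lambda>x. f x + g x) = (\<lambda>x. pd i f x + pd i g x)" for i
    by (intro ext pd_add) auto
  with Suc show ?case by auto
qed auto

lemma ck_minus: "ck n f \<Longrightarrow> ck n (\<lambda>x. - f x)"
proof (induction n arbitrary: f)
  case (Suc n)
  then have "pd i (\<lambda>x. - f x) = (\<lambda>x. - pd i f x)" for i
    by (intro ext pd_minus) auto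
  with Suc show ?case by auto
qed auto

lemma ck_mult: "ck n f \<Longrightarrow> ck n g \<Longrightarrow> ck n (\<lambda>x. f x * g x :: real)"
proof (induction n arbitrary: f g)
  case (Suc n)
  then have "pd i (\<lambda>x. f x * g x) = (\<lambda>x. f x * pd i g x + pd i f x * g x)" for i
    by (intro ext pd_mult) auto
  with Suc show ?case using ck_Suc_D[OF Suc.prems(1)] ck_Suc_D[OF Suc.prems(2)]
    by (auto intro!: ck_add)
qed auto

lemma smooth3_const [simp, intro]: "smooth3 (\<lambda>x. c)"
  by (simp add: smooth3_iff_ck)
lemma smooth3_add [intro]: "smooth3 f \<Longrightarrow> smooth3 g \<Longrightarrow> smooth3 (\<lambda>x. f x + g x)"
  by (simp add: smooth3_iff_ck ck_add)
lemma smooth3_minus [intro]: "smooth3 f \<Longrightarrow> smooth3 (\<lambda>x. - f x)"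
  by (simp add: smooth3_iff_ck ck_minus)
lemma smooth3_diff [intro]: "smooth3 f \<Longrightarrow> smooth3 g \<Longrightarrow> smooth3 (\<lambda>x. f x - g x)"
  using smooth3_add[of f "\<lambda>x. - g x"] smooth3_minus[of g] by simp
lemma smooth3_mult [intro]: "smooth3 f \<Longrightarrow> smooth3 g \<Longrightarrow> smooth3 (\<lambda>x. f x * g x :: real)"
  by (simp add: smooth3_iff_ck ck_mult)
lemma smooth3_power [intro]: "smooth3 f \<Longrightarrow> smooth3 (\<lambda>x. f x ^ n :: real)"
  by (induction n) auto
lemma smooth3_sum [intro]: "(\<And>k. k \<in> K \<Longrightarrow> smooth3 (f k)) \<Longrightarrow> smooth3 (\<lambda>x. \<Sum>k\<in>K. f k x)"
  by (induction K rule: infinite_finite_induct) auto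

lemma ck_linear:
  assumes "bounded_linear L" "ck n f" shows "ck n (\<lambda>x. L (f x))"
  using assms(2)
proof (induction n arbitrary: f)
  case 0
  then show ?case using assms(1)
    by (auto simp: differentiable_def intro: bounded_linear.has_derivative)
next
  case (Suc n)
  have d: "((\<lambda>x. L (f x)) has_derivative (\<lambda>h. L (frechet_derivative f (at x) h))) (at x)" for x
    using Suc assms(1) by (auto intro!: bounded_linear.has_derivative[OF assms(1)] differentiable_has_fd)
  then have "pd i (\<lambda>x. L (f x)) = (\<lambda>x. L (pd i f x))" for i
    by (intro ext) (auto simp: pd_eq[OF d] pd_def)
  with Suc d show ?case by (auto simp: differentiable_def)
qed

lemma smooth3_linear: "bounded_linear L \<Longrightarrow> smooth3 f \<Longrightarrow> smooth3 (\<lambda>x. L (f x))"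
  by (simp add: smooth3_iff_ck ck_linear)

lemma smooth3_component [intro]: "smooth3 f \<Longrightarrow> smooth3 (\<lambda>x. f x $ i)"
  by (rule smooth3_linear[OF bounded_linear_vec_nth])

lemma smooth3_coord [simp, intro]: "smooth3 (\<lambda>x. x $ i)" and pd_coord [simp]: "pd j (\<lambda>x. x $ i) x = (if i = j then 1 else 0)"
proof -
  have d: "((\<lambda>x. x $ i) has_derivative (\<lambda>h. h $ i)) (at x)" for x :: "real^3"
    using bounded_linear_vec_nth[of i] by (rule bounded_linear_imp_has_derivative)
  show 1: "pd j (\<lambda>x. x $ i) x = (if i = j then 1 else 0)" for x j
    by (simp add: pd_eq[OF d] axis_def)
  have "ck n (\<lambda>x. x $ i)" for n
  proof (cases n)
    case (Suc m)
    have "pd j (\<lambda>x. x $ i) = (\<lambda>x. if i = j then 1 else 0)" for j using 1 by auto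
    then show ?thesis using d Suc by (auto simp: differentiable_def)
  qed (use d in \<open>auto simp: differentiable_def\<close>)
  then show "smooth3 (\<lambda>x. x $ i)" by (simp add: smooth3_iff_ck)
qed

lemma smooth3_D [simp]: "smooth3 f \<Longrightarrow> f differentiable (at x)" 
  by (rule smooth3_differentiable)

lemma vec3_expand: "(h::real^3) = (\<Sum>i\<in>UNIV. (h $ i) *\<^sub>R axis i 1)"
  by (simp add: basis_expansion scalar_mult_eq_scaleR[symmetric])

lemma has_derivative_pd:
  fixes f :: "real^3 \<Rightarrow> 'b::real_normed_vector"
  assumes "f differentiable (at x)"
  shows "(f has_derivative (\<lambda>h. \<Sum>i\<in>UNIV. h $ i *\<^sub>R pd i f x)) (at x)"
proof -
  note d = differentiable_has_fd[OF assms]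
  then have bl: "bounded_linear (frechet_derivative f (at x))" by (rule has_derivative_bounded_linear)
  have "frechet_derivative f (at x) h = (\<Sum>i\<in>UNIV. h $ i *\<^sub>R pd i f x)" for h
  proof -
    have "frechet_derivative f (at x) h = frechet_derivative f (at x) (\<Sum>i\<in>UNIV. (h $ i) *\<^sub>R axis i 1)"
      using vec3_expand[of h] by simp
    also have "\<dots> = (\<Sum>i\<in>UNIV. h $ i *\<^sub>R pd i f x)"
      using bl by (simp add: linear_sum[OF bounded_linear.linear[OF bl]] linear_cmul[OF bounded_linear.linear[OF bl]] pd_def)
    finally show ?thesis .
  qed
  then have "frechet_derivative f (at x) = (\<lambda>h. \<Sum>i\<in>UNIV. h $ i *\<^sub>R pd i f x)" by auto
  then show ?thesis using d by simp
qed

lemma line_derivative: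
  fixes f :: "real^3 \<Rightarrow> real"
  assumes "\<And>x. f differentiable (at x)"
  shows "((\<lambda>t. f (x + t *\<^sub>R v)) has_real_derivative (\<Sum>i\<in>UNIV. v $ i * pd i f (x + t *\<^sub>R v))) (at t within S)"
proof -
  have "((\<lambda>t. f (x + t *\<^sub>R v)) has_derivative (\<lambda>h. \<Sum>i\<in>UNIV. (h *\<^sub>R v) $ i *\<^sub>R pd i f (x + t *\<^sub>R v))) (at t within S)"
    by (rule has_derivative_compose[OF _ has_derivative_pd[OF assms]])
       (auto intro!: derivative_eq_intros)
  moreover have "(\<lambda>h. \<Sum>i\<in>UNIV. (h *\<^sub>R v) $ i *\<^sub>R pd i f (x + t *\<^sub>R v)) = (*) (\<Sum>i\<in>UNIV. v $ i * pd i f (x + t *\<^sub>R v))"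
    by (auto simp: sum_distrib_right sum_distrib_left mult_ac intro!: sum.cong)
  ultimately show ?thesis by (simp add: has_field_derivative_def)
qed

lemma axis_line_derivative:
  fixes f :: "real^3 \<Rightarrow> real"
  assumes "\<And>x. f differentiable (at x)"
  shows "((\<lambda>t. f (x + t *\<^sub>R axis i 1)) has_real_derivative pd i f (x + t *\<^sub>R axis i 1)) (at t within S)"
  using line_derivative[of f x "axis i 1" t S, OF assms]
  by (simp add: axis_def if_distrib if_distribR sum.delta cong: if_cong)

text \<open>Schwarz' theorem, by differentiating
  \<open>f (y + t e\<^sub>j) = f y + \<integral>\<^sub>0\<^sup>t \<partial>\<^sub>j f (y + r e\<^sub>j) dr\<close> in direction \<open>i\<close> under the integral.\<close>
lemma pd_commute:
  fixes f :: "real^3 \<Rightarrow> real"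
  assumes f: "smooth3 f"
  shows "pd i (pd j f) x = pd j (pd i f) x"
proof -
  let ?p = "\<lambda>s t. x + s *\<^sub>R axis i 1 + t *\<^sub>R axis j (1::real)"
  have ftc: "f (?p s t) = f (?p s 0) + integral (cbox 0 t) (\<lambda>r. pd j f (?p s r))" if "t \<ge> 0" for s t
  proof -
    have "((\<lambda>r. pd j f (?p s r)) has_integral (f (?p s t) - f (?p s 0))) {0..t}"
      by (intro fundamental_theorem_of_calculus that)
         (auto simp: has_real_derivative_iff_has_vector_derivative[symmetric] f intro!: axis_line_derivative)
    then show ?thesis by (auto simp: integral_unique)
  qed
  have c: "continuous_on UNIV (\<lambda>q. pd i (pd j f) (?p (fst q) (snd q)))"
    by (rule continuous_on_compose2[OF smooth3_cont[of "pd i (pd j f)" UNIV]])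
       (auto intro!: continuous_intros f)
  have D1: "((\<lambda>s. integral (cbox 0 t) (\<lambda>r. pd j f (?p s r))) has_real_derivative
        integral (cbox 0 t) (\<lambda>r. pd i (pd j f) (?p 0 r))) (at 0 within UNIV)" for t
  proof (rule leibniz_rule_field_derivative)
    fix s r :: real
    show "((\<lambda>s. pd j f (?p s r)) has_real_derivative pd i (pd j f) (?p s r)) (at s within UNIV)"
      using axis_line_derivative[of "pd j f" "x + r *\<^sub>R axis j 1" i s UNIV] f
      by (simp add: algebra_simps smooth3_pd)
    show "(\<lambda>r. pd j f (?p s r)) integrable_on cbox 0 t"
      by (intro integrable_continuous continuous_on_compose2[OF smooth3_cont[of "pd j f" UNIV]])
         (auto intro!: continuous_intros f)
  next
    show "continuous_on (UNIV \<times> cbox 0 t) (\<lambda>(s, r). pd i (pd j f) (?p s r))"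
      using continuous_on_subset[OF c] by (auto simp: split_beta)
  qed auto
  have eq: "pd i f (?p 0 t) = pd i f (?p 0 0) + integral (cbox 0 t) (\<lambda>r. pd i (pd j f) (?p 0 r))" if t: "t \<ge> 0" for t
  proof -
    have "((\<lambda>s. f (?p s t)) has_real_derivative pd i f (?p 0 t)) (at 0)"
      using axis_line_derivative[of f "x + t *\<^sub>R axis j 1" i 0 UNIV] f by (simp add: algebra_simps)
    moreover have "((\<lambda>s. f (?p s t)) has_real_derivative pd i f (?p 0 0) + integral (cbox 0 t) (\<lambda>r. pd i (pd j f) (?p 0 r))) (at 0)"
      unfolding ftc[OF t] using axis_line_derivative[of f x i 0 UNIV] f D1[of t]
      by (auto intro!: derivative_intros simp: algebra_simps)
    ultimately show ?thesis by (rule DERIV_unique)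
  qed
  have "((\<lambda>t. pd i f (?p 0 t)) has_real_derivative pd j (pd i f) (?p 0 0)) (at 0 within {0..1})"
    using axis_line_derivative[of "pd i f" x j 0 "{0..1}"] f by (simp add: smooth3_pd)
  moreover have "((\<lambda>t. integral {0..t} (\<lambda>r. pd i (pd j f) (?p 0 r))) has_real_derivative pd i (pd j f) (?p 0 0)) (at 0 within {0..1})"
    by (rule integral_has_real_derivative)
       (auto intro!: continuous_on_compose2[OF smooth3_cont[of "pd i (pd j f)" UNIV]] continuous_intros f)
  then have "((\<lambda>t. pd i f (?p 0 0) + integral (cbox 0 t) (\<lambda>r. pd i (pd j f) (?p 0 r))) has_real_derivative pd i (pd j f) (?p 0 0)) (at 0 within {0..1})"
    by (auto intro!: derivative_eq_intros)
  then have "((\<lambda>t. pd i f (?p 0 t)) has_real_derivative pd i (pd j f) (?p 0 0)) (at 0 within {0..1})"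
    unfolding has_field_derivative_def
    by (rule has_derivative_transform[rotated 2]) (use eq in auto)
  ultimately show ?thesis
    using vector_derivative_unique_within[of 0 "{0..1}" "\<lambda>t. pd i f (?p 0 t)"]
    by (simp add: has_real_derivative_iff_has_vector_derivative trivial_limit_within)
qed

section \<open>Integrals over balls\<close>

text \<open>Lebesgue measure on a compact ball: every continuous function is integrable for it, so
  continuity is the only side condition carried through the estimates.\<close>

definition BM :: "real \<Rightarrow> (real^3) measure" where
  "BM r = restrict_space lborel (cball 0 r)"

lemma space_BM [simp]: "space (BM r) = cball 0 r"
  by (simp add: BM_def space_restrict_space)

lemma finite_measure_BM: "finite_measure (BM r)"
  by (rule finite_measureI)
     (use emeasure_compact_finite[OF compact_cball, of "0::real^3" r] in \<open>auto simp: BM_def space_restrict_space emeasure_restrict_space\<close>)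

lemma measurable_BM [intro]: "continuous_on UNIV f \<Longrightarrow> f \<in> borel_measurable (BM r)"
  unfolding BM_def by (rule measurable_restrict_space1) (simp add: borel_measurable_continuous_onI)

lemma integrable_indicator_cball:
  fixes f :: "real^3 \<Rightarrow> real"
  assumes "continuous_on UNIV f" shows "integrable lborel (\<lambda>x. indicator (cball 0 r) x * f x)"
  using borel_integrable_compact[OF compact_cball continuous_on_subset[OF assms], of 0 r] by simp

lemma integrable_BM:
  fixes f :: "real^3 \<Rightarrow> real"
  assumes "continuous_on UNIV f" shows "integrable (BM r) f"
  unfolding BM_def
  by (subst integrable_restrict_space)
     (auto simp: integrable_indicator_cball[OF assms])

lemma integrable_compact_support:
  fixes f :: "real^3 \<Rightarrow> real"
  assumes "continuous_on UNIV f" "\<And>x. norm x > r \<Longrightarrow> f x = 0"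
  shows "integrable lborel f" "integral\<^sup>L lborel f = integral\<^sup>L (BM r) f"
proof -
  have e: "(\<lambda>x. indicator (cball 0 r) x *\<^sub>R f x) = f"
    using assms(2) by (auto simp: indicator_def not_le fun_eq_iff)
  have "integrable lborel (\<lambda>x. indicator (cball 0 r) x *\<^sub>R f x)"
    by (intro borel_integrable_compact continuous_on_subset[OF assms(1)]) auto
  then show "integrable lborel f" unfolding e .
  show "integral\<^sup>L lborel f = integral\<^sup>L (BM r) f"
    unfolding BM_def using e by (subst integral_restrict_space) auto
qed

lemma BM_mono:
  fixes f g :: "real^3 \<Rightarrow> real"
  assumes "continuous_on UNIV f" "continuous_on UNIV g" "\<And>x. norm x \<le> r \<Longrightarrow> f x \<le> g x"
  shows "integral\<^sup>L (BM r) f \<le> integral\<^sup>L (BM r) g"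
  by (rule integral_mono) (auto simp: integrable_BM assms)

lemma BM_cong:
  fixes f g :: "real^3 \<Rightarrow> real"
  assumes "\<And>x. norm x \<le> r \<Longrightarrow> f x = g x"
  shows "integral\<^sup>L (BM r) f = integral\<^sup>L (BM r) g"
  by (rule Bochner_Integration.integral_cong) (auto simp: assms)

lemma BM_nonneg:
  fixes f :: "real^3 \<Rightarrow> real"
  shows "(\<And>x. norm x \<le> r \<Longrightarrow> 0 \<le> f x) \<Longrightarrow> 0 \<le> integral\<^sup>L (BM r) f"
  by (rule integral_nonneg_AE) auto

lemma BM_abs:
  fixes f :: "real^3 \<Rightarrow> real"
  shows "\<bar>integral\<^sup>L (BM r) f\<bar> \<le> integral\<^sup>L (BM r) (\<lambda>x. \<bar>f x\<bar>)"
  using integral_norm_bound[of "BM r" f] by simp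

lemma BM_subset:
  fixes f :: "real^3 \<Rightarrow> real"
  assumes "continuous_on UNIV f" "r \<le> r'" "\<And>x. 0 \<le> f x"
  shows "integral\<^sup>L (BM r) f \<le> integral\<^sup>L (BM r') f"
proof -
  have "(\<integral>x. indicator (cball 0 r) x *\<^sub>R f x \<partial>lborel) \<le> (\<integral>x. indicator (cball 0 r') x *\<^sub>R f x \<partial>lborel)"
    by (rule integral_mono)
      (auto split: split_indicator dest: order_trans[OF _ assms(2)] simp: assms(3) integrable_indicator_cball[OF assms(1)])
  then show ?thesis unfolding BM_def by (subst (1 2) integral_restrict_space) auto
qed

lemma pd_zero_outside:
  assumes "\<And>x. norm x > r \<Longrightarrow> f x = 0" "norm x > r"
  shows "pd i f x = 0"
proof -
  have "(f has_derivative (\<lambda>h. 0)) (at x)"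
    by (rule has_derivative_transform_within_open[of "\<lambda>x. 0" "\<lambda>h. 0" x UNIV "{x. norm x > r}"])
       (use assms in \<open>auto intro!: open_Collect_less continuous_intros\<close>)
  from pd_eq[OF this] show ?thesis by simp
qed

lemma bounded_compact_support:
  fixes f :: "real^3 \<Rightarrow> real"
  assumes "continuous_on UNIV f" "\<And>x. norm x > r \<Longrightarrow> f x = 0"
  obtains c where "c > 0" "\<And>x. \<bar>f x\<bar> \<le> c"
proof -
  have "compact (f ` cball 0 r)"
    by (intro compact_continuous_image continuous_on_subset[OF assms(1)]) auto
  then obtain c where c: "\<And>x. x \<in> cball 0 r \<Longrightarrow> \<bar>f x\<bar> \<le> c"
    using compact_imp_bounded bounded_iff by (metis image_eqI real_norm_def)
  show thesis
  proof (rule that[of "\<bar>c\<bar> + 1"])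
    fix x show "\<bar>f x\<bar> \<le> \<bar>c\<bar> + 1"
      using c[of x] assms(2)[of x] by (cases "norm x > r") auto
  qed auto
qed

text \<open>By translation invariance the integral of every difference quotient is 0, and dominated
  convergence passes to the derivative. Only a continuous partial derivative is demanded, not
  smoothness, because \<open>cubic_component\<close> applies this to products containing
  \<open>g x * \<bar>g x\<bar>\<close>.\<close>

lemma integral_pd_zero:
  fixes f :: "real^3 \<Rightarrow> real"
  assumes d: "\<And>x. f differentiable (at x)" and c: "continuous_on UNIV (pd i f)"
    and z: "\<And>x. norm x > r \<Longrightarrow> f x = 0" and r: "r \<le> r'"
  shows "integral\<^sup>L (BM r') (pd i f) = 0"
proof -
  have cf: "continuous_on UNIV f"
    by (meson d continuous_at_imp_continuous_on differentiable_imp_continuous_within)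
  have zp: "\<And>x. norm x > r \<Longrightarrow> pd i f x = 0" using pd_zero_outside[OF z] by auto
  obtain k where k: "k > 0" "\<And>x. \<bar>pd i f x\<bar> \<le> k"
    using bounded_compact_support[OF c zp] by auto
  define e where "e n = inverse (real (Suc n))" for n
  have e: "0 < e n" "e n \<le> 1" for n by (auto simp: e_def inverse_eq_divide)
  have e0: "e \<longlonglongrightarrow> 0" unfolding e_def by (rule LIMSEQ_inverse_real_of_nat)
  let ?v = "axis i 1 :: real^3"
  define D where "D n x = (f (x + e n *\<^sub>R ?v) - f x) / e n" for n x
  have If: "integrable lborel f" using integrable_compact_support[OF cf z] by auto
  have It: "integrable lborel (\<lambda>x. f (x + t *\<^sub>R ?v))" "integral\<^sup>L lborel (\<lambda>x. f (x + t *\<^sub>R ?v)) = integral\<^sup>L lborel f" for t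
  proof -
    have f: "f \<in> borel_measurable borel" using cf by (rule borel_measurable_continuous_onI)
    have e: "(\<lambda>x. f (t *\<^sub>R ?v + x)) = (\<lambda>x. f (x + t *\<^sub>R ?v))" by (simp add: add.commute)
    show "integrable lborel (\<lambda>x. f (x + t *\<^sub>R ?v))"
      using If integrable_distr_eq[of "(+) (t *\<^sub>R ?v)" lborel borel f] f by (simp add: lborel_distr_plus e)
    show "integral\<^sup>L lborel (\<lambda>x. f (x + t *\<^sub>R ?v)) = integral\<^sup>L lborel f"
      using integral_distr[of "(+) (t *\<^sub>R ?v)" lborel borel f] f by (simp add: lborel_distr_plus e)
  qed
  have cD: "continuous_on UNIV (D n)" for n
    unfolding D_def using e(1)[of n]
    by (auto intro!: continuous_on_divide continuous_on_diff cf continuous_on_compose2[OF cf] continuous_intros)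
  have ID: "integral\<^sup>L lborel (D n) = 0" for n
    unfolding D_def using If It by simp
  have "(\<lambda>n. integral\<^sup>L lborel (D n)) \<longlonglongrightarrow> integral\<^sup>L lborel (pd i f)"
  proof (rule integral_dominated_convergence[where w="\<lambda>x. k * indicator (cball 0 (r + 1)) x"])
    show "integrable lborel (\<lambda>x::real^3. k * indicator (cball 0 (r + 1)) x :: real)"
      using emeasure_compact_finite[OF compact_cball, of "0::real^3" "r+1"]
      by (intro integrable_mult_right integrable_real_indicator) auto
    show "AE x in lborel. (\<lambda>n. D n x) \<longlonglongrightarrow> pd i f x"
    proof (rule AE_I2)
      fix x
      have "((\<lambda>t. f (x + t *\<^sub>R ?v)) has_real_derivative pd i f (x + 0 *\<^sub>R ?v)) (at 0)"
        by (rule axis_line_derivative[OF d])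
      then have "((\<lambda>t. (f (x + t *\<^sub>R ?v) - f x) / t) \<longlongrightarrow> pd i f x) (at 0)"
        by (simp add: DERIV_def)
      moreover have "filterlim e (at 0) sequentially"
        unfolding filterlim_at using e e0 by (auto simp: less_imp_neq[symmetric])
      ultimately show "(\<lambda>n. D n x) \<longlonglongrightarrow> pd i f x"
        unfolding D_def by (rule filterlim_compose)
    qed
    \<comment> \<open>The mean value theorem bounds the quotients by \<open>k\<close>; as
      \<open>e n \<le> 1\<close>, they vanish outside radius \<open>r + 1\<close>.\<close>
    show "AE x in lborel. norm (D n x) \<le> k * indicator (cball 0 (r + 1)) x" for n
    proof (rule AE_I2)
      fix x
      show "norm (D n x) \<le> k * indicator (cball 0 (r + 1)) x"
      proof (cases "x \<in> cball 0 (r+1)")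
        case True
        have "\<exists>z. z > 0 \<and> z < e n \<and> f (x + e n *\<^sub>R ?v) - f (x + 0 *\<^sub>R ?v) = (e n - 0) * pd i f (x + z *\<^sub>R ?v)"
          by (rule MVT2[OF e(1)]) (rule axis_line_derivative[OF d])
        then obtain z where "f (x + e n *\<^sub>R ?v) - f x = e n * pd i f (x + z *\<^sub>R ?v)" by auto
        then have "D n x = pd i f (x + z *\<^sub>R ?v)" using e(1)[of n] by (simp add: D_def)
        then show ?thesis using k(2) True by simp
      next
        case False
        have "norm x \<le> norm (x + e n *\<^sub>R ?v) + norm (e n *\<^sub>R ?v)"
          by (metis add_diff_cancel_right' norm_triangle_ineq4)
        then have "norm x \<le> norm (x + e n *\<^sub>R ?v) + e n" using e[of n] by (simp add: norm_axis_1)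
        with False e[of n] have "norm (x + e n *\<^sub>R ?v) > r" "norm x > r" by auto
        then show ?thesis using False by (simp add: D_def z)
      qed
    qed
  qed (use cD c in \<open>auto simp: borel_measurable_continuous_onI\<close>)
  then have "integral\<^sup>L lborel (pd i f) = 0"
    unfolding ID using LIMSEQ_unique tendsto_const by blast
  moreover have "integral\<^sup>L lborel (pd i f) = integral\<^sup>L (BM r') (pd i f)"
    by (rule integrable_compact_support[OF c]) (use zp r in auto)
  ultimately show ?thesis by simp
qed

lemma integral_pd_by_parts:
  fixes f g :: "real^3 \<Rightarrow> real"
  assumes "smooth3 f" "smooth3 g" "\<And>x. norm x > r \<Longrightarrow> g x = 0" "r \<le> r'"
  shows "(\<integral>x. pd i f x * g x \<partial>BM r') = - (\<integral>x. f x * pd i g x \<partial>BM r')"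
proof -
  have "pd i (\<lambda>x. f x * g x) = (\<lambda>x. f x * pd i g x + pd i f x * g x)"
    using assms by (auto intro!: pd_mult)
  moreover have "integral\<^sup>L (BM r') (pd i (\<lambda>x. f x * g x)) = 0"
    by (rule integral_pd_zero[where r=r]) (use assms in \<open>auto intro!: smooth3_cont\<close>)
  ultimately show ?thesis
    using assms by (simp add: integrable_BM smooth3_cont smooth3_mult smooth3_pd)
qed

text \<open>One operator for all smoothing constructions: the mollifier \<open>moll\<close>, the
  average \<open>kavg\<close>, the cutoffs (with a kernel as \<open>f\<close>) and the smooth part
  of the divergence inverse differ only in weight and shift. The parameter space is left general so
  that an extra scalar variable can be added to the space variable.\<close>

definition shift_avg :: "('p::euclidean_space \<Rightarrow> real) \<Rightarrow> ('p \<Rightarrow> real^3) \<Rightarrow> 'p \<Rightarrow> 'p \<Rightarrow> (real^3 \<Rightarrow> real) \<Rightarrow> real^3 \<Rightarrow> real" where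
  "shift_avg w h a b f x = integral (cbox a b) (\<lambda>p. w p * f (x - h p))"

lemma shift_avg_integrable:
  fixes f :: "real^3 \<Rightarrow> real"
  assumes "continuous_on (cbox a b) w" "continuous_on (cbox a b) h" "continuous_on UNIV f"
  shows "(\<lambda>p. w p * f (x - h p)) integrable_on cbox a b"
  by (rule integrable_continuous)
     (auto intro!: continuous_on_mult continuous_on_diff continuous_on_const assms(1,2) continuous_on_compose2[OF assms(3)])

lemma shift_avg_has_derivative:
  assumes w: "continuous_on (cbox a b) w" and h: "continuous_on (cbox a b) h" and f: "smooth3 f"
  shows "(shift_avg w h a b f has_derivative (\<lambda>v. \<Sum>i\<in>UNIV. v $ i *\<^sub>R shift_avg w h a b (pd i f) x)) (at x)"
proof -
  \<comment> \<open>The Leibniz rule wants the derivative as a continuous function with values in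
    bounded linear maps, hence the detour through coordinate functionals.\<close>
  define fx where "fx x p = (\<Sum>i\<in>UNIV. (w p * pd i f (x - h p)) *\<^sub>R Blinfun (\<lambda>v::real^3. v $ i))" for x p
  have bl: "blinfun_apply (Blinfun (\<lambda>v::real^3. v $ i)) = (\<lambda>v. v $ i)" for i
    by (rule bounded_linear_Blinfun_apply) (rule bounded_linear_vec_nth)
  have fxa: "blinfun_apply (fx x p) = (\<lambda>v. \<Sum>i\<in>UNIV. (w p * pd i f (x - h p)) * v $ i)" for x p
    unfolding fx_def by (auto simp: blinfun.sum_left blinfun.scaleR_left bl)
  have cj: "continuous_on (UNIV \<times> cbox a b) (\<lambda>z. pd i f (fst z - h (snd z)))" for i
    by (rule continuous_on_compose2[OF smooth3_cont[OF smooth3_pd[OF f], of UNIV]])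
       (auto intro!: continuous_intros continuous_on_compose2[OF h])
  have wj: "continuous_on (UNIV \<times> cbox a b) (\<lambda>z. w (snd z))"
    by (auto intro!: continuous_intros continuous_on_compose2[OF w])
  have "((\<lambda>x. integral (cbox a b) (\<lambda>p. w p * f (x - h p))) has_derivative integral (cbox a b) (fx x)) (at x within UNIV)"
  proof (rule leibniz_rule)
    fix x p
    have "((\<lambda>x. f (x - h p)) has_derivative (\<lambda>v. \<Sum>i\<in>UNIV. v $ i *\<^sub>R pd i f (x - h p))) (at x)"
      by (rule has_derivative_compose[OF _ has_derivative_pd]) (auto intro!: derivative_eq_intros simp: f)
    then have "((\<lambda>x. w p * f (x - h p)) has_derivative (\<lambda>v. w p * (\<Sum>i\<in>UNIV. v $ i *\<^sub>R pd i f (x - h p)))) (at x)"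
      by (rule has_derivative_mult_right)
    then show "((\<lambda>x. w p * f (x - h p)) has_derivative blinfun_apply (fx x p)) (at x within UNIV)"
      by (simp add: fxa sum_distrib_left mult_ac)
  next
    show "continuous_on (UNIV \<times> cbox a b) (\<lambda>(x, t). fx x t)"
      unfolding fx_def split_beta by (intro continuous_intros cj wj)
  qed (auto intro!: shift_avg_integrable w h smooth3_cont f)
  moreover have "blinfun_apply (integral (cbox a b) (fx x)) = (\<lambda>v. \<Sum>i\<in>UNIV. v $ i *\<^sub>R shift_avg w h a b (pd i f) x)"
  proof
    fix v
    have ci: "continuous_on (cbox a b) (fx x)" unfolding fx_def
      by (intro continuous_intros w h continuous_on_compose2[OF smooth3_cont[OF smooth3_pd[OF f], of UNIV]]) auto
    have "blinfun_apply (integral (cbox a b) (fx x)) v = integral (cbox a b) (\<lambda>p. fx x p v)"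
      using integral_linear[OF integrable_continuous[OF ci] bounded_linear_apply_blinfun[of v]] by (simp add: o_def)
    also have "\<dots> = integral (cbox a b) (\<lambda>p. \<Sum>i\<in>UNIV. v $ i * (w p * pd i f (x - h p)))"
      by (simp add: fxa mult_ac)
    also have "\<dots> = (\<Sum>i\<in>UNIV. integral (cbox a b) (\<lambda>p. v $ i * (w p * pd i f (x - h p))))"
      by (rule integral_sum)
        (use integrable_cmul[OF shift_avg_integrable[OF w h smooth3_cont[OF smooth3_pd[OF f]]]] in auto)
    finally show "blinfun_apply (integral (cbox a b) (fx x)) v = (\<Sum>i\<in>UNIV. v $ i *\<^sub>R shift_avg w h a b (pd i f) x)"
      by (simp add: shift_avg_def)
  qed
  ultimately show ?thesis unfolding shift_avg_def[abs_def] by simp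
qed

lemma pd_shift_avg:
  assumes "continuous_on (cbox a b) w" "continuous_on (cbox a b) h" "smooth3 f"
  shows "pd i (shift_avg w h a b f) = shift_avg w h a b (pd i f)"
  by (rule ext) (simp add: pd_eq[OF shift_avg_has_derivative[OF assms]] axis_def if_distrib if_distribR cong: if_cong)

lemma smooth3_shift_avg [intro]:
  assumes "continuous_on (cbox a b) w" "continuous_on (cbox a b) h" "smooth3 f"
  shows "smooth3 (shift_avg w h a b f)"
proof -
  have "ck n (shift_avg w h a b f)" for n
    using assms(3)
  proof (induction n arbitrary: f)
    case 0 then show ?case using shift_avg_has_derivative[OF assms(1,2) 0] by (auto simp: differentiable_def)
  next
    case (Suc n)
    then show ?case using shift_avg_has_derivative[OF assms(1,2) Suc(2)] pd_shift_avg[OF assms(1,2) Suc(2)]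
      by (auto simp: differentiable_def)
  qed
  then show ?thesis by (simp add: smooth3_iff_ck)
qed

section \<open>Lebesgue norms\<close>

abbreviation contU :: "(real^3 \<Rightarrow> real) \<Rightarrow> bool" where
  "contU f \<equiv> continuous_on UNIV f"

definition Ln :: "real \<Rightarrow> real \<Rightarrow> (real^3 \<Rightarrow> real) \<Rightarrow> real" where
  "Ln r q f = (\<integral>x. \<bar>f x\<bar> powr q \<partial>BM r) powr (1 / q)"

lemma Ln_nonneg [simp]: "0 \<le> Ln r q f"
  by (simp add: Ln_def)

lemma cont_powr [continuous_intros]: "continuous_on S f \<Longrightarrow> 0 < q \<Longrightarrow> continuous_on S (\<lambda>x. \<bar>f x\<bar> powr q :: real)"
  by (intro continuous_on_powr' continuous_intros) auto

lemma integrable_powr: "contU f \<Longrightarrow> 0 < q \<Longrightarrow> integrable (BM r) (\<lambda>x. \<bar>f x\<bar> powr q)"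
  by (intro integrable_BM continuous_intros)

lemma Ln_powr: "0 < q \<Longrightarrow> Ln r q f powr q = (\<integral>x. \<bar>f x\<bar> powr q \<partial>BM r)"
  by (simp add: Ln_def powr_powr BM_nonneg)

lemma Ln_le_iff:
  assumes "0 < q" "0 \<le> c" shows "Ln r q f \<le> c \<longleftrightarrow> (\<integral>x. \<bar>f x\<bar> powr q \<partial>BM r) \<le> c powr q"
  using assms Ln_powr[of q r f] powr_mono2[of q] powr_less_mono2[of q]
  by (metis Ln_nonneg linorder_not_less less_eq_real_def)

lemma Ln_mono:
  assumes "contU f" "contU g" "0 < q" "\<And>x. norm x \<le> r \<Longrightarrow> \<bar>f x\<bar> \<le> \<bar>g x\<bar>"
  shows "Ln r q f \<le> Ln r q g"
  unfolding Ln_def using assms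
  by (intro powr_mono2 BM_mono BM_nonneg continuous_intros) auto

lemma Ln_cong: "(\<And>x. norm x \<le> r \<Longrightarrow> \<bar>f x\<bar> = \<bar>g x\<bar>) \<Longrightarrow> Ln r q f = Ln r q g"
  unfolding Ln_def by (subst BM_cong[of r _ "\<lambda>x. \<bar>g x\<bar> powr q"]) auto

lemma Ln_abs [simp]: "Ln r q (\<lambda>x. \<bar>f x\<bar>) = Ln r q f"
  by (simp add: Ln_def)

lemma Ln_radius_mono:
  assumes "contU f" "0 < q" "r \<le> r'" shows "Ln r q f \<le> Ln r' q f"
  unfolding Ln_def using assms by (intro powr_mono2 BM_subset BM_nonneg continuous_intros) auto

lemma Ln_cmult: assumes "contU f" "0 < q" shows "Ln r q (\<lambda>x. c * f x) = \<bar>c\<bar> * Ln r q f"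
  using assms by (simp add: Ln_def abs_mult powr_mult powr_powr integrable_powr BM_nonneg)

text \<open>Convexity: the tangent of t^q at c, rearranged. It replaces Jensen's inequality in
  \<open>Ln_add\<close> and \<open>shift_avg_Ln\<close>.\<close>

lemma powr_tangent:
  fixes t c q :: real
  assumes "0 \<le> t" "0 < c" "1 < q"
  shows "t * c powr (q - 1) \<le> t powr q / q + (1 - 1 / q) * c powr q"
proof -
  let ?q' = "q / (q - 1)"
  have "t * c powr (q - 1) \<le> t powr q / q + (c powr (q - 1)) powr ?q' / ?q'"
    by (rule Youngs_inequality) (use assms in \<open>auto simp: field_simps\<close>)
  also have "(c powr (q - 1)) powr ?q' / ?q' = (1 - 1 / q) * c powr q"
  proof -
    have "(q - 1) * ?q' = q" using assms by simp
    then have "(c powr (q - 1)) powr ?q' = c powr q" by (simp only: powr_powr)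
    then show ?thesis using assms by (simp add: field_simps)
  qed
  finally show ?thesis .
qed

text \<open>Allows Hoelder's inequality to be normalised by numbers strictly above the norms, so
  that a vanishing norm is not a separate case.\<close>

lemma le_mult_epsilon:
  fixes I A B :: real
  assumes "\<And>e. e > 0 \<Longrightarrow> I \<le> (A + e) * (B + e)" shows "I \<le> A * B"
proof -
  have "((\<lambda>e. (A + e) * (B + e)) \<longlongrightarrow> (A + 0) * (B + 0)) (at_right 0)"
    by (intro tendsto_intros)
  moreover have "\<forall>\<^sub>F e in at_right (0::real). I \<le> (A + e) * (B + e)"
    using assms by (auto simp: eventually_at_filter)
  ultimately show ?thesis using tendsto_lowerbound[of _ "A * B" "at_right (0::real)"] by auto
qed

lemma normalized_le_1:
  assumes q: "0 < q" and e: "Ln r q f < c"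
  shows "(\<integral>x. \<bar>f x / c\<bar> powr q \<partial>BM r) \<le> 1"
proof -
  have c: "c > 0" using e Ln_nonneg[of r q f] by linarith
  have "(\<integral>x. \<bar>f x / c\<bar> powr q \<partial>BM r) = Ln r q f powr q / c powr q"
    using c q by (simp add: powr_divide Ln_powr)
  also have "\<dots> \<le> 1" using e c q by (simp add: powr_mono2)
  finally show ?thesis .
qed

lemma Holder_BM:
  assumes f: "contU f" and g: "contU g" and ab: "1 < a" "1 < b" "1 / a + 1 / b = 1"
  shows "(\<integral>x. \<bar>f x * g x\<bar> \<partial>BM r) \<le> Ln r a f * Ln r b g"
proof (rule le_mult_epsilon)
  fix e :: real assume e: "e > 0"
  define A where "A = Ln r a f + e"
  define B where "B = Ln r b g + e"
  have AB: "A > 0" "B > 0" "Ln r a f < A" "Ln r b g < B"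
    using e Ln_nonneg[of r a f] Ln_nonneg[of r b g] by (auto simp: A_def B_def simp del: Ln_nonneg)
  have c: "contU (\<lambda>x. \<bar>f x / A\<bar> powr a)" "contU (\<lambda>x. \<bar>g x / B\<bar> powr b)"
    by (rule cont_powr; use f g ab AB in \<open>auto intro!: continuous_intros\<close>)+
  have "(\<integral>x. \<bar>f x * g x\<bar> \<partial>BM r) \<le> (\<integral>x. A * B * (\<bar>f x / A\<bar> powr a / a + \<bar>g x / B\<bar> powr b / b) \<partial>BM r)"
  proof (rule BM_mono)
    fix x
    have "\<bar>f x / A\<bar> * \<bar>g x / B\<bar> \<le> \<bar>f x / A\<bar> powr a / a + \<bar>g x / B\<bar> powr b / b"
      by (rule Youngs_inequality) (use ab in auto)
    then have "A * B * (\<bar>f x / A\<bar> * \<bar>g x / B\<bar>) \<le> A * B * (\<bar>f x / A\<bar> powr a / a + \<bar>g x / B\<bar> powr b / b)"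
      using AB by (intro mult_left_mono) auto
    then show "\<bar>f x * g x\<bar> \<le> A * B * (\<bar>f x / A\<bar> powr a / a + \<bar>g x / B\<bar> powr b / b)"
      using AB by (simp add: abs_mult)
  qed (use f g c ab AB in \<open>auto intro!: continuous_on_mult continuous_on_add continuous_on_divide continuous_on_const continuous_on_rabs\<close>)
  also have "\<dots> = A * B * ((\<integral>x. \<bar>f x / A\<bar> powr a \<partial>BM r) / a + (\<integral>x. \<bar>g x / B\<bar> powr b \<partial>BM r) / b)"
    using integrable_BM[OF c(1), of r] integrable_BM[OF c(2), of r]
    by (subst integral_mult_right_zero, subst Bochner_Integration.integral_add) auto
  also have "\<dots> \<le> A * B * (1 / a + 1 / b)"
    using ab AB normalized_le_1[of a r f A] normalized_le_1[of b r g B]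
    by (intro mult_left_mono add_mono divide_right_mono) auto
  finally show "(\<integral>x. \<bar>f x * g x\<bar> \<partial>BM r) \<le> (Ln r a f + e) * (Ln r b g + e)"
    using ab by (simp add: A_def B_def)
qed

lemma Ln_mult:
  assumes f: "contU f" and g: "contU g" and ab: "0 < a" "0 < b" "0 < c" "1 / c = 1 / a + 1 / b"
  shows "Ln r c (\<lambda>x. f x * g x) \<le> Ln r a f * Ln r b g"
proof -
  have ca: "c < a" "c < b" using ab by (auto simp: field_simps add_pos_pos)
     (metis add.commute add_pos_pos less_add_same_cancel1 mult.commute mult_less_cancel_left_pos mult_pos_pos)+
  have "c / a + c / b = c * (1 / a + 1 / b)" by (simp add: distrib_left)
  then have e: "c / a + c / b = 1" using ab by (metis less_numeral_extra(3) nonzero_eq_divide_eq mult.commute)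
  have "(\<integral>x. \<bar>f x * g x\<bar> powr c \<partial>BM r) = (\<integral>x. \<bar>\<bar>f x\<bar> powr c * \<bar>g x\<bar> powr c\<bar> \<partial>BM r)"
    by (rule BM_cong) (simp add: abs_mult powr_mult)
  also have "\<dots> \<le> Ln r (a / c) (\<lambda>x. \<bar>f x\<bar> powr c) * Ln r (b / c) (\<lambda>x. \<bar>g x\<bar> powr c)"
    by (rule Holder_BM) (use f g ab ca e in \<open>auto intro!: continuous_intros simp: distrib_left\<close>)
  also have "\<dots> = (Ln r a f * Ln r b g) powr c"
    using ab by (simp add: Ln_def powr_powr powr_mult)
  finally show ?thesis using ab by (subst Ln_le_iff) auto
qed

lemma Ln_add:
  assumes f: "contU f" and g: "contU g" and q: "1 < q"
  shows "Ln r q (\<lambda>x. f x + g x) \<le> Ln r q f + Ln r q g"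
proof (rule field_le_epsilon)
  fix e :: real assume e: "e > 0"
  define A where "A = Ln r q f + e/2"
  define B where "B = Ln r q g + e/2"
  have AB: "A > 0" "B > 0" "Ln r q f < A" "Ln r q g < B"
    using e Ln_nonneg[of r q f] Ln_nonneg[of r q g] by (auto simp: A_def B_def simp del: Ln_nonneg)
  have c: "contU (\<lambda>x. \<bar>f x / A\<bar> powr q)" "contU (\<lambda>x. \<bar>g x / B\<bar> powr q)" "contU (\<lambda>x. \<bar>f x + g x\<bar> powr q)"
    by (rule cont_powr; use f g q AB in \<open>auto intro!: continuous_intros\<close>)+
  have "(\<integral>x. \<bar>f x + g x\<bar> powr q \<partial>BM r) \<le> (\<integral>x. (A + B) powr (q - 1) * (A * \<bar>f x / A\<bar> powr q + B * \<bar>g x / B\<bar> powr q) \<partial>BM r)"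
  proof (rule BM_mono)
    fix x
    \<comment> \<open>\<open>t\<close> is the convex combination of the normalised values with
      weights A/(A+B) and B/(A+B). The tangent inequality at \<open>t\<close>, applied to
      \<open>u\<close> and to \<open>v\<close>, is convexity of t^q.\<close>
    define u v t where "u = \<bar>f x / A\<bar>" and "v = \<bar>g x / B\<bar>" and "t = (A * u + B * v) / (A + B)"
    have uv: "u \<ge> 0" "v \<ge> 0" "t \<ge> 0" "(A + B) * t = A * u + B * v" using AB by (auto simp: u_def v_def t_def)
    have "\<bar>f x + g x\<bar> \<le> (A + B) * t"
      unfolding uv using AB by (simp add: u_def v_def)
    then have "\<bar>f x + g x\<bar> powr q \<le> (A + B) powr q * t powr q"
      using AB uv q by (subst powr_mult[symmetric]) (auto intro!: powr_mono2)
    also have "\<dots> = (A + B) powr (q - 1) * ((A + B) * t powr q)"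
      using AB powr_add[of "A+B" "q-1" 1] by (simp add: powr_one)
    finally have 1: "\<bar>f x + g x\<bar> powr q \<le> (A + B) powr (q - 1) * ((A + B) * t powr q)" .
    have "(A + B) * t powr q \<le> A * u powr q + B * v powr q"
    proof (cases "t = 0")
      case False
      then have t: "t > 0" using uv by auto
      have "(A + B) * t powr q = ((A + B) * t) * t powr (q - 1)"
        using t powr_add[of t "q-1" 1] by simp
      also have "\<dots> = A * (u * t powr (q - 1)) + B * (v * t powr (q - 1))"
        unfolding uv by (simp add: algebra_simps)
      also have "\<dots> \<le> A * (u powr q / q + (1 - 1 / q) * t powr q) + B * (v powr q / q + (1 - 1 / q) * t powr q)"
        using AB uv q t by (intro add_mono mult_left_mono powr_tangent) auto
      also have "\<dots> = (A * u powr q + B * v powr q) / q + (1 - 1 / q) * ((A + B) * t powr q)"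
      proof -
        have "A * (u' / q + (1 - 1 / q) * T) + B * (v' / q + (1 - 1 / q) * T) = (A * u' + B * v') / q + (1 - 1 / q) * ((A + B) * T)" for u' v' T
          using q by (simp add: field_simps)
        then show ?thesis .
      qed
      finally have *: "S \<le> N / q + (1 - 1 / q) * S" if "S = (A + B) * t powr q" "N = A * u powr q + B * v powr q" for S N
        using that by simp
      have "S / q \<le> N / q" if "S = (A + B) * t powr q" "N = A * u powr q + B * v powr q" for S N
        using *[OF that] by (simp add: left_diff_distrib)
      then show ?thesis using q by (simp add: divide_le_cancel)
    qed (use AB in auto)
    from order_trans[OF 1 mult_left_mono[OF this]]
    show "\<bar>f x + g x\<bar> powr q \<le> (A + B) powr (q - 1) * (A * \<bar>f x / A\<bar> powr q + B * \<bar>g x / B\<bar> powr q)"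
      unfolding u_def v_def by simp
  qed (intro c continuous_on_mult continuous_on_add continuous_on_const)+
  also have "\<dots> = (A + B) powr (q - 1) * (A * (\<integral>x. \<bar>f x / A\<bar> powr q \<partial>BM r) + B * (\<integral>x. \<bar>g x / B\<bar> powr q \<partial>BM r))"
    using integrable_BM[OF c(1), of r] integrable_BM[OF c(2), of r]
    by (subst integral_mult_right_zero, subst Bochner_Integration.integral_add) auto
  also have "\<dots> \<le> (A + B) powr (q - 1) * (A * 1 + B * 1)"
    using q AB normalized_le_1[of q r f A] normalized_le_1[of q r g B]
    by (intro mult_left_mono add_mono) auto
  also have "\<dots> = (A + B) powr q" using AB powr_add[of "A+B" "q-1" 1] by simp
  finally have "Ln r q (\<lambda>x. f x + g x) \<le> A + B"
    using q AB by (subst Ln_le_iff) auto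
  then show "Ln r q (\<lambda>x. f x + g x) \<le> Ln r q f + Ln r q g + e" by (simp add: A_def B_def)
qed

lemma Ln_zero [simp]: "Ln r q (\<lambda>x. 0) = 0"
  by (simp add: Ln_def)

lemma Ln_sum:
  assumes "\<And>k. k \<in> K \<Longrightarrow> contU (f k)" "1 < q"
  shows "Ln r q (\<lambda>x. \<Sum>k\<in>K. f k x) \<le> (\<Sum>k\<in>K. Ln r q (f k))"
  using assms(1)
proof (induction K rule: infinite_finite_induct)
  case (insert k K)
  have "Ln r q (\<lambda>x. f k x + (\<Sum>k\<in>K. f k x)) \<le> Ln r q (f k) + Ln r q (\<lambda>x. \<Sum>k\<in>K. f k x)"
    by (rule Ln_add) (use insert assms(2) in \<open>auto intro!: continuous_intros\<close>)
  then show ?case using insert by fastforce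
qed auto

text \<open>One constant for all embeddings between Lebesgue norms on balls of radius at most 3:
  being at least 1, it dominates every power of the volume with exponent in [0,1].\<close>

definition volc :: real where "volc = 1 + (\<integral>x. 1 \<partial>BM 3)"

lemma volc_ge_1: "1 \<le> volc"
  unfolding volc_def by (simp add: BM_nonneg)

lemma Ln_le_Ln:
  assumes f: "contU f" and q: "1 \<le> q" "q \<le> q'" and r: "r \<le> 3"
  shows "Ln r q f \<le> volc * Ln r q' f"
proof (cases "q = q'")
  case True
  then show ?thesis using volc_ge_1 Ln_nonneg[of r q' f] by (simp add: mult_le_cancel_right1 del: Ln_nonneg)
next
  case False
  define b where "b = q * q' / (q' - q)"
  have b: "b > 0" "1 / q = 1 / q' + 1 / b" using q False by (auto simp: b_def field_simps)
  have b1: "1 / b \<le> 1" using q False b by (smt (verit, ccfv_SIG) divide_le_eq_1_pos zero_le_divide_1_iff)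
  have "Ln r b (\<lambda>x. 1) \<le> Ln 3 b (\<lambda>x. 1)" using r b by (intro Ln_radius_mono) auto
  also have "\<dots> \<le> volc"
  proof -
    have "Ln 3 b (\<lambda>x. 1) = (\<integral>x. 1 \<partial>BM 3) powr (1 / b)" by (simp add: Ln_def)
    also have "\<dots> \<le> volc powr (1/b)" using b by (intro powr_mono2) (auto simp: volc_def BM_nonneg)
    also have "\<dots> \<le> volc powr 1" using b1 volc_ge_1 by (intro powr_mono) auto
    finally show ?thesis using volc_ge_1 by simp
  qed
  finally have *: "Ln r b (\<lambda>x. 1) \<le> volc" .
  have "Ln r q (\<lambda>x. f x * 1) \<le> Ln r q' f * Ln r b (\<lambda>x. 1)"
    by (rule Ln_mult) (use f q b in auto)
  also have "\<dots> \<le> Ln r q' f * volc" using * by (intro mult_left_mono) auto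
  finally show ?thesis by (simp add: mult.commute)
qed

lemma Ln_2: "contU f \<Longrightarrow> (Ln r 2 f)\<^sup>2 = (\<integral>x. (f x)\<^sup>2 \<partial>BM r)"
  using Ln_powr[of 2 r f] by simp

lemma shift_avg_continuous:
  assumes w: "continuous_on (cbox a b) w" and h: "continuous_on (cbox a b) h" and f: "contU f"
  shows "contU (shift_avg w h a b f)"
proof -
  have "continuous_on (UNIV \<times> cbox a b) (\<lambda>(x, p). w p * f (x - h p))"
    unfolding split_beta
    by (rule continuous_on_mult)
       (auto intro!: continuous_intros continuous_on_compose2[OF w] continuous_on_compose2[OF f] continuous_on_compose2[OF h])
  from integral_continuous_on_param[OF this] show ?thesis by (simp add: shift_avg_def[abs_def])
qed


lemma shift_avg_integrable':
  fixes f :: "real^3 \<Rightarrow> real"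
  assumes w: "continuous_on (cbox a b) w" and h: "continuous_on (cbox a b) h" and f: "contU f"
  shows "integrable lborel (\<lambda>p. indicator (cbox a b) p * (w p * f (x - h p)))"
    "shift_avg w h a b f x = (\<integral>p. indicator (cbox a b) p * (w p * f (x - h p)) \<partial>lborel)"
proof -
  have "continuous_on (cbox a b) (\<lambda>p. w p * f (x - h p))"
    by (auto intro!: continuous_on_mult continuous_on_diff continuous_on_const w h continuous_on_compose2[OF f])
  then have "set_integrable lborel (cbox a b) (\<lambda>p. w p * f (x - h p))"
    unfolding set_integrable_def by (intro borel_integrable_compact compact_cbox)
  from set_borel_integral_eq_integral(2)[OF this] this
  show "integrable lborel (\<lambda>p. indicator (cbox a b) p * (w p * f (x - h p)))"
    "shift_avg w h a b f x = (\<integral>p. indicator (cbox a b) p * (w p * f (x - h p)) \<partial>lborel)"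
    by (auto simp: shift_avg_def set_integrable_def set_lebesgue_integral_def)
qed

lemma nn_integral_BM:
  fixes f :: "real^3 \<Rightarrow> real"
  assumes "contU f" "\<And>x. 0 \<le> f x"
  shows "(\<integral>\<^sup>+x. indicator (cball 0 r) x * ennreal (f x) \<partial>lborel) = ennreal (integral\<^sup>L (BM r) f)"
proof -
  have "ennreal (integral\<^sup>L (BM r) f) = (\<integral>\<^sup>+x. ennreal (f x) \<partial>BM r)"
    using assms by (subst nn_integral_eq_integral) (auto simp: integrable_BM)
  also have "\<dots> = (\<integral>\<^sup>+x. ennreal (f x) * indicator (cball 0 r) x \<partial>lborel)"
    unfolding BM_def by (subst nn_integral_restrict_space) auto
  finally show ?thesis by (simp add: mult.commute)
qed

text \<open>Tonelli: for fixed \<open>p\<close> the inner integral is that of \<open>F\<close> over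
  a ball moved by at most \<open>d\<close>, hence contained in the ball of radius
  \<open>r + d\<close>.\<close>

lemma shift_avg_L1:
  fixes w :: "'p::euclidean_space \<Rightarrow> real"
  assumes w: "continuous_on (cbox a b) w" and h: "continuous_on (cbox a b) h" and F: "contU F" "\<And>x. 0 \<le> F x"
    and w0: "\<And>p. 0 \<le> w p" and d: "\<And>p. p \<in> cbox a b \<Longrightarrow> norm (h p) \<le> d"
  shows "(\<integral>x. shift_avg w h a b F x \<partial>BM r) \<le> integral (cbox a b) w * (\<integral>x. F x \<partial>BM (r + d))"
proof -
  let ?W = "integral (cbox a b) w" and ?J = "\<integral>x. F x \<partial>BM (r + d)"
  have W: "integrable lborel (\<lambda>p. indicator (cbox a b) p * w p)" "?W = (\<integral>p. indicator (cbox a b) p * w p \<partial>lborel)"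
    using shift_avg_integrable'[of a b w "\<lambda>_. 0" "\<lambda>_. 1"] w by (auto simp: shift_avg_def)
  have J0: "?J \<ge> 0" using F by (intro BM_nonneg) auto
  have mw: "(\<lambda>p. indicator (cbox a b) p *\<^sub>R w p) \<in> borel_measurable borel"
    by (rule borel_measurable_continuous_on_indicator[OF _ w]) auto
  have mh: "(\<lambda>p. indicator (cbox a b) p *\<^sub>R h p) \<in> borel_measurable borel"
    by (rule borel_measurable_continuous_on_indicator[OF _ h]) auto
  have mF: "F \<in> borel_measurable borel" using F by (simp add: borel_measurable_continuous_onI)
  \<comment> \<open>The indicators inside make the kernel globally Borel although \<open>w\<close>
    and \<open>h\<close> are continuous only on the box.\<close>
  define k where "k x p = indicator (cball 0 r) x * ennreal ((indicator (cbox a b) p *\<^sub>R w p) * F (x - indicator (cbox a b) p *\<^sub>R h p))" for x p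
  have km: "case_prod k \<in> borel_measurable (lborel \<Otimes>\<^sub>M lborel)"
  proof -
    have 1: "(\<lambda>z. indicator (cbox a b) (snd z) *\<^sub>R w (snd z)) \<in> borel_measurable (lborel \<Otimes>\<^sub>M lborel)"
      by (rule measurable_compose[OF measurable_snd]) (use mw in simp)
    have 2: "(\<lambda>z. indicator (cbox a b) (snd z) *\<^sub>R h (snd z)) \<in> borel_measurable (lborel \<Otimes>\<^sub>M lborel)"
      by (rule measurable_compose[OF measurable_snd]) (use mh in simp)
    have 3: "(\<lambda>z. fst z) \<in> borel_measurable (lborel \<Otimes>\<^sub>M lborel)"
      using measurable_fst[of lborel lborel] by simp
    have 4: "(\<lambda>z. F (fst z - indicator (cbox a b) (snd z) *\<^sub>R h (snd z))) \<in> borel_measurable (lborel \<Otimes>\<^sub>M lborel)"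
      by (rule measurable_compose[OF borel_measurable_diff[OF 3 2] mF])
    have 5: "(\<lambda>z. indicator (cball 0 r) (fst z) :: ennreal) \<in> borel_measurable (lborel \<Otimes>\<^sub>M lborel)"
      by (rule measurable_compose[OF measurable_fst]) (intro borel_measurable_indicator, auto)
    show ?thesis unfolding k_def split_beta
      using borel_measurable_times[OF 1 4] 5 by (intro borel_measurable_times_ennreal) auto
  qed
  have kx: "(\<integral>\<^sup>+p. k x p \<partial>lborel) = indicator (cball 0 r) x * ennreal (shift_avg w h a b F x)" for x
  proof -
    have e: "(indicator (cbox a b) p *\<^sub>R w p) * F (x - indicator (cbox a b) p *\<^sub>R h p) = indicator (cbox a b) p * (w p * F (x - h p))" for p
      by (auto simp: indicator_def)
    have "(\<integral>\<^sup>+p. k x p \<partial>lborel) = indicator (cball 0 r) x * (\<integral>\<^sup>+p. ennreal (indicator (cbox a b) p * (w p * F (x - h p))) \<partial>lborel)"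
      unfolding k_def e
      using borel_measurable_integrable[OF shift_avg_integrable'(1)[OF w h F(1), of x]]
      by (intro nn_integral_cmult) (intro measurable_compose[OF _ measurable_ennreal], simp)
    also have "(\<integral>\<^sup>+p. ennreal (indicator (cbox a b) p * (w p * F (x - h p))) \<partial>lborel) = ennreal (shift_avg w h a b F x)"
      by (subst nn_integral_eq_integral) (use w0 F in \<open>auto intro!: shift_avg_integrable' w h simp: shift_avg_integrable'[OF w h]\<close>)
    finally show ?thesis .
  qed
  have inner: "(\<integral>\<^sup>+x. k x p \<partial>lborel) \<le> ennreal (indicator (cbox a b) p * w p) * ennreal ?J" for p
  proof (cases "p \<in> cbox a b")
    case True
    have "(\<lambda>x. indicator (cball 0 r) x * ennreal (F (x - h p))) \<in> borel_measurable borel"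
      by (intro borel_measurable_times_ennreal borel_measurable_indicator measurable_compose[OF _ measurable_ennreal] measurable_compose[OF _ mF]) auto
    then have "(\<integral>\<^sup>+x. k x p \<partial>lborel) = ennreal (w p) * (\<integral>\<^sup>+x. indicator (cball 0 r) x * ennreal (F (x - h p)) \<partial>lborel)"
      unfolding k_def using True w0 mF
      by (subst nn_integral_cmult[symmetric]) (auto simp: ennreal_mult F mult_ac intro!: nn_integral_cong)
    also have "(\<integral>\<^sup>+x. indicator (cball 0 r) x * ennreal (F (x - h p)) \<partial>lborel)
        \<le> (\<integral>\<^sup>+x. indicator (cball 0 (r + d)) (x - h p) * ennreal (F (x - h p)) \<partial>lborel)"
    proof (intro nn_integral_mono mult_right_mono)
      fix x
      have "norm (x - h p) \<le> norm x + norm (h p)" by (rule norm_triangle_ineq4)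
      then show "indicator (cball 0 r) x \<le> (indicator (cball 0 (r + d)) (x - h p) :: ennreal)"
        using d[OF True] by (auto simp: indicator_def)
    qed auto
    also have "\<dots> = (\<integral>\<^sup>+x. indicator (cball 0 (r + d)) x * ennreal (F x) \<partial>lborel)"
      using nn_integral_distr[of "(+) (- h p)" lborel borel "\<lambda>x. indicator (cball 0 (r + d)) x * ennreal (F x)"]
        borel_measurable_times_ennreal[OF borel_measurable_indicator measurable_compose[OF mF measurable_ennreal], of "cball 0 (r + d)"]
      by (simp add: lborel_distr_plus add.commute)
    also have "\<dots> = ennreal ?J" by (rule nn_integral_BM) (use F in auto)
    finally show ?thesis using True by (simp add: mult_left_mono)
  qed (simp add: k_def)
  have "ennreal (\<integral>x. shift_avg w h a b F x \<partial>BM r) = (\<integral>\<^sup>+x. \<integral>\<^sup>+p. k x p \<partial>lborel \<partial>lborel)"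
    unfolding kx
  proof (rule nn_integral_BM[symmetric])
    show "contU (shift_avg w h a b F)" by (rule shift_avg_continuous[OF w h F(1)])
    show "0 \<le> shift_avg w h a b F x" for x
      unfolding shift_avg_def using w0 F by (intro integral_nonneg shift_avg_integrable w h) auto
  qed
  also have "\<dots> = (\<integral>\<^sup>+p. \<integral>\<^sup>+x. k x p \<partial>lborel \<partial>lborel)"
    by (rule lborel_pair.Fubini'[symmetric, OF km])
  also have "\<dots> \<le> (\<integral>\<^sup>+p. ennreal (indicator (cbox a b) p * w p) * ennreal ?J \<partial>lborel)"
    by (intro nn_integral_mono inner)
  also have "\<dots> = ennreal ?W * ennreal ?J"
    using W w0 by (subst nn_integral_multc) (auto simp: nn_integral_eq_integral)
  also have "\<dots> = ennreal (?W * ?J)" using J0 by (simp add: ennreal_mult'')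
  finally show ?thesis
    using J0 w0 by (subst (asm) ennreal_le_iff) (auto intro!: mult_nonneg_nonneg integral_nonneg integrable_continuous w)
qed

text \<open>Young's convolution inequality, obtained pointwise from Jensen's inequality for the
  measure with density \<bar>w\<bar> and then integrated by \<open>shift_avg_L1\<close>. The radius
  grows by the size of the largest shift.\<close>

lemma shift_avg_Ln:
  fixes w :: "'p::euclidean_space \<Rightarrow> real"
  assumes w: "continuous_on (cbox a b) w" and h: "continuous_on (cbox a b) h" and f: "contU f" and q: "1 < q"
    and d: "\<And>p. p \<in> cbox a b \<Longrightarrow> norm (h p) \<le> d"
  shows "Ln r q (shift_avg w h a b f) \<le> integral (cbox a b) (\<lambda>p. \<bar>w p\<bar>) * Ln (r + d) q f"
proof -
  define W where "W = integral (cbox a b) (\<lambda>p. \<bar>w p\<bar>)"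
  define I where "I = shift_avg (\<lambda>p. \<bar>w p\<bar>) h a b (\<lambda>x. \<bar>f x\<bar>)"
  define K where "K = shift_avg (\<lambda>p. \<bar>w p\<bar>) h a b (\<lambda>x. \<bar>f x\<bar> powr q)"
  have wa: "continuous_on (cbox a b) (\<lambda>p. \<bar>w p\<bar>)" by (intro continuous_intros w)
  have fa: "contU (\<lambda>x. \<bar>f x\<bar>)" "contU (\<lambda>x. \<bar>f x\<bar> powr q)" using f q by (auto intro!: cont_powr continuous_on_rabs)
  note ig = shift_avg_integrable[OF wa h fa(1)] shift_avg_integrable[OF wa h fa(2)]
  have W0: "W \<ge> 0" unfolding W_def by (intro integral_nonneg integrable_continuous wa) auto
  have K0: "K x \<ge> 0" and I0: "I x \<ge> 0" for x
    unfolding K_def I_def shift_avg_def by (intro integral_nonneg ig; simp)+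
  have le: "\<bar>shift_avg w h a b f x\<bar> \<le> I x" for x
    unfolding I_def shift_avg_def using integral_norm_bound_integral[OF shift_avg_integrable[OF w h f] ig(1), of x x]
    by (simp add: abs_mult)
  have IK: "I x powr q \<le> W powr (q - 1) * K x" for x
  proof (cases "I x = 0 \<or> W = 0")
    case True
    have "I x = 0"
    proof (cases "W = 0")
      case W: True
      have "compact ((\<lambda>p. f (x - h p)) ` cbox a b)"
        by (intro compact_continuous_image compact_cbox continuous_on_compose2[OF f]) (auto intro!: continuous_intros h)
      then obtain c where c: "\<And>p. p \<in> cbox a b \<Longrightarrow> \<bar>f (x - h p)\<bar> \<le> c"
        using compact_imp_bounded bounded_iff by (metis image_eqI real_norm_def)
      have "I x \<le> integral (cbox a b) (\<lambda>p. \<bar>w p\<bar> * c)"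
        unfolding I_def shift_avg_def
        by (intro integral_le ig integrable_on_mult_left integrable_continuous wa mult_left_mono c) auto
      then have "I x \<le> W * c" by (simp add: W_def)
      then show ?thesis using I0[of x] W by simp
    qed (use True in auto)
    then show ?thesis using K0 q by auto
  next
    case False
    then have pos: "I x > 0" "W > 0" using I0[of x] W0 by (auto simp: less_le)
    \<comment> \<open>Integrating the tangent inequality at the mean value \<open>c\<close> is
      Jensen's inequality.\<close>
    define c where "c = I x / W"
    have c: "c > 0" using pos by (simp add: c_def)
    have "I x * c powr (q - 1) = integral (cbox a b) (\<lambda>p. (\<bar>w p\<bar> * \<bar>f (x - h p)\<bar>) * c powr (q - 1))"
      by (simp add: I_def shift_avg_def)
    also have "\<dots> \<le> integral (cbox a b) (\<lambda>p. (\<bar>w p\<bar> * \<bar>f (x - h p)\<bar> powr q) * (1 / q) + \<bar>w p\<bar> * ((1 - 1 / q) * c powr q))"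
    proof (rule integral_le)
      fix p
      have "\<bar>w p\<bar> * (\<bar>f (x - h p)\<bar> * c powr (q - 1)) \<le> \<bar>w p\<bar> * (\<bar>f (x - h p)\<bar> powr q / q + (1 - 1 / q) * c powr q)"
        using c q by (intro mult_left_mono powr_tangent) auto
      then show "(\<bar>w p\<bar> * \<bar>f (x - h p)\<bar>) * c powr (q - 1) \<le> (\<bar>w p\<bar> * \<bar>f (x - h p)\<bar> powr q) * (1 / q) + \<bar>w p\<bar> * ((1 - 1 / q) * c powr q)"
        by (simp add: algebra_simps)
    qed (use ig(1) integrable_on_mult_left[OF ig(2), of x "1/q"] integrable_continuous[OF wa] in \<open>auto intro!: integrable_add integrable_on_mult_left\<close>)
    also have "\<dots> = K x * (1 / q) + W * ((1 - 1 / q) * c powr q)"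
      using ig integrable_on_mult_left[OF ig(2), of x "1/q"] integrable_continuous[OF wa]
      by (subst Henstock_Kurzweil_Integration.integral_add)
         (auto intro!: integrable_on_mult_left simp: K_def W_def shift_avg_def)
    finally have "W * (c * c powr (q - 1)) \<le> K x / q + W * c powr q - W * c powr q / q"
      using pos by (simp add: c_def algebra_simps)
    moreover have "c * c powr (q - 1) = c powr q" using c powr_add[of c 1 "q-1"] by simp
    ultimately have "W * c powr q \<le> K x" using q by (simp add: field_simps)
    moreover have "W powr (q - 1) * (W * c powr q) = I x powr q"
      using pos powr_add[of W "q-1" 1] by (simp add: c_def powr_divide)
    ultimately show ?thesis using mult_left_mono[of "W * c powr q" "K x" "W powr (q - 1)"] by simp
  qed
  have "(\<integral>x. \<bar>shift_avg w h a b f x\<bar> powr q \<partial>BM r) \<le> (\<integral>x. W powr (q - 1) * K x \<partial>BM r)"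
  proof (rule BM_mono)
    fix x
    have "\<bar>shift_avg w h a b f x\<bar> powr q \<le> I x powr q" using le q by (intro powr_mono2) auto
    then show "\<bar>shift_avg w h a b f x\<bar> powr q \<le> W powr (q - 1) * K x" using IK[of x] by linarith
  qed (use q in \<open>auto intro!: cont_powr continuous_on_mult continuous_on_const shift_avg_continuous w h f wa fa simp: K_def\<close>)
  also have "\<dots> = W powr (q - 1) * (\<integral>x. K x \<partial>BM r)" by simp
  also have "\<dots> \<le> W powr (q - 1) * (W * (\<integral>x. \<bar>f x\<bar> powr q \<partial>BM (r + d)))"
    unfolding K_def W_def using fa d by (intro mult_left_mono shift_avg_L1 wa h) auto
  also have "\<dots> = (W * Ln (r + d) q f) powr q"
    using W0 q powr_add[of W "q-1" 1] by (cases "W = 0") (auto simp: powr_mult Ln_powr)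
  finally show ?thesis using W0 q unfolding W_def by (subst Ln_le_iff) auto
qed

section \<open>Mollification\<close>

text \<open>The functions p(1/t) exp(-1/t), continued by 0, form a class closed under
  differentiation, with p replaced by X^2 (p - p'). Smoothness of the bump is therefore an induction
  in which only the polynomial changes.\<close>

definition expG :: "real poly \<Rightarrow> real \<Rightarrow> real" where
  "expG p t = (if t > 0 then poly p (1 / t) * exp (- (1 / t)) else 0)"

lemma poly_exp_tendsto_0: "((\<lambda>x. poly p x * exp (- x)) \<longlongrightarrow> 0) (at_top :: real filter)"
proof -
  have "((\<lambda>x. \<Sum>i\<le>degree p. coeff p i * (x ^ i / exp x)) \<longlongrightarrow> (\<Sum>i\<le>degree p. coeff p i * 0)) (at_top :: real filter)"
    by (intro tendsto_intros tendsto_power_div_exp_0)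
  then show ?thesis by (simp add: poly_altdef sum_distrib_right sum_distrib_left exp_minus divide_inverse mult_ac)
qed

lemma expG_derivative:
  "(expG p has_real_derivative expG ([:0, 0, 1:] * (p - pderiv p)) t) (at t)"
proof -
  consider "t > 0" | "t < 0" | "t = 0" by linarith
  then show ?thesis
  proof cases
    case 1
    have "((\<lambda>t. poly p (1 / t) * exp (- (1 / t))) has_real_derivative expG ([:0, 0, 1:] * (p - pderiv p)) t) (at t)"
      using 1 by (auto intro!: derivative_eq_intros poly_DERIV[THEN DERIV_chain2] simp: expG_def field_simps power2_eq_square)
    then show ?thesis
      by (rule has_field_derivative_transform_within_open[where S="{0<..}"]) (use 1 in \<open>auto simp: expG_def\<close>)
  next
    case 2
    have "((\<lambda>t. 0) has_real_derivative 0) (at t)" by simp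
    then have "(expG p has_real_derivative 0) (at t)"
      by (rule has_field_derivative_transform_within_open[where S="{..<0}"]) (use 2 in \<open>auto simp: expG_def\<close>)
    then show ?thesis using 2 by (simp add: expG_def)
  next
    case 3
    have "((\<lambda>h. expG p h / h) \<longlongrightarrow> 0) (at_left 0)"
      by (rule tendsto_eventually) (auto simp: eventually_at_filter expG_def)
    moreover have "((\<lambda>h. expG p h / h) \<longlongrightarrow> 0) (at_right 0)"
    proof -
      have "((\<lambda>h. poly ([:0, 1:] * p) (inverse h) * exp (- inverse h)) \<longlongrightarrow> 0) (at_right (0::real))"
        by (rule filterlim_compose[OF poly_exp_tendsto_0 filterlim_inverse_at_top_right])
      then show ?thesis
        by (rule Lim_transform_eventually)
           (auto simp: eventually_at_filter expG_def field_simps)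
    qed
    ultimately have "((\<lambda>h. expG p h / h) \<longlongrightarrow> 0) (at 0)"
      by (simp add: filterlim_at_split)
    then show ?thesis using 3 by (simp add: DERIV_def expG_def)
  qed
qed

lemma expG_compose:
  assumes "q differentiable (at x)"
  shows "((\<lambda>x. expG p (q x)) has_derivative (\<lambda>v. frechet_derivative q (at x) v * expG ([:0, 0, 1:] * (p - pderiv p)) (q x))) (at x)"
  using has_derivative_compose[OF differentiable_has_fd[OF assms] expG_derivative[THEN has_field_derivative_imp_has_derivative], of p]
  by (simp add: mult.commute)

lemma expG_differentiable: "q differentiable (at x) \<Longrightarrow> (\<lambda>x. expG p (q x)) differentiable (at x)"
  using expG_compose differentiableI by blast

lemma ck_expG: "ck n q \<Longrightarrow> ck n (\<lambda>x. expG p (q x))"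
proof (induction n arbitrary: p)
  case 0 then show ?case by (auto intro: expG_differentiable)
next
  case (Suc n)
  have "pd i (\<lambda>x. expG p (q x)) = (\<lambda>x. pd i q x * expG ([:0, 0, 1:] * (p - pderiv p)) (q x))" for i
    using Suc.prems by (intro ext, subst pd_eq[OF expG_compose]) (auto simp: pd_def[of i q])
  moreover have "ck n (\<lambda>x. pd i q x * expG ([:0, 0, 1:] * (p - pderiv p)) (q x))" for i
    by (rule ck_mult[OF _ Suc.IH[OF ck_Suc_D[OF Suc.prems]]]) (use Suc.prems in auto)
  ultimately show ?case using Suc.prems by (auto intro: expG_differentiable)
qed

lemma smooth3_expG [intro]: "smooth3 q \<Longrightarrow> smooth3 (\<lambda>x. expG p (q x))"
  by (simp add: smooth3_iff_ck ck_expG)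

lemma pd_expG: "smooth3 q \<Longrightarrow> pd i (\<lambda>x. expG p (q x)) x = pd i q x * expG ([:0, 0, 1:] * (p - pderiv p)) (q x)"
  by (subst pd_eq[OF expG_compose]) (auto simp: pd_def[of i q])

lemma norm3_sq: "(norm (x::real^3))\<^sup>2 = (\<Sum>i\<in>UNIV. x $ i * x $ i)"
  by (simp add: norm_vec_def L2_set_def power2_eq_square sum_nonneg)

abbreviation "cut_arg x \<equiv> 1 - (\<Sum>i\<in>UNIV. x $ i * (x::real^3) $ i)"

lemma smooth3_cut_arg: "smooth3 (\<lambda>x. cut_arg x)" by (auto intro!: smooth3_diff smooth3_sum smooth3_mult)

lemma pd_cut_arg: "pd i (\<lambda>x. cut_arg x) x = - 2 * x $ i"
proof -
  have "pd i (\<lambda>x. cut_arg x) x = pd i (\<lambda>x. 1) x - pd i (\<lambda>x. \<Sum>j\<in>UNIV. x $ j * x $ j) x"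
    by (rule pd_diff) (auto intro!: smooth3_D smooth3_sum)
  also have "pd i (\<lambda>x::real^3. \<Sum>j\<in>UNIV. x $ j * x $ j) x = (\<Sum>j\<in>UNIV. pd i (\<lambda>x. x $ j * x $ j) x)"
    by (rule pd_sum) auto
  also have "\<dots> = (\<Sum>j\<in>UNIV. if j = i then 2 * x $ i else 0)"
    by (intro sum.cong refl) (auto simp: pd_mult)
  finally show ?thesis by simp
qed

abbreviation "lo3 \<equiv> (\<chi> i. -1) :: real^3"
abbreviation "hi3 \<equiv> (\<chi> i. 1) :: real^3"

lemma cball_subset_cbox: "norm x \<le> c \<Longrightarrow> x \<in> cbox ((\<chi> i. - c) :: real^3) (\<chi> i. c)"
  using component_le_norm_cart[of x] by (auto simp: mem_box_cart abs_le_iff intro: order_trans) 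
    (metis abs_le_iff minus_le_iff order_trans)+

text \<open>The polynomial X^2 is the one produced by differentiating \<open>expG 1\<close>. Thus
  \<open>x * bump x\<close> is an exact gradient, that of \<open>bumpi\<close>, and can be
  integrated by parts in \<open>moll_laplacian\<close>.\<close>

definition bump0 :: "real^3 \<Rightarrow> real" where "bump0 x = expG [:0, 0, 1:] (cut_arg x)"
definition bumpc :: real where "bumpc = integral (cbox lo3 hi3) bump0"
definition bump :: "real^3 \<Rightarrow> real" where "bump x = bump0 x / bumpc"
definition bumpi :: "real^3 \<Rightarrow> real" where "bumpi x = - expG 1 (cut_arg x) / (2 * bumpc)"

lemma smooth3_bump0: "smooth3 bump0"
  unfolding bump0_def[abs_def] by (intro smooth3_expG smooth3_cut_arg)

text \<open>On the cube of half side 1/4 the argument stays in [1/2, 1], where s^2 exp(-s) with s in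
  [1, 2] is at least exp(-2).\<close>

lemma bumpc_pos: "bumpc > 0"
proof -
  let ?B = "cbox ((\<chi> i. - (1/4)) :: real^3) (\<chi> i. 1/4)"
  have ge: "exp (-2) \<le> bump0 x" if "x \<in> ?B" for x
  proof -
    have "\<bar>x $ i\<bar> \<le> 1/4" for i
    proof -
      have "- (1/4) \<le> x $ i \<and> x $ i \<le> 1/4" using that by (simp add: mem_box_cart)
      then show ?thesis by (auto simp: abs_le_iff)
    qed
    then have "x $ i * x $ i \<le> 1/16" for i
      using mult_mono[of "\<bar>x $ i\<bar>" "1/4" "\<bar>x $ i\<bar>" "1/4"] by (simp add: abs_mult[symmetric])
    then have "(\<Sum>i\<in>UNIV. x $ i * x $ i) \<le> (\<Sum>i\<in>(UNIV::3 set). 1/16)" by (intro sum_mono) auto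
    moreover have "0 \<le> (\<Sum>i\<in>UNIV. x $ i * x $ i)" by (intro sum_nonneg) auto
    ultimately have c: "cut_arg x \<ge> 1/2" "cut_arg x \<le> 1" by auto
    define s where "s = 1 / cut_arg x"
    have s: "1 \<le> s" "s \<le> 2" using c by (auto simp: s_def field_simps)
    have "bump0 x = s * s * exp (- s)" using c by (simp add: bump0_def expG_def s_def)
    moreover have "1 * exp (-2) \<le> (s * s) * exp (- s)"
      using s mult_mono[of 1 s 1 s] by (intro mult_mono) auto
    ultimately show ?thesis by simp
  qed
  have "0 \<in> ?B" by (simp add: mem_box_cart)
  then have "?B \<noteq> {}" by blast
  then have "0 < measure lborel ?B * exp (-2)" by (simp add: content_cbox_if_cart)
  also have "\<dots> = integral ?B (\<lambda>x. exp (-2))" by simp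
  also have "\<dots> \<le> integral ?B bump0"
    by (intro integral_le ge integrable_continuous smooth3_cont smooth3_bump0) auto
  also have "\<dots> \<le> bumpc" unfolding bumpc_def
  proof (rule integral_subset_le)
    show "?B \<subseteq> cbox lo3 hi3"
    proof
      fix x assume "x \<in> ?B"
      then have "- (1/4) \<le> x $ i \<and> x $ i \<le> 1/4" for i by (simp add: mem_box_cart)
      then have "- 1 \<le> x $ i \<and> x $ i \<le> 1" for i by (smt (verit) divide_le_eq_1_pos)
      then show "x \<in> cbox lo3 hi3" by (simp add: mem_box_cart)
    qed
    show "\<forall>x\<in>cbox lo3 hi3. 0 \<le> bump0 x" by (simp add: bump0_def expG_def)
  qed (intro integrable_continuous smooth3_cont smooth3_bump0)+
  finally show ?thesis .
qed

lemma smooth3_bump [intro, simp]: "smooth3 bump"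
  using smooth3_mult[OF smooth3_bump0 smooth3_const[of "1 / bumpc"]] by (simp add: bump_def[abs_def])

lemma smooth3_bumpi [intro, simp]: "smooth3 bumpi"
  using smooth3_mult[OF smooth3_expG[OF smooth3_cut_arg, of 1] smooth3_const[of "- 1 / (2 * bumpc)"]]
  by (simp add: bumpi_def[abs_def])

lemma cut_arg_le_0: "norm x \<ge> 1 \<Longrightarrow> cut_arg x \<le> 0"
  using norm3_sq[of x] power_mono[of 1 "norm x" 2] by simp

lemma bump_zero: "norm x \<ge> 1 \<Longrightarrow> bump x = 0"
  using cut_arg_le_0[of x] by (simp add: bump_def bump0_def expG_def)

lemma bumpi_zero: "norm x \<ge> 1 \<Longrightarrow> bumpi x = 0"
  using cut_arg_le_0[of x] by (simp add: bumpi_def expG_def)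

lemma bump_nonneg: "bump x \<ge> 0"
  using bumpc_pos by (auto simp: bump_def bump0_def expG_def)

lemma integral_bump: "integral (cbox lo3 hi3) bump = 1"
  using bumpc_pos by (simp add: bump_def[abs_def] bumpc_def)

lemma pd_bumpi: "pd i bumpi x = x $ i * bump x"
proof -
  have "pd i bumpi x = pd i (\<lambda>x. (- 1 / (2 * bumpc)) * expG 1 (cut_arg x)) x"
    by (simp add: bumpi_def[abs_def])
  also have "\<dots> = (- 1 / (2 * bumpc)) * pd i (\<lambda>x. expG 1 (cut_arg x)) x"
    by (intro pd_cmult smooth3_D smooth3_expG smooth3_cut_arg)
  also have "\<dots> = x $ i * bump x"
    using bumpc_pos by (simp add: pd_expG smooth3_cut_arg pd_cut_arg bump_def bump0_def)
  finally show ?thesis .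
qed

section \<open>Affine changes of variables\<close>

lemma affine_pd:
  fixes f :: "real^3 \<Rightarrow> 'b::real_normed_vector"
  assumes "f differentiable (at (y + c *\<^sub>R x))"
  shows "((\<lambda>x. f (y + c *\<^sub>R x)) has_derivative (\<lambda>v. \<Sum>i\<in>UNIV. (c *\<^sub>R v) $ i *\<^sub>R pd i f (y + c *\<^sub>R x))) (at x)"
  by (rule has_derivative_compose[OF _ has_derivative_pd]) (auto intro!: derivative_eq_intros simp: assms)

lemma affine_differentiable:
  fixes f :: "real^3 \<Rightarrow> 'b::real_normed_vector"
  assumes "f differentiable (at (y + c *\<^sub>R x))"
  shows "(\<lambda>x. f (y + c *\<^sub>R x)) differentiable (at x)"
  using affine_pd[OF assms] by (rule differentiableI)

lemma pd_affine:
  fixes f :: "real^3 \<Rightarrow> 'b::real_normed_vector"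
  assumes "f differentiable (at (y + c *\<^sub>R x))"
  shows "pd i (\<lambda>x. f (y + c *\<^sub>R x)) x = c *\<^sub>R pd i f (y + c *\<^sub>R x)"
  by (simp add: pd_eq[OF affine_pd[OF assms]] axis_def if_distrib if_distribR cong: if_cong)

lemma smooth3_affine [intro]:
  fixes f :: "real^3 \<Rightarrow> 'b::real_normed_vector"
  assumes "smooth3 f" shows "smooth3 (\<lambda>x. f (y + c *\<^sub>R x))"
proof -
  have "ck n (\<lambda>x. f (y + c *\<^sub>R x))" for n
    using assms
  proof (induction n arbitrary: f)
    case 0 then show ?case by (auto intro: affine_differentiable)
  next
    case (Suc n)
    have "pd i (\<lambda>x. f (y + c *\<^sub>R x)) = (\<lambda>x. c *\<^sub>R pd i f (y + c *\<^sub>R x))" for i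
      using Suc by (intro ext pd_affine) auto
    moreover have "ck n (\<lambda>x. c *\<^sub>R pd i f (y + c *\<^sub>R x))" for i
      by (rule ck_linear[OF bounded_linear_scaleR_right]) (use Suc in auto)
    ultimately show ?case using Suc by (auto intro: affine_differentiable)
  qed
  then show ?thesis by (simp add: smooth3_iff_ck)
qed

lemma integral_affine3:
  fixes f :: "real^3 \<Rightarrow> real"
  assumes "f \<in> borel_measurable borel" "c \<noteq> 0"
  shows "integral\<^sup>L lborel f = \<bar>c\<bar> ^ 3 * (\<integral>x. f (t + c *\<^sub>R x) \<partial>lborel)"
proof -
  have "integral\<^sup>L lborel f = integral\<^sup>L (density (distr lborel borel (\<lambda>x. t + c *\<^sub>R x)) (\<lambda>_. ennreal (\<bar>c\<bar> ^ 3))) f"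
    using lborel_affine[OF assms(2), of t] by simp
  also have "\<dots> = \<bar>c\<bar> ^ 3 * (\<integral>x. f (t + c *\<^sub>R x) \<partial>lborel)"
    using assms by (subst integral_density) (auto simp: integral_distr)
  finally show ?thesis .
qed

lemma cbox_integral_BM:
  fixes f :: "real^3 \<Rightarrow> real"
  assumes "contU f" "\<And>x. norm x > c \<Longrightarrow> f x = 0"
  shows "integral (cbox (\<chi> i. - c) (\<chi> i. c)) f = integral\<^sup>L (BM c) f"
    "integral (cbox (\<chi> i. - c) (\<chi> i. c)) f = integral\<^sup>L lborel f"
proof -
  let ?a = "(\<chi> i. - c) :: real^3" and ?b = "(\<chi> i. c) :: real^3"
  have "integral (cbox ?a ?b) f = shift_avg f (\<lambda>_. 0) ?a ?b (\<lambda>_. 1) 0" by (simp add: shift_avg_def)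
  also have "\<dots> = (\<integral>p. indicator (cbox ?a ?b) p * (f p * 1) \<partial>lborel)"
    by (subst shift_avg_integrable') (auto intro: continuous_on_subset[OF assms(1)])
  also have "(\<lambda>p. indicator (cbox ?a ?b) p * (f p * 1)) = f"
    using assms(2) cball_subset_cbox[of _ c] by (auto simp: indicator_def fun_eq_iff) (meson not_le)
  finally show 1: "integral (cbox ?a ?b) f = integral\<^sup>L lborel f" .
  show "integral (cbox ?a ?b) f = integral\<^sup>L (BM c) f"
    unfolding 1 by (rule integrable_compact_support) (use assms in auto)
qed

definition moll :: "real \<Rightarrow> (real^3 \<Rightarrow> real) \<Rightarrow> real^3 \<Rightarrow> real" where
  "moll d = shift_avg bump (\<lambda>z. d *\<^sub>R z) lo3 hi3"

lemma bump_cont: "continuous_on S bump" by (simp add: smooth3_cont)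
lemma bumpi_cont: "continuous_on S bumpi" by (simp add: smooth3_cont)

lemma smooth3_moll [intro]: "smooth3 f \<Longrightarrow> smooth3 (moll d f)"
  unfolding moll_def by (intro smooth3_shift_avg bump_cont continuous_intros)

lemma pd_moll: "smooth3 f \<Longrightarrow> pd i (moll d f) = moll d (pd i f)"
  unfolding moll_def by (intro pd_shift_avg bump_cont continuous_intros)

text \<open>Weight and shift come from integrating the t-derivative of \<open>moll (d * t) g\<close>
  over [0,1] after the integration by parts in z: the factors d and d t combine to the weight d^2 t
  \<open>bumpi z\<close>. Its Laplacian is the mollification error of \<open>g\<close>.\<close>

definition kavg :: "real \<Rightarrow> (real^3 \<Rightarrow> real) \<Rightarrow> real^3 \<Rightarrow> real" where
  "kavg d = shift_avg (\<lambda>p. d\<^sup>2 * fst p * bumpi (snd p)) (\<lambda>p. (d * fst p) *\<^sub>R snd p) (0, lo3) (1, hi3)"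

lemma kavg_cont: "continuous_on S (\<lambda>p::real\<times>(real^3). d\<^sup>2 * fst p * bumpi (snd p))"
    "continuous_on S (\<lambda>p::real\<times>(real^3). (d * fst p) *\<^sub>R snd p)"
  by (auto intro!: continuous_intros continuous_on_compose2[OF bumpi_cont[of UNIV]])

lemma smooth3_kavg [intro]: "smooth3 f \<Longrightarrow> smooth3 (kavg d f)"
  unfolding kavg_def by (intro smooth3_shift_avg kavg_cont)

lemma pd_kavg: "smooth3 f \<Longrightarrow> pd i (kavg d f) = kavg d (pd i f)"
  unfolding kavg_def by (intro pd_shift_avg kavg_cont)

lemma moll_at_0 [simp]: "moll 0 f x = f x"
  using integral_bump by (simp add: moll_def shift_avg_def)

text \<open>Used twice: for the first-order error bound \<open>moll_diff_Ln\<close>, and, after one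
  more integration by parts, for the exact second-order formula
  \<open>moll_laplacian\<close>.\<close>

lemma moll_has_derivative:
  assumes g: "smooth3 g"
  shows "((\<lambda>t. moll (d * t) g x) has_real_derivative
    integral (cbox lo3 hi3) (\<lambda>z. bump z * (\<Sum>i\<in>UNIV. (- d *\<^sub>R z) $ i * pd i g (x + t *\<^sub>R (- d *\<^sub>R z))))) (at t within S)"
proof -
  have "((\<lambda>t. integral (cbox lo3 hi3) (\<lambda>z. bump z * g (x + t *\<^sub>R (- d *\<^sub>R z)))) has_real_derivative
    integral (cbox lo3 hi3) (\<lambda>z. bump z * (\<Sum>i\<in>UNIV. (- d *\<^sub>R z) $ i * pd i g (x + t *\<^sub>R (- d *\<^sub>R z))))) (at t within UNIV)"
  proof (rule leibniz_rule_field_derivative)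
    show "((\<lambda>t. bump z * g (x + t *\<^sub>R (- d *\<^sub>R z))) has_real_derivative
        bump z * (\<Sum>i\<in>UNIV. (- d *\<^sub>R z) $ i * pd i g (x + t *\<^sub>R (- d *\<^sub>R z)))) (at t within UNIV)" for t z
      by (intro DERIV_cmult line_derivative) (auto simp: g)
    show "(\<lambda>z. bump z * g (x + t *\<^sub>R (- d *\<^sub>R z))) integrable_on cbox lo3 hi3" for t
      by (intro integrable_continuous continuous_on_mult bump_cont continuous_on_compose2[OF smooth3_cont[OF g, of UNIV]] continuous_intros) auto
    show "continuous_on (UNIV \<times> cbox lo3 hi3) (\<lambda>(t, z). bump z * (\<Sum>i\<in>UNIV. (- d *\<^sub>R z) $ i * pd i g (x + t *\<^sub>R (- d *\<^sub>R z))))"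
      unfolding split_beta
      by (intro continuous_on_mult continuous_on_sum continuous_on_compose2[OF bump_cont[of UNIV]]
            continuous_on_compose2[OF smooth3_cont[OF smooth3_pd[OF g], of UNIV]] continuous_intros) auto
  qed auto
  then show ?thesis
    by (auto simp: moll_def shift_avg_def mult.commute intro: has_field_derivative_subset)
qed

text \<open>Differentiate \<open>t \<mapsto> moll (d t) g x\<close>; because \<open>z * bump z\<close> is the gradient of \<open>bumpi\<close>,
  an integration by parts in \<open>z\<close> turns the derivative into an average of the Laplacian of \<open>g\<close>.\<close>
lemma moll_laplacian:
  assumes g: "smooth3 g"
  shows "g x - moll d g x = (\<Sum>i\<in>UNIV. pd i (pd i (kavg d g)) x)"
proof -
  define L where "L = (\<lambda>x. \<Sum>i\<in>UNIV. pd i (pd i g) x)"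
  have cL: "contU L" unfolding L_def by (intro smooth3_cont smooth3_sum smooth3_pd g)
  have der: "((\<lambda>t. moll (d * t) g x) has_real_derivative
      - integral (cbox lo3 hi3) (\<lambda>z. d\<^sup>2 * t * bumpi z * L (x - (d * t) *\<^sub>R z))) (at t within {0..1})" for t
  proof -
    have e: "integral (cbox lo3 hi3) (\<lambda>z. bump z * (\<Sum>i\<in>UNIV. (- d *\<^sub>R z) $ i * pd i g (x + t *\<^sub>R (- d *\<^sub>R z))))
        = - integral (cbox lo3 hi3) (\<lambda>z. d\<^sup>2 * t * bumpi z * L (x - (d * t) *\<^sub>R z))"
    proof -
      define h where "h i z = pd i g (x + (- (d * t)) *\<^sub>R z)" for i z
      have h: "smooth3 (h i)" for i unfolding h_def by (intro smooth3_affine smooth3_pd g)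
      have ph: "pd i (h i) z = - (d * t) * pd i (pd i g) (x + (- (d * t)) *\<^sub>R z)" for i z
        unfolding h_def by (subst pd_affine) (auto simp: g smooth3_pd)
      have "integral (cbox lo3 hi3) (\<lambda>z. bump z * (\<Sum>i\<in>UNIV. (- d *\<^sub>R z) $ i * pd i g (x + t *\<^sub>R (- d *\<^sub>R z))))
        = integral (cbox lo3 hi3) (\<lambda>z. \<Sum>i\<in>UNIV. - d * (pd i bumpi z * h i z))"
        by (intro Henstock_Kurzweil_Integration.integral_cong)
           (simp add: pd_bumpi h_def sum_distrib_left algebra_simps)
      also have "\<dots> = (\<integral>z. (\<Sum>i\<in>UNIV. - d * (pd i bumpi z * h i z)) \<partial>BM 1)"
        by (rule cbox_integral_BM(1))
          (intro smooth3_cont smooth3_sum smooth3_mult smooth3_const smooth3_pd smooth3_bumpi h, simp add: pd_bumpi bump_zero)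
      also have "\<dots> = (\<Sum>i\<in>UNIV. - d * (\<integral>z. pd i bumpi z * h i z \<partial>BM 1))"
        by (subst Bochner_Integration.integral_sum)
           (auto intro!: integrable_BM smooth3_cont smooth3_mult h smooth3_pd)
      also have "\<dots> = (\<Sum>i\<in>UNIV. d * (\<integral>z. bumpi z * pd i (h i) z \<partial>BM 1))"
      proof (intro sum.cong refl)
        fix i :: 3
        have "(\<integral>z. pd i (h i) z * bumpi z \<partial>BM 1) = - (\<integral>z. h i z * pd i bumpi z \<partial>BM 1)"
          by (rule integral_pd_by_parts[where r=1]) (auto simp: h bumpi_zero)
        then show "- d * (\<integral>z. pd i bumpi z * h i z \<partial>BM 1) = d * (\<integral>z. bumpi z * pd i (h i) z \<partial>BM 1)"
          by (simp add: mult.commute)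
      qed
      also have "\<dots> = (\<integral>z. (\<Sum>i\<in>UNIV. d * (bumpi z * pd i (h i) z)) \<partial>BM 1)"
        by (subst Bochner_Integration.integral_sum)
           (auto intro!: integrable_BM smooth3_cont smooth3_mult h smooth3_pd)
      also have "\<dots> = integral (cbox lo3 hi3) (\<lambda>z. \<Sum>i\<in>UNIV. d * (bumpi z * pd i (h i) z))"
        by (rule cbox_integral_BM(1)[symmetric])
          (intro smooth3_cont smooth3_sum smooth3_mult smooth3_const smooth3_pd smooth3_bumpi h, simp add: bumpi_zero)
      also have "\<dots> = integral (cbox lo3 hi3) (\<lambda>z. - (d\<^sup>2 * t * bumpi z * L (x - (d * t) *\<^sub>R z)))"
        by (intro Henstock_Kurzweil_Integration.integral_cong)
           (simp add: ph L_def sum_distrib_left power2_eq_square algebra_simps sum_negf)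
      finally show ?thesis by simp
    qed
    show ?thesis using moll_has_derivative[OF g, of d x t "{0..1}"] unfolding e .
  qed
  have c: "continuous_on (cbox (0, lo3) (1, hi3)) (\<lambda>p. d\<^sup>2 * fst p * bumpi (snd p) * L (x - (d * fst p) *\<^sub>R snd p))"
    by (intro continuous_on_mult continuous_on_compose2[OF bumpi_cont[of UNIV]] continuous_on_compose2[OF cL] continuous_intros) auto
  have "((\<lambda>t. - integral (cbox lo3 hi3) (\<lambda>z. d\<^sup>2 * t * bumpi z * L (x - (d * t) *\<^sub>R z))) has_integral
      (moll (d * 1) g x - moll (d * 0) g x)) {0..1}"
    by (rule fundamental_theorem_of_calculus) (use der in \<open>auto simp: has_real_derivative_iff_has_vector_derivative[symmetric]\<close>)
  then have "g x - moll d g x = integral {0..1} (\<lambda>t. integral (cbox lo3 hi3) (\<lambda>z. d\<^sup>2 * t * bumpi z * L (x - (d * t) *\<^sub>R z)))"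
    by (auto dest: integral_unique)
  also have "\<dots> = kavg d L x"
    using integral_prod_continuous[OF c] by (simp add: kavg_def shift_avg_def)
  also have "\<dots> = (\<Sum>i\<in>UNIV. kavg d (pd i (pd i g)) x)"
    unfolding kavg_def L_def shift_avg_def sum_distrib_left
    by (rule integral_sum) (auto intro!: shift_avg_integrable kavg_cont smooth3_cont smooth3_pd g)
  also have "\<dots> = (\<Sum>i\<in>UNIV. pd i (pd i (kavg d g)) x)"
    by (simp add: pd_kavg g smooth3_pd)
  finally show ?thesis .
qed

lemma content_cube:
  assumes "c \<ge> 0" shows "measure lborel (cbox ((\<chi> i. - c) :: real^3) (\<chi> i. c)) = (2 * c) ^ 3"
proof -
  have "(0::real^3) \<in> cbox (\<chi> i. - c) (\<chi> i. c)" using assms by (simp add: mem_box_cart)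
  then have "cbox ((\<chi> i. - c) :: real^3) (\<chi> i. c) \<noteq> {}" by blast
  then show ?thesis by (simp add: content_cbox_if_cart prod_constant)
qed

text \<open>The square root of 3 rounded up; this is why mollification at scale d enlarges radii by
  2 d.\<close>

lemma norm_cbox3: assumes "z \<in> cbox lo3 hi3" shows "norm z \<le> 2"
proof -
  have "z $ i * z $ i \<le> 1" for i
  proof -
    have "- 1 \<le> z $ i \<and> z $ i \<le> 1" using assms by (simp add: mem_box_cart)
    then have "\<bar>z $ i\<bar> \<le> 1" by auto
    then show ?thesis using mult_mono[of "\<bar>z $ i\<bar>" 1 "\<bar>z $ i\<bar>" 1] by (simp add: abs_mult[symmetric])
  qed
  then have "(norm z)\<^sup>2 \<le> (\<Sum>i\<in>(UNIV::3 set). 1)" unfolding norm3_sq by (intro sum_mono) auto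
  then have "(norm z)\<^sup>2 \<le> 2\<^sup>2" by simp
  then show ?thesis by (rule power2_le_imp_le) simp
qed

lemma moll_h: "z \<in> cbox lo3 hi3 \<Longrightarrow> 0 \<le> d \<Longrightarrow> norm (d *\<^sub>R z) \<le> 2 * d"
  using norm_cbox3[of z] mult_left_mono[of "norm z" 2 d] by (simp add: mult.commute)

lemma moll_Ln:
  assumes "contU f" "1 < q" "0 \<le> d" shows "Ln r q (moll d f) \<le> Ln (r + 2 * d) q f"
proof -
  have "Ln r q (moll d f) \<le> integral (cbox lo3 hi3) (\<lambda>z. \<bar>bump z\<bar>) * Ln (r + 2 * d) q f"
    unfolding moll_def by (rule shift_avg_Ln) (use assms moll_h in \<open>auto intro!: bump_cont continuous_intros\<close>)
  then show ?thesis using integral_bump by (simp add: bump_nonneg)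
qed

text \<open>By the fundamental theorem of calculus along the shift the error is again a
  \<open>shift_avg\<close>, now of the first derivatives and with a weight of total mass at most d,
  so the convolution inequality applies. The factor 8 is generous.\<close>

lemma moll_diff_Ln:
  assumes f: "smooth3 f" and d: "0 \<le> d"
  shows "Ln r 2 (\<lambda>x. f x - moll d f x) \<le> 8 * d * (\<Sum>i\<in>UNIV. Ln (r + 2 * d) 2 (pd i f))"
proof -
  define w where "w i = (\<lambda>p::real\<times>(real^3). d * bump (snd p) * snd p $ i)" for i
  define h where "h = (\<lambda>p::real\<times>(real^3). (d * fst p) *\<^sub>R snd p)"
  have cw: "continuous_on S (w i)" for S i unfolding w_def
    by (intro continuous_on_mult continuous_on_compose2[OF bump_cont[of UNIV]] continuous_intros) auto
  have ch: "continuous_on S h" for S unfolding h_def by (intro continuous_intros)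
  have e: "f x - moll d f x = (\<Sum>i\<in>UNIV. shift_avg (w i) h (0, lo3) (1, hi3) (pd i f) x)" for x
  proof -
    have c: "continuous_on (cbox (0, lo3) (1, hi3)) (\<lambda>p. \<Sum>i\<in>UNIV. w i p * pd i f (x - h p))"
      by (intro continuous_on_sum continuous_on_mult cw continuous_on_compose2[OF smooth3_cont[OF smooth3_pd[OF f], of UNIV]] continuous_intros ch) auto
    have "((\<lambda>t. integral (cbox lo3 hi3) (\<lambda>z. bump z * (\<Sum>i\<in>UNIV. (- d *\<^sub>R z) $ i * pd i f (x + t *\<^sub>R (- d *\<^sub>R z))))) has_integral
        (moll (d * 1) f x - moll (d * 0) f x)) {0..1}"
      by (rule fundamental_theorem_of_calculus)
        (simp, subst has_real_derivative_iff_has_vector_derivative[symmetric], rule moll_has_derivative[OF f])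
    then have "f x - moll d f x = - integral {0..1} (\<lambda>t. integral (cbox lo3 hi3) (\<lambda>z. bump z * (\<Sum>i\<in>UNIV. (- d *\<^sub>R z) $ i * pd i f (x + t *\<^sub>R (- d *\<^sub>R z)))))"
      by (auto dest: integral_unique)
    also have "\<dots> = - integral {0..1} (\<lambda>t. integral (cbox lo3 hi3) (\<lambda>z. - (\<Sum>i\<in>UNIV. w i (t, z) * pd i f (x - h (t, z)))))"
      by (intro arg_cong[where f=uminus] Henstock_Kurzweil_Integration.integral_cong)
         (simp add: w_def h_def sum_distrib_left sum_negf algebra_simps)
    also have "\<dots> = integral (cbox (0, lo3) (1, hi3)) (\<lambda>p. \<Sum>i\<in>UNIV. w i p * pd i f (x - h p))"
      using integral_prod_continuous[OF c] by simp
    also have "\<dots> = (\<Sum>i\<in>UNIV. shift_avg (w i) h (0, lo3) (1, hi3) (pd i f) x)"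
      unfolding shift_avg_def by (rule integral_sum) (auto intro!: shift_avg_integrable cw ch smooth3_cont smooth3_pd f)
    finally show ?thesis .
  qed
  have W: "integral (cbox (0, lo3) (1, hi3)) (\<lambda>p. \<bar>w i p\<bar>) \<le> 8 * d" for i
  proof -
    have c: "continuous_on (cbox (0, lo3) (1, hi3)) (\<lambda>p::real\<times>(real^3). d * bump (snd p))"
      by (intro continuous_on_mult continuous_on_compose2[OF bump_cont[of UNIV]] continuous_intros) auto
    have "integral (cbox (0, lo3) (1, hi3)) (\<lambda>p. \<bar>w i p\<bar>) \<le> integral (cbox (0, lo3) (1, hi3)) (\<lambda>p::real\<times>(real^3). d * bump (snd p))"
    proof (rule integral_le)
      fix p :: "real \<times> (real^3)" assume "p \<in> cbox (0, lo3) (1, hi3)"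
      then have "- 1 \<le> snd p $ i \<and> snd p $ i \<le> 1" by (cases p) (auto simp: mem_box_cart)
      then have "\<bar>snd p $ i\<bar> \<le> 1" by auto
      then have "(d * bump (snd p)) * \<bar>snd p $ i\<bar> \<le> (d * bump (snd p)) * 1"
        using d bump_nonneg by (intro mult_left_mono) auto
      then show "\<bar>w i p\<bar> \<le> d * bump (snd p)" using d bump_nonneg by (simp add: w_def abs_mult)
    qed (auto intro!: integrable_continuous continuous_on_rabs cw c)
    also have "\<dots> = d" using integral_prod_continuous[OF c] integral_bump by simp
    finally show ?thesis using d by simp
  qed
  have "Ln r 2 (\<lambda>x. f x - moll d f x) \<le> (\<Sum>i\<in>UNIV. Ln r 2 (shift_avg (w i) h (0, lo3) (1, hi3) (pd i f)))"
    unfolding e by (rule Ln_sum) (auto intro!: shift_avg_continuous cw ch smooth3_cont smooth3_pd f)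
  also have "\<dots> \<le> (\<Sum>i\<in>UNIV. 8 * d * Ln (r + 2 * d) 2 (pd i f))"
  proof (rule sum_mono)
    fix i
    have "norm (h p) \<le> 2 * d" if "p \<in> cbox (0, lo3) (1, hi3)" for p
    proof -
      obtain t z where p: "p = (t, z)" by (cases p)
      with that have tz: "0 \<le> t" "t \<le> 1" "z \<in> cbox lo3 hi3" by auto
      have "norm (h p) \<le> 1 * norm (d *\<^sub>R z)" using tz d unfolding p h_def
        by (simp add: abs_mult mult_right_mono mult_left_le)
      then show ?thesis using moll_h[OF tz(3) d] by simp
    qed
    then have "Ln r 2 (shift_avg (w i) h (0, lo3) (1, hi3) (pd i f)) \<le> integral (cbox (0, lo3) (1, hi3)) (\<lambda>p. \<bar>w i p\<bar>) * Ln (r + 2 * d) 2 (pd i f)"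
      by (intro shift_avg_Ln) (auto intro!: cw ch smooth3_cont smooth3_pd f)
    also have "\<dots> \<le> 8 * d * Ln (r + 2 * d) 2 (pd i f)" by (intro mult_right_mono W) auto
    finally show "Ln r 2 (shift_avg (w i) h (0, lo3) (1, hi3) (pd i f)) \<le> 8 * d * Ln (r + 2 * d) 2 (pd i f)" .
  qed
  finally show ?thesis by (simp add: sum_distrib_left)
qed

definition "bump_bound C \<longleftrightarrow> C > 0 \<and> (\<forall>i j x. \<bar>bump x\<bar> \<le> C \<and> \<bar>pd i bump x\<bar> \<le> C \<and> \<bar>pd i (pd j bump) x\<bar> \<le> C)"
text \<open>A chosen constant instead of an existential one keeps every later constant a closed
  term, visibly independent of the solution and of the radii.\<close>

definition "bumpC = (SOME C. bump_bound C)"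

lemma bump_bound_bumpC: "bump_bound bumpC"
proof -
  have z: "norm x > 1 \<Longrightarrow> bump x = 0" for x using bump_zero[of x] by simp
  have z1: "norm x > 1 \<Longrightarrow> pd i bump x = 0" for x i by (rule pd_zero_outside[of 1 bump]) (use z in auto)
  have z2: "norm x > 1 \<Longrightarrow> pd i (pd j bump) x = 0" for x i j by (rule pd_zero_outside[of 1 "pd j bump"]) (use z1 in auto)
  obtain c0 where c0: "c0 > 0" "\<And>x. \<bar>bump x\<bar> \<le> c0"
    using bounded_compact_support[of bump 1] z bump_cont by auto
  have "\<forall>i. \<exists>c>0. \<forall>x. \<bar>pd i bump x\<bar> \<le> c"
    using bounded_compact_support[OF smooth3_cont[OF smooth3_pd[OF smooth3_bump]] z1] by metis
  then obtain c1 where c1: "\<And>i. c1 i > 0" "\<And>i x. \<bar>pd i bump x\<bar> \<le> c1 i" by metis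
  have "\<forall>i j. \<exists>c>0. \<forall>x. \<bar>pd i (pd j bump) x\<bar> \<le> c"
    using bounded_compact_support[OF smooth3_cont[OF smooth3_pd[OF smooth3_pd[OF smooth3_bump]]] z2] by metis
  then obtain c2 where c2: "\<And>i j. c2 i j > 0" "\<And>i j x. \<bar>pd i (pd j bump) x\<bar> \<le> c2 i j" by metis
  let ?C = "c0 + (\<Sum>i\<in>UNIV. c1 i) + (\<Sum>i\<in>UNIV. \<Sum>j\<in>UNIV. c2 i j)"
  have p: "0 \<le> (\<Sum>i\<in>UNIV. c1 i)" "0 \<le> (\<Sum>i\<in>UNIV. \<Sum>j\<in>UNIV. c2 i j)"
    using c1(1) c2(1) by (simp_all add: sum_nonneg less_imp_le)
  have 1: "c1 i \<le> (\<Sum>i\<in>UNIV. c1 i)" for i using c1 by (intro member_le_sum) (auto intro: less_imp_le)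
  have 2: "c2 i j \<le> (\<Sum>i\<in>UNIV. \<Sum>j\<in>UNIV. c2 i j)" for i j
  proof -
    have "c2 i j \<le> (\<Sum>j\<in>UNIV. c2 i j)" using c2 by (intro member_le_sum) (auto intro: less_imp_le)
    also have "\<dots> \<le> (\<Sum>i\<in>UNIV. \<Sum>j\<in>UNIV. c2 i j)" using c2 by (intro member_le_sum[of _ _ "\<lambda>i. \<Sum>j\<in>UNIV. c2 i j"]) (auto intro!: sum_nonneg intro: less_imp_le)
    finally show ?thesis .
  qed
  have "bump_bound ?C" unfolding bump_bound_def
  proof (intro conjI allI)
    fix i j x
    show "\<bar>bump x\<bar> \<le> ?C" using c0(2)[of x] p by linarith
    show "\<bar>pd i bump x\<bar> \<le> ?C" using c0(1) c1(2)[of i x] 1[of i] p by linarith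
    show "\<bar>pd i (pd j bump) x\<bar> \<le> ?C" using c0(1) c2(2)[of i j x] 2[of i j] p by linarith
  qed (use c0 p in linarith)
  then show ?thesis unfolding bumpC_def by (rule someI)
qed

lemma bumpC: "bumpC > 0" "\<bar>bump x\<bar> \<le> bumpC" "\<bar>pd i bump x\<bar> \<le> bumpC" "\<bar>pd i (pd j bump) x\<bar> \<le> bumpC"
  using bump_bound_bumpC unfolding bump_bound_def by auto

text \<open>The derivative is moved onto the kernel, which trades it for 1/d. It is applied to the
  potentials, whose own gradient is not under control. The factor 8 is the volume of the cube
  carrying the kernel.\<close>

lemma pd_moll_Ln:
  assumes f: "smooth3 f" and q: "1 < q" and d: "0 < d"
  shows "Ln r q (pd i (moll d f)) \<le> 8 * bumpC / d * Ln (r + 2 * d) q f"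
proof -
  have e: "pd i (moll d f) x = (1 / d) * shift_avg (pd i bump) (\<lambda>z. d *\<^sub>R z) lo3 hi3 f x" for x
  proof -
    have s: "smooth3 (\<lambda>z. f (x + (- d) *\<^sub>R z))" by (intro smooth3_affine f)
    have p: "pd i (\<lambda>z. f (x + (- d) *\<^sub>R z)) z = - d * pd i f (x + (- d) *\<^sub>R z)" for z
      by (subst pd_affine) (auto simp: f)
    have "pd i (moll d f) x = (- 1 / d) * integral (cbox lo3 hi3) (\<lambda>z. pd i (\<lambda>z. f (x + (- d) *\<^sub>R z)) z * bump z)"
    proof -
      have "pd i (moll d f) x = integral (cbox lo3 hi3) (\<lambda>z. bump z * pd i f (x - d *\<^sub>R z))"
        by (simp only: pd_moll[OF f]) (simp only: moll_def shift_avg_def)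
      also have "\<dots> = integral (cbox lo3 hi3) (\<lambda>z. (- 1 / d) * (pd i (\<lambda>z. f (x + (- d) *\<^sub>R z)) z * bump z))"
        using d by (intro Henstock_Kurzweil_Integration.integral_cong) (simp only: p, simp add: field_simps)
      finally show ?thesis by (simp only: Henstock_Kurzweil_Integration.integral_mult_right)
    qed
    also have "integral (cbox lo3 hi3) (\<lambda>z. pd i (\<lambda>z. f (x + (- d) *\<^sub>R z)) z * bump z) = (\<integral>z. pd i (\<lambda>z. f (x + (- d) *\<^sub>R z)) z * bump z \<partial>BM 1)"
      by (rule cbox_integral_BM(1)) (intro smooth3_cont smooth3_mult smooth3_pd s smooth3_bump, simp add: bump_zero)
    also have "\<dots> = - (\<integral>z. f (x + (- d) *\<^sub>R z) * pd i bump z \<partial>BM 1)"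
      by (rule integral_pd_by_parts[OF s smooth3_bump, where r=1]) (auto simp: bump_zero)
    also have "(\<integral>z. f (x + (- d) *\<^sub>R z) * pd i bump z \<partial>BM 1) = integral (cbox lo3 hi3) (\<lambda>z. f (x + (- d) *\<^sub>R z) * pd i bump z)"
      by (rule cbox_integral_BM(1)[symmetric])
        (rule smooth3_cont[OF smooth3_mult[OF s smooth3_pd[OF smooth3_bump]]], simp add: pd_zero_outside[of 1 bump] bump_zero)
    finally show ?thesis by (simp add: shift_avg_def mult.commute)
  qed
  have c: "continuous_on S (pd i bump)" for S by (intro smooth3_cont smooth3_pd smooth3_bump)
  have W: "integral (cbox lo3 hi3) (\<lambda>z. \<bar>pd i bump z\<bar>) \<le> 8 * bumpC"
  proof -
    have "integral (cbox lo3 hi3) (\<lambda>z. \<bar>pd i bump z\<bar>) \<le> integral (cbox lo3 hi3) (\<lambda>z. bumpC)"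
      by (intro integral_le integrable_continuous continuous_on_rabs c continuous_on_const bumpC)
    also have "\<dots> = 8 * bumpC" by (use content_cube[of 1] in simp)
    finally show ?thesis .
  qed
  have "Ln r q (pd i (moll d f)) = Ln r q (\<lambda>x. (1 / d) * shift_avg (pd i bump) (\<lambda>z. d *\<^sub>R z) lo3 hi3 f x)"
    by (rule Ln_cong) (simp add: e)
  also have "\<dots> = (1 / d) * Ln r q (shift_avg (pd i bump) (\<lambda>z. d *\<^sub>R z) lo3 hi3 f)"
    using q d shift_avg_continuous[OF c continuous_on_scaleR[OF continuous_on_const continuous_on_id] smooth3_cont[OF f]]
    by (subst Ln_cmult) auto
  also have "\<dots> \<le> (1 / d) * (integral (cbox lo3 hi3) (\<lambda>z. \<bar>pd i bump z\<bar>) * Ln (r + 2 * d) q f)"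
    using q d norm_cbox3 smooth3_cont[OF f]
    by (intro mult_left_mono shift_avg_Ln) (auto intro!: c continuous_on_scaleR continuous_on_const continuous_on_id)
  also have "\<dots> \<le> (1 / d) * (8 * bumpC * Ln (r + 2 * d) q f)"
    using d by (intro mult_left_mono mult_right_mono W) auto
  finally show ?thesis by simp
qed

definition bumpd :: "real \<Rightarrow> real^3 \<Rightarrow> real" where
  "bumpd d x = (1 / d ^ 3) * bump (0 + (1 / d) *\<^sub>R x)"

lemma smooth3_bumpd [intro, simp]: "smooth3 (bumpd d)"
  unfolding bumpd_def[abs_def] by (intro smooth3_mult smooth3_const smooth3_affine smooth3_bump)

lemma bumpd_zero: "norm x \<ge> d \<Longrightarrow> d > 0 \<Longrightarrow> bumpd d x = 0"
  by (simp add: bumpd_def bump_zero)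

lemma bumpd_nonneg: "d > 0 \<Longrightarrow> 0 \<le> bumpd d x"
  by (simp add: bumpd_def bump_nonneg)

lemma pd_bumpd: "pd i (bumpd d) = (\<lambda>x. (1 / d ^ 4) * pd i bump (0 + (1 / d) *\<^sub>R x))"
proof
  fix x
  have "pd i (bumpd d) x = (1 / d ^ 3) * pd i (\<lambda>x. bump (0 + (1 / d) *\<^sub>R x)) x"
    unfolding bumpd_def[abs_def] by (intro pd_cmult smooth3_D smooth3_affine smooth3_bump)
  also have "pd i (\<lambda>x. bump (0 + (1 / d) *\<^sub>R x)) x = (1 / d) * pd i bump (0 + (1 / d) *\<^sub>R x)"
    by (subst pd_affine) auto
  finally show "pd i (bumpd d) x = (1 / d ^ 4) * pd i bump (0 + (1 / d) *\<^sub>R x)"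
    by (simp add: eval_nat_numeral)
qed

lemma pd2_bumpd: "pd i (pd j (bumpd d)) x = (1 / d ^ 5) * pd i (pd j bump) (0 + (1 / d) *\<^sub>R x)"
proof -
  have s: "smooth3 (pd j bump)" by (intro smooth3_pd smooth3_bump)
  have "pd i (pd j (bumpd d)) x = (1 / d ^ 4) * pd i (\<lambda>x. pd j bump (0 + (1 / d) *\<^sub>R x)) x"
    unfolding pd_bumpd by (intro pd_cmult smooth3_D smooth3_affine s)
  also have "pd i (\<lambda>x. pd j bump (0 + (1 / d) *\<^sub>R x)) x = (1 / d) * pd i (pd j bump) (0 + (1 / d) *\<^sub>R x)"
    using s by (subst pd_affine) auto
  finally show ?thesis by (simp add: eval_nat_numeral)
qed

lemma bumpd_bounds:
  assumes "d > 0"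
  shows "\<bar>pd i (bumpd d) x\<bar> \<le> bumpC / d ^ 4" "\<bar>pd i (pd j (bumpd d)) x\<bar> \<le> bumpC / d ^ 5"
proof -
  show "\<bar>pd i (bumpd d) x\<bar> \<le> bumpC / d ^ 4"
    using assms bumpC(3)[of i "0 + (1 / d) *\<^sub>R x"] by (simp only: pd_bumpd) (simp add: abs_mult divide_right_mono)
  have "\<bar>pd i (pd j (bumpd d)) x\<bar> = \<bar>pd i (pd j bump) (0 + (1 / d) *\<^sub>R x)\<bar> / d ^ 5"
    using assms by (simp only: pd2_bumpd) (simp add: abs_mult)
  then show "\<bar>pd i (pd j (bumpd d)) x\<bar> \<le> bumpC / d ^ 5"
    using assms bumpC(4)[of i j "0 + (1 / d) *\<^sub>R x"] by (simp only: divide_right_mono zero_le_power less_imp_le)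
qed

text \<open>The substitution y = x - d z. In this form the kernel at x - y can be compared with the
  kernel at x, which is how \<open>bogovskii\<close> uses the mean-zero condition.\<close>

lemma moll_kernel:
  assumes f: "contU f" and d: "d > 0"
  shows "moll d f x = (\<integral>y. bumpd d (x - y) * f y \<partial>lborel)"
proof -
  let ?F = "\<lambda>y. bumpd d (x - y) * f y"
  have "contU ?F" by (intro continuous_on_mult f continuous_on_compose2[OF smooth3_cont[OF smooth3_bumpd, of UNIV]] continuous_intros) auto
  then have "integral\<^sup>L lborel ?F = \<bar>- d\<bar> ^ 3 * (\<integral>z. ?F (x + (- d) *\<^sub>R z) \<partial>lborel)"
    using d by (intro integral_affine3 borel_measurable_continuous_onI) auto
  also have "\<dots> = (\<integral>z. bump z * f (x - d *\<^sub>R z) \<partial>lborel)"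
    using d by (subst integral_mult_right_zero[symmetric]) (simp add: bumpd_def)
  also have "\<dots> = integral (cbox lo3 hi3) (\<lambda>z. bump z * f (x - d *\<^sub>R z))"
    by (rule cbox_integral_BM(2)[symmetric])
       (auto intro!: continuous_on_mult bump_cont continuous_on_compose2[OF f] continuous_intros simp: bump_zero)
  finally show ?thesis by (simp add: moll_def shift_avg_def)
qed

section \<open>Cutoffs and a Bogovskii operator\<close>

lemma bumpd_integral:
  assumes "d > 0" shows "(\<integral>y. bumpd d (x - y) \<partial>lborel) = 1"
proof -
  have "moll d (\<lambda>_. 1) x = 1" using integral_bump by (simp add: moll_def shift_avg_def)
  then show ?thesis using moll_kernel[of "\<lambda>_. 1" d x] assms by simp
qed

lemma shift_avg_bound:
  fixes w :: "'p::euclidean_space \<Rightarrow> real"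
  assumes w: "continuous_on (cbox a b) w" and h: "continuous_on (cbox a b) h" and f: "contU f" "\<And>x. \<bar>f x\<bar> \<le> c"
  shows "\<bar>shift_avg w h a b f x\<bar> \<le> integral (cbox a b) (\<lambda>p. \<bar>w p\<bar>) * c"
proof -
  have wa: "continuous_on (cbox a b) (\<lambda>p. \<bar>w p\<bar>)" by (intro continuous_intros w)
  have "\<bar>shift_avg w h a b f x\<bar> \<le> integral (cbox a b) (\<lambda>p. \<bar>w p\<bar> * c)"
    unfolding shift_avg_def
  proof (rule integral_norm_bound_integral[where 'a=real, unfolded real_norm_def])
    show "(\<lambda>p. w p * f (x - h p)) integrable_on cbox a b" by (rule shift_avg_integrable[OF w h f(1)])
    show "(\<lambda>p. \<bar>w p\<bar> * c) integrable_on cbox a b" by (intro integrable_on_mult_left integrable_continuous wa)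
    show "\<bar>w p * f (x - h p)\<bar> \<le> \<bar>w p\<bar> * c" for p using f(2) by (simp add: abs_mult mult_left_mono)
  qed
  then show ?thesis by simp
qed

text \<open>The bounds are deliberately crude: 216 is the volume of the cube of side 6, times the
  size e^(-5) of second derivatives of a kernel of width e = d/4. First derivatives are given the
  same rate since e \<le> 1; powers of d need no economy later.\<close>

definition is_cutoff :: "real \<Rightarrow> real \<Rightarrow> (real^3 \<Rightarrow> real) \<Rightarrow> bool" where
  "is_cutoff r d \<eta> \<longleftrightarrow> smooth3 \<eta> \<and> (\<forall>x. 0 \<le> \<eta> x \<and> \<eta> x \<le> 1) \<and> (\<forall>x. norm x \<le> r \<longrightarrow> \<eta> x = 1) \<and> (\<forall>x. r + d < norm x \<longrightarrow> \<eta> x = 0) \<and>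
    (\<forall>i x. \<bar>pd i \<eta> x\<bar> \<le> 216 * 4 ^ 5 * bumpC / d ^ 5) \<and> (\<forall>i j x. \<bar>pd i (pd j \<eta>) x\<bar> \<le> 216 * 4 ^ 5 * bumpC / d ^ 5)"

lemma cutoff_exists:
  assumes d: "0 < d" "d \<le> 1" and r: "0 \<le> r" "r + d \<le> 3"
  shows "\<exists>\<eta>. is_cutoff r d \<eta>"
proof -
  \<comment> \<open>Mollifying at a quarter of the layer a profile that is 1 up to r + e and 0 from
    r + 3 e leaves the value exactly 1 on radius r and 0 beyond r + 4 e = r + d.\<close>
  define e where "e = d / 4"
  have e: "0 < e" "e \<le> 1" using d by (auto simp: e_def)
  define \<kappa> where "\<kappa> y = max 0 (min 1 ((r + 3 * e - norm (y::real^3)) / (2 * e)))" for y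
  have k01: "0 \<le> \<kappa> y" "\<kappa> y \<le> 1" for y by (auto simp: \<kappa>_def)
  have k1: "\<kappa> y = 1" if "norm y \<le> r + e" for y using that e by (simp add: \<kappa>_def max_def min_def field_simps)
  have k0: "\<kappa> y = 0" if "norm y \<ge> r + 3 * e" for y
  proof -
    have "(r + 3 * e - norm y) / (2 * e) \<le> 0" using that e by (simp add: divide_le_0_iff)
    then show ?thesis unfolding \<kappa>_def by (auto simp: max_def min_def)
  qed
  have ck: "continuous_on S \<kappa>" for S unfolding \<kappa>_def[abs_def] using e by (intro continuous_intros) auto
  let ?a = "(\<chi> i. - 3) :: real^3" and ?b = "(\<chi> i. 3) :: real^3"
  define \<eta> where "\<eta> = shift_avg \<kappa> (\<lambda>y. y) ?a ?b (bumpd e)"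
  have sm: "smooth3 \<eta>" unfolding \<eta>_def by (intro smooth3_shift_avg ck continuous_intros smooth3_bumpd)
  have cb: "contU (\<lambda>y. bumpd e (x - y))" for x
    by (intro continuous_on_compose2[OF smooth3_cont[OF smooth3_bumpd, of UNIV]] continuous_intros) auto
  have int: "integrable lborel (\<lambda>y. bumpd e (x - y))" for x
  proof (rule integrable_compact_support(1)[OF cb, of "norm x + e"])
    fix y :: "real^3" assume "norm y > norm x + e"
    then have "norm (x - y) \<ge> e" using norm_triangle_ineq2[of y x] by (simp add: norm_minus_commute)
    then show "bumpd e (x - y) = 0" using e by (intro bumpd_zero) auto
  qed
  have eq: "\<eta> x = (\<integral>y. \<kappa> y * bumpd e (x - y) \<partial>lborel)" for x
  proof -
    have "norm (y::real^3) > 3 \<Longrightarrow> \<kappa> y * bumpd e (x - y) = 0" for y :: "real^3" using k0[of y] r d by (auto simp: e_def)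
    then show ?thesis unfolding \<eta>_def shift_avg_def
      by (intro cbox_integral_BM(2)) (intro continuous_on_mult ck cb, auto)
  qed
  have intk: "integrable lborel (\<lambda>y. \<kappa> y * bumpd e (x - y))" for x
    using int[of x] by (rule Bochner_Integration.integrable_bound)
      (use k01 bumpd_nonneg[OF e(1)] in \<open>auto intro!: borel_measurable_continuous_onI continuous_on_mult ck cb simp: abs_mult mult_left_le_one_le\<close>)
  have "0 \<le> \<eta> x" for x
    unfolding eq using k01 bumpd_nonneg[OF e(1)] by (intro integral_nonneg_AE) auto
  moreover have "\<eta> x \<le> 1" for x
  proof -
    have "\<eta> x \<le> (\<integral>y. bumpd e (x - y) \<partial>lborel)"
      unfolding eq using k01 bumpd_nonneg[OF e(1)] by (intro integral_mono intk int) (auto simp: mult_left_le_one_le)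
    then show ?thesis using bumpd_integral[OF e(1)] by simp
  qed
  moreover have "\<eta> x = 1" if x: "norm x \<le> r" for x
  proof -
    have kk: "\<kappa> y * bumpd e (x - y) = bumpd e (x - y)" for y :: "real^3"
    proof (cases "norm (x - y) \<ge> e")
      case False
      then have "norm y \<le> r + e" using x norm_triangle_ineq2[of y x] by (simp add: norm_minus_commute)
      then show ?thesis by (simp add: k1)
    qed (use bumpd_zero e in auto)
    show ?thesis unfolding eq kk using bumpd_integral[OF e(1)] .
  qed
  moreover have "\<eta> x = 0" if x: "r + d < norm x" for x
  proof -
    have kk: "\<kappa> y * bumpd e (x - y) = 0" for y :: "real^3"
    proof (cases "norm (x - y) \<ge> e")
      case False
      then have "norm y \<ge> r + 3 * e" using x norm_triangle_ineq2[of x y] by (simp add: e_def)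
      then show ?thesis by (simp add: k0)
    qed (use bumpd_zero e in auto)
    show ?thesis unfolding eq kk by simp
  qed
  moreover have W: "integral (cbox ?a ?b) (\<lambda>y. \<bar>\<kappa> y\<bar>) \<le> 216"
  proof -
    have "integral (cbox ?a ?b) (\<lambda>y. \<bar>\<kappa> y\<bar>) \<le> integral (cbox ?a ?b) (\<lambda>y. 1)"
      using k01 by (intro integral_le integrable_continuous continuous_on_rabs ck continuous_on_const) auto
    also have "\<dots> = 216" by (use content_cube[of 3] in simp)
    finally show ?thesis .
  qed
  moreover have "\<bar>pd i \<eta> x\<bar> \<le> 216 * 4 ^ 5 * bumpC / d ^ 5" for i x
  proof -
    have "\<bar>pd i \<eta> x\<bar> \<le> integral (cbox ?a ?b) (\<lambda>y. \<bar>\<kappa> y\<bar>) * (bumpC / e ^ 4)"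
      unfolding \<eta>_def pd_shift_avg[OF ck continuous_on_id smooth3_bumpd]
      by (rule shift_avg_bound[OF ck continuous_on_id smooth3_cont[OF smooth3_pd[OF smooth3_bumpd]] bumpd_bounds(1)[OF e(1)]])
    also have "\<dots> \<le> 216 * (bumpC / e ^ 5)"
      using W bumpC(1) e power_decreasing[of 4 5 e] by (intro mult_mono divide_left_mono) auto
    finally show ?thesis by (simp add: e_def power_divide)
  qed
  moreover have "\<bar>pd i (pd j \<eta>) x\<bar> \<le> 216 * 4 ^ 5 * bumpC / d ^ 5" for i j x
  proof -
    have "\<bar>pd i (pd j \<eta>) x\<bar> \<le> integral (cbox ?a ?b) (\<lambda>y. \<bar>\<kappa> y\<bar>) * (bumpC / e ^ 5)"
      unfolding \<eta>_def pd_shift_avg[OF ck continuous_on_id smooth3_bumpd] pd_shift_avg[OF ck continuous_on_id smooth3_pd[OF smooth3_bumpd]]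
      by (rule shift_avg_bound[OF ck continuous_on_id smooth3_cont[OF smooth3_pd[OF smooth3_pd[OF smooth3_bumpd]]] bumpd_bounds(2)[OF e(1)]])
    also have "\<dots> \<le> 216 * (bumpC / e ^ 5)"
      using W bumpC(1) e by (intro mult_mono) auto
    finally show ?thesis by (simp add: e_def power_divide)
  qed
  ultimately show ?thesis using sm unfolding is_cutoff_def by blast
qed

lemma Ln_support:
  assumes f: "contU f" and z: "\<And>x. norm x > r \<Longrightarrow> f x = 0" and q: "0 < q" and r: "r \<le> r1" "r \<le> r2"
  shows "Ln r1 q f = Ln r2 q f"
proof -
  have "(\<integral>x. \<bar>f x\<bar> powr q \<partial>BM s) = (\<integral>x. \<bar>f x\<bar> powr q \<partial>lborel)" if "r \<le> s" for s
    by (rule integrable_compact_support(2)[symmetric]) (use that z q in \<open>auto intro!: cont_powr f\<close>)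
  then show ?thesis using r by (simp add: Ln_def)
qed

lemma BM_int_add: "contU f \<Longrightarrow> contU g \<Longrightarrow> (\<integral>x. f x + g x \<partial>BM r) = integral\<^sup>L (BM r) f + integral\<^sup>L (BM r) g"
  by (rule Bochner_Integration.integral_add) (auto intro: integrable_BM)
lemma BM_int_diff: "contU f \<Longrightarrow> contU g \<Longrightarrow> (\<integral>x. f x - g x \<partial>BM r) = integral\<^sup>L (BM r) f - integral\<^sup>L (BM r) g"
  by (rule Bochner_Integration.integral_diff) (auto intro: integrable_BM)
lemma BM_int_sum: "(\<And>k. k \<in> K \<Longrightarrow> contU (f k)) \<Longrightarrow> (\<integral>x. (\<Sum>k\<in>K. f k x) \<partial>BM r) = (\<Sum>k\<in>K. integral\<^sup>L (BM r) (f k))"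
  by (rule Bochner_Integration.integral_sum) (auto intro: integrable_BM)

text \<open>For compact support two integrations by parts show that the squared L^2 norms of all
  second derivatives add up to that of the Laplacian: the L^2 case of the Calderon-Zygmund
  estimate.\<close>

lemma hessian_le_laplacian:
  assumes b: "smooth3 b" and z: "\<And>x. norm x > r \<Longrightarrow> b x = 0" and r: "r \<le> r'"
  shows "Ln r' 2 (pd j (pd i b)) \<le> Ln r' 2 (\<lambda>x. \<Sum>i\<in>UNIV. pd i (pd i b) x)"
proof -
  have z1: "pd i b x = 0" if "norm x > r" for i x by (rule pd_zero_outside[of r b]) (use z that in auto)
  have z2: "pd j (pd i b) x = 0" if "norm x > r" for i j x by (rule pd_zero_outside[of r "pd i b"]) (use z1 that in auto)
  note s = b smooth3_pd[OF b] smooth3_pd[OF smooth3_pd[OF b]] smooth3_pd[OF smooth3_pd[OF smooth3_pd[OF b]]]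
  note c = s[THEN smooth3_cont]
  have *: "(\<integral>x. pd j (pd i b) x * pd j (pd i b) x \<partial>BM r') = (\<integral>x. pd i (pd i b) x * pd j (pd j b) x \<partial>BM r')" for i j
  proof -
    have cm: "pd i (pd j b) = pd j (pd i b)" for i j using pd_commute[OF b] by auto
    have cm2: "pd j (pd j (pd i b)) = pd i (pd j (pd j b))" for i j
      using pd_commute[OF s(2)] cm by auto
    have "(\<integral>x. pd j (pd i b) x * pd j (pd i b) x \<partial>BM r') = - (\<integral>x. pd i b x * pd j (pd j (pd i b)) x \<partial>BM r')"
      by (rule integral_pd_by_parts[where r=r]) (use s z2 r in auto)
    also have "\<dots> = (\<integral>x. pd i (pd i b) x * pd j (pd j b) x \<partial>BM r')"
      unfolding cm2[of j i] using integral_pd_by_parts[of "pd i b" "pd j (pd j b)" r r' i] s z2 r by simp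
    finally show ?thesis .
  qed
  have "(\<Sum>i\<in>UNIV. \<Sum>j\<in>UNIV. (\<integral>x. pd j (pd i b) x * pd j (pd i b) x \<partial>BM r')) = (\<integral>x. (\<Sum>i\<in>UNIV. pd i (pd i b) x) * (\<Sum>i\<in>UNIV. pd i (pd i b) x) \<partial>BM r')"
    unfolding * sum_product
    by (subst BM_int_sum, (intro continuous_on_sum continuous_on_mult c)[1], subst BM_int_sum, (intro continuous_on_mult c)[1]) simp
  moreover have "(\<integral>x. pd j (pd i b) x * pd j (pd i b) x \<partial>BM r') \<le> (\<Sum>i\<in>UNIV. \<Sum>j\<in>UNIV. (\<integral>x. pd j (pd i b) x * pd j (pd i b) x \<partial>BM r'))"
  proof -
    have n: "0 \<le> (\<integral>x. pd j (pd i b) x * pd j (pd i b) x \<partial>BM r')" for i j by (intro BM_nonneg) auto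
    have "(\<integral>x. pd j (pd i b) x * pd j (pd i b) x \<partial>BM r') \<le> (\<Sum>j\<in>UNIV. (\<integral>x. pd j (pd i b) x * pd j (pd i b) x \<partial>BM r'))"
      by (rule member_le_sum) (use n in auto)
    also have "\<dots> \<le> (\<Sum>i\<in>UNIV. \<Sum>j\<in>UNIV. (\<integral>x. pd j (pd i b) x * pd j (pd i b) x \<partial>BM r'))"
      by (rule member_le_sum[of _ _ "\<lambda>i. \<Sum>j\<in>UNIV. (\<integral>x. pd j (pd i b) x * pd j (pd i b) x \<partial>BM r')"]) (use n in \<open>auto intro!: sum_nonneg\<close>)
    finally show ?thesis .
  qed
  ultimately have "(Ln r' 2 (pd j (pd i b)))\<^sup>2 \<le> (Ln r' 2 (\<lambda>x. \<Sum>i\<in>UNIV. pd i (pd i b) x))\<^sup>2"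
    by (subst (1 2) Ln_2) (auto intro!: c continuous_on_sum simp: power2_eq_square)
  then show ?thesis by (rule power2_le_imp_le) simp
qed

lemma Ln1: "contU f \<Longrightarrow> Ln r 1 f = (\<integral>x. \<bar>f x\<bar> \<partial>BM r)"
  by (simp add: Ln_def BM_nonneg)

text \<open>A smooth mean-zero \<open>g\<close> is the sum of \<open>g - moll d g\<close>, a Laplacian by \<open>moll_laplacian\<close>, and of
  \<open>moll d g\<close>, which equals \<open>\<integral> g y (bumpd d (x - y) - bumpd d x) dy\<close> and is therefore the divergence of
  \<open>x \<mapsto> - \<integral>\<^sub>0\<^sup>1 \<integral> g y y bumpd d (x - s y) dy ds\<close>.\<close>
lemma bogovskii:
  assumes g: "smooth3 g" and z: "\<And>x. norm x > r \<Longrightarrow> g x = 0" and d: "0 < d" "d \<le> 1" and r: "r + d \<le> 3"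
    and mean: "(\<integral>x. g x \<partial>BM 3) = 0"
  shows "\<exists>v :: 3 \<Rightarrow> real^3 \<Rightarrow> real. (\<forall>i. smooth3 (v i)) \<and> (\<forall>i x. norm x > r + d \<longrightarrow> v i x = 0) \<and>
    (\<forall>x. (\<Sum>i\<in>UNIV. pd i (v i) x) = g x) \<and>
    (\<forall>i j. Ln 3 2 (pd j (v i)) \<le> (2 + 3 * bumpC * volc\<^sup>2) / d ^ 4 * Ln 3 2 g)"
proof -
  have cg: "continuous_on S g" for S using g by (rule smooth3_cont)
  define b where "b = kavg d g"
  have sb: "smooth3 b" unfolding b_def by (intro smooth3_kavg g)
  have zb: "b x = 0" if x: "norm x > r + d" for x
  proof -
    have zz: "d\<^sup>2 * fst p * bumpi (snd p) * g (x - (d * fst p) *\<^sub>R snd p) = 0" if p: "p \<in> cbox (0, lo3) (1, hi3)" for p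
    proof (cases "norm (snd p) \<ge> 1")
      case False
      have "0 \<le> fst p" "fst p \<le> 1" using p by (cases p; simp)+
      then have "\<bar>d * fst p\<bar> * norm (snd p) \<le> d * 1" using d False
        by (intro mult_mono) (auto simp: abs_mult mult_left_le)
      then have "norm (x - (d * fst p) *\<^sub>R snd p) > r"
        using x norm_triangle_ineq2[of x "(d * fst p) *\<^sub>R snd p"] by simp
      then show ?thesis by (simp add: z)
    qed (simp add: bumpi_zero)
    have "b x = integral (cbox (0, lo3) (1, hi3)) (\<lambda>p::real\<times>(real^3). 0)"
      unfolding b_def kavg_def shift_avg_def by (rule Henstock_Kurzweil_Integration.integral_cong) (rule zz)
    then show ?thesis by simp
  qed
  let ?a = "(\<chi> i. - 3) :: real^3" and ?b = "(\<chi> i. 3) :: real^3"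
  define w where "w i = (\<lambda>p::(real^3)\<times>real. - (g (fst p) * fst p $ i))" for i
  define h where "h = (\<lambda>p::(real^3)\<times>real. snd p *\<^sub>R fst p)"
  have cw: "continuous_on S (w i)" for S i unfolding w_def
    by (intro continuous_on_minus continuous_on_mult continuous_on_compose2[OF cg[of UNIV]] continuous_intros) auto
  have ch: "continuous_on S h" for S unfolding h_def by (intro continuous_intros)
  define v' where "v' i = shift_avg (w i) h (?a, 0) (?b, 1) (bumpd d)" for i
  have sv': "smooth3 (v' i)" for i unfolding v'_def by (intro smooth3_shift_avg cw ch smooth3_bumpd)
  have zv': "v' i x = 0" if x: "norm x > r + d" for i x
  proof -
    have zz: "w i p * bumpd d (x - h p) = 0" if p: "p \<in> cbox (?a, 0) (?b, 1)" for p
    proof (cases "norm (fst p) > r")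
      case False
      have "0 \<le> snd p" "snd p \<le> 1" using p by (cases p; simp)+
      then have "norm (h p) \<le> 1 * r" unfolding h_def norm_scaleR using False by (intro mult_mono) auto
      then have "norm (x - h p) \<ge> d" using x norm_triangle_ineq2[of x "h p"] by simp
      then show ?thesis using d by (simp add: bumpd_zero)
    qed (simp add: w_def z)
    have "v' i x = integral (cbox (?a, 0) (?b, 1)) (\<lambda>p::(real^3)\<times>real. 0)"
      unfolding v'_def shift_avg_def by (rule Henstock_Kurzweil_Integration.integral_cong) (rule zz)
    then show ?thesis by simp
  qed
  have div': "(\<Sum>i\<in>UNIV. pd i (v' i) x) = moll d g x" for x
  proof -
    have cbd: "continuous_on S (\<lambda>p. pd i (bumpd d) (x - h p))" for S i
      by (intro continuous_on_compose2[OF smooth3_cont[OF smooth3_pd[OF smooth3_bumpd], of UNIV]] continuous_intros ch) auto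
    have cb: "contU (\<lambda>y. bumpd d (c - y))" for c
      by (intro continuous_on_compose2[OF smooth3_cont[OF smooth3_bumpd, of UNIV]] continuous_intros) auto
    have c: "continuous_on (cbox (?a, 0) (?b, 1)) (\<lambda>p. \<Sum>i\<in>UNIV. w i p * pd i (bumpd d) (x - h p))"
      by (intro continuous_on_sum continuous_on_mult cw cbd)
    have inner: "integral (cbox 0 1) (\<lambda>s. \<Sum>i\<in>UNIV. w i (y, s) * pd i (bumpd d) (x - h (y, s))) = g y * (bumpd d (x - y) - bumpd d x)" for y
    proof -
      have "((\<lambda>s. \<Sum>i\<in>UNIV. (- y) $ i * pd i (bumpd d) (x + s *\<^sub>R (- y))) has_integral (bumpd d (x + 1 *\<^sub>R (- y)) - bumpd d (x + 0 *\<^sub>R (- y)))) {0..1}"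
        by (rule fundamental_theorem_of_calculus)
           (simp, subst has_real_derivative_iff_has_vector_derivative[symmetric], rule line_derivative, simp)
      then have "integral {0..1} (\<lambda>s. \<Sum>i\<in>UNIV. (- y) $ i * pd i (bumpd d) (x + s *\<^sub>R (- y))) = bumpd d (x - y) - bumpd d x"
        by (simp add: integral_unique)
      then have "integral {0..1} (\<lambda>s. g y * (\<Sum>i\<in>UNIV. (- y) $ i * pd i (bumpd d) (x + s *\<^sub>R (- y)))) = g y * (bumpd d (x - y) - bumpd d x)"
        by simp
      then show ?thesis by (simp add: w_def h_def sum_distrib_left mult_ac)
    qed
    have gz: "norm y > 3 \<Longrightarrow> g y = 0" for y using z[of y] r d by auto
    have g0: "integral (cbox ?a ?b) g = 0"
      using cbox_integral_BM(1)[OF cg gz] mean by simp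
    have "(\<Sum>i\<in>UNIV. pd i (v' i) x) = (\<Sum>i\<in>UNIV. integral (cbox (?a, 0) (?b, 1)) (\<lambda>p. w i p * pd i (bumpd d) (x - h p)))"
      unfolding v'_def by (intro sum.cong refl, subst pd_shift_avg) (auto intro!: cw ch simp: shift_avg_def)
    also have "\<dots> = integral (cbox (?a, 0) (?b, 1)) (\<lambda>p. \<Sum>i\<in>UNIV. w i p * pd i (bumpd d) (x - h p))"
      by (rule integral_sum[symmetric]) (auto intro!: integrable_continuous continuous_on_mult cw cbd)
    also have "\<dots> = integral (cbox ?a ?b) (\<lambda>y. bumpd d (x - y) * g y - bumpd d x * g y)"
      unfolding integral_prod_continuous[OF c] inner by (simp add: algebra_simps)
    also have "\<dots> = integral (cbox ?a ?b) (\<lambda>y. bumpd d (x - y) * g y)"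
      using g0 by (subst Henstock_Kurzweil_Integration.integral_diff)
        (auto intro!: integrable_continuous continuous_on_mult continuous_on_subset[OF cb] cg continuous_on_const)
    also have "\<dots> = moll d g x"
      unfolding moll_kernel[OF cg d(1)] by (rule cbox_integral_BM(2)) (auto intro!: continuous_on_mult cb cg simp: gz)
    finally show ?thesis .
  qed
  have c1: "contU (pd j (v' i))" for i j by (intro smooth3_cont smooth3_pd sv')
  have c2: "contU (pd j (pd i b))" for i j by (intro smooth3_cont smooth3_pd sb)
  \<comment> \<open>Sup bound for the kernel gradient times the L^1 norm of y g(y). The 3 bounds a
    coordinate in the box, and \<open>volc\<close> enters twice: from L^1 to L^2 of
    \<open>g\<close>, and as the L^2 norm of a constant.\<close>
  have L': "Ln 3 2 (pd j (v' i)) \<le> 3 * bumpC * volc\<^sup>2 / d ^ 4 * Ln 3 2 g" for i j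
  proof -
    define I where "I = integral (cbox (?a, 0) (?b, 1)) (\<lambda>p. \<bar>w i p\<bar>)"
    have "I \<le> 3 * Ln 3 1 g"
    proof -
      have ca: "continuous_on (cbox (?a, 0) (?b, 1)) (\<lambda>p::(real^3)\<times>real. 3 * \<bar>g (fst p)\<bar>)"
        by (intro continuous_intros continuous_on_compose2[OF cg[of UNIV]]) auto
      have "I \<le> integral (cbox (?a, 0) (?b, 1)) (\<lambda>p::(real^3)\<times>real. 3 * \<bar>g (fst p)\<bar>)" unfolding I_def
      proof (rule integral_le)
        fix p :: "(real^3)\<times>real" assume "p \<in> cbox (?a, 0) (?b, 1)"
        then have "- 3 \<le> fst p $ i \<and> fst p $ i \<le> 3" by (cases p) (auto simp: mem_box_cart)
        then have "\<bar>fst p $ i\<bar> \<le> 3" by auto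
        then show "\<bar>w i p\<bar> \<le> 3 * \<bar>g (fst p)\<bar>" using mult_right_mono[of "\<bar>fst p $ i\<bar>" 3 "\<bar>g (fst p)\<bar>"] by (simp add: w_def abs_mult mult.commute)
      qed (intro integrable_continuous continuous_on_rabs cw ca)+
      also have "\<dots> = integral (cbox ?a ?b) (\<lambda>y. 3 * \<bar>g y\<bar>)"
        using integral_prod_continuous[OF ca] by simp
      also have "\<dots> = 3 * (\<integral>y. \<bar>g y\<bar> \<partial>BM 3)"
        using cbox_integral_BM(1)[OF continuous_on_rabs[OF cg], of 3] z r d by auto
      finally show ?thesis by (simp add: Ln1 cg)
    qed
    then have I: "I \<le> 3 * (volc * Ln 3 2 g)" using Ln_le_Ln[OF cg, of 1 2 3] by simp
    have "\<bar>pd j (v' i) x\<bar> \<le> I * (bumpC / d ^ 4)" for x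
      unfolding v'_def I_def pd_shift_avg[OF cw ch smooth3_bumpd]
      by (rule shift_avg_bound[OF cw ch smooth3_cont[OF smooth3_pd[OF smooth3_bumpd]] bumpd_bounds(1)[OF d(1)]])
    then have b: "\<bar>pd j (v' i) x\<bar> \<le> 3 * (volc * Ln 3 2 g) * (bumpC / d ^ 4)" for x
      using mult_right_mono[OF I, of "bumpC / d ^ 4"] bumpC(1) d by (meson divide_nonneg_nonneg less_imp_le order_trans zero_le_power)
    have "Ln 3 2 (pd j (v' i)) \<le> Ln 3 2 (\<lambda>x. (3 * (volc * Ln 3 2 g) * (bumpC / d ^ 4)) * 1)"
    proof (rule Ln_mono[OF c1])
      fix x show "\<bar>pd j (v' i) x\<bar> \<le> \<bar>(3 * (volc * Ln 3 2 g) * (bumpC / d ^ 4)) * 1\<bar>"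
        unfolding mult_1_right using b[of x] abs_ge_self by (rule order_trans)
    qed auto
    also have "\<dots> = (3 * (volc * Ln 3 2 g) * (bumpC / d ^ 4)) * Ln 3 2 (\<lambda>x. 1)"
      using volc_ge_1 bumpC(1) d by (subst Ln_cmult) auto
    also have "\<dots> \<le> (3 * (volc * Ln 3 2 g) * (bumpC / d ^ 4)) * volc"
    proof (intro mult_left_mono)
      have "Ln 3 2 (\<lambda>x. 1) = (\<integral>x. 1 \<partial>BM 3) powr (1 / 2)" by (simp add: Ln_def)
      also have "\<dots> \<le> volc powr (1/2)" by (intro powr_mono2) (auto simp: volc_def BM_nonneg)
      also have "\<dots> \<le> volc powr 1" using volc_ge_1 by (intro powr_mono) auto
      finally show "Ln 3 2 (\<lambda>x. 1) \<le> volc" using volc_ge_1 by simp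
    qed (use volc_ge_1 bumpC(1) d in auto)
    finally show ?thesis by (simp add: power2_eq_square mult_ac)
  qed
  \<comment> \<open>The gradient part of the solution costs no power of d at all; the whole loss
    d^(-4) comes from the smooth part \<open>v'\<close>.\<close>
  have Lb: "Ln 3 2 (pd j (pd i b)) \<le> 2 * Ln 3 2 g" for i j
  proof -
    have "Ln 3 2 (pd j (pd i b)) \<le> Ln 3 2 (\<lambda>x. \<Sum>i\<in>UNIV. pd i (pd i b) x)"
      by (rule hessian_le_laplacian[OF sb zb]) (use r in auto)
    also have "\<dots> = Ln 3 2 (\<lambda>x. g x + (- 1) * moll d g x)"
      by (rule Ln_cong) (simp add: moll_laplacian[OF g, symmetric] b_def)
    also have "\<dots> \<le> Ln 3 2 g + Ln 3 2 (\<lambda>x. (- 1) * moll d g x)"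
      by (rule Ln_add) (auto intro!: cg continuous_intros smooth3_cont smooth3_moll g)
    also have "Ln 3 2 (\<lambda>x. (- 1) * moll d g x) = Ln 3 2 (moll d g)"
      by (subst Ln_cmult) (auto intro!: smooth3_cont smooth3_moll g)
    also have "\<dots> \<le> Ln (3 + 2 * d) 2 g" using d by (intro moll_Ln cg) auto
    also have "\<dots> = Ln 3 2 g" using r d by (intro Ln_support[OF cg z]) auto
    finally show ?thesis by simp
  qed
  define v where "v i = (\<lambda>x. pd i b x + v' i x)" for i
  have pv: "pd j (v i) x = pd j (pd i b) x + pd j (v' i) x" for i j x
    unfolding v_def by (intro pd_add smooth3_D smooth3_pd sb sv')
  have "Ln 3 2 (pd j (v i)) \<le> (2 + 3 * bumpC * volc\<^sup>2) / d ^ 4 * Ln 3 2 g" for i j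
  proof -
    have "Ln 3 2 (pd j (v i)) = Ln 3 2 (\<lambda>x. pd j (pd i b) x + pd j (v' i) x)" by (rule Ln_cong) (simp add: pv)
    also have "\<dots> \<le> Ln 3 2 (pd j (pd i b)) + Ln 3 2 (pd j (v' i))" by (intro Ln_add c1 c2) auto
    also have "\<dots> \<le> 2 * Ln 3 2 g + 3 * bumpC * volc\<^sup>2 / d ^ 4 * Ln 3 2 g" by (intro add_mono Lb L')
    also have "2 * Ln 3 2 g \<le> 2 / d ^ 4 * Ln 3 2 g"
      using d power_le_one[of d 4] by (intro mult_right_mono) (auto simp: field_simps)
    finally show ?thesis by (simp add: add_divide_distrib distrib_right)
  qed
  moreover have "(\<Sum>i\<in>UNIV. pd i (v i) x) = g x" for x
    using moll_laplacian[OF g, of x d] by (simp add: pv sum.distrib div' b_def)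
  moreover have "v i x = 0" if "norm x > r + d" for i x
    using zv'[OF that] pd_zero_outside[of "r + d" b x i] zb that by (simp add: v_def)
  moreover have "smooth3 (v i)" for i unfolding v_def by (intro smooth3_add smooth3_pd sb sv')
  ultimately show ?thesis by blast
qed

section \<open>The Sobolev inequality\<close>

lemma interval_CS:
  fixes f g :: "real \<Rightarrow> real"
  assumes f: "continuous_on {a..b} f" and g: "continuous_on {a..b} g"
  shows "integral {a..b} (\<lambda>x. f x * g x) \<le> sqrt (integral {a..b} (\<lambda>x. (f x)\<^sup>2)) * sqrt (integral {a..b} (\<lambda>x. (g x)\<^sup>2))"
proof -
  define A where "A = integral {a..b} (\<lambda>x. (f x)\<^sup>2)"
  define B where "B = integral {a..b} (\<lambda>x. (g x)\<^sup>2)"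
  define t where "t = integral {a..b} (\<lambda>x. f x * g x)"
  have i: "(\<lambda>x. (f x)\<^sup>2) integrable_on {a..b}" "(\<lambda>x. (g x)\<^sup>2) integrable_on {a..b}" "(\<lambda>x. f x * g x) integrable_on {a..b}"
    by (intro integrable_continuous_interval continuous_intros f g)+
  have q: "0 \<le> p\<^sup>2 * A + 2 * p * r * t + r\<^sup>2 * B" for p r
  proof -
    have "0 \<le> integral {a..b} (\<lambda>x. (p * f x + r * g x)\<^sup>2)"
      by (intro integral_nonneg integrable_continuous_interval continuous_intros f g) auto
    also have "\<dots> = integral {a..b} (\<lambda>x. p\<^sup>2 * (f x)\<^sup>2 + (2 * p * r) * (f x * g x) + r\<^sup>2 * (g x)\<^sup>2)"
      by (intro Henstock_Kurzweil_Integration.integral_cong) (simp add: power2_eq_square algebra_simps)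
    also have "\<dots> = p\<^sup>2 * A + 2 * p * r * t + r\<^sup>2 * B"
      unfolding A_def B_def t_def using i
      by (simp add: Henstock_Kurzweil_Integration.integral_add integrable_add integrable_on_mult_right)
    finally show ?thesis .
  qed
  have A0: "A \<ge> 0" "B \<ge> 0" using q[of 1 0] q[of 0 1] by auto
  have "t\<^sup>2 \<le> A * B"
  proof (cases "B = 0")
    case True
    have "t = 0"
    proof (rule ccontr)
      assume "t \<noteq> 0"
      then have "0 \<le> A + 2 * (- (A + 1) / (2 * t)) * t" using q[of 1 "- (A + 1) / (2 * t)"] True by simp
      then show False using \<open>t \<noteq> 0\<close> by (simp add: field_simps)
    qed
    then show ?thesis using True by simp
  next
    case False
    then have B: "B > 0" using A0 by simp
    have "0 \<le> B\<^sup>2 * A + 2 * B * (- t) * t + (- t)\<^sup>2 * B" by (rule q)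
    also have "\<dots> = B * (A * B - t\<^sup>2)" by (simp add: power2_eq_square algebra_simps)
    finally show ?thesis using B by (simp add: zero_le_mult_iff)
  qed
  then have "t \<le> sqrt (A * B)" using real_le_rsqrt by blast
  then show ?thesis by (simp add: real_sqrt_mult A_def B_def t_def)
qed

lemma interval_CS_sqrt:
  fixes f g :: "real \<Rightarrow> real"
  assumes "continuous_on {a..b} f" "continuous_on {a..b} g" "\<And>x. 0 \<le> f x" "\<And>x. 0 \<le> g x"
  shows "integral {a..b} (\<lambda>x. sqrt (f x) * sqrt (g x)) \<le> sqrt (integral {a..b} f) * sqrt (integral {a..b} g)"
  using interval_CS[of a b "\<lambda>x. sqrt (f x)" "\<lambda>x. sqrt (g x)"] assms
  by (simp add: continuous_on_real_sqrt)

section \<open>Iterated integrals over a cube and the Loomis-Whitney inequality\<close>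

definition trip :: "real \<Rightarrow> real \<Rightarrow> real \<Rightarrow> real^3" where
  "trip x y z = x *\<^sub>R axis 1 1 + y *\<^sub>R axis 2 1 + z *\<^sub>R axis 3 1"

lemma trip_nth [simp]: "trip x y z $ 1 = x" "trip x y z $ 2 = y" "trip x y z $ 3 = z"
  by (auto simp: trip_def axis_def)

definition int3 :: "real \<Rightarrow> (real \<Rightarrow> real \<Rightarrow> real \<Rightarrow> real) \<Rightarrow> real" where
  "int3 c F = integral {-c..c} (\<lambda>z. integral {-c..c} (\<lambda>y. integral {-c..c} (\<lambda>x. F x y z)))"

lemma cont_param:
  fixes F :: "'a::topological_space \<Rightarrow> real \<Rightarrow> real"
  assumes "continuous_on UNIV (\<lambda>p. F (fst p) (snd p))"
  shows "continuous_on UNIV (\<lambda>p. integral {-c..c} (F p))"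
  using integral_continuous_on_param[of UNIV "-c" c F] continuous_on_subset[OF assms, of "UNIV \<times> cbox (-c) c"]
  by (simp add: split_beta)

lemma int3_mono:
  assumes F: "continuous_on UNIV (\<lambda>(z, y, x). F x y z)" and G: "continuous_on UNIV (\<lambda>(z, y, x). G x y z)"
    and le: "\<And>x y z. \<bar>x\<bar> \<le> c \<Longrightarrow> \<bar>y\<bar> \<le> c \<Longrightarrow> \<bar>z\<bar> \<le> c \<Longrightarrow> F x y z \<le> G x y z"
  shows "int3 c F \<le> int3 c G"
proof -
  have c1: "continuous_on S (\<lambda>x. H x y z)" if "continuous_on UNIV (\<lambda>(z, y, x). H x y z)" for H :: "real \<Rightarrow> real \<Rightarrow> real \<Rightarrow> real" and y z S
  proof -
    have "continuous_on S (\<lambda>x. (z, y, x))" by (intro continuous_intros)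
    from continuous_on_compose2[OF that this] show ?thesis by simp
  qed
  have c2: "continuous_on UNIV (\<lambda>p. integral {-c..c} (\<lambda>x. H x (snd p) (fst p)))" if "continuous_on UNIV (\<lambda>(z, y, x). H x y z)" for H :: "real \<Rightarrow> real \<Rightarrow> real \<Rightarrow> real"
  proof (rule cont_param)
    have "continuous_on UNIV (\<lambda>p::(real\<times>real)\<times>real. (fst (fst p), snd (fst p), snd p))" by (intro continuous_intros)
    from continuous_on_compose2[OF that this]
    show "continuous_on UNIV (\<lambda>p. H (snd p) (snd (fst p)) (fst (fst p)))" by simp
  qed
  have c2': "continuous_on S (\<lambda>y. integral {-c..c} (\<lambda>x. H x y z))" if "continuous_on UNIV (\<lambda>(z, y, x). H x y z)" for H :: "real \<Rightarrow> real \<Rightarrow> real \<Rightarrow> real" and z S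
  proof -
    have "continuous_on S (\<lambda>y. (z, y))" by (intro continuous_intros)
    from continuous_on_compose2[OF c2[OF that] this] show ?thesis by simp
  qed
  have c3: "continuous_on S (\<lambda>z. integral {-c..c} (\<lambda>y. integral {-c..c} (\<lambda>x. H x y z)))" if "continuous_on UNIV (\<lambda>(z, y, x). H x y z)" for H :: "real \<Rightarrow> real \<Rightarrow> real \<Rightarrow> real" and S
    using cont_param[of "\<lambda>z y. integral {-c..c} (\<lambda>x. H x y z)" c] c2[OF that] continuous_on_subset by blast
  show ?thesis unfolding int3_def
    by (intro integral_le integrable_continuous_interval c1[OF F] c1[OF G] c2'[OF F] c2'[OF G] c3[OF F] c3[OF G] le) auto
qed

text \<open>Cauchy-Schwarz three times, in x, then y, then z. In each integration exactly two of the
  remaining factors depend on the variable, and the third is pulled out as a constant.\<close>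

lemma loomis_whitney:
  fixes h1 h2 h3 :: "real \<Rightarrow> real \<Rightarrow> real"
  assumes c: "continuous_on UNIV (\<lambda>p. h1 (fst p) (snd p))" "continuous_on UNIV (\<lambda>p. h2 (fst p) (snd p))" "continuous_on UNIV (\<lambda>p. h3 (fst p) (snd p))"
    and n: "\<And>x y. 0 \<le> h1 x y" "\<And>x y. 0 \<le> h2 x y" "\<And>x y. 0 \<le> h3 x y"
  shows "int3 c (\<lambda>x y z. sqrt (h1 y z) * (sqrt (h2 x z) * sqrt (h3 x y))) \<le>
    sqrt (integral {-c..c} (\<lambda>z. integral {-c..c} (\<lambda>y. h1 y z))) * sqrt (integral {-c..c} (\<lambda>z. integral {-c..c} (\<lambda>x. h2 x z)))
      * sqrt (integral {-c..c} (\<lambda>y. integral {-c..c} (\<lambda>x. h3 x y)))"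
proof -
  have cs: "continuous_on S (\<lambda>x. h x y)" "continuous_on S (\<lambda>y. h x y)" "continuous_on UNIV (\<lambda>p. h (snd p) (fst p))"
    if "continuous_on UNIV (\<lambda>p. h (fst p) (snd p))" for h :: "real \<Rightarrow> real \<Rightarrow> real" and x y S
  proof -
    have a: "continuous_on S (\<lambda>x. (x, y))" "continuous_on S (\<lambda>y. (x, y))" "continuous_on UNIV (\<lambda>p::real\<times>real. (snd p, fst p))"
      by (intro continuous_intros)+
    show "continuous_on S (\<lambda>x. h x y)" using continuous_on_compose2[OF that a(1)] by simp
    show "continuous_on S (\<lambda>y. h x y)" using continuous_on_compose2[OF that a(2)] by simp
    show "continuous_on UNIV (\<lambda>p. h (snd p) (fst p))" using continuous_on_compose2[OF that a(3)] by simp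
  qed
  have gc: "continuous_on S (\<lambda>y. integral {-c..c} (\<lambda>x. h x y))" if "continuous_on UNIV (\<lambda>p. h (fst p) (snd p))" for h :: "real \<Rightarrow> real \<Rightarrow> real" and S
    using cont_param[of "\<lambda>y x. h x y" c, OF cs(3)[OF that]] continuous_on_subset by blast
  have gn: "0 \<le> integral {-c..c} (\<lambda>x. h x y)" if "continuous_on UNIV (\<lambda>p. h (fst p) (snd p))" "\<And>x y. 0 \<le> h x y" for h :: "real \<Rightarrow> real \<Rightarrow> real" and y
    using that(2) by (intro integral_nonneg integrable_continuous_interval cs(1)[OF that(1)]) auto
  define G1 where "G1 z = integral {-c..c} (\<lambda>y. h1 y z)" for z
  define G2 where "G2 z = integral {-c..c} (\<lambda>x. h2 x z)" for z
  define G3 where "G3 y = integral {-c..c} (\<lambda>x. h3 x y)" for y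
  have G: "continuous_on S G1" "continuous_on S G2" "continuous_on S G3" "\<And>z. 0 \<le> G1 z" "\<And>z. 0 \<le> G2 z" "\<And>z. 0 \<le> G3 z" for S
    unfolding G1_def[abs_def] G2_def[abs_def] G3_def[abs_def]
    by (rule gc[OF c(1)] gc[OF c(2)] gc[OF c(3)] gn[OF c(1) n(1)] gn[OF c(2) n(2)] gn[OF c(3) n(3)])+
  define m where "m z y = integral {-c..c} (\<lambda>x. sqrt (h1 y z) * (sqrt (h2 x z) * sqrt (h3 x y)))" for z y
  have mc: "continuous_on UNIV (\<lambda>p. m (fst p) (snd p))"
    unfolding m_def
  proof (rule cont_param)
    show "continuous_on UNIV (\<lambda>p. sqrt (h1 (snd (fst p)) (fst (fst p))) * (sqrt (h2 (snd p) (fst (fst p))) * sqrt (h3 (snd p) (snd (fst p)))) :: real)"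
    proof -
      have a: "continuous_on UNIV (\<lambda>p::(real\<times>real)\<times>real. (snd (fst p), fst (fst p)))" "continuous_on UNIV (\<lambda>p::(real\<times>real)\<times>real. (snd p, fst (fst p)))"
        "continuous_on UNIV (\<lambda>p::(real\<times>real)\<times>real. (snd p, snd (fst p)))"
        by (intro continuous_intros)+
      show ?thesis
        using continuous_on_compose2[OF c(1) a(1)] continuous_on_compose2[OF c(2) a(2)] continuous_on_compose2[OF c(3) a(3)]
        by (intro continuous_on_mult continuous_on_real_sqrt) simp_all
    qed
  qed
  have m: "m z y \<le> sqrt (G2 z) * (sqrt (h1 y z) * sqrt (G3 y))" for z y
  proof -
    have "m z y = sqrt (h1 y z) * integral {-c..c} (\<lambda>x. sqrt (h2 x z) * sqrt (h3 x y))" by (simp add: m_def)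
    also have "\<dots> \<le> sqrt (h1 y z) * (sqrt (G2 z) * sqrt (G3 y))"
      unfolding G2_def G3_def by (intro mult_left_mono interval_CS_sqrt cs(1)[OF c(2)] cs(1)[OF c(3)] n) (auto simp: n)
    finally show ?thesis by (simp add: mult_ac)
  qed
  have mi: "integral {-c..c} (m z) \<le> sqrt (integral {-c..c} G3) * (sqrt (G1 z) * sqrt (G2 z))" for z
  proof -
    have "integral {-c..c} (m z) \<le> integral {-c..c} (\<lambda>y. sqrt (G2 z) * (sqrt (h1 y z) * sqrt (G3 y)))"
      by (intro integral_le integrable_continuous_interval m continuous_on_mult continuous_on_const continuous_on_real_sqrt G cs(1)[OF c(1)] cs(2)[OF mc])
    also have "\<dots> = sqrt (G2 z) * integral {-c..c} (\<lambda>y. sqrt (h1 y z) * sqrt (G3 y))" by simp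
    also have "\<dots> \<le> sqrt (G2 z) * (sqrt (G1 z) * sqrt (integral {-c..c} G3))"
      unfolding G1_def by (intro mult_left_mono interval_CS_sqrt cs(1)[OF c(1)] n G) (auto simp: G)
    finally show ?thesis by (simp add: mult_ac)
  qed
  have G3i: "0 \<le> integral {-c..c} G3" by (intro integral_nonneg integrable_continuous_interval G)
  have "integral {-c..c} (\<lambda>z. integral {-c..c} (m z)) \<le> integral {-c..c} (\<lambda>z. sqrt (integral {-c..c} G3) * (sqrt (G1 z) * sqrt (G2 z)))"
    by (intro integral_le integrable_continuous_interval mi continuous_on_mult continuous_on_const continuous_on_real_sqrt G
          continuous_on_subset[OF cont_param[OF mc] subset_UNIV])
  also have "\<dots> = sqrt (integral {-c..c} G3) * integral {-c..c} (\<lambda>z. sqrt (G1 z) * sqrt (G2 z))" by simp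
  also have "\<dots> \<le> sqrt (integral {-c..c} G3) * (sqrt (integral {-c..c} G1) * sqrt (integral {-c..c} G2))"
    by (intro mult_left_mono interval_CS_sqrt G) (use G3i in auto)
  finally show ?thesis
    by (simp add: int3_def m_def[abs_def] G1_def[abs_def] G2_def[abs_def] G3_def[abs_def] mult_ac)
qed

definition tripp :: "real \<times> real \<times> real \<Rightarrow> real^3" where
  "tripp p = trip (snd (snd p)) (fst (snd p)) (fst p)"

lemma tripp_cont: "continuous_on S tripp"
  unfolding tripp_def[abs_def] trip_def by (intro continuous_intros)

text \<open>Triples are stored as (z, y, x), the nesting order of \<open>int3\<close>. The map only
  permutes coordinates, so box volumes agree, and these determine the measure.\<close>

lemma lborel_tripp: "lborel = distr lborel borel tripp"
proof (rule lborel_eqI)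
  fix l u :: "real^3" assume lu: "\<And>b. b \<in> Basis \<Longrightarrow> l \<bullet> b \<le> u \<bullet> b"
  have le: "l $ i \<le> u $ i" for i using lu[of "axis i 1"] by (simp add: inner_axis)
  have tm: "tripp \<in> measurable lborel borel" using tripp_cont by (simp add: borel_measurable_continuous_onI)
  have "tripp -` box l u = box (l $ 3, l $ 2, l $ 1) (u $ 3, u $ 2, u $ 1)"
    by (auto simp: mem_box_cart tripp_def forall_3 mem_box Basis_prod_def)
  then have "emeasure (distr lborel borel tripp) (box l u) = emeasure lborel (box (l $ 3, l $ 2, l $ 1) (u $ 3, u $ 2, u $ 1))"
    using tm by (simp add: emeasure_distr)
  also have "\<dots> = ennreal (measure lborel (cbox (l $ 3, l $ 2, l $ 1) (u $ 3, u $ 2, u $ 1)))"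
  proof -
    have "emeasure lborel (box (l $ 3, l $ 2, l $ 1) (u $ 3, u $ 2, u $ 1)) \<noteq> top"
      using emeasure_lborel_box_finite[of "(l $ 3, l $ 2, l $ 1)" "(u $ 3, u $ 2, u $ 1)"] by simp
    moreover have "measure lborel (box (l $ 3, l $ 2, l $ 1) (u $ 3, u $ 2, u $ 1)) = measure lborel (cbox (l $ 3, l $ 2, l $ 1) (u $ 3, u $ 2, u $ 1))"
      by (simp only: measure_lborel_box_eq measure_lborel_cbox_eq)
    ultimately show ?thesis by (metis emeasure_eq_ennreal_measure)
  qed
  also have "measure lborel (cbox (l $ 3, l $ 2, l $ 1) (u $ 3, u $ 2, u $ 1)) = measure lborel (cbox l u)"
  proof -
    have "cbox l u \<noteq> {}" using le by (simp add: interval_ne_empty_cart)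
    then have "measure lborel (cbox l u) = (\<Prod>i\<in>UNIV. u $ i - l $ i)" by (rule content_cbox_cart)
    also have "\<dots> = (u $ 1 - l $ 1) * ((u $ 2 - l $ 2) * (u $ 3 - l $ 3))" unfolding UNIV_3 by simp
    also have "\<dots> = measure lborel (cbox (l $ 3, l $ 2, l $ 1) (u $ 3, u $ 2, u $ 1))"
      using le[of 1] le[of 2] le[of 3] by (simp only: content_Pair) simp
    finally show ?thesis ..
  qed
  also have "\<dots> = (\<Prod>b\<in>Basis. (u - l) \<bullet> b)"
    using lu by (simp add: measure_lborel_cbox_eq inner_diff_left)
  finally show "emeasure (distr lborel borel tripp) (box l u) = (\<Prod>b\<in>Basis. (u - l) \<bullet> b)" .
qed simp

lemma int3_eq:
  fixes g :: "real^3 \<Rightarrow> real"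
  assumes g: "contU g" and z: "\<And>x. norm x > c \<Longrightarrow> g x = 0"
  shows "int3 c (\<lambda>x y z. g (trip x y z)) = integral\<^sup>L (BM c) g"
proof -
  let ?a = "(- c, - c, - c)" and ?b = "(c, c, c)"
  have ct: "continuous_on S (\<lambda>p. g (tripp p))" for S by (intro continuous_on_compose2[OF g tripp_cont]) auto
  have ct2: "continuous_on S (\<lambda>p. g (tripp (z, p)))" for S z
  proof -
    have "continuous_on S (\<lambda>p. (z, p))" by (intro continuous_intros)
    from continuous_on_compose2[OF ct[of UNIV] this] show ?thesis by simp
  qed
  have "integral (cbox ?a ?b) (\<lambda>p. g (tripp p)) = integral {-c..c} (\<lambda>z. integral (cbox (-c,-c) (c,c)) (\<lambda>p. g (tripp (z, p))))"
    using integral_prod_continuous[OF ct[of "cbox ?a ?b"]] by simp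
  also have "\<dots> = int3 c (\<lambda>x y z. g (trip x y z))"
    unfolding int3_def integral_prod_continuous[OF ct2] by (simp add: tripp_def)
  finally have 1: "int3 c (\<lambda>x y z. g (trip x y z)) = integral (cbox ?a ?b) (\<lambda>p. g (tripp p))" by simp
  have "integral (cbox ?a ?b) (\<lambda>p. g (tripp p)) = shift_avg (\<lambda>p. g (tripp p)) (\<lambda>_. 0) ?a ?b (\<lambda>_. 1) 0" by (simp add: shift_avg_def)
  also have "\<dots> = (\<integral>p. indicator (cbox ?a ?b) p * (g (tripp p) * 1) \<partial>lborel)"
    by (subst shift_avg_integrable') (auto intro!: ct)
  also have "(\<lambda>p. indicator (cbox ?a ?b) p * (g (tripp p) * 1)) = (\<lambda>p. g (tripp p))"
  proof
    fix p :: "real \<times> real \<times> real"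
    have "g (tripp p) = 0" if "p \<notin> cbox ?a ?b"
    proof (rule ccontr)
      assume "g (tripp p) \<noteq> 0"
      then have "norm (tripp p) \<le> c" using z by force
      then have "\<bar>tripp p $ i\<bar> \<le> c" for i using component_le_norm_cart[of "tripp p" i] by linarith
      from this[of 1] this[of 2] this[of 3] that show False
        by (cases p) (auto simp: tripp_def abs_le_iff cbox_Pair_eq)
    qed
    then show "indicator (cbox ?a ?b) p * (g (tripp p) * 1) = g (tripp p)" by (auto simp: indicator_def)
  qed
  also have "(\<integral>p. g (tripp p) \<partial>lborel) = integral\<^sup>L (distr lborel borel tripp) g"
    using tripp_cont g by (subst integral_distr) (auto intro!: borel_measurable_continuous_onI)
  also have "\<dots> = integral\<^sup>L lborel g" using lborel_tripp by simp
  also have "\<dots> = integral\<^sup>L (BM c) g" by (rule integrable_compact_support(2)[OF g z])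
  finally show ?thesis using 1 by simp
qed

text \<open>Gagliardo's argument with the fourth power: f^4 is bounded by the integral of 4
  \<bar>f\<bar>^3 \<bar>\<partial>_i f\<bar> along each axis. The product of the three square roots
  bounds \<bar>f\<bar>^6 and is integrated by \<open>loomis_whitney\<close>. Putting \<bar>f\<bar>^3
  in L^2 recreates the L^6 norm on the right, where a power of it is cancelled.\<close>

lemma sobolev:
  assumes f: "smooth3 f" and z: "\<And>x. norm x > r \<Longrightarrow> f x = 0" and r: "r \<le> R"
  shows "Ln R 6 f \<le> 4 * (\<Sum>i\<in>UNIV. Ln R 2 (pd i f))"
proof -
  \<comment> \<open>The cube needs a positive half side, and \<open>R\<close> is not assumed
    positive. Norms over radius \<open>R\<close> return at the end through the support of
    \<open>f\<close>.\<close>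
  define c where "c = max R 1"
  have c: "c > 0" "r \<le> c" using r by (auto simp: c_def)
  have cf: "contU f" and cp: "contU (pd i f)" for i using f by (auto intro!: smooth3_cont)
  have zc: "f x = 0" if "norm x > c" for x using z that c by auto
  define D where "D i x = 4 * \<bar>f x\<bar> ^ 3 * \<bar>pd i f x\<bar>" for i x
  have cD: "contU (D i)" for i unfolding D_def by (intro continuous_intros cf cp)
  have Dn: "0 \<le> D i x" for i x by (simp add: D_def)
  have zD: "D i x = 0" if "norm x > c" for i x using zc[OF that] by (simp add: D_def)
  have line: "(f (y + t *\<^sub>R axis i 1)) ^ 4 \<le> integral {-c..c} (\<lambda>t. D i (y + t *\<^sub>R axis i 1))" if y: "y $ i = 0" and t: "\<bar>t\<bar> \<le> c" for y i t
  proof -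
    let ?l = "\<lambda>t. y + t *\<^sub>R axis i (1::real)"
    have cl: "continuous_on S (\<lambda>t. D i (?l t))" for S
      by (intro continuous_on_compose2[OF cD] continuous_intros) auto
    \<comment> \<open>\<open>zc\<close> covers only points of norm strictly above \<open>c\<close>;
      the endpoint of the line follows by continuity.\<close>
    have f0: "f (?l (- c)) = 0"
    proof -
      have "f (?l s) = 0" if "s < - c" for s
      proof (rule zc)
        have "\<bar>?l s $ i\<bar> \<le> norm (?l s)" by (rule component_le_norm_cart)
        then show "norm (?l s) > c" using that y by (simp add: axis_def)
      qed
      then have "((\<lambda>s. f (?l s)) \<longlongrightarrow> 0) (at_left (- c))"
        by (intro tendsto_eventually) (auto simp: eventually_at_filter)
      moreover have "((\<lambda>s. f (?l s)) \<longlongrightarrow> f (?l (- c))) (at_left (- c))"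
        using axis_line_derivative[of f y i "- c" "{..<- c}"] f
        by (auto dest!: DERIV_continuous simp: continuous_within)
      ultimately show ?thesis using tendsto_unique trivial_limit_at_left_real by blast
    qed
    have ft: "((\<lambda>s. 4 * f (?l s) ^ 3 * pd i f (?l s)) has_integral (f (?l t) ^ 4 - f (?l (- c)) ^ 4)) {-c..t}"
    proof (rule fundamental_theorem_of_calculus)
      show "- c \<le> t" using t by auto
      fix s
      have "((\<lambda>s. f (?l s) ^ 4) has_real_derivative 4 * f (?l s) ^ 3 * pd i f (?l s)) (at s within {- c..t})"
        using axis_line_derivative[of f y i s "{-c..t}"] f by (auto intro!: derivative_eq_intros)
      then show "((\<lambda>s. f (?l s) ^ 4) has_vector_derivative 4 * f (?l s) ^ 3 * pd i f (?l s)) (at s within {- c..t})"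
        by (simp add: has_real_derivative_iff_has_vector_derivative)
    qed
    then have "(f (?l t)) ^ 4 = integral {-c..t} (\<lambda>s. 4 * f (?l s) ^ 3 * pd i f (?l s))"
      using f0 by (simp add: integral_unique)
    also have "\<dots> \<le> integral {-c..t} (\<lambda>s. D i (?l s))"
    proof (rule integral_le)
      show "(\<lambda>s. 4 * f (?l s) ^ 3 * pd i f (?l s)) integrable_on {-c..t}" using ft by blast
      show "(\<lambda>s. D i (?l s)) integrable_on {-c..t}" by (intro integrable_continuous_interval cl)
      show "4 * f (?l s) ^ 3 * pd i f (?l s) \<le> D i (?l s)" for s
        using abs_ge_self[of "4 * f (?l s) ^ 3 * pd i f (?l s)"] by (simp add: D_def abs_mult power_abs)
    qed
    also have "\<dots> \<le> integral {-c..c} (\<lambda>s. D i (?l s))"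
      using t by (intro integral_subset_le integrable_continuous_interval cl) (auto simp: Dn)
    finally show ?thesis .
  qed
  define h1 where "h1 y z = integral {-c..c} (\<lambda>x. D 1 (trip x y z))" for y z
  define h2 where "h2 x z = integral {-c..c} (\<lambda>y. D 2 (trip x y z))" for x z
  define h3 where "h3 x y = integral {-c..c} (\<lambda>z. D 3 (trip x y z))" for x y
  have tc: "continuous_on UNIV (\<lambda>p. D i (trip (a p) (b p) (e p)))" if "continuous_on UNIV a" "continuous_on UNIV b" "continuous_on UNIV e"
    for i and a b e :: "'t::topological_space \<Rightarrow> real"
    unfolding trip_def by (intro continuous_on_compose2[OF cD[of i]] continuous_intros that) auto
  have hc: "continuous_on UNIV (\<lambda>p. h1 (fst p) (snd p))" "continuous_on UNIV (\<lambda>p. h2 (fst p) (snd p))" "continuous_on UNIV (\<lambda>p. h3 (fst p) (snd p))"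
    unfolding h1_def h2_def h3_def
    by (rule cont_param, rule tc; intro continuous_intros)+
  have tc1: "continuous_on {-c..c} (\<lambda>x. D i (trip x y z))" "continuous_on {-c..c} (\<lambda>y. D i (trip x y z))" "continuous_on {-c..c} (\<lambda>z. D i (trip x y z))" for i x y z
    by (rule continuous_on_subset[OF tc[of "\<lambda>t. t" "\<lambda>_. y" "\<lambda>_. z" i] subset_UNIV] continuous_on_subset[OF tc[of "\<lambda>_. x" "\<lambda>t. t" "\<lambda>_. z" i] subset_UNIV]
        continuous_on_subset[OF tc[of "\<lambda>_. x" "\<lambda>_. y" "\<lambda>t. t" i] subset_UNIV]; intro continuous_intros)+
  have hn: "0 \<le> h1 x y" "0 \<le> h2 x y" "0 \<le> h3 x y" for x y
    unfolding h1_def h2_def h3_def by (intro integral_nonneg integrable_continuous_interval tc1 Dn)+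
  have pw: "\<bar>f (trip x y z)\<bar> ^ 6 \<le> sqrt (h1 y z) * (sqrt (h2 x z) * sqrt (h3 x y))" if "\<bar>x\<bar> \<le> c" "\<bar>y\<bar> \<le> c" "\<bar>z\<bar> \<le> c" for x y z
  proof -
    let ?F = "\<bar>f (trip x y z)\<bar>"
    have "(f (trip x y z)) ^ 4 \<le> h1 y z"
      using line[of "trip 0 y z" 1 x] that by (simp add: h1_def trip_def axis_def add_ac)
    moreover have "(f (trip x y z)) ^ 4 \<le> h2 x z"
      using line[of "trip x 0 z" 2 y] that by (simp add: h2_def trip_def axis_def add_ac)
    moreover have "(f (trip x y z)) ^ 4 \<le> h3 x y"
      using line[of "trip x y 0" 3 z] that by (simp add: h3_def trip_def axis_def add_ac)
    moreover have "sqrt (f (trip x y z) ^ 4) = ?F ^ 2"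
      using real_sqrt_abs[of "(f (trip x y z))\<^sup>2"] by (simp add: power_mult[symmetric])
    ultimately have s: "?F ^ 2 \<le> sqrt (h1 y z)" "?F ^ 2 \<le> sqrt (h2 x z)" "?F ^ 2 \<le> sqrt (h3 x y)"
      by (metis real_sqrt_le_mono)+
    have "?F ^ 6 = ?F ^ 2 * (?F ^ 2 * ?F ^ 2)" by (simp add: power_add[symmetric] del: power2_abs)
    also have "\<dots> \<le> sqrt (h1 y z) * (sqrt (h2 x z) * sqrt (h3 x y))"
      by (intro mult_mono s) (auto simp: hn)
    finally show ?thesis .
  qed
  define W where "W = (\<integral>x. \<bar>f x\<bar> ^ 6 \<partial>BM c)"
  have W0: "W \<ge> 0" unfolding W_def by (intro BM_nonneg) auto
  have c6: "contU (\<lambda>x. \<bar>f x\<bar> ^ 6)" by (intro continuous_intros cf)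
  define J where "J i = integral\<^sup>L (BM c) (D i)" for i
  have J: "int3 c (\<lambda>x y z. D i (trip x y z)) = J i" for i
    unfolding J_def by (rule int3_eq[OF cD zD])
  have sw: "integral {-c..c} (\<lambda>a. integral {-c..c} (\<lambda>b. g a b)) = integral {-c..c} (\<lambda>b. integral {-c..c} (\<lambda>a. g a b))"
    if "continuous_on UNIV (\<lambda>p. g (fst p) (snd p))" for g :: "real \<Rightarrow> real \<Rightarrow> real"
    using integral_swap_continuous[of "-c" "-c" c c g] continuous_on_subset[OF that, of "cbox (-c,-c) (c,c)"] by (simp add: split_beta)
  have "W = int3 c (\<lambda>x y z. \<bar>f (trip x y z)\<bar> ^ 6)"
    unfolding W_def by (rule int3_eq[symmetric, OF c6]) (use zc in auto)
  also have "\<dots> \<le> int3 c (\<lambda>x y z. sqrt (h1 y z) * (sqrt (h2 x z) * sqrt (h3 x y)))"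
  proof (rule int3_mono[OF _ _ pw])
    show "continuous_on UNIV (\<lambda>(z, y, x). \<bar>f (trip x y z)\<bar> ^ 6)"
      unfolding split_beta trip_def by (intro continuous_intros continuous_on_compose2[OF cf]) auto
    show "continuous_on UNIV (\<lambda>(z, y, x). sqrt (h1 y z) * (sqrt (h2 x z) * sqrt (h3 x y)))"
    proof -
      have a: "continuous_on UNIV (\<lambda>p::real\<times>real\<times>real. (fst (snd p), fst p))" "continuous_on UNIV (\<lambda>p::real\<times>real\<times>real. (snd (snd p), fst p))"
        "continuous_on UNIV (\<lambda>p::real\<times>real\<times>real. (snd (snd p), fst (snd p)))"
        by (intro continuous_intros)+
      show ?thesis unfolding split_beta
        using continuous_on_compose2[OF hc(1) a(1)] continuous_on_compose2[OF hc(2) a(2)] continuous_on_compose2[OF hc(3) a(3)]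
        by (intro continuous_on_mult continuous_on_real_sqrt) simp_all
    qed
  qed auto
  also have "\<dots> \<le> sqrt (integral {-c..c} (\<lambda>z. integral {-c..c} (\<lambda>y. h1 y z))) * sqrt (integral {-c..c} (\<lambda>z. integral {-c..c} (\<lambda>x. h2 x z)))
      * sqrt (integral {-c..c} (\<lambda>y. integral {-c..c} (\<lambda>x. h3 x y)))"
    by (rule loomis_whitney[OF hc hn])
  also have "integral {-c..c} (\<lambda>z. integral {-c..c} (\<lambda>y. h1 y z)) = J 1"
    unfolding h1_def J[symmetric] int3_def ..
  also have "integral {-c..c} (\<lambda>z. integral {-c..c} (\<lambda>x. h2 x z)) = J 2"
  proof -
    have "integral {-c..c} (\<lambda>x. h2 x z) = integral {-c..c} (\<lambda>y. integral {-c..c} (\<lambda>x. D 2 (trip x y z)))" for z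
      unfolding h2_def by (rule sw, rule tc; intro continuous_intros)
    then show ?thesis unfolding J[symmetric] int3_def by simp
  qed
  also have "integral {-c..c} (\<lambda>y. integral {-c..c} (\<lambda>x. h3 x y)) = J 3"
  proof -
    have "integral {-c..c} (\<lambda>y. integral {-c..c} (\<lambda>x. h3 x y)) = integral {-c..c} (\<lambda>y. integral {-c..c} (\<lambda>z. integral {-c..c} (\<lambda>x. D 3 (trip x y z))))"
      unfolding h3_def by (subst sw, rule tc; (intro continuous_intros)?) simp
    also have "\<dots> = integral {-c..c} (\<lambda>z. integral {-c..c} (\<lambda>y. integral {-c..c} (\<lambda>x. D 3 (trip x y z))))"
      by (rule sw, rule cont_param, rule tc; intro continuous_intros)
    finally show ?thesis unfolding J[symmetric] int3_def .
  qed
  finally have WJ: "W \<le> sqrt (J 1) * sqrt (J 2) * sqrt (J 3)" .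
  define A where "A = (\<Sum>i\<in>UNIV. Ln c 2 (pd i f))"
  have A0: "A \<ge> 0" unfolding A_def by (intro sum_nonneg) auto
  have JA: "J i \<le> 4 * (sqrt W * A)" for i
  proof -
    have c3: "contU (\<lambda>x. \<bar>f x\<bar> ^ 3)" by (intro continuous_intros cf)
    have "J i = 4 * (\<integral>x. \<bar>\<bar>f x\<bar> ^ 3 * pd i f x\<bar> \<partial>BM c)"
      unfolding J_def D_def by (simp add: abs_mult mult.assoc)
    also have "\<dots> \<le> 4 * (Ln c 2 (\<lambda>x. \<bar>f x\<bar> ^ 3) * Ln c 2 (pd i f))"
      by (intro mult_left_mono Holder_BM c3 cp) auto
    also have "Ln c 2 (\<lambda>x. \<bar>f x\<bar> ^ 3) = sqrt W"
    proof -
      have "(Ln c 2 (\<lambda>x. \<bar>f x\<bar> ^ 3))\<^sup>2 = W" unfolding W_def Ln_2[OF c3] by (simp add: power_mult[symmetric])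
      then show ?thesis by (metis Ln_nonneg real_sqrt_unique)
    qed
    also have "Ln c 2 (pd i f) \<le> A" unfolding A_def by (rule member_le_sum) auto
    finally show ?thesis using W0 by (simp add: mult_left_mono)
  qed
  have Jn: "0 \<le> J i" for i unfolding J_def by (intro BM_nonneg) (simp add: Dn)
  let ?X = "4 * (sqrt W * A)"
  have "W \<le> sqrt ?X * sqrt ?X * sqrt ?X"
    by (rule order_trans[OF WJ]) (intro mult_mono real_sqrt_le_mono JA; simp add: Jn A0 W0)
  then have "W\<^sup>2 \<le> (sqrt ?X * sqrt ?X * sqrt ?X)\<^sup>2" using W0 by (intro power_mono) auto
  also have "\<dots> = ?X ^ 3" using A0 W0 by (simp add: power_mult_distrib power3_eq_cube power2_eq_square)
  finally have W2: "W\<^sup>2 \<le> 64 * (sqrt W) ^ 3 * A ^ 3" by (simp add: power_mult_distrib mult_ac)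
  \<comment> \<open>From W^2 \<le> 64 W^(3/2) A^3, after cancelling W^(3/2) when W is
    positive.\<close>
  have W6: "W \<le> (4 * A) ^ 6"
  proof (cases "W = 0")
    case False
    then have s: "sqrt W > 0" using W0 by simp
    have "W = (sqrt W)\<^sup>2" using W0 by simp
    then have "(sqrt W) ^ 3 * sqrt W \<le> (sqrt W) ^ 3 * (64 * A ^ 3)" using W2
      by (simp add: power2_eq_square power3_eq_cube mult_ac)
    then have "sqrt W \<le> 64 * A ^ 3" using s by simp
    then have "(sqrt W)\<^sup>2 \<le> (64 * A ^ 3)\<^sup>2" using s by (intro power_mono) auto
    then show ?thesis using W0 by (simp add: power_mult_distrib power_mult[symmetric])
  qed (use A0 in auto)
  have RA: "A = (\<Sum>i\<in>UNIV. Ln R 2 (pd i f))"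
    unfolding A_def
    by (intro sum.cong refl Ln_support[OF cp, of r]) (use pd_zero_outside[of r f] z r c in auto)
  have "Ln R 6 f = Ln c 6 f" by (rule Ln_support[OF cf z]) (use r c in auto)
  also have "\<dots> \<le> 4 * A"
    using W6 A0 by (subst Ln_le_iff) (auto simp: W_def)
  finally show ?thesis unfolding RA .
qed

section \<open>Local energy inequality\<close>

lemma divergence_zero:
  fixes Z :: "3 \<Rightarrow> real^3 \<Rightarrow> real"
  assumes "\<And>i. smooth3 (Z i)" "\<And>i x. norm x > r \<Longrightarrow> Z i x = 0" "r \<le> R"
  shows "(\<integral>x. (\<Sum>i\<in>UNIV. pd i (Z i) x) \<partial>BM R) = 0"
proof -
  have "integral\<^sup>L (BM R) (pd i (Z i)) = 0" for i
    by (rule integral_pd_zero[where r=r]) (use assms in \<open>auto intro!: smooth3_cont\<close>)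
  then show ?thesis
    by (subst BM_int_sum) (auto intro!: smooth3_cont assms)
qed

lemma green_identity:
  fixes f h :: "real^3 \<Rightarrow> real"
  assumes f: "smooth3 f" and h: "smooth3 h" "\<And>x. norm x > r \<Longrightarrow> h x = 0" "r \<le> R"
  shows "(\<integral>x. (\<Sum>i\<in>UNIV. pd i (pd i f) x) * h x \<partial>BM R) = - (\<integral>x. (\<Sum>i\<in>UNIV. pd i f x * pd i h x) \<partial>BM R)"
proof -
  have "(\<integral>x. (\<Sum>i\<in>UNIV. pd i (pd i f) x) * h x \<partial>BM R) = (\<Sum>i\<in>UNIV. (\<integral>x. pd i (pd i f) x * h x \<partial>BM R))"
    unfolding sum_distrib_right by (rule BM_int_sum) (auto intro!: smooth3_cont f h)
  also have "\<dots> = (\<Sum>i\<in>UNIV. - (\<integral>x. pd i f x * pd i h x \<partial>BM R))"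
    by (intro sum.cong refl integral_pd_by_parts[where r=r]) (use f h in auto)
  also have "\<dots> = - (\<integral>x. (\<Sum>i\<in>UNIV. pd i f x * pd i h x) \<partial>BM R)"
    by (subst BM_int_sum) (auto intro!: smooth3_cont f h simp: sum_negf)
  finally show ?thesis .
qed

lemma transport_identity:
  fixes V :: "3 \<Rightarrow> real^3 \<Rightarrow> real" and f h :: "real^3 \<Rightarrow> real"
  assumes V: "\<And>i. smooth3 (V i)" "\<And>x. (\<Sum>i\<in>UNIV. pd i (V i) x) = 0"
    and f: "smooth3 f" and h: "smooth3 h" "\<And>x. norm x > r \<Longrightarrow> h x = 0" "r \<le> R"
  shows "(\<integral>x. (\<Sum>i\<in>UNIV. V i x * pd i f x) * h x \<partial>BM R) = - (\<integral>x. f x * (\<Sum>i\<in>UNIV. V i x * pd i h x) \<partial>BM R)"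
proof -
  have e: "(\<Sum>i\<in>UNIV. pd i (\<lambda>x. V i x * (f x * h x)) x) = (\<Sum>i\<in>UNIV. V i x * pd i f x) * h x + f x * (\<Sum>i\<in>UNIV. V i x * pd i h x)" for x
  proof -
    have p: "pd i (\<lambda>x. V i x * (f x * h x)) x = V i x * (f x * pd i h x + pd i f x * h x) + pd i (V i) x * (f x * h x)" for i
      using V f h by (subst pd_mult) (auto simp: pd_mult intro!: smooth3_D)
    have "(\<Sum>i\<in>UNIV. pd i (\<lambda>x. V i x * (f x * h x)) x) = (\<Sum>i\<in>UNIV. V i x * pd i f x) * h x + f x * (\<Sum>i\<in>UNIV. V i x * pd i h x) + (\<Sum>i\<in>UNIV. pd i (V i) x) * (f x * h x)"
      unfolding p sum_distrib_right sum_distrib_left sum.distrib[symmetric] by (intro sum.cong refl) (simp add: algebra_simps)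
    then show ?thesis using V(2) by simp
  qed
  have "(\<integral>x. (\<Sum>i\<in>UNIV. pd i (\<lambda>x. V i x * (f x * h x)) x) \<partial>BM R) = 0"
    by (rule divergence_zero[where r=r]) (use V f h in auto)
  then show ?thesis unfolding e
    by (subst (asm) BM_int_add) (auto intro!: smooth3_cont smooth3_mult smooth3_sum V f h)
qed

text \<open>For f = g this turns a convective term into a flux through the cutoff. The mixed form is
  what makes the two magnetic coupling terms, one from each equation, cancel up to such a
  flux.\<close>

lemma transport_square:
  fixes V :: "3 \<Rightarrow> real^3 \<Rightarrow> real" and f g h :: "real^3 \<Rightarrow> real"
  assumes V: "\<And>i. smooth3 (V i)" "\<And>x. (\<Sum>i\<in>UNIV. pd i (V i) x) = 0"
    and f: "smooth3 f" and g: "smooth3 g" and h: "smooth3 h" "\<And>x. norm x > r \<Longrightarrow> h x = 0" "r \<le> R"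
  shows "(\<integral>x. (\<Sum>i\<in>UNIV. V i x * pd i f x) * (g x * h x) \<partial>BM R) + (\<integral>x. (\<Sum>i\<in>UNIV. V i x * pd i g x) * (f x * h x) \<partial>BM R)
     = - (\<integral>x. f x * g x * (\<Sum>i\<in>UNIV. V i x * pd i h x) \<partial>BM R)"
proof -
  have e: "f x * (\<Sum>i\<in>UNIV. V i x * pd i (\<lambda>x. g x * h x) x) = (\<Sum>i\<in>UNIV. V i x * pd i g x) * (f x * h x) + f x * g x * (\<Sum>i\<in>UNIV. V i x * pd i h x)" for x
  proof -
    have p: "pd i (\<lambda>x. g x * h x) x = g x * pd i h x + pd i g x * h x" for i
      using g h by (intro pd_mult) auto
    show ?thesis unfolding p sum_distrib_right sum_distrib_left sum.distrib[symmetric]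
      by (intro sum.cong refl) (simp add: algebra_simps)
  qed
  have "(\<integral>x. (\<Sum>i\<in>UNIV. V i x * pd i f x) * (g x * h x) \<partial>BM R) = - (\<integral>x. f x * (\<Sum>i\<in>UNIV. V i x * pd i (\<lambda>x. g x * h x) x) \<partial>BM R)"
    by (rule transport_identity[where r=r]) (use V f g h in auto)
  also have "\<dots> = - ((\<integral>x. (\<Sum>i\<in>UNIV. V i x * pd i g x) * (f x * h x) \<partial>BM R) + (\<integral>x. f x * g x * (\<Sum>i\<in>UNIV. V i x * pd i h x) \<partial>BM R))"
    unfolding e by (subst BM_int_add) (auto intro!: smooth3_cont smooth3_mult smooth3_sum V f g h)
  finally show ?thesis by simp
qed

section \<open>Curl, cross product and the Hall nonlinearity in components\<close>

definition curlc :: "(3 \<Rightarrow> real^3 \<Rightarrow> real) \<Rightarrow> 3 \<Rightarrow> real^3 \<Rightarrow> real" where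
  "curlc f k x = (if k = 1 then pd 2 (f 3) x - pd 3 (f 2) x else if k = 2 then pd 3 (f 1) x - pd 1 (f 3) x else pd 1 (f 2) x - pd 2 (f 1) x)"

definition crossc :: "(3 \<Rightarrow> real) \<Rightarrow> (3 \<Rightarrow> real) \<Rightarrow> 3 \<Rightarrow> real" where
  "crossc a b k = (if k = 1 then a 2 * b 3 - a 3 * b 2 else if k = 2 then a 3 * b 1 - a 1 * b 3 else a 1 * b 2 - a 2 * b 1)"

definition hallF :: "(3 \<Rightarrow> real^3 \<Rightarrow> real) \<Rightarrow> 3 \<Rightarrow> real^3 \<Rightarrow> real" where
  "hallF b k x = crossc (\<lambda>j. curlc b j x) (\<lambda>j. b j x) k"

lemma smooth3_curlc: "(\<And>j. smooth3 (b j)) \<Longrightarrow> smooth3 (curlc b k)"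
  unfolding curlc_def[abs_def] by (cases "k = 1"; cases "k = 2") (auto intro!: smooth3_diff)

lemma smooth3_hallF: "(\<And>j. smooth3 (b j)) \<Longrightarrow> smooth3 (hallF b k)"
  unfolding hallF_def[abs_def] crossc_def by (cases "k = 1"; cases "k = 2") (auto intro!: smooth3_diff smooth3_curlc)

text \<open>The Hall term only produces derivatives of the cutoff because \<open>curl b \<times> b\<close> is orthogonal to \<open>curl b\<close>.\<close>
lemma hall_identity:
  assumes b: "\<And>j. smooth3 (b j)" and h: "smooth3 h" "\<And>x. norm x > r \<Longrightarrow> h x = 0" "r \<le> R"
  shows "(\<integral>x. (\<Sum>k\<in>UNIV. curlc (hallF b) k x * (b k x * h x)) \<partial>BM R) =
    - (\<integral>x. hallF b 3 x * pd 2 h x * b 1 x - hallF b 2 x * pd 3 h x * b 1 x + hallF b 1 x * pd 3 h x * b 2 x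
      - hallF b 3 x * pd 1 h x * b 2 x + hallF b 2 x * pd 1 h x * b 3 x - hallF b 1 x * pd 2 h x * b 3 x \<partial>BM R)"
proof -
  let ?F = "hallF b"
  define g where "g k x = b k x * h x" for k x
  have sF: "smooth3 (?F k)" for k by (rule smooth3_hallF[OF b])
  have sg: "smooth3 (g k)" for k unfolding g_def by (intro smooth3_mult b h)
  have zg: "norm x > r \<Longrightarrow> g k x = 0" for k x by (simp add: g_def h)
  have pg: "pd i (g k) x = b k x * pd i h x + pd i (b k) x * h x" for i k x
    unfolding g_def by (rule pd_mult) (auto intro!: smooth3_D b h)
  have p: "(\<integral>x. pd i (?F j) x * g k x \<partial>BM R) = - (\<integral>x. ?F j x * pd i (g k) x \<partial>BM R)" for i j k
    by (rule integral_pd_by_parts[where r=r]) (use sF sg zg h in auto)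
  have c: "contU (\<lambda>x. pd i (?F j) x * g k x)" "contU (\<lambda>x. ?F j x * pd i (g k) x)" for i j k
    by (intro smooth3_cont smooth3_mult smooth3_pd sF sg)+
  have "(\<integral>x. (\<Sum>k\<in>UNIV. curlc ?F k x * (b k x * h x)) \<partial>BM R) =
     (\<integral>x. (pd 2 (?F 3) x * g 1 x - pd 3 (?F 2) x * g 1 x) + ((pd 3 (?F 1) x * g 2 x - pd 1 (?F 3) x * g 2 x) + (pd 1 (?F 2) x * g 3 x - pd 2 (?F 1) x * g 3 x)) \<partial>BM R)"
    by (intro BM_cong) (simp add: sum_3 curlc_def g_def algebra_simps)
  also have "\<dots> = - (\<integral>x. (?F 3 x * pd 2 (g 1) x - ?F 2 x * pd 3 (g 1) x) + ((?F 1 x * pd 3 (g 2) x - ?F 3 x * pd 1 (g 2) x) + (?F 2 x * pd 1 (g 3) x - ?F 1 x * pd 2 (g 3) x)) \<partial>BM R)"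
    using c by (simp add: BM_int_add BM_int_diff continuous_on_add continuous_on_diff p)
  also have "(\<integral>x. (?F 3 x * pd 2 (g 1) x - ?F 2 x * pd 3 (g 1) x) + ((?F 1 x * pd 3 (g 2) x - ?F 3 x * pd 1 (g 2) x) + (?F 2 x * pd 1 (g 3) x - ?F 1 x * pd 2 (g 3) x)) \<partial>BM R)
     = (\<integral>x. ?F 3 x * pd 2 h x * b 1 x - ?F 2 x * pd 3 h x * b 1 x + ?F 1 x * pd 3 h x * b 2 x
      - ?F 3 x * pd 1 h x * b 2 x + ?F 2 x * pd 1 h x * b 3 x - ?F 1 x * pd 2 h x * b 3 x \<partial>BM R)"
    by (intro BM_cong) (simp add: pg hallF_def crossc_def curlc_def algebra_simps)
  finally show ?thesis by simp
qed

text \<open>The system at unit scale: the same small \<nu> multiplies both Laplacians and the Hall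
  term. Vector fields are indexed families of scalar functions, so that all calculus is
  scalar.\<close>

locale unit_sol =
  fixes \<nu> :: real and U b :: "3 \<Rightarrow> real^3 \<Rightarrow> real" and P :: "real^3 \<Rightarrow> real" and F H :: "3 \<Rightarrow> 3 \<Rightarrow> real^3 \<Rightarrow> real"
  assumes nu: "0 < \<nu>"
    and smU: "smooth3 (U k)" and smb: "smooth3 (b k)" and smP: "smooth3 P" and smF: "smooth3 (F i j)" and smH: "smooth3 (H i j)"
    and NS: "- \<nu> * (\<Sum>i\<in>UNIV. pd i (pd i (U k)) x) + (\<Sum>i\<in>UNIV. U i x * pd i (U k) x) = - pd k P x + (\<Sum>i\<in>UNIV. b i x * pd i (b k) x)"
    and MF: "- \<nu> * (\<Sum>i\<in>UNIV. pd i (pd i (b k)) x) + (\<Sum>i\<in>UNIV. U i x * pd i (b k) x) = (\<Sum>i\<in>UNIV. b i x * pd i (U k) x) + \<nu> * curlc (hallF b) k x"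
    and divU: "(\<Sum>i\<in>UNIV. pd i (U i) x) = 0" and divb: "(\<Sum>i\<in>UNIV. pd i (b i) x) = 0"
    and divF: "(\<Sum>j\<in>UNIV. pd j (F i j) x) = U i x" and divH: "(\<Sum>j\<in>UNIV. pd j (H i j) x) = b i x"
begin

text \<open>Pointwise norms of pairs, so that velocity and magnetic terms are estimated at once.
  \<open>b\<close> alone also gets a norm, \<open>vb\<close>, because the Hall term and the
  hypothesis on its oscillation involve only the magnetic field.\<close>

definition va :: "real^3 \<Rightarrow> real" where "va x = sqrt (\<Sum>k\<in>UNIV. (U k x)\<^sup>2 + (b k x)\<^sup>2)"
definition vb :: "real^3 \<Rightarrow> real" where "vb x = sqrt (\<Sum>k\<in>UNIV. (b k x)\<^sup>2)"
definition vG :: "real^3 \<Rightarrow> real" where "vG x = sqrt (\<Sum>k\<in>UNIV. \<Sum>i\<in>UNIV. (pd i (U k) x)\<^sup>2 + (pd i (b k) x)\<^sup>2)"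
definition vM :: "real^3 \<Rightarrow> real" where "vM x = sqrt (\<Sum>i\<in>UNIV. \<Sum>j\<in>UNIV. (F i j x)\<^sup>2 + (H i j x)\<^sup>2)"

lemma cont_v [continuous_intros]: "continuous_on S va" "continuous_on S vb" "continuous_on S vG" "continuous_on S vM"
  unfolding va_def[abs_def] vb_def[abs_def] vG_def[abs_def] vM_def[abs_def]
  by (intro continuous_on_real_sqrt continuous_on_sum continuous_on_add continuous_on_power smooth3_cont smooth3_pd smU smb smF smH)+

lemma v_nonneg [simp]: "0 \<le> va x" "0 \<le> vb x" "0 \<le> vG x" "0 \<le> vM x"
  by (auto simp: va_def vb_def vG_def vM_def intro!: sum_nonneg add_nonneg_nonneg)

lemma le_sqrt_sum:
  fixes f g :: "3 \<Rightarrow> real"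
  shows "\<bar>f k\<bar> \<le> sqrt (\<Sum>k\<in>UNIV. (f k)\<^sup>2 + (g k)\<^sup>2)" "\<bar>g k\<bar> \<le> sqrt (\<Sum>k\<in>UNIV. (f k)\<^sup>2 + (g k)\<^sup>2)"
proof -
  have "(f k)\<^sup>2 + (g k)\<^sup>2 \<le> (\<Sum>k\<in>UNIV. (f k)\<^sup>2 + (g k)\<^sup>2)" by (rule member_le_sum) auto
  then have "(f k)\<^sup>2 \<le> (\<Sum>k\<in>UNIV. (f k)\<^sup>2 + (g k)\<^sup>2)" "(g k)\<^sup>2 \<le> (\<Sum>k\<in>UNIV. (f k)\<^sup>2 + (g k)\<^sup>2)"
    using zero_le_power2[of "f k"] zero_le_power2[of "g k"] by linarith+
  then show "\<bar>f k\<bar> \<le> sqrt (\<Sum>k\<in>UNIV. (f k)\<^sup>2 + (g k)\<^sup>2)" "\<bar>g k\<bar> \<le> sqrt (\<Sum>k\<in>UNIV. (f k)\<^sup>2 + (g k)\<^sup>2)"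
    by (auto intro!: real_le_rsqrt)
qed

lemma le_sqrt_sum2:
  fixes f g :: "3 \<Rightarrow> 3 \<Rightarrow> real"
  shows "\<bar>f k i\<bar> \<le> sqrt (\<Sum>k\<in>UNIV. \<Sum>i\<in>UNIV. (f k i)\<^sup>2 + (g k i)\<^sup>2)" "\<bar>g k i\<bar> \<le> sqrt (\<Sum>k\<in>UNIV. \<Sum>i\<in>UNIV. (f k i)\<^sup>2 + (g k i)\<^sup>2)"
proof -
  have "(\<Sum>i\<in>UNIV. (f k i)\<^sup>2 + (g k i)\<^sup>2) \<le> (\<Sum>k\<in>UNIV. \<Sum>i\<in>UNIV. (f k i)\<^sup>2 + (g k i)\<^sup>2)"
    by (rule member_le_sum[of _ _ "\<lambda>k. \<Sum>i\<in>UNIV. (f k i)\<^sup>2 + (g k i)\<^sup>2"]) (auto intro!: sum_nonneg)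
  then have "sqrt (\<Sum>i\<in>UNIV. (f k i)\<^sup>2 + (g k i)\<^sup>2) \<le> sqrt (\<Sum>k\<in>UNIV. \<Sum>i\<in>UNIV. (f k i)\<^sup>2 + (g k i)\<^sup>2)" by simp
  then show "\<bar>f k i\<bar> \<le> sqrt (\<Sum>k\<in>UNIV. \<Sum>i\<in>UNIV. (f k i)\<^sup>2 + (g k i)\<^sup>2)" "\<bar>g k i\<bar> \<le> sqrt (\<Sum>k\<in>UNIV. \<Sum>i\<in>UNIV. (f k i)\<^sup>2 + (g k i)\<^sup>2)"
    using le_sqrt_sum[where f="f k" and k=i and g="g k"] by linarith+
qed

lemma le_v: "\<bar>U k x\<bar> \<le> va x" "\<bar>b k x\<bar> \<le> va x" "\<bar>b k x\<bar> \<le> vb x" "vb x \<le> va x"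
    "\<bar>pd i (U k) x\<bar> \<le> vG x" "\<bar>pd i (b k) x\<bar> \<le> vG x" "\<bar>F i j x\<bar> \<le> vM x" "\<bar>H i j x\<bar> \<le> vM x"
  using le_sqrt_sum[where f="\<lambda>k. U k x" and k=k and g="\<lambda>k. b k x"] le_sqrt_sum[where f="\<lambda>k. b k x" and k=k and g="\<lambda>k. 0"]
    le_sqrt_sum2[where f="\<lambda>k i. pd i (U k) x" and k=k and i=i and g="\<lambda>k i. pd i (b k) x"]
    le_sqrt_sum2[where f="\<lambda>i j. F i j x" and k=i and i=j and g="\<lambda>i j. H i j x"]
  by (auto simp: va_def vb_def vG_def vM_def intro!: sum_mono)

lemma vG_sq: "(vG x)\<^sup>2 = (\<Sum>k\<in>UNIV. \<Sum>i\<in>UNIV. (pd i (U k) x)\<^sup>2 + (pd i (b k) x)\<^sup>2)"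
  unfolding vG_def by (intro real_sqrt_pow2 sum_nonneg) auto

text \<open>Test the momentum equation with \<open>\<eta> U - v\<close>, which is divergence free so that the pressure drops out,
  and the induction equation with \<open>\<eta> b\<close>.\<close>
lemma energy_identity:
  assumes e: "smooth3 \<eta>" "\<And>x. norm x > R \<Longrightarrow> \<eta> x = 0" and v: "\<And>k. smooth3 (v k)" "\<And>k x. norm x > R \<Longrightarrow> v k x = 0"
    and dv: "\<And>x. (\<Sum>k\<in>UNIV. pd k (v k) x) = (\<Sum>i\<in>UNIV. U i x * pd i \<eta> x)"
  shows "\<nu> * (\<integral>x. \<eta> x * (vG x)\<^sup>2 \<partial>BM R) =
    (\<Sum>k\<in>UNIV. - \<nu> * (\<integral>x. (\<Sum>i\<in>UNIV. pd i (U k) x * (U k x * pd i \<eta> x)) \<partial>BM R) - \<nu> * (\<integral>x. (\<Sum>i\<in>UNIV. pd i (b k) x * (b k x * pd i \<eta> x)) \<partial>BM R)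
      + \<nu> * (\<integral>x. (\<Sum>i\<in>UNIV. pd i (U k) x * pd i (v k) x) \<partial>BM R)
      + (\<integral>x. U k x * U k x * (\<Sum>i\<in>UNIV. U i x * pd i \<eta> x) \<partial>BM R) / 2 + (\<integral>x. b k x * b k x * (\<Sum>i\<in>UNIV. U i x * pd i \<eta> x) \<partial>BM R) / 2
      - (\<integral>x. b k x * U k x * (\<Sum>i\<in>UNIV. b i x * pd i \<eta> x) \<partial>BM R)
      + (\<integral>x. (\<Sum>i\<in>UNIV. U i x * pd i (U k) x) * v k x \<partial>BM R) - (\<integral>x. (\<Sum>i\<in>UNIV. b i x * pd i (b k) x) * v k x \<partial>BM R))
      + \<nu> * (\<integral>x. (\<Sum>k\<in>UNIV. curlc (hallF b) k x * (b k x * \<eta> x)) \<partial>BM R)"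
proof -
  define w where "w k x = U k x * \<eta> x - v k x" for k x
  have sw: "smooth3 (w k)" for k unfolding w_def by (intro smooth3_diff smooth3_mult smU e v)
  have zw: "norm x > R \<Longrightarrow> w k x = 0" for k x by (simp add: w_def e v)
  have pw: "pd i (w k) x = U k x * pd i \<eta> x + pd i (U k) x * \<eta> x - pd i (v k) x" for i k x
    unfolding w_def by (subst pd_diff) (auto intro!: smooth3_D smU e v simp: pd_mult[OF smooth3_D[OF smU] smooth3_D[OF e(1)]])
  have sh: "smooth3 (hallF b k)" for k by (rule smooth3_hallF[OF smb])
  have sch: "smooth3 (curlc (hallF b) k)" for k by (rule smooth3_curlc[OF sh])
  note sm = smooth3_cont smooth3_mult smooth3_sum smooth3_diff smooth3_add smooth3_pd smooth3_const smU smb smP e v sw sch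
  have cc: "contU f \<Longrightarrow> integrable (BM R) f" for f by (rule integrable_BM)
  have m1: "- \<nu> * (\<integral>x. (\<Sum>i\<in>UNIV. pd i (pd i (U k)) x) * w k x \<partial>BM R) + (\<integral>x. (\<Sum>i\<in>UNIV. U i x * pd i (U k) x) * w k x \<partial>BM R)
     = - (\<integral>x. pd k P x * w k x \<partial>BM R) + (\<integral>x. (\<Sum>i\<in>UNIV. b i x * pd i (b k) x) * w k x \<partial>BM R)" for k
  proof -
    have "(\<integral>x. (- \<nu> * ((\<Sum>i\<in>UNIV. pd i (pd i (U k)) x) * w k x)) + (\<Sum>i\<in>UNIV. U i x * pd i (U k) x) * w k x \<partial>BM R)
       = (\<integral>x. (- 1 * (pd k P x * w k x)) + (\<Sum>i\<in>UNIV. b i x * pd i (b k) x) * w k x \<partial>BM R)"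
    proof (rule BM_cong)
      fix x
      have "(- \<nu> * (\<Sum>i\<in>UNIV. pd i (pd i (U k)) x) + (\<Sum>i\<in>UNIV. U i x * pd i (U k) x)) * w k x = (- pd k P x + (\<Sum>i\<in>UNIV. b i x * pd i (b k) x)) * w k x"
        by (simp only: NS)
      then show "(- \<nu> * ((\<Sum>i\<in>UNIV. pd i (pd i (U k)) x) * w k x)) + (\<Sum>i\<in>UNIV. U i x * pd i (U k) x) * w k x = (- 1 * (pd k P x * w k x)) + (\<Sum>i\<in>UNIV. b i x * pd i (b k) x) * w k x"
        by (simp only: distrib_right mult.assoc mult_minus_left mult_1_left)
    qed
    moreover have "(\<integral>x. (- \<nu> * ((\<Sum>i\<in>UNIV. pd i (pd i (U k)) x) * w k x)) + (\<Sum>i\<in>UNIV. U i x * pd i (U k) x) * w k x \<partial>BM R) =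
      - \<nu> * (\<integral>x. (\<Sum>i\<in>UNIV. pd i (pd i (U k)) x) * w k x \<partial>BM R) + (\<integral>x. (\<Sum>i\<in>UNIV. U i x * pd i (U k) x) * w k x \<partial>BM R)"
      by (subst BM_int_add) ((intro sm)+, simp)
    moreover have "(\<integral>x. (- 1 * (pd k P x * w k x)) + (\<Sum>i\<in>UNIV. b i x * pd i (b k) x) * w k x \<partial>BM R) = - (\<integral>x. pd k P x * w k x \<partial>BM R) + (\<integral>x. (\<Sum>i\<in>UNIV. b i x * pd i (b k) x) * w k x \<partial>BM R)"
      by (subst BM_int_add) ((intro sm)+, simp)
    ultimately show ?thesis by simp
  qed
  have m2: "- \<nu> * (\<integral>x. (\<Sum>i\<in>UNIV. pd i (pd i (b k)) x) * (b k x * \<eta> x) \<partial>BM R) + (\<integral>x. (\<Sum>i\<in>UNIV. U i x * pd i (b k) x) * (b k x * \<eta> x) \<partial>BM R)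
     = (\<integral>x. (\<Sum>i\<in>UNIV. b i x * pd i (U k) x) * (b k x * \<eta> x) \<partial>BM R) + \<nu> * (\<integral>x. curlc (hallF b) k x * (b k x * \<eta> x) \<partial>BM R)" for k
  proof -
    have "(\<integral>x. (- \<nu> * ((\<Sum>i\<in>UNIV. pd i (pd i (b k)) x) * (b k x * \<eta> x))) + (\<Sum>i\<in>UNIV. U i x * pd i (b k) x) * (b k x * \<eta> x) \<partial>BM R)
       = (\<integral>x. (\<Sum>i\<in>UNIV. b i x * pd i (U k) x) * (b k x * \<eta> x) + \<nu> * (curlc (hallF b) k x * (b k x * \<eta> x)) \<partial>BM R)"
    proof (rule BM_cong)
      fix x
      have "(- \<nu> * (\<Sum>i\<in>UNIV. pd i (pd i (b k)) x) + (\<Sum>i\<in>UNIV. U i x * pd i (b k) x)) * (b k x * \<eta> x) = ((\<Sum>i\<in>UNIV. b i x * pd i (U k) x) + \<nu> * curlc (hallF b) k x) * (b k x * \<eta> x)"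
        by (simp only: MF)
      then show "(- \<nu> * ((\<Sum>i\<in>UNIV. pd i (pd i (b k)) x) * (b k x * \<eta> x))) + (\<Sum>i\<in>UNIV. U i x * pd i (b k) x) * (b k x * \<eta> x) = (\<Sum>i\<in>UNIV. b i x * pd i (U k) x) * (b k x * \<eta> x) + \<nu> * (curlc (hallF b) k x * (b k x * \<eta> x))"
        by (simp only: distrib_right mult.assoc)
    qed
    moreover have "(\<integral>x. (- \<nu> * ((\<Sum>i\<in>UNIV. pd i (pd i (b k)) x) * (b k x * \<eta> x))) + (\<Sum>i\<in>UNIV. U i x * pd i (b k) x) * (b k x * \<eta> x) \<partial>BM R) =
      - \<nu> * (\<integral>x. (\<Sum>i\<in>UNIV. pd i (pd i (b k)) x) * (b k x * \<eta> x) \<partial>BM R) + (\<integral>x. (\<Sum>i\<in>UNIV. U i x * pd i (b k) x) * (b k x * \<eta> x) \<partial>BM R)"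
      by (subst BM_int_add) ((intro sm)+, simp)
    moreover have "(\<integral>x. (\<Sum>i\<in>UNIV. b i x * pd i (U k) x) * (b k x * \<eta> x) + \<nu> * (curlc (hallF b) k x * (b k x * \<eta> x)) \<partial>BM R) =
      (\<integral>x. (\<Sum>i\<in>UNIV. b i x * pd i (U k) x) * (b k x * \<eta> x) \<partial>BM R) + \<nu> * (\<integral>x. curlc (hallF b) k x * (b k x * \<eta> x) \<partial>BM R)"
      by (subst BM_int_add) ((intro sm)+, simp)
    ultimately show ?thesis by simp
  qed
  have v1: "(\<integral>x. (\<Sum>i\<in>UNIV. pd i (pd i (U k)) x) * w k x \<partial>BM R) =
      - (\<integral>x. (\<Sum>i\<in>UNIV. (pd i (U k) x)\<^sup>2) * \<eta> x \<partial>BM R) - (\<integral>x. (\<Sum>i\<in>UNIV. pd i (U k) x * (U k x * pd i \<eta> x)) \<partial>BM R) + (\<integral>x. (\<Sum>i\<in>UNIV. pd i (U k) x * pd i (v k) x) \<partial>BM R)" for k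
  proof -
    have "(\<integral>x. (\<Sum>i\<in>UNIV. pd i (pd i (U k)) x) * w k x \<partial>BM R) = - (\<integral>x. (\<Sum>i\<in>UNIV. pd i (U k) x * pd i (w k) x) \<partial>BM R)"
      by (rule green_identity[where r=R]) (use smU sw zw in auto)
    also have "(\<integral>x. (\<Sum>i\<in>UNIV. pd i (U k) x * pd i (w k) x) \<partial>BM R) =
       (\<integral>x. ((\<Sum>i\<in>UNIV. pd i (U k) x * pd i (U k) x) * \<eta> x + (\<Sum>i\<in>UNIV. pd i (U k) x * (U k x * pd i \<eta> x))) - (\<Sum>i\<in>UNIV. pd i (U k) x * pd i (v k) x) \<partial>BM R)"
      unfolding pw sum_distrib_right sum.distrib[symmetric] sum_subtractf[symmetric]
      by (intro BM_cong sum.cong refl) (simp add: algebra_simps)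
    also have "\<dots> = (\<integral>x. (\<Sum>i\<in>UNIV. pd i (U k) x * pd i (U k) x) * \<eta> x \<partial>BM R) + (\<integral>x. (\<Sum>i\<in>UNIV. pd i (U k) x * (U k x * pd i \<eta> x)) \<partial>BM R) - (\<integral>x. (\<Sum>i\<in>UNIV. pd i (U k) x * pd i (v k) x) \<partial>BM R)"
      by (subst BM_int_diff, (intro sm)+, subst BM_int_add, (intro sm)+, rule refl)
    finally show ?thesis by (simp add: power2_eq_square)
  qed
  have v2: "(\<integral>x. (\<Sum>i\<in>UNIV. pd i (pd i (b k)) x) * (b k x * \<eta> x) \<partial>BM R) =
      - (\<integral>x. (\<Sum>i\<in>UNIV. (pd i (b k) x)\<^sup>2) * \<eta> x \<partial>BM R) - (\<integral>x. (\<Sum>i\<in>UNIV. pd i (b k) x * (b k x * pd i \<eta> x)) \<partial>BM R)" for k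
  proof -
    have pb: "pd i (\<lambda>x. b k x * \<eta> x) x = b k x * pd i \<eta> x + pd i (b k) x * \<eta> x" for i x
      by (rule pd_mult) (auto intro!: smooth3_D smb e)
    have "(\<integral>x. (\<Sum>i\<in>UNIV. pd i (pd i (b k)) x) * (b k x * \<eta> x) \<partial>BM R) = - (\<integral>x. (\<Sum>i\<in>UNIV. pd i (b k) x * pd i (\<lambda>x. b k x * \<eta> x) x) \<partial>BM R)"
      by (rule green_identity[where r=R]) (use smb e in auto)
    also have "(\<integral>x. (\<Sum>i\<in>UNIV. pd i (b k) x * pd i (\<lambda>x. b k x * \<eta> x) x) \<partial>BM R) =
       (\<integral>x. (\<Sum>i\<in>UNIV. pd i (b k) x * pd i (b k) x) * \<eta> x + (\<Sum>i\<in>UNIV. pd i (b k) x * (b k x * pd i \<eta> x)) \<partial>BM R)"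
      unfolding pb sum_distrib_right sum.distrib[symmetric]
      by (intro BM_cong sum.cong refl) (simp add: algebra_simps)
    also have "\<dots> = (\<integral>x. (\<Sum>i\<in>UNIV. pd i (b k) x * pd i (b k) x) * \<eta> x \<partial>BM R) + (\<integral>x. (\<Sum>i\<in>UNIV. pd i (b k) x * (b k x * pd i \<eta> x)) \<partial>BM R)"
      by (subst BM_int_add, (intro sm)+, rule refl)
    finally show ?thesis by (simp add: power2_eq_square)
  qed
  have pr: "(\<Sum>k\<in>UNIV. (\<integral>x. pd k P x * w k x \<partial>BM R)) = 0"
  proof -
    have dw: "(\<Sum>k\<in>UNIV. pd k (w k) x) = 0" for x
      by (simp add: pw sum.distrib sum_subtractf dv sum_distrib_right[symmetric] divU)
    have "(\<Sum>k\<in>UNIV. (\<integral>x. pd k P x * w k x \<partial>BM R)) = (\<Sum>k\<in>UNIV. - (\<integral>x. P x * pd k (w k) x \<partial>BM R))"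
      by (intro sum.cong refl integral_pd_by_parts[where r=R]) (use smP sw zw in auto)
    also have "\<dots> = - (\<integral>x. (\<Sum>k\<in>UNIV. P x * pd k (w k) x) \<partial>BM R)"
      by (subst BM_int_sum) ((intro sm)+, simp add: sum_negf)
    also have "\<dots> = 0" by (simp add: sum_distrib_left[symmetric] dw)
    finally show ?thesis .
  qed
  have splitw: "(\<integral>x. g x * w k x \<partial>BM R) = (\<integral>x. g x * (U k x * \<eta> x) \<partial>BM R) - (\<integral>x. g x * v k x \<partial>BM R)" if "smooth3 g" for g k
  proof -
    have "(\<integral>x. g x * w k x \<partial>BM R) = (\<integral>x. g x * (U k x * \<eta> x) - g x * v k x \<partial>BM R)"
      by (intro BM_cong) (simp add: w_def right_diff_distrib)
    also have "\<dots> = (\<integral>x. g x * (U k x * \<eta> x) \<partial>BM R) - (\<integral>x. g x * v k x \<partial>BM R)"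
      by (subst BM_int_diff, (intro sm that)+, rule refl)
    finally show ?thesis .
  qed
  have t1: "2 * (\<integral>x. (\<Sum>i\<in>UNIV. U i x * pd i (U k) x) * (U k x * \<eta> x) \<partial>BM R) = - (\<integral>x. U k x * U k x * (\<Sum>i\<in>UNIV. U i x * pd i \<eta> x) \<partial>BM R)" for k
    using transport_square[OF smU divU smU[of k] smU[of k] e, of R] by simp
  have t2: "2 * (\<integral>x. (\<Sum>i\<in>UNIV. U i x * pd i (b k) x) * (b k x * \<eta> x) \<partial>BM R) = - (\<integral>x. b k x * b k x * (\<Sum>i\<in>UNIV. U i x * pd i \<eta> x) \<partial>BM R)" for k
    using transport_square[OF smU divU smb[of k] smb[of k] e, of R] by simp
  have t3: "(\<integral>x. (\<Sum>i\<in>UNIV. b i x * pd i (b k) x) * (U k x * \<eta> x) \<partial>BM R) + (\<integral>x. (\<Sum>i\<in>UNIV. b i x * pd i (U k) x) * (b k x * \<eta> x) \<partial>BM R) = - (\<integral>x. b k x * U k x * (\<Sum>i\<in>UNIV. b i x * pd i \<eta> x) \<partial>BM R)" for k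
    using transport_square[OF smb divb smb[of k] smU[of k] e, of R] by simp
  have su: "smooth3 (\<lambda>x. \<Sum>i\<in>UNIV. U i x * pd i (U k) x)" "smooth3 (\<lambda>x. \<Sum>i\<in>UNIV. b i x * pd i (b k) x)" for k by (intro sm)+
  let ?T = "\<lambda>k. - \<nu> * (\<integral>x. (\<Sum>i\<in>UNIV. pd i (U k) x * (U k x * pd i \<eta> x)) \<partial>BM R) - \<nu> * (\<integral>x. (\<Sum>i\<in>UNIV. pd i (b k) x * (b k x * pd i \<eta> x)) \<partial>BM R)
      + \<nu> * (\<integral>x. (\<Sum>i\<in>UNIV. pd i (U k) x * pd i (v k) x) \<partial>BM R)
      + (\<integral>x. U k x * U k x * (\<Sum>i\<in>UNIV. U i x * pd i \<eta> x) \<partial>BM R) / 2 + (\<integral>x. b k x * b k x * (\<Sum>i\<in>UNIV. U i x * pd i \<eta> x) \<partial>BM R) / 2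
      - (\<integral>x. b k x * U k x * (\<Sum>i\<in>UNIV. b i x * pd i \<eta> x) \<partial>BM R)
      + (\<integral>x. (\<Sum>i\<in>UNIV. U i x * pd i (U k) x) * v k x \<partial>BM R) - (\<integral>x. (\<Sum>i\<in>UNIV. b i x * pd i (b k) x) * v k x \<partial>BM R)"
  let ?A = "\<lambda>k. (\<integral>x. (\<Sum>i\<in>UNIV. (pd i (U k) x)\<^sup>2) * \<eta> x \<partial>BM R) + (\<integral>x. (\<Sum>i\<in>UNIV. (pd i (b k) x)\<^sup>2) * \<eta> x \<partial>BM R)"
  have k: "\<nu> * ?A k = ?T k - (\<integral>x. pd k P x * w k x \<partial>BM R) + \<nu> * (\<integral>x. curlc (hallF b) k x * (b k x * \<eta> x) \<partial>BM R)" for k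
    using m1[of k] m2[of k] t1[of k] t2[of k] t3[of k] splitw[OF su(1), of k k] splitw[OF su(2), of k k]
    unfolding v1 v2 by (simp add: algebra_simps)
  have "(\<integral>x. \<eta> x * (vG x)\<^sup>2 \<partial>BM R) = (\<Sum>k\<in>UNIV. ?A k)"
  proof -
    have "(\<integral>x. \<eta> x * (vG x)\<^sup>2 \<partial>BM R) = (\<integral>x. (\<Sum>k\<in>UNIV. (\<Sum>i\<in>UNIV. pd i (U k) x * pd i (U k) x) * \<eta> x + (\<Sum>i\<in>UNIV. pd i (b k) x * pd i (b k) x) * \<eta> x) \<partial>BM R)"
      unfolding vG_sq sum_distrib_left sum_distrib_right sum.distrib[symmetric]
      by (intro BM_cong sum.cong refl) (simp add: power2_eq_square algebra_simps)
    also have "\<dots> = (\<Sum>k\<in>UNIV. (\<integral>x. (\<Sum>i\<in>UNIV. pd i (U k) x * pd i (U k) x) * \<eta> x \<partial>BM R) + (\<integral>x. (\<Sum>i\<in>UNIV. pd i (b k) x * pd i (b k) x) * \<eta> x \<partial>BM R))"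
      by (subst BM_int_sum, (intro sm)+, subst BM_int_add, (intro sm)+, rule refl)
    finally show ?thesis by (simp add: power2_eq_square)
  qed
  then have "\<nu> * (\<integral>x. \<eta> x * (vG x)\<^sup>2 \<partial>BM R) = (\<Sum>k\<in>UNIV. \<nu> * ?A k)" by (simp only: sum_distrib_left)
  also have "\<dots> = (\<Sum>k\<in>UNIV. ?T k) - (\<Sum>k\<in>UNIV. (\<integral>x. pd k P x * w k x \<partial>BM R)) + \<nu> * (\<Sum>k\<in>UNIV. (\<integral>x. curlc (hallF b) k x * (b k x * \<eta> x) \<partial>BM R))"
    unfolding k by (simp only: sum.distrib sum_subtractf sum_distrib_left)
  also have "(\<Sum>k\<in>UNIV. (\<integral>x. curlc (hallF b) k x * (b k x * \<eta> x) \<partial>BM R)) = (\<integral>x. (\<Sum>k\<in>UNIV. curlc (hallF b) k x * (b k x * \<eta> x)) \<partial>BM R)"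
    by (rule BM_int_sum[symmetric]) (intro sm)
  finally show ?thesis unfolding pr by simp
qed

end

section \<open>The divergence corrector for the momentum test field\<close>

lemma Ln_bmult:
  assumes "contU g" "contU h" "\<And>x. norm x \<le> r \<Longrightarrow> \<bar>h x\<bar> \<le> N" "0 < q"
  shows "Ln r q (\<lambda>x. g x * h x) \<le> N * Ln r q g"
proof (cases "r \<ge> 0")
  case True
  then have "N \<ge> 0" using assms(3)[of 0] by auto
  have "Ln r q (\<lambda>x. g x * h x) \<le> Ln r q (\<lambda>x. N * g x)"
  proof (rule Ln_mono)
    fix x :: "real^3" assume "norm x \<le> r"
    then show "\<bar>g x * h x\<bar> \<le> \<bar>N * g x\<bar>"
      using mult_left_mono[OF assms(3), of x "\<bar>g x\<bar>"] \<open>N \<ge> 0\<close> by (simp add: abs_mult mult.commute)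
  qed (use assms in \<open>auto intro!: continuous_on_mult continuous_on_const\<close>)
  also have "\<dots> = N * Ln r q g" using assms \<open>N \<ge> 0\<close> by (simp add: Ln_cmult)
  finally show ?thesis .
next
  case False
  then have "\<not> norm x \<le> r" for x :: "real^3" using norm_ge_zero[of x] by linarith
  then have "Ln r q f = Ln r q (\<lambda>x. 0)" for f by (intro Ln_cong) auto
  then have "Ln r q f = 0" for f by (simp only: Ln_zero)
  then show ?thesis by simp
qed

lemma moll_sum: "(\<And>k. k \<in> K \<Longrightarrow> contU (f k)) \<Longrightarrow> finite K \<Longrightarrow> moll d (\<lambda>x. \<Sum>k\<in>K. f k x) x = (\<Sum>k\<in>K. moll d (f k) x)"
  unfolding moll_def shift_avg_def sum_distrib_left
  by (rule integral_sum) (auto intro!: shift_avg_integrable bump_cont continuous_intros)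

text \<open>\<open>cutC\<close> belongs to a cutoff with layer d/2, whence 32 = 2^5;
  \<open>bogC\<close> to the divergence equation solved with layer d/4, whence 256 = 4^4.
  \<open>k1C\<close> and \<open>k2C\<close> bound the gradients of the explicit and of the remaining
  part of the corrector.\<close>

definition "cutC = 216 * 4 ^ 5 * bumpC * 32"
definition "bogC = (2 + 3 * bumpC * volc\<^sup>2) * 256"
definition "k1C = 3 * cutC * volc * (1 + 8 * bumpC)"
definition "k2C = bogC * (72 + 9 * volc) * cutC"

lemma constC_pos: "cutC > 0" "bogC > 0" "k1C > 0" "k2C > 0"
proof -
  note p = bumpC(1) volc_ge_1
  show 1: "cutC > 0" "bogC > 0" using p by (auto simp: cutC_def bogC_def intro!: add_pos_nonneg mult_nonneg_nonneg)
  show "k1C > 0" "k2C > 0" using p 1 by (auto simp: k1C_def k2C_def intro!: mult_pos_pos add_pos_nonneg)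
qed

context unit_sol
begin

text \<open>As div F = U, contracting F with the gradient of \<eta> gives a field whose divergence
  is U times that gradient, up to F times second derivatives of \<eta>. F is mollified first to make
  the gradient of this field available. The defect then contains no derivative of F: it consists of
  U minus its mollification, of size \<delta> times the gradient of U, and of a zero-order term in
  F. It is removed by \<open>v2\<close>. The explicit part is exposed only through a pointwise
  bound, since it will be measured in L^s, whereas \<open>v2\<close> is measured in L^6.\<close>

lemma velocity_corrector:
  assumes r: "1 \<le> r" "r < r'" "r' \<le> 2" and d: "d = r' - r" and \<delta>: "0 < \<delta>" "\<delta> \<le> d / 16" and s: "2 \<le> s"
    and r'1: "r'1 = r + 3 * d / 4"
    and e: "smooth3 \<eta>" "\<And>x. norm x > r + d / 2 \<Longrightarrow> \<eta> x = 0"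
    and N: "\<And>i x. \<bar>pd i \<eta> x\<bar> \<le> cutC / d ^ 5" "\<And>i j x. \<bar>pd i (pd j \<eta>) x\<bar> \<le> cutC / d ^ 5"
  obtains v v2 where "\<And>k. smooth3 (v k)" "\<And>k x. norm x > r'1 \<Longrightarrow> v k x = 0"
    "\<And>x. (\<Sum>k\<in>UNIV. pd k (v k) x) = (\<Sum>i\<in>UNIV. U i x * pd i \<eta> x)"
    "\<And>k. smooth3 (v2 k)" "\<And>k x. \<bar>v k x\<bar> \<le> cutC / d ^ 5 * (\<Sum>j\<in>UNIV. \<bar>moll \<delta> (F j k) x\<bar>) + \<bar>v2 k x\<bar>"
    "\<And>i k. Ln r'1 2 (pd i (v k)) \<le> (k1C + k2C) / d ^ 9 * (Ln r' s vM / \<delta> + \<delta> * Ln r' 2 vG)"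
    "\<And>k. Ln r'1 6 (v2 k) \<le> 12 * k2C / d ^ 9 * (\<delta> * Ln r' 2 vG + Ln r' s vM)"
proof -
  define A where "A = Ln r' 2 vG"
  define m where "m = Ln r' s vM"
  define N where "N = cutC / d ^ 5"
  have dp: "0 < d" "d \<le> 1" using r d by auto
  have N0: "N \<ge> 0" using constC_pos dp by (simp add: N_def)
  have A0: "A \<ge> 0" "m \<ge> 0" by (auto simp: A_def m_def)
  \<comment> \<open>Bookkeeping of layers: \<eta> lives in radius r + d/2, the divergence equation
    adds d/4 and leads to \<open>r'1\<close>, and mollification needs a further 2 \<delta> \<le>
    d/8.\<close>
  have r'12: "r'1 + 2 * \<delta> \<le> r'" "r'1 \<le> r'" "r'1 \<le> 3" "r + d / 2 \<le> r'1" using r d \<delta> r'1 by linarith+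
  define \<Phi> where "\<Phi> i j = moll \<delta> (F i j)" for i j
  have s\<Phi>: "smooth3 (\<Phi> i j)" for i j unfolding \<Phi>_def by (intro smooth3_moll smF)
  have ze: "pd i \<eta> x = 0" if "norm x > r + d / 2" for i x
    by (rule pd_zero_outside[of "r + d / 2" \<eta>]) (use e that in auto)
  have se: "smooth3 (pd i \<eta>)" "smooth3 (pd j (pd i \<eta>))" for i j using e by auto
  define v1 where "v1 j = (\<lambda>x. \<Sum>i\<in>UNIV. \<Phi> i j x * pd i \<eta> x)" for j
  have sv1: "smooth3 (v1 j)" for j unfolding v1_def by (intro smooth3_sum smooth3_mult s\<Phi> se)
  have zv1: "v1 j x = 0" if "norm x > r + d / 2" for j x using ze[OF that] by (simp add: v1_def)
  have pv1: "pd k (v1 j) x = (\<Sum>i\<in>UNIV. \<Phi> i j x * pd k (pd i \<eta>) x + pd k (\<Phi> i j) x * pd i \<eta> x)" for j k x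
    unfolding v1_def
    by (subst pd_sum) (auto intro!: sum.cong pd_mult smooth3_D smooth3_mult s\<Phi> se)
  define f where "f x = (\<Sum>i\<in>UNIV. U i x * pd i \<eta> x) - (\<Sum>j\<in>UNIV. pd j (v1 j) x)" for x
  have sf: "smooth3 f" unfolding f_def[abs_def] by (intro smooth3_diff smooth3_sum smooth3_mult smU se smooth3_pd sv1)
  have zf: "f x = 0" if "norm x > r + d / 2" for x
    using ze[OF that] pd_zero_outside[of "r + d/2" "v1 j" x j for j] zv1 that by (simp add: f_def)
  \<comment> \<open>Compatibility condition for the divergence equation: both terms of
    \<open>f\<close> are divergences of compactly supported fields, the first because U is
    solenoidal.\<close>
  have mf: "(\<integral>x. f x \<partial>BM 3) = 0"
  proof -
    have "(\<Sum>i\<in>UNIV. pd i (\<lambda>x. U i x * \<eta> x) x) = (\<Sum>i\<in>UNIV. U i x * pd i \<eta> x)" for x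
    proof -
      have "pd i (\<lambda>x. U i x * \<eta> x) x = U i x * pd i \<eta> x + pd i (U i) x * \<eta> x" for i
        by (rule pd_mult) (auto intro!: smooth3_D smU e)
      then show ?thesis by (simp add: sum.distrib sum_distrib_right[symmetric] divU)
    qed
    moreover have "(\<integral>x. (\<Sum>i\<in>UNIV. pd i (\<lambda>x. U i x * \<eta> x) x) \<partial>BM 3) = 0"
      by (rule divergence_zero[where r="r + d/2"]) (use e smU r'12 in auto)
    moreover have "(\<integral>x. (\<Sum>j\<in>UNIV. pd j (v1 j) x) \<partial>BM 3) = 0"
      by (rule divergence_zero[where r="r + d/2"]) (use sv1 zv1 r'12 in auto)
    ultimately show ?thesis unfolding f_def
      by (subst BM_int_diff) (auto intro!: smooth3_cont smooth3_sum smooth3_mult smU se smooth3_pd sv1)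
  qed
  \<comment> \<open>Mollification commutes with derivatives, so the divergence of the mollified
    potential is the mollified velocity.\<close>
  have f_eq: "f x = (\<Sum>i\<in>UNIV. (U i x - moll \<delta> (U i) x) * pd i \<eta> x) + (\<Sum>j\<in>UNIV. \<Sum>i\<in>UNIV. (- 1) * (\<Phi> i j x * pd j (pd i \<eta>) x))" for x
  proof -
    have "(\<Sum>j\<in>UNIV. pd j (\<Phi> i j) x) = moll \<delta> (U i) x" for i
    proof -
      have "(\<Sum>j\<in>UNIV. pd j (\<Phi> i j) x) = moll \<delta> (\<lambda>x. \<Sum>j\<in>UNIV. pd j (F i j) x) x"
        unfolding \<Phi>_def pd_moll[OF smF]
        by (subst moll_sum) (auto intro!: smooth3_cont smooth3_pd smF)
      then show ?thesis by (simp add: divF)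
    qed
    moreover have "(\<Sum>j\<in>UNIV. pd j (v1 j) x) = (\<Sum>j\<in>UNIV. \<Sum>i\<in>UNIV. \<Phi> i j x * pd j (pd i \<eta>) x) + (\<Sum>i\<in>UNIV. (\<Sum>j\<in>UNIV. pd j (\<Phi> i j) x) * pd i \<eta> x)"
      unfolding pv1 sum.distrib sum_distrib_right by (subst (2) sum.swap) simp
    ultimately show ?thesis unfolding f_def by (simp add: left_diff_distrib sum_subtractf sum_negf)
  qed
  have c: "contU (\<lambda>x. U i x - moll \<delta> (U i) x)" "contU (\<Phi> i j)" "contU (pd i \<eta>)" "contU (pd j (pd i \<eta>))" "contU (pd k (\<Phi> i j))" for i j k
    by (intro smooth3_cont smooth3_diff smU smooth3_moll s\<Phi> se smooth3_pd)+
  have LU: "Ln r'1 2 (\<lambda>x. U i x - moll \<delta> (U i) x) \<le> 24 * \<delta> * A" for i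
  proof -
    have "Ln (r'1 + 2 * \<delta>) 2 (pd j (U i)) \<le> A" for j
    proof -
      have "Ln (r'1 + 2 * \<delta>) 2 (pd j (U i)) \<le> Ln r' 2 (pd j (U i))" using r'12 by (intro Ln_radius_mono smooth3_cont smooth3_pd smU) auto
      also have "\<dots> \<le> A" unfolding A_def using le_v by (intro Ln_mono smooth3_cont smooth3_pd smU cont_v) auto
      finally show ?thesis .
    qed
    then have "(\<Sum>j\<in>UNIV. Ln (r'1 + 2 * \<delta>) 2 (pd j (U i))) \<le> (\<Sum>j\<in>(UNIV::3 set). A)" by (intro sum_mono)
    then have "8 * \<delta> * (\<Sum>j\<in>UNIV. Ln (r'1 + 2 * \<delta>) 2 (pd j (U i))) \<le> 8 * \<delta> * (3 * A)" using \<delta> by (intro mult_left_mono) auto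
    moreover have "Ln r'1 2 (\<lambda>x. U i x - moll \<delta> (U i) x) \<le> 8 * \<delta> * (\<Sum>j\<in>UNIV. Ln (r'1 + 2 * \<delta>) 2 (pd j (U i)))"
      using \<delta> by (intro moll_diff_Ln smU) auto
    ultimately show ?thesis by linarith
  qed
  have LF: "Ln (r'1 + 2 * \<delta>) 2 (F i j) \<le> volc * m" for i j
  proof -
    have "Ln (r'1 + 2 * \<delta>) 2 (F i j) \<le> Ln r' 2 (F i j)" using r'12 by (intro Ln_radius_mono smooth3_cont smF) auto
    also have "\<dots> \<le> Ln r' 2 vM" using le_v by (intro Ln_mono smooth3_cont smF cont_v) auto
    also have "\<dots> \<le> volc * m" unfolding m_def using s r by (intro Ln_le_Ln cont_v) auto
    finally show ?thesis .
  qed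
  have L\<Phi>: "Ln r'1 2 (\<Phi> i j) \<le> volc * m" for i j
    unfolding \<Phi>_def using \<delta> by (intro order_trans[OF moll_Ln LF] smooth3_cont smF) auto
  have Ld\<Phi>: "Ln r'1 2 (pd k (\<Phi> i j)) \<le> 8 * bumpC / \<delta> * (volc * m)" for i j k
  proof -
    have "Ln r'1 2 (pd k (\<Phi> i j)) \<le> 8 * bumpC / \<delta> * Ln (r'1 + 2 * \<delta>) 2 (F i j)"
      unfolding \<Phi>_def using \<delta> by (intro pd_moll_Ln smF) auto
    also have "\<dots> \<le> 8 * bumpC / \<delta> * (volc * m)" using \<delta> bumpC(1) by (intro mult_left_mono LF) auto
    finally show ?thesis .
  qed
  have Lf: "Ln r'1 2 f \<le> N * (72 + 9 * volc) * (\<delta> * A + m)"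
  proof -
    have "Ln r'1 2 f = Ln r'1 2 (\<lambda>x. (\<Sum>i\<in>UNIV. (U i x - moll \<delta> (U i) x) * pd i \<eta> x) + (\<Sum>j\<in>UNIV. \<Sum>i\<in>UNIV. (- 1) * (\<Phi> i j x * pd j (pd i \<eta>) x)))"
      by (rule Ln_cong) (simp add: f_eq)
    also have "\<dots> \<le> Ln r'1 2 (\<lambda>x. \<Sum>i\<in>UNIV. (U i x - moll \<delta> (U i) x) * pd i \<eta> x) + Ln r'1 2 (\<lambda>x. \<Sum>j\<in>UNIV. \<Sum>i\<in>UNIV. (- 1) * (\<Phi> i j x * pd j (pd i \<eta>) x))"
      by (intro Ln_add continuous_on_sum continuous_on_mult continuous_on_const c) auto
    also have "Ln r'1 2 (\<lambda>x. \<Sum>i\<in>UNIV. (U i x - moll \<delta> (U i) x) * pd i \<eta> x) \<le> (\<Sum>i\<in>(UNIV::3 set). N * (24 * \<delta> * A))"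
    proof (intro order_trans[OF Ln_sum] sum_mono)
      fix i :: 3
      have "Ln r'1 2 (\<lambda>x. (U i x - moll \<delta> (U i) x) * pd i \<eta> x) \<le> N * Ln r'1 2 (\<lambda>x. U i x - moll \<delta> (U i) x)"
        by (rule Ln_bmult) (use c N in \<open>auto simp: N_def\<close>)
      also have "\<dots> \<le> N * (24 * \<delta> * A)" by (intro mult_left_mono LU N0)
      finally show "Ln r'1 2 (\<lambda>x. (U i x - moll \<delta> (U i) x) * pd i \<eta> x) \<le> N * (24 * \<delta> * A)" .
    qed (auto intro!: continuous_on_mult c)
    also have "Ln r'1 2 (\<lambda>x. \<Sum>j\<in>UNIV. \<Sum>i\<in>UNIV. (- 1) * (\<Phi> i j x * pd j (pd i \<eta>) x)) \<le> (\<Sum>j\<in>(UNIV::3 set). \<Sum>i\<in>(UNIV::3 set). N * (volc * m))"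
    proof (rule order_trans[OF Ln_sum])
      show "(\<Sum>j\<in>UNIV. Ln r'1 2 (\<lambda>x. \<Sum>i\<in>UNIV. (- 1) * (\<Phi> i j x * pd j (pd i \<eta>) x))) \<le> (\<Sum>j\<in>(UNIV::3 set). \<Sum>i\<in>(UNIV::3 set). N * (volc * m))"
      proof (intro sum_mono order_trans[OF Ln_sum])
        fix i j :: 3
        have "Ln r'1 2 (\<lambda>x. (- 1) * (\<Phi> i j x * pd j (pd i \<eta>) x)) = Ln r'1 2 (\<lambda>x. \<Phi> i j x * pd j (pd i \<eta>) x)" by (rule Ln_cong) simp
        also have "\<dots> \<le> N * Ln r'1 2 (\<Phi> i j)" by (rule Ln_bmult) (use c N in \<open>auto simp: N_def\<close>)
        also have "\<dots> \<le> N * (volc * m)" by (intro mult_left_mono L\<Phi> N0)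
        finally show "Ln r'1 2 (\<lambda>x. (- 1) * (\<Phi> i j x * pd j (pd i \<eta>) x)) \<le> N * (volc * m)" .
      qed (auto intro!: continuous_on_mult continuous_on_const continuous_on_minus c)
    qed (auto intro!: continuous_on_sum continuous_on_mult continuous_on_const continuous_on_minus c)
    finally have "Ln r'1 2 f \<le> N * (72 * (\<delta> * A) + 9 * volc * m)" by (simp add: algebra_simps)
    also have "\<dots> \<le> N * ((72 + 9 * volc) * (\<delta> * A + m))"
    proof (rule mult_left_mono[OF _ N0])
      have "0 \<le> 9 * volc * (\<delta> * A)" "0 \<le> 72 * m" using volc_ge_1 \<delta> A0 by auto
      then show "72 * (\<delta> * A) + 9 * volc * m \<le> (72 + 9 * volc) * (\<delta> * A + m)" by (simp add: algebra_simps)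
    qed
    finally show ?thesis by (simp add: mult.assoc)
  qed
  obtain v2 where v2: "\<And>i. smooth3 (v2 i)" "\<And>i x. norm x > r + d / 2 + d / 4 \<Longrightarrow> v2 i x = 0" "\<And>x. (\<Sum>i\<in>UNIV. pd i (v2 i) x) = f x"
     "\<And>i j. Ln 3 2 (pd j (v2 i)) \<le> (2 + 3 * bumpC * volc\<^sup>2) / (d / 4) ^ 4 * Ln 3 2 f"
  proof -
    have "\<exists>v :: 3 \<Rightarrow> real^3 \<Rightarrow> real. (\<forall>i. smooth3 (v i)) \<and> (\<forall>i x. norm x > r + d / 2 + d / 4 \<longrightarrow> v i x = 0) \<and>
      (\<forall>x. (\<Sum>i\<in>UNIV. pd i (v i) x) = f x) \<and>
      (\<forall>i j. Ln 3 2 (pd j (v i)) \<le> (2 + 3 * bumpC * volc\<^sup>2) / (d / 4) ^ 4 * Ln 3 2 f)"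
      by (rule bogovskii[OF sf zf _ _ _ mf]; use dp r d in linarith)
    then show thesis using that by blast
  qed
  have zv2: "norm x > r'1 \<Longrightarrow> v2 i x = 0" for i x using v2(2)[of x i] r'1 by simp
  have Lv2: "Ln r'1 2 (pd j (v2 i)) \<le> k2C / d ^ 9 * (\<delta> * A + m)" for i j
  proof -
    have "Ln r'1 2 (pd j (v2 i)) \<le> Ln 3 2 (pd j (v2 i))" using r'12 by (intro Ln_radius_mono smooth3_cont smooth3_pd v2) auto
    also have "\<dots> \<le> bogC / d ^ 4 * Ln 3 2 f" using v2(4)[of j i] by (simp add: bogC_def power_divide mult.commute)
    also have "Ln 3 2 f = Ln r'1 2 f" by (rule Ln_support[OF smooth3_cont[OF sf] zf]) (use r'12 dp r in auto)
    also have "bogC / d ^ 4 * Ln r'1 2 f \<le> bogC / d ^ 4 * (N * (72 + 9 * volc) * (\<delta> * A + m))"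
      using constC_pos dp by (intro mult_left_mono Lf) auto
    also have "\<dots> = k2C / d ^ 9 * (\<delta> * A + m)"
      using dp by (simp add: k2C_def N_def field_simps power_add[symmetric])
    finally show ?thesis .
  qed
  have Lv26: "Ln r'1 6 (v2 k) \<le> 12 * k2C / d ^ 9 * (\<delta> * A + m)" for k
  proof -
    have "Ln r'1 6 (v2 k) \<le> 4 * (\<Sum>i\<in>UNIV. Ln r'1 2 (pd i (v2 k)))" by (rule sobolev[where r=r'1]) (use v2 zv2 in auto)
    also have "\<dots> \<le> 4 * (\<Sum>i\<in>(UNIV::3 set). k2C / d ^ 9 * (\<delta> * A + m))" by (intro mult_left_mono sum_mono Lv2) auto
    finally show ?thesis by simp
  qed
  have Lv1: "Ln r'1 2 (pd k (v1 j)) \<le> k1C / d ^ 9 * (m / \<delta>)" for k j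
  proof -
    have "Ln r'1 2 (pd k (v1 j)) = Ln r'1 2 (\<lambda>x. \<Sum>i\<in>UNIV. \<Phi> i j x * pd k (pd i \<eta>) x + pd k (\<Phi> i j) x * pd i \<eta> x)"
      by (rule Ln_cong) (simp add: pv1)
    also have "\<dots> \<le> (\<Sum>i\<in>(UNIV::3 set). N * (volc * m) + N * (8 * bumpC / \<delta> * (volc * m)))"
    proof (intro order_trans[OF Ln_sum] sum_mono order_trans[OF Ln_add] add_mono)
      fix i :: 3
      show "Ln r'1 2 (\<lambda>x. \<Phi> i j x * pd k (pd i \<eta>) x) \<le> N * (volc * m)"
        by (rule order_trans[OF Ln_bmult[where N=N] mult_left_mono[OF L\<Phi> N0]]) (use c N in \<open>auto simp: N_def\<close>)
      show "Ln r'1 2 (\<lambda>x. pd k (\<Phi> i j) x * pd i \<eta> x) \<le> N * (8 * bumpC / \<delta> * (volc * m))"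
        by (rule order_trans[OF Ln_bmult[where N=N] mult_left_mono[OF Ld\<Phi> N0]]) (use c N in \<open>auto simp: N_def\<close>)
    qed (auto intro!: continuous_on_add continuous_on_mult c)
    also have "\<dots> = 3 * N * volc * (m + 8 * bumpC * (m / \<delta>))" by (simp add: algebra_simps)
    also have "\<dots> \<le> 3 * N * volc * ((1 + 8 * bumpC) * (m / \<delta>))"
    proof (rule mult_left_mono)
      have "\<delta> \<le> 1" using \<delta> dp by simp
      then have "m * \<delta> \<le> m * 1" using A0 by (intro mult_left_mono) auto
      then have "m \<le> m / \<delta>" using \<delta> by (simp add: field_simps)
      then show "m + 8 * bumpC * (m / \<delta>) \<le> (1 + 8 * bumpC) * (m / \<delta>)" by (simp add: algebra_simps)
    qed (use N0 volc_ge_1 in auto)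
    also have "\<dots> = k1C / d ^ 5 * (m / \<delta>)" by (simp add: k1C_def N_def mult_ac)
    also have "\<dots> \<le> k1C / d ^ 9 * (m / \<delta>)"
      using constC_pos dp A0 \<delta> power_decreasing[of 5 9 d] by (intro mult_right_mono divide_left_mono) auto
    finally show ?thesis .
  qed
  define v where "v k = (\<lambda>x. v1 k x + v2 k x)" for k
  have pv: "pd i (v k) x = pd i (v1 k) x + pd i (v2 k) x" for i k x
    unfolding v_def by (rule pd_add) (auto intro!: smooth3_D sv1 v2)
  show thesis
  proof (rule that[of v v2])
    show "smooth3 (v k)" for k unfolding v_def by (intro smooth3_add sv1 v2)
    show "v k x = 0" if "norm x > r'1" for k x using zv1[of x k] zv2[OF that, of k] that r'12 by (simp add: v_def)
    show "(\<Sum>k\<in>UNIV. pd k (v k) x) = (\<Sum>i\<in>UNIV. U i x * pd i \<eta> x)" for x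
      by (simp add: pv sum.distrib v2(3) f_def)
    show "smooth3 (v2 k)" for k by (rule v2)
    show "\<bar>v k x\<bar> \<le> cutC / d ^ 5 * (\<Sum>j\<in>UNIV. \<bar>moll \<delta> (F j k) x\<bar>) + \<bar>v2 k x\<bar>" for k x
    proof -
      have "\<bar>v1 k x\<bar> \<le> (\<Sum>j\<in>UNIV. \<bar>\<Phi> j k x * pd j \<eta> x\<bar>)" unfolding v1_def by (rule sum_abs)
      also have "\<dots> \<le> (\<Sum>j\<in>UNIV. N * \<bar>\<Phi> j k x\<bar>)"
      proof (rule sum_mono)
        fix j
        show "\<bar>\<Phi> j k x * pd j \<eta> x\<bar> \<le> N * \<bar>\<Phi> j k x\<bar>"
          using mult_right_mono[OF N(1)[of j x], of "\<bar>\<Phi> j k x\<bar>"] by (simp add: abs_mult mult.commute N_def)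
      qed
      finally show ?thesis by (simp add: v_def N_def \<Phi>_def sum_distrib_left)
    qed
    show "Ln r'1 2 (pd i (v k)) \<le> (k1C + k2C) / d ^ 9 * (Ln r' s vM / \<delta> + \<delta> * Ln r' 2 vG)" for i k
    proof -
      have "Ln r'1 2 (pd i (v k)) = Ln r'1 2 (\<lambda>x. pd i (v1 k) x + pd i (v2 k) x)" by (rule Ln_cong) (simp add: pv)
      also have "\<dots> \<le> Ln r'1 2 (pd i (v1 k)) + Ln r'1 2 (pd i (v2 k))"
        by (intro Ln_add smooth3_cont smooth3_pd sv1 v2) auto
      also have "\<dots> \<le> k1C / d ^ 9 * (m / \<delta>) + k2C / d ^ 9 * (\<delta> * A + m)" by (intro add_mono Lv1 Lv2)
      also have "\<dots> \<le> k1C / d ^ 9 * (m / \<delta> + \<delta> * A) + k2C / d ^ 9 * (m / \<delta> + \<delta> * A)"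
      proof (rule add_mono[OF mult_left_mono mult_left_mono])
        have "\<delta> \<le> 1" using \<delta> dp by simp
        then have "m * \<delta> \<le> m * 1" using A0 by (intro mult_left_mono) auto
        then show "\<delta> * A + m \<le> m / \<delta> + \<delta> * A" using \<delta> by (simp add: field_simps)
      qed (use constC_pos dp \<delta> A0 in auto)
      finally show ?thesis by (simp add: add_divide_distrib distrib_right A_def m_def)
    qed
    show "Ln r'1 6 (v2 k) \<le> 12 * k2C / d ^ 9 * (\<delta> * Ln r' 2 vG + Ln r' s vM)" for k
      using Lv26[of k] by (simp add: A_def m_def)
  qed
qed

end

text \<open>The coefficients met in \<open>master\<close> added up, so that each of them is at most
  \<open>mC\<close>.\<close>

definition "mC = 24 * (cutC * volc) + 9 * (k1C + k2C) + 18 * cutC + 54 * cutC + 216 * k2C + 24 * cutC * 9"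

lemma mC_pos: "mC > 0"
  using constC_pos volc_ge_1 by (simp add: mC_def add_pos_pos)

lemma BM_abs_le:
  assumes "contU f" "contU g" "\<And>x. norm x \<le> r \<Longrightarrow> \<bar>f x\<bar> \<le> g x"
  shows "\<bar>integral\<^sup>L (BM r) f\<bar> \<le> integral\<^sup>L (BM r) g"
  by (rule order_trans[OF BM_abs BM_mono]) (use assms in \<open>auto intro: continuous_on_rabs\<close>)

lemma Holder2:
  assumes "contU f" "contU g"
  shows "(\<integral>x. \<bar>f x * g x\<bar> \<partial>BM r) \<le> Ln r 2 f * Ln r 2 g"
  by (rule Holder_BM) (use assms in auto)

lemma sum3_le: "(\<And>i. \<bar>f i\<bar> \<le> c) \<Longrightarrow> \<bar>\<Sum>i\<in>(UNIV::3 set). f i\<bar> \<le> 3 * (c::real)"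
  using sum_norm_bound[of "UNIV :: 3 set" f c] by simp

context unit_sol
begin

lemma hallF_bound: "\<bar>hallF b k x\<bar> \<le> 4 * vG x * vb x"
proof -
  have c: "\<bar>curlc b j x\<bar> \<le> 2 * vG x" for j
    using le_v(6)[of 2 3 x] le_v(6)[of 3 2 x] le_v(6)[of 3 1 x] le_v(6)[of 1 3 x] le_v(6)[of 1 2 x] le_v(6)[of 2 1 x]
    by (auto simp: curlc_def abs_le_iff)
  have p: "\<bar>curlc b i x * b j x\<bar> \<le> 2 * vG x * vb x" for i j
    unfolding abs_mult by (intro mult_mono c le_v) auto
  show ?thesis
    using p[of 2 3] p[of 3 2] p[of 3 1] p[of 1 3] p[of 1 2] p[of 2 1]
    by (auto simp: hallF_def crossc_def abs_le_iff)
qed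

text \<open>Six terms, each at most 4 N times the gradient times \<bar>b\<bar>^2. With the gradient
  in L^2 only, b has to be placed in L^4; estimating that norm is the whole difficulty of the Hall
  term.\<close>

lemma hall_bound:
  assumes h: "smooth3 h" "\<And>x. norm x > R \<Longrightarrow> h x = 0" "\<And>i x. \<bar>pd i h x\<bar> \<le> N" and N: "0 \<le> N"
  shows "\<bar>\<integral>x. (\<Sum>k\<in>UNIV. curlc (hallF b) k x * (b k x * h x)) \<partial>BM R\<bar> \<le> 24 * N * (Ln R 2 vG * (Ln R 4 vb)\<^sup>2)"
proof -
  have s: "smooth3 (hallF b k)" for k by (rule smooth3_hallF[OF smb])
  note sm = smooth3_cont smooth3_mult smooth3_diff smooth3_add smooth3_pd smb h s
  have t: "\<bar>hallF b j x * pd i h x * b k x\<bar> \<le> (4 * N) * (vG x * (vb x * vb x))" for i j k x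
  proof -
    have "\<bar>hallF b j x * pd i h x * b k x\<bar> \<le> (4 * vG x * vb x) * N * vb x"
      unfolding abs_mult by (intro mult_mono hallF_bound h le_v) (auto simp: N)
    then show ?thesis by (simp add: mult_ac)
  qed
  let ?I = "\<lambda>x. hallF b 3 x * pd 2 h x * b 1 x - hallF b 2 x * pd 3 h x * b 1 x + hallF b 1 x * pd 3 h x * b 2 x
      - hallF b 3 x * pd 1 h x * b 2 x + hallF b 2 x * pd 1 h x * b 3 x - hallF b 1 x * pd 2 h x * b 3 x"
  have "(\<integral>x. (\<Sum>k\<in>UNIV. curlc (hallF b) k x * (b k x * h x)) \<partial>BM R) = - integral\<^sup>L (BM R) ?I"
    by (rule hall_identity[OF smb h(1) h(2) order_refl])
  then have "\<bar>\<integral>x. (\<Sum>k\<in>UNIV. curlc (hallF b) k x * (b k x * h x)) \<partial>BM R\<bar> = \<bar>integral\<^sup>L (BM R) ?I\<bar>" by simp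
  also have "\<dots> \<le> (\<integral>x. (24 * N) * \<bar>vG x * (vb x * vb x)\<bar> \<partial>BM R)"
  proof (rule BM_abs_le)
    fix x
    have "\<bar>a1 - a2 + a3 - a4 + a5 - a6\<bar> \<le> 6 * c" if "\<bar>a1\<bar> \<le> c" "\<bar>a2\<bar> \<le> c" "\<bar>a3\<bar> \<le> c" "\<bar>a4\<bar> \<le> c" "\<bar>a5\<bar> \<le> c" "\<bar>a6\<bar> \<le> c" for a1 a2 a3 a4 a5 a6 c :: real
      using that by linarith
    from this[OF t[of 3 x 2 1] t[of 2 x 3 1] t[of 1 x 3 2] t[of 3 x 1 2] t[of 2 x 1 3] t[of 1 x 2 3]]
    show "\<bar>hallF b 3 x * pd 2 h x * b 1 x - hallF b 2 x * pd 3 h x * b 1 x + hallF b 1 x * pd 3 h x * b 2 x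
      - hallF b 3 x * pd 1 h x * b 2 x + hallF b 2 x * pd 1 h x * b 3 x - hallF b 1 x * pd 2 h x * b 3 x\<bar> \<le> (24 * N) * \<bar>vG x * (vb x * vb x)\<bar>"
      by (simp add: abs_mult)
  qed ((intro sm)[1], intro continuous_intros)
  also have "\<dots> = (24 * N) * (\<integral>x. \<bar>vG x * (vb x * vb x)\<bar> \<partial>BM R)" by simp
  also have "\<dots> \<le> (24 * N) * (Ln R 2 vG * (Ln R 4 vb * Ln R 4 vb))"
    using N by (intro mult_left_mono order_trans[OF Holder2] Ln_mult continuous_intros) auto
  finally show ?thesis by (simp add: power2_eq_square)
qed

text \<open>The summands on the right are, in order: viscosity hitting the cutoff; cubic fluxes;
  viscosity paired with the corrector; convection paired with the explicit part of the corrector,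
  where 1/2 = 1/q + 1/s; convection paired with \<open>v2\<close>, using L^2, L^3 and L^6; the Hall
  term. Field norms are needed only on the radius \<open>r'1\<close>, strictly inside
  \<open>r'\<close>, which leaves a layer for estimating them.\<close>

lemma master:
  assumes r: "1 \<le> r" "r < r'" "r' \<le> 2" and d: "d = r' - r" and \<delta>: "0 < \<delta>" "\<delta> \<le> d / 16"
    and s: "3 < s" and q: "q = 2 * s / (s - 2)" and r'1: "r'1 = r + 3 * d / 4"
  defines "A \<equiv> Ln r' 2 vG" and "m \<equiv> Ln r' s vM" and "X \<equiv> Ln r'1 3 va" and "Q \<equiv> Ln r'1 q va" and "Z \<equiv> Ln r'1 4 vb"
  shows "\<nu> * (Ln r 2 vG)\<^sup>2 \<le> mC / d ^ 9 * (\<nu> * A * X + X ^ 3 + \<nu> * A * (m / \<delta> + \<delta> * A) + A * m * Q + A * X * (\<delta> * A + m) + \<nu> * A * Z\<^sup>2)"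
proof -
  have dp: "0 < d" "d \<le> 1" using r d by auto
  have r'12: "r'1 + 2 * \<delta> \<le> r'" "r'1 \<le> r'" "r'1 \<le> 3" "r \<le> r'1" "r + d / 2 \<le> r'1" using r d \<delta> r'1 by linarith+
  have "\<exists>\<eta>. is_cutoff r (d / 2) \<eta>" by (rule cutoff_exists) (use r d dp in linarith)+
  then obtain \<eta> where "is_cutoff r (d / 2) \<eta>" by blast
  then have e: "smooth3 \<eta>" "\<And>x. norm x > r + d / 2 \<Longrightarrow> \<eta> x = 0" "\<And>x. 0 \<le> \<eta> x" "\<And>x. norm x \<le> r \<Longrightarrow> \<eta> x = 1"
    and N: "\<And>i x. \<bar>pd i \<eta> x\<bar> \<le> cutC / d ^ 5" "\<And>i j x. \<bar>pd i (pd j \<eta>) x\<bar> \<le> cutC / d ^ 5"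
    by (auto simp: is_cutoff_def cutC_def power_divide mult.commute)
  define N where "N = cutC / d ^ 5"
  have N0: "N \<ge> 0" using constC_pos dp by (simp add: N_def)
  note N' = N[folded N_def]
  have s2: "2 \<le> s" using s by simp
  obtain v v2 where v: "\<And>k. smooth3 (v k)" "\<And>k x. norm x > r'1 \<Longrightarrow> v k x = 0"
    "\<And>x. (\<Sum>k\<in>UNIV. pd k (v k) x) = (\<Sum>i\<in>UNIV. U i x * pd i \<eta> x)"
    and v2: "\<And>k. smooth3 (v2 k)" "\<And>k x. \<bar>v k x\<bar> \<le> N * (\<Sum>j\<in>UNIV. \<bar>moll \<delta> (F j k) x\<bar>) + \<bar>v2 k x\<bar>"
    and Lv: "\<And>i k. Ln r'1 2 (pd i (v k)) \<le> (k1C + k2C) / d ^ 9 * (m / \<delta> + \<delta> * A)"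
    and Lv2: "\<And>k. Ln r'1 6 (v2 k) \<le> 12 * k2C / d ^ 9 * (\<delta> * A + m)"
    using velocity_corrector[OF r d \<delta> s2 r'1 e(1,2) N] unfolding N_def A_def m_def by blast
  have e0: "norm x > r'1 \<Longrightarrow> \<eta> x = 0" for x using e(2)[of x] r'12 by auto
  have A1: "Ln r'1 2 vG \<le> A" unfolding A_def using r'12 by (intro Ln_radius_mono cont_v) auto
  have pos: "0 \<le> A" "0 \<le> m" "0 \<le> X" "0 \<le> Q" by (auto simp: A_def m_def X_def Q_def)
  have X2: "Ln r'1 2 va \<le> volc * X" unfolding X_def using r'12 by (intro Ln_le_Ln cont_v) auto
  note sm = smooth3_cont smooth3_mult smooth3_sum smooth3_diff smooth3_add smooth3_pd smU smb smP e(1) v(1) v2(1)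
  have cv: "contU va" "contU vb" "contU vG" by (intro cont_v)+
  have GX: "(\<integral>x. \<bar>vG x * va x\<bar> \<partial>BM r'1) \<le> A * (volc * X)"
    by (rule order_trans[OF Holder2 mult_mono[OF A1 X2]]) (use cv pos in auto)
  have X3: "(\<integral>x. \<bar>va x\<bar> ^ 3 \<partial>BM r'1) = X ^ 3"
    using Ln_powr[of 3 r'1 va] by (simp add: X_def)
  have T1: "\<bar>\<integral>x. (\<Sum>i\<in>UNIV. pd i g x * (g x * pd i \<eta> x)) \<partial>BM r'1\<bar> \<le> 3 * N * (A * (volc * X))"
    if g: "smooth3 g" "\<And>x. \<bar>g x\<bar> \<le> va x" "\<And>i x. \<bar>pd i g x\<bar> \<le> vG x" for g
  proof -
    have "\<bar>\<integral>x. (\<Sum>i\<in>UNIV. pd i g x * (g x * pd i \<eta> x)) \<partial>BM r'1\<bar> \<le> (\<integral>x. (3 * N) * \<bar>vG x * va x\<bar> \<partial>BM r'1)"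
    proof (rule BM_abs_le)
      fix x
      have "\<bar>pd i g x * (g x * pd i \<eta> x)\<bar> \<le> vG x * (va x * N)" for i
        unfolding abs_mult by (intro mult_mono g N') auto
      from sum3_le[OF this] show "\<bar>\<Sum>i\<in>UNIV. pd i g x * (g x * pd i \<eta> x)\<bar> \<le> (3 * N) * \<bar>vG x * va x\<bar>"
        by (simp add: abs_mult mult_ac)
    qed ((intro sm g)[1], intro continuous_on_mult continuous_on_const continuous_on_rabs cv)
    also have "\<dots> = (3 * N) * (\<integral>x. \<bar>vG x * va x\<bar> \<partial>BM r'1)" by simp
    also have "\<dots> \<le> (3 * N) * (A * (volc * X))" using N0 by (intro mult_left_mono GX) auto
    finally show ?thesis .
  qed
  have T2: "\<bar>\<integral>x. (\<Sum>i\<in>UNIV. pd i (U k) x * pd i (v k) x) \<partial>BM r'1\<bar> \<le> 3 * (A * ((k1C + k2C) / d ^ 9 * (m / \<delta> + \<delta> * A)))" for k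
  proof -
    have "(\<integral>x. (\<Sum>i\<in>UNIV. pd i (U k) x * pd i (v k) x) \<partial>BM r'1) = (\<Sum>i\<in>UNIV. (\<integral>x. pd i (U k) x * pd i (v k) x \<partial>BM r'1))"
      by (rule BM_int_sum) (intro sm)
    moreover have "\<bar>\<integral>x. pd i (U k) x * pd i (v k) x \<partial>BM r'1\<bar> \<le> A * ((k1C + k2C) / d ^ 9 * (m / \<delta> + \<delta> * A))" for i
    proof -
      have "\<bar>\<integral>x. pd i (U k) x * pd i (v k) x \<partial>BM r'1\<bar> \<le> Ln r'1 2 (pd i (U k)) * Ln r'1 2 (pd i (v k))"
        by (rule order_trans[OF BM_abs Holder2]) (intro sm)+
      also have "\<dots> \<le> A * ((k1C + k2C) / d ^ 9 * (m / \<delta> + \<delta> * A))"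
        using le_v by (intro mult_mono Lv order_trans[OF Ln_mono A1] cv) (auto simp: pos intro: sm)
      finally show ?thesis .
    qed
    ultimately show ?thesis using sum3_le by presburger
  qed
  have T3: "\<bar>\<integral>x. g x * h x * (\<Sum>i\<in>UNIV. w i x * pd i \<eta> x) \<partial>BM r'1\<bar> \<le> 3 * N * X ^ 3"
    if g: "smooth3 g" "smooth3 h" "\<And>i. smooth3 (w i)" "\<And>x. \<bar>g x\<bar> \<le> va x" "\<And>x. \<bar>h x\<bar> \<le> va x" "\<And>i x. \<bar>w i x\<bar> \<le> va x" for g h w
  proof -
    have "\<bar>\<integral>x. g x * h x * (\<Sum>i\<in>UNIV. w i x * pd i \<eta> x) \<partial>BM r'1\<bar> \<le> (\<integral>x. (3 * N) * \<bar>va x\<bar> ^ 3 \<partial>BM r'1)"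
    proof (rule BM_abs_le)
      fix x
      have 1: "\<bar>\<Sum>i\<in>UNIV. w i x * pd i \<eta> x\<bar> \<le> 3 * (va x * N)"
        by (rule sum3_le) (unfold abs_mult, intro mult_mono g N', auto)
      have "\<bar>g x * h x * (\<Sum>i\<in>UNIV. w i x * pd i \<eta> x)\<bar> \<le> va x * va x * (3 * (va x * N))"
        unfolding abs_mult[of _ "sum _ _"] abs_mult[of "g x"] by (intro mult_mono g 1) auto
      then show "\<bar>g x * h x * (\<Sum>i\<in>UNIV. w i x * pd i \<eta> x)\<bar> \<le> (3 * N) * \<bar>va x\<bar> ^ 3"
        by (simp add: power3_eq_cube mult_ac)
    qed ((intro sm g)[1], intro continuous_on_mult continuous_on_const continuous_on_rabs continuous_on_power cv)
    then show ?thesis using X3 by simp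
  qed
  have T4: "\<bar>\<integral>x. (\<Sum>i\<in>UNIV. w i x * pd i g x) * v k x \<partial>BM r'1\<bar> \<le> 9 * N * (A * (m * Q)) + 36 * (A * (X * (k2C / d ^ 9 * (\<delta> * A + m))))"
    if g: "smooth3 g" "\<And>i. smooth3 (w i)" "\<And>i x. \<bar>pd i g x\<bar> \<le> vG x" "\<And>i x. \<bar>w i x\<bar> \<le> va x" for g w k
  proof -
    have cm: "contU (moll \<delta> (F j k))" for j by (intro smooth3_cont smooth3_moll smF)
    have c2: "contU (v2 k)" by (intro sm)
    have ci: "contU (\<lambda>x. \<bar>vG x * (va x * moll \<delta> (F j k) x)\<bar>)" "contU (\<lambda>x. \<bar>vG x * (va x * v2 k x)\<bar>)" for j
      by (intro continuous_on_mult continuous_on_rabs cv cm c2)+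
    have "\<bar>\<integral>x. (\<Sum>i\<in>UNIV. w i x * pd i g x) * v k x \<partial>BM r'1\<bar> \<le>
       (\<integral>x. (\<Sum>j\<in>UNIV. (3 * N) * \<bar>vG x * (va x * moll \<delta> (F j k) x)\<bar>) + 3 * \<bar>vG x * (va x * v2 k x)\<bar> \<partial>BM r'1)"
    proof (rule BM_abs_le)
      fix x
      have 1: "\<bar>\<Sum>i\<in>UNIV. w i x * pd i g x\<bar> \<le> 3 * (va x * vG x)"
        by (rule sum3_le) (unfold abs_mult, intro mult_mono g, auto)
      have "\<bar>(\<Sum>i\<in>UNIV. w i x * pd i g x) * v k x\<bar> \<le> 3 * (va x * vG x) * (N * (\<Sum>j\<in>UNIV. \<bar>moll \<delta> (F j k) x\<bar>) + \<bar>v2 k x\<bar>)"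
        unfolding abs_mult[of "sum _ _"] by (intro mult_mono 1 v2) auto
      also have "\<dots> = (\<Sum>j\<in>UNIV. (3 * N) * \<bar>vG x * (va x * moll \<delta> (F j k) x)\<bar>) + 3 * \<bar>vG x * (va x * v2 k x)\<bar>"
        by (simp add: abs_mult sum_distrib_left distrib_left mult_ac)
      finally show "\<bar>(\<Sum>i\<in>UNIV. w i x * pd i g x) * v k x\<bar> \<le> (\<Sum>j\<in>UNIV. (3 * N) * \<bar>vG x * (va x * moll \<delta> (F j k) x)\<bar>) + 3 * \<bar>vG x * (va x * v2 k x)\<bar>" .
    qed ((intro sm g)[1], intro continuous_on_add continuous_on_sum continuous_on_mult[OF continuous_on_const] ci)
    also have "\<dots> = (\<Sum>j\<in>UNIV. (3 * N) * (\<integral>x. \<bar>vG x * (va x * moll \<delta> (F j k) x)\<bar> \<partial>BM r'1)) + 3 * (\<integral>x. \<bar>vG x * (va x * v2 k x)\<bar> \<partial>BM r'1)"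
      by (subst BM_int_add, intro continuous_on_sum continuous_on_mult[OF continuous_on_const] ci, intro continuous_on_mult[OF continuous_on_const] ci,
          subst BM_int_sum, intro continuous_on_mult[OF continuous_on_const] ci, simp)
    also have "\<dots> \<le> (\<Sum>j\<in>(UNIV::3 set). (3 * N) * (A * (Q * m))) + 3 * (A * (X * (12 * k2C / d ^ 9 * (\<delta> * A + m))))"
    proof (intro add_mono sum_mono mult_left_mono)
      fix j :: 3
      have qq: "1 / 2 = 1 / q + 1 / s" "0 < q" unfolding q using s by (auto simp: field_simps)
      have "Ln r'1 s (moll \<delta> (F j k)) \<le> Ln (r'1 + 2 * \<delta>) s (F j k)" using s \<delta> by (intro moll_Ln smooth3_cont smF) auto
      also have "\<dots> \<le> Ln r' s (F j k)" using r'12 s by (intro Ln_radius_mono smooth3_cont smF) auto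
      also have "\<dots> \<le> m" unfolding m_def using s le_v by (intro Ln_mono smooth3_cont smF cont_v) auto
      finally have lm: "Ln r'1 s (moll \<delta> (F j k)) \<le> m" .
      have "Ln r'1 2 (\<lambda>x. va x * moll \<delta> (F j k) x) \<le> Q * m"
        unfolding Q_def by (rule order_trans[OF Ln_mult[OF cv(1) cm, where a=q and b=s] mult_left_mono[OF lm]]) (use qq s in auto)
      then show "(\<integral>x. \<bar>vG x * (va x * moll \<delta> (F j k) x)\<bar> \<partial>BM r'1) \<le> A * (Q * m)"
        by (intro order_trans[OF Holder2] mult_mono A1 continuous_on_mult cv cm) (auto simp: pos)
    next
      have "Ln r'1 2 (\<lambda>x. va x * v2 k x) \<le> X * (12 * k2C / d ^ 9 * (\<delta> * A + m))"
        unfolding X_def by (rule order_trans[OF Ln_mult[OF cv(1) c2, where a=3 and b=6] mult_left_mono[OF Lv2]]) auto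
      then show "(\<integral>x. \<bar>vG x * (va x * v2 k x)\<bar> \<partial>BM r'1) \<le> A * (X * (12 * k2C / d ^ 9 * (\<delta> * A + m)))"
        by (intro order_trans[OF Holder2] mult_mono A1 continuous_on_mult cv c2) (auto simp: pos)
    qed (use N0 in auto)
    finally show ?thesis by (simp add: mult_ac)
  qed
  have T5: "\<bar>\<integral>x. (\<Sum>k\<in>UNIV. curlc (hallF b) k x * (b k x * \<eta> x)) \<partial>BM r'1\<bar> \<le> 24 * N * (A * Z\<^sup>2)"
  proof -
    have "\<bar>\<integral>x. (\<Sum>k\<in>UNIV. curlc (hallF b) k x * (b k x * \<eta> x)) \<partial>BM r'1\<bar> \<le> 24 * N * (Ln r'1 2 vG * (Ln r'1 4 vb)\<^sup>2)"
      by (rule hall_bound) (use e e0 N' N0 in auto)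
    also have "\<dots> \<le> 24 * N * (A * Z\<^sup>2)" unfolding Z_def using N0 by (intro mult_left_mono mult_right_mono A1) auto
    finally show ?thesis .
  qed
  have lhs: "(Ln r 2 vG)\<^sup>2 \<le> (\<integral>x. \<eta> x * (vG x)\<^sup>2 \<partial>BM r'1)"
  proof -
    have "(Ln r 2 vG)\<^sup>2 = (\<integral>x. \<eta> x * (vG x)\<^sup>2 \<partial>BM r)"
      unfolding Ln_2[OF cv(3)] by (rule BM_cong) (simp add: e)
    also have "\<dots> \<le> (\<integral>x. \<eta> x * (vG x)\<^sup>2 \<partial>BM r'1)"
      using r'12 e by (intro BM_subset continuous_on_mult continuous_on_power cv smooth3_cont) auto
    finally show ?thesis .
  qed
  define W where "W = (k1C + k2C) / d ^ 9 * (m / \<delta> + \<delta> * A)"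
  define Y where "Y = k2C / d ^ 9 * (\<delta> * A + m)"
  let ?Tk = "\<lambda>k. - \<nu> * (\<integral>x. (\<Sum>i\<in>UNIV. pd i (U k) x * (U k x * pd i \<eta> x)) \<partial>BM r'1) - \<nu> * (\<integral>x. (\<Sum>i\<in>UNIV. pd i (b k) x * (b k x * pd i \<eta> x)) \<partial>BM r'1)
      + \<nu> * (\<integral>x. (\<Sum>i\<in>UNIV. pd i (U k) x * pd i (v k) x) \<partial>BM r'1)
      + (\<integral>x. U k x * U k x * (\<Sum>i\<in>UNIV. U i x * pd i \<eta> x) \<partial>BM r'1) / 2 + (\<integral>x. b k x * b k x * (\<Sum>i\<in>UNIV. U i x * pd i \<eta> x) \<partial>BM r'1) / 2
      - (\<integral>x. b k x * U k x * (\<Sum>i\<in>UNIV. b i x * pd i \<eta> x) \<partial>BM r'1)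
      + (\<integral>x. (\<Sum>i\<in>UNIV. U i x * pd i (U k) x) * v k x \<partial>BM r'1) - (\<integral>x. (\<Sum>i\<in>UNIV. b i x * pd i (b k) x) * v k x \<partial>BM r'1)"
  have Tk: "?Tk k \<le> \<nu> * (6 * N * (A * (volc * X))) + \<nu> * (3 * (A * W)) + 6 * N * X ^ 3 + 18 * N * (A * (m * Q)) + 72 * (A * (X * Y))" for k
  proof -
    have a1: "- \<nu> * t \<le> \<nu> * c" if "\<bar>t\<bar> \<le> c" for t c using mult_left_mono[of "- t" c \<nu>] nu that by auto
    have a2: "\<nu> * t \<le> \<nu> * c" if "\<bar>t\<bar> \<le> c" for t c using mult_left_mono[of t c \<nu>] nu that by auto
    have "- \<nu> * (\<integral>x. (\<Sum>i\<in>UNIV. pd i (U k) x * (U k x * pd i \<eta> x)) \<partial>BM r'1) \<le> \<nu> * (3 * N * (A * (volc * X)))"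
      by (rule a1, rule T1) (auto intro: smU le_v)
    moreover have "- \<nu> * (\<integral>x. (\<Sum>i\<in>UNIV. pd i (b k) x * (b k x * pd i \<eta> x)) \<partial>BM r'1) \<le> \<nu> * (3 * N * (A * (volc * X)))"
      by (rule a1, rule T1) (auto intro: smb le_v)
    moreover have "\<nu> * (\<integral>x. (\<Sum>i\<in>UNIV. pd i (U k) x * pd i (v k) x) \<partial>BM r'1) \<le> \<nu> * (3 * (A * W))"
      by (rule a2) (use T2[of k] in \<open>simp add: W_def\<close>)
    moreover have "\<bar>\<integral>x. U k x * U k x * (\<Sum>i\<in>UNIV. U i x * pd i \<eta> x) \<partial>BM r'1\<bar> \<le> 3 * N * X ^ 3"
      by (rule T3) (auto intro: smU le_v)
    moreover have "\<bar>\<integral>x. b k x * b k x * (\<Sum>i\<in>UNIV. U i x * pd i \<eta> x) \<partial>BM r'1\<bar> \<le> 3 * N * X ^ 3"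
      by (rule T3) (auto intro: smU smb le_v)
    moreover have "\<bar>\<integral>x. b k x * U k x * (\<Sum>i\<in>UNIV. b i x * pd i \<eta> x) \<partial>BM r'1\<bar> \<le> 3 * N * X ^ 3"
      by (rule T3) (auto intro: smU smb le_v)
    moreover have "\<bar>\<integral>x. (\<Sum>i\<in>UNIV. U i x * pd i (U k) x) * v k x \<partial>BM r'1\<bar> \<le> 9 * N * (A * (m * Q)) + 36 * (A * (X * Y))"
      unfolding Y_def by (rule T4) (auto intro: smU le_v)
    moreover have "\<bar>\<integral>x. (\<Sum>i\<in>UNIV. b i x * pd i (b k) x) * v k x \<partial>BM r'1\<bar> \<le> 9 * N * (A * (m * Q)) + 36 * (A * (X * Y))"
      unfolding Y_def by (rule T4) (auto intro: smb le_v)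
    moreover have "\<nu> * (6 * N * (A * (volc * X))) = \<nu> * (3 * N * (A * (volc * X))) + \<nu> * (3 * N * (A * (volc * X)))" by simp
    ultimately show ?thesis by linarith
  qed
  have "\<nu> * (Ln r 2 vG)\<^sup>2 \<le> \<nu> * (\<integral>x. \<eta> x * (vG x)\<^sup>2 \<partial>BM r'1)" using lhs nu by (intro mult_left_mono) auto
  also have "\<dots> = (\<Sum>k\<in>UNIV. ?Tk k) + \<nu> * (\<integral>x. (\<Sum>k\<in>UNIV. curlc (hallF b) k x * (b k x * \<eta> x)) \<partial>BM r'1)"
    by (rule energy_identity) (use e e0 v in auto)
  also have "\<dots> \<le> (\<Sum>k\<in>(UNIV::3 set). \<nu> * (6 * N * (A * (volc * X))) + \<nu> * (3 * (A * W)) + 6 * N * X ^ 3 + 18 * N * (A * (m * Q)) + 72 * (A * (X * Y))) + \<nu> * (24 * N * (A * Z\<^sup>2))"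
    using T5 nu by (intro add_mono sum_mono Tk mult_left_mono) auto
  also have "\<dots> = 18 * N * volc * (\<nu> * A * X) + 9 * (\<nu> * A * W) + 18 * N * X ^ 3 + 54 * N * (A * m * Q) + 216 * (A * X * Y) + 24 * N * (\<nu> * A * Z\<^sup>2)"
    by (simp add: algebra_simps)
  also have "\<dots> \<le> mC / d ^ 9 * (\<nu> * A * X + X ^ 3 + \<nu> * A * (m / \<delta> + \<delta> * A) + A * m * Q + A * X * (\<delta> * A + m) + \<nu> * A * Z\<^sup>2)"
  proof -
    have N9: "N \<le> cutC / d ^ 9" unfolding N_def using constC_pos dp power_decreasing[of 5 9 d] by (intro divide_left_mono) auto
    have le: "c * N * T \<le> mC / d ^ 9 * T" if "c * cutC \<le> mC" "0 \<le> T" "0 \<le> c" for c T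
    proof -
      have "c * N \<le> c * (cutC / d ^ 9)" using that by (intro mult_left_mono N9) auto
      also have "\<dots> \<le> mC / d ^ 9" using that dp by (simp add: divide_right_mono)
      finally show ?thesis using that by (intro mult_right_mono) auto
    qed
    have le': "c * (B / d ^ 9 * T) \<le> mC / d ^ 9 * T" if "c * B \<le> mC" "0 \<le> T" for c B T
      using mult_right_mono[OF divide_right_mono[OF that(1), of "d ^ 9"] that(2)] dp by simp
    note p = constC_pos volc_ge_1 mult_pos_pos[OF constC_pos(1) less_le_trans[OF zero_less_one volc_ge_1]]
    have "18 * volc * N * (\<nu> * A * X) \<le> mC / d ^ 9 * (\<nu> * A * X)"
      by (rule le) (use p nu pos in \<open>auto simp: mC_def\<close>)
    moreover have "18 * N * X ^ 3 \<le> mC / d ^ 9 * X ^ 3" by (rule le) (use p nu pos in \<open>auto simp: mC_def\<close>)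
    moreover have "54 * N * (A * m * Q) \<le> mC / d ^ 9 * (A * m * Q)" by (rule le) (use p nu pos in \<open>auto simp: mC_def\<close>)
    moreover have "24 * N * (\<nu> * A * Z\<^sup>2) \<le> mC / d ^ 9 * (\<nu> * A * Z\<^sup>2)" by (rule le) (use p nu pos in \<open>auto simp: mC_def\<close>)
    moreover have "9 * ((k1C + k2C) / d ^ 9 * (\<nu> * A * (m / \<delta> + \<delta> * A))) \<le> mC / d ^ 9 * (\<nu> * A * (m / \<delta> + \<delta> * A))"
      by (rule le') (use p nu pos \<delta> in \<open>auto simp: mC_def\<close>)
    moreover have "216 * (k2C / d ^ 9 * (A * X * (\<delta> * A + m))) \<le> mC / d ^ 9 * (A * X * (\<delta> * A + m))"
      by (rule le') (use p nu pos \<delta> in \<open>auto simp: mC_def\<close>)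
    moreover have "9 * (\<nu> * A * W) = 9 * ((k1C + k2C) / d ^ 9 * (\<nu> * A * (m / \<delta> + \<delta> * A)))" by (simp add: W_def mult_ac)
    moreover have "216 * (A * X * Y) = 216 * (k2C / d ^ 9 * (A * X * (\<delta> * A + m)))" by (simp add: Y_def mult_ac)
    moreover have "18 * N * volc * (\<nu> * A * X) = 18 * volc * N * (\<nu> * A * X)" by simp
    ultimately show ?thesis unfolding distrib_left[of "mC / d ^ 9"] by linarith
  qed
  finally show ?thesis .
qed

end

section \<open>Estimates at the critical exponents\<close>

text \<open>Shows that \<bar>g\<bar>^3 is g times the continuously differentiable function g
  \<bar>g\<bar>, so that g can be replaced by a divergence and integrated by parts.\<close>

lemma abs_square_derivative: "((\<lambda>t::real. t * \<bar>t\<bar>) has_real_derivative 2 * \<bar>t\<bar>) (at t)"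
proof -
  consider "t > 0" | "t < 0" | "t = 0" by linarith
  then show ?thesis
  proof cases
    case 1
    have "((\<lambda>t. t * t) has_real_derivative 2 * \<bar>t\<bar>) (at t)" using 1 by (auto intro!: derivative_eq_intros)
    then show ?thesis by (rule has_field_derivative_transform_within_open[where S="{0<..}"]) (use 1 in auto)
  next
    case 2
    have "((\<lambda>t. - (t * t)) has_real_derivative 2 * \<bar>t\<bar>) (at t)" using 2 by (auto intro!: derivative_eq_intros)
    then show ?thesis by (rule has_field_derivative_transform_within_open[where S="{..<0}"]) (use 2 in auto)
  next
    case 3
    have "((\<lambda>h. \<bar>h\<bar>) \<longlongrightarrow> \<bar>0::real\<bar>) (at 0)" by (intro tendsto_intros)
    then have "((\<lambda>h. h * \<bar>h\<bar> / h) \<longlongrightarrow> 0) (at (0::real))"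
      by (simp, elim Lim_transform_eventually) (auto simp: eventually_at_filter)
    then show ?thesis using 3 by (simp add: DERIV_def)
  qed
qed

lemma pd_abs_square:
  assumes g: "smooth3 (g :: real^3 \<Rightarrow> real)"
  shows "(\<lambda>x. g x * \<bar>g x\<bar>) differentiable (at x)" "pd i (\<lambda>x. g x * \<bar>g x\<bar>) x = 2 * \<bar>g x\<bar> * pd i g x"
proof -
  have "((\<lambda>x. g x * \<bar>g x\<bar>) has_derivative (\<lambda>h. 2 * \<bar>g x\<bar> * frechet_derivative g (at x) h)) (at x)"
    using has_derivative_compose[OF differentiable_has_fd[OF smooth3_D[OF g]] abs_square_derivative[THEN has_field_derivative_imp_has_derivative]]
    by simp
  then show "(\<lambda>x. g x * \<bar>g x\<bar>) differentiable (at x)" "pd i (\<lambda>x. g x * \<bar>g x\<bar>) x = 2 * \<bar>g x\<bar> * pd i g x"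
    by (auto intro: differentiableI simp: pd_eq pd_def[of i g])
qed

text \<open>216 = 6^3 and 72 = 6 * 12 count the six scalar components of (U, b). In 288 = 9 * 32 and
  64 = 2 * 32 the 32 is the cost of a cutoff layer d/4 instead of d/2.\<close>

definition "lC = 216 * (6 + 288 * cutC * volc)"
definition "sC = 72 * (1 + 64 * cutC * volc)"

lemma lsC_ge_1: "1 \<le> lC" "1 \<le> sC"
proof -
  have "0 \<le> cutC * volc" using constC_pos volc_ge_1 by auto
  then show "1 \<le> lC" "1 \<le> sC" by (auto simp: lC_def sC_def)
qed

lemma powr_between:
  fixes h L q :: real
  assumes "0 \<le> h" "0 < L" "3 \<le> q" "q \<le> 6"
  shows "h powr q \<le> L powr (q - 3) * h ^ 3 + L powr (q - 6) * h ^ 6"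
proof (cases "h = 0")
  case False
  then have h: "h > 0" using assms by simp
  show ?thesis
  proof (cases "h \<le> L")
    case True
    have "h powr q = h powr (q - 3) * h ^ 3" using h powr_add[of h "q - 3" 3] by simp
    also have "\<dots> \<le> L powr (q - 3) * h ^ 3" using True h assms by (intro mult_right_mono powr_mono2) auto
    finally show ?thesis using h by (smt (verit) mult_nonneg_nonneg powr_ge_zero zero_le_power)
  next
    case False
    have "h powr q = h powr (q - 6) * h ^ 6" using h powr_add[of h "q - 6" 6] by simp
    also have "\<dots> \<le> L powr (q - 6) * h ^ 6" using False h assms by (intro mult_right_mono powr_mono2') auto
    finally show ?thesis using h by (smt (verit) mult_nonneg_nonneg powr_ge_zero zero_le_power)
  qed
qed (use assms in auto)

lemma Ln_nat_powr: "0 < n \<Longrightarrow> Ln r (real n) f ^ n = (\<integral>x. \<bar>f x\<bar> ^ n \<partial>BM r)"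
  using Ln_powr[of "real n" r f] by (simp add: powr_realpow')

text \<open>Interpolation between L^3 and L^6 by splitting the values of \<open>h\<close>. Two
  different majorants are allowed because the cutoff occurs with a different power in each
  norm.\<close>

lemma Ln_interpolation:
  assumes c: "contU h" "contU f" "contU g" and le: "\<And>x. norm x \<le> r \<Longrightarrow> \<bar>h x\<bar> \<le> \<bar>f x\<bar>" "\<And>x. norm x \<le> r \<Longrightarrow> \<bar>h x\<bar> \<le> \<bar>g x\<bar>"
    and q: "3 \<le> q" "q \<le> 6" and Y: "Ln r 3 f \<le> Y" "0 < Y" and S: "Ln r 6 g \<le> S" "0 < S"
  shows "Ln r q h \<le> 2 * (S powr (2 - 6 / q) * Y powr (6 / q - 1))"
proof -
  \<comment> \<open>The threshold at which the bounds for small and for large values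
    coincide.\<close>
  define L where "L = S powr 2 / Y"
  have SS: "(S powr 2) powr (q - 3) = S powr (2 * q - 6)" "(S powr 2) powr (q - 6) = S powr (2 * q - 12)"
    unfolding powr_powr by (simp_all add: right_diff_distrib)
  have L: "L > 0" using Y S by (simp add: L_def)
  have "(\<integral>x. \<bar>h x\<bar> powr q \<partial>BM r) \<le> (\<integral>x. L powr (q - 3) * \<bar>f x\<bar> ^ 3 + L powr (q - 6) * \<bar>g x\<bar> ^ 6 \<partial>BM r)"
  proof (rule BM_mono)
    fix x :: "real^3" assume x: "norm x \<le> r"
    have "\<bar>h x\<bar> powr q \<le> L powr (q - 3) * \<bar>h x\<bar> ^ 3 + L powr (q - 6) * \<bar>h x\<bar> ^ 6"
      using L q by (intro powr_between) auto
    also have "\<dots> \<le> L powr (q - 3) * \<bar>f x\<bar> ^ 3 + L powr (q - 6) * \<bar>g x\<bar> ^ 6"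
      using le[OF x] by (intro add_mono mult_left_mono power_mono) auto
    finally show "\<bar>h x\<bar> powr q \<le> L powr (q - 3) * \<bar>f x\<bar> ^ 3 + L powr (q - 6) * \<bar>g x\<bar> ^ 6" .
  qed (use q c in \<open>auto intro!: cont_powr continuous_intros\<close>)
  also have "\<dots> = L powr (q - 3) * Ln r 3 f ^ 3 + L powr (q - 6) * Ln r 6 g ^ 6"
    using Ln_nat_powr[of 3 r f] Ln_nat_powr[of 6 r g]
    by (subst BM_int_add) (auto intro!: continuous_intros c)
  also have "\<dots> \<le> L powr (q - 3) * Y ^ 3 + L powr (q - 6) * S ^ 6"
    using Y S by (intro add_mono mult_left_mono power_mono) auto
  also have "L powr (q - 3) * Y ^ 3 = S powr (2 * q - 6) * Y powr (6 - q)"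
  proof -
    have "L powr (q - 3) = S powr (2 * q - 6) / Y powr (q - 3)" unfolding L_def SS[symmetric] by (intro powr_divide)
    also have "\<dots> * Y ^ 3 = S powr (2 * q - 6) * (Y powr 3 / Y powr (q - 3))"
      using S Y by simp
    also have "Y powr 3 / Y powr (q - 3) = Y powr (6 - q)" using Y powr_diff[of Y 3 "q - 3"] by simp
    finally show ?thesis .
  qed
  also have "L powr (q - 6) * S ^ 6 = S powr (2 * q - 6) * Y powr (6 - q)"
  proof -
    have "L powr (q - 6) = S powr (2 * q - 12) / Y powr (q - 6)" unfolding L_def SS[symmetric] by (intro powr_divide)
    also have "\<dots> * S ^ 6 = (S powr (2 * q - 12) * S powr 6) * (1 / Y powr (q - 6))"
      using S Y by simp
    also have "S powr (2 * q - 12) * S powr 6 = S powr (2 * q - 6)" using S powr_add[of S "2 * q - 12" 6] by simp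
    also have "1 / Y powr (q - 6) = Y powr (6 - q)" using Y by (simp add: powr_minus_divide[of Y "q - 6", symmetric])
    finally show ?thesis .
  qed
  finally have "(\<integral>x. \<bar>h x\<bar> powr q \<partial>BM r) \<le> 2 * (S powr (2 * q - 6) * Y powr (6 - q))" by (simp add: mult_ac)
  also have "\<dots> \<le> (2 * (S powr (2 - 6 / q) * Y powr (6 / q - 1))) powr q"
  proof -
    have "(S powr (2 - 6 / q)) powr q = S powr (2 * q - 6)" "(Y powr (6 / q - 1)) powr q = Y powr (6 - q)"
      using q by (simp_all add: powr_powr left_diff_distrib)
    then have "(2 * (S powr (2 - 6 / q) * Y powr (6 / q - 1))) powr q = 2 powr q * (S powr (2 * q - 6) * Y powr (6 - q))"
      by (simp add: powr_mult)
    moreover have "2 powr 1 \<le> 2 powr q" using q by (intro powr_mono) auto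
    ultimately show ?thesis by (simp add: mult_right_mono)
  qed
  finally show ?thesis using q by (subst Ln_le_iff) auto
qed

context unit_sol
begin

lemma va_le_sum: "va x \<le> (\<Sum>k\<in>UNIV. \<bar>U k x\<bar> + \<bar>b k x\<bar>)"
proof -
  have "va x = L2_set (\<lambda>k. sqrt ((U k x)\<^sup>2 + (b k x)\<^sup>2)) UNIV" by (simp add: va_def L2_set_def)
  also have "\<dots> \<le> (\<Sum>k\<in>UNIV. sqrt ((U k x)\<^sup>2 + (b k x)\<^sup>2))" by (rule L2_set_le_sum) auto
  also have "\<dots> \<le> (\<Sum>k\<in>UNIV. \<bar>U k x\<bar> + \<bar>b k x\<bar>)" by (intro sum_mono sqrt_sum_squares_le_sum_abs)
  finally show ?thesis .
qed

lemma Ln_va_le: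
  assumes w: "contU w" "\<And>x. 0 \<le> w x" and q: "1 < q"
    and U: "\<And>k. Ln r q (\<lambda>x. w x * U k x) \<le> c" and b: "\<And>k. Ln r q (\<lambda>x. w x * b k x) \<le> c"
  shows "Ln r q (\<lambda>x. w x * va x) \<le> 6 * c"
proof -
  have cc: "contU (\<lambda>x. \<bar>w x * U k x\<bar>)" "contU (\<lambda>x. \<bar>w x * b k x\<bar>)" for k
    by (intro continuous_on_rabs continuous_on_mult w smooth3_cont smU smb)+
  have "Ln r q (\<lambda>x. w x * va x) \<le> Ln r q (\<lambda>x. \<Sum>k\<in>UNIV. \<bar>w x * U k x\<bar> + \<bar>w x * b k x\<bar>)"
  proof (rule Ln_mono)
    fix x
    have "w x * va x \<le> w x * (\<Sum>k\<in>UNIV. \<bar>U k x\<bar> + \<bar>b k x\<bar>)" by (intro mult_left_mono va_le_sum w)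
    also have "\<dots> = (\<Sum>k\<in>UNIV. \<bar>w x * U k x\<bar> + \<bar>w x * b k x\<bar>)"
      using w(2)[of x] by (simp add: sum_distrib_left abs_mult distrib_left)
    finally show "\<bar>w x * va x\<bar> \<le> \<bar>\<Sum>k\<in>UNIV. \<bar>w x * U k x\<bar> + \<bar>w x * b k x\<bar>\<bar>"
      using w(2)[of x] by (simp add: abs_mult)
  qed (use q in \<open>auto intro!: continuous_on_mult w cont_v continuous_on_sum continuous_on_add cc\<close>)
  also have "\<dots> \<le> (\<Sum>k\<in>(UNIV::3 set). c + c)"
  proof (intro order_trans[OF Ln_sum] sum_mono order_trans[OF Ln_add] add_mono)
    fix k :: 3
    show "Ln r q (\<lambda>x. \<bar>w x * U k x\<bar>) \<le> c" "Ln r q (\<lambda>x. \<bar>w x * b k x\<bar>) \<le> c"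
      unfolding Ln_abs by (rule U b)+
  qed (use q cc in \<open>auto intro!: continuous_on_add\<close>)
  finally show ?thesis by simp
qed

text \<open>\<bar>\<zeta> g\<bar>^3 is the divergence of \<Phi> times \<zeta>^3 g \<bar>g\<bar>.
  Integrating by parts exchanges one factor g for the potential and puts the derivative on g
  \<bar>g\<bar> or on the cutoff. This is where the hypothesis on the potentials acquires control
  over the fields.\<close>

lemma cubic_component:
  assumes g: "smooth3 g" and \<Phi>: "\<And>j. smooth3 (\<Phi> j)" "\<And>x. (\<Sum>j\<in>UNIV. pd j (\<Phi> j) x) = g x"
    and le: "\<And>x. \<bar>g x\<bar> \<le> va x" "\<And>j x. \<bar>pd j g x\<bar> \<le> vG x" "\<And>j x. \<bar>\<Phi> j x\<bar> \<le> vM x"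
    and z: "smooth3 \<zeta>" "\<And>x. 0 \<le> \<zeta> x" "\<And>x. norm x > r' \<Longrightarrow> \<zeta> x = 0" "\<And>i x. \<bar>pd i \<zeta> x\<bar> \<le> N" and N: "0 \<le> N"
  shows "(\<integral>x. \<bar>\<zeta> x * g x\<bar> ^ 3 \<partial>BM r') \<le> 6 * (\<integral>x. vM x * (vG x * (\<zeta> x ^ 3 * va x)) \<partial>BM r') + 9 * N * (\<integral>x. vM x * (\<zeta> x * va x)\<^sup>2 \<partial>BM r')"
proof -
  define h where "h x = \<zeta> x ^ 3 * (g x * \<bar>g x\<bar>)" for x
  note pg = pd_abs_square[OF g]
  have pz: "pd i (\<lambda>x. \<zeta> x ^ 3) x = 3 * \<zeta> x ^ 2 * pd i \<zeta> x" for i x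
  proof -
    have "pd i (\<lambda>x. \<zeta> x * (\<zeta> x * \<zeta> x)) x = 3 * \<zeta> x ^ 2 * pd i \<zeta> x"
      using z(1) by (subst pd_mult) (auto simp: pd_mult power2_eq_square algebra_simps intro!: smooth3_D)
    then show ?thesis by (simp add: power3_eq_cube mult.assoc)
  qed
  have sz: "smooth3 (\<lambda>x. \<zeta> x ^ 3)" by (intro smooth3_power z)
  have dh: "h differentiable (at x)" for x
    unfolding h_def by (intro differentiable_mult smooth3_D[OF sz] pg)
  have ph: "pd i h x = \<zeta> x ^ 3 * (2 * \<bar>g x\<bar> * pd i g x) + 3 * \<zeta> x ^ 2 * pd i \<zeta> x * (g x * \<bar>g x\<bar>)" for i x
    unfolding h_def by (subst pd_mult[OF smooth3_D[OF sz] pg(1)]) (simp add: pg pz)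
  have cont: "contU g" "contU \<zeta>" "contU (pd i \<zeta>)" "contU (pd i g)" "contU (\<Phi> j)" "contU (pd j (\<Phi> j))" for i j
    by (intro smooth3_cont smooth3_pd g z \<Phi>)+
  have ch: "contU h" "contU (pd i h)" for i
    unfolding h_def ph[abs_def] by (intro continuous_intros cont)+
  have zero: "(\<integral>x. \<Phi> j x * pd j h x + pd j (\<Phi> j) x * h x \<partial>BM r') = 0" for j
  proof -
    have e: "pd j (\<lambda>x. \<Phi> j x * h x) = (\<lambda>x. \<Phi> j x * pd j h x + pd j (\<Phi> j) x * h x)"
      by (intro ext pd_mult smooth3_D \<Phi> dh)
    have "integral\<^sup>L (BM r') (pd j (\<lambda>x. \<Phi> j x * h x)) = 0"
    proof (rule integral_pd_zero[where r=r'])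
      show "(\<lambda>x. \<Phi> j x * h x) differentiable at x" for x by (intro differentiable_mult smooth3_D \<Phi> dh)
      show "contU (pd j (\<lambda>x. \<Phi> j x * h x))" unfolding e by (intro continuous_intros cont ch)
    qed (auto simp: h_def z)
    then show ?thesis unfolding e .
  qed
  have "(\<integral>x. \<bar>\<zeta> x * g x\<bar> ^ 3 \<partial>BM r') = (\<integral>x. (\<Sum>j\<in>UNIV. pd j (\<Phi> j) x * h x) \<partial>BM r')"
  proof (rule BM_cong)
    fix x
    have "\<bar>\<zeta> x * g x\<bar> ^ 3 = \<zeta> x ^ 3 * (\<bar>g x\<bar> * \<bar>g x\<bar> * \<bar>g x\<bar>)" using z(2)[of x] by (simp add: abs_mult power_mult_distrib power3_eq_cube)
    also have "\<dots> = g x * h x" by (simp add: h_def mult_ac flip: abs_mult)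
    finally show "\<bar>\<zeta> x * g x\<bar> ^ 3 = (\<Sum>j\<in>UNIV. pd j (\<Phi> j) x * h x)" by (simp add: sum_distrib_right[symmetric] \<Phi>)
  qed
  also have "\<dots> = (\<Sum>j\<in>UNIV. (\<integral>x. pd j (\<Phi> j) x * h x \<partial>BM r'))"
    by (rule BM_int_sum) (intro continuous_on_mult cont ch)
  also have "\<dots> \<le> (\<Sum>j\<in>(UNIV::3 set). 2 * (\<integral>x. vM x * (vG x * (\<zeta> x ^ 3 * va x)) \<partial>BM r') + 3 * N * (\<integral>x. vM x * (\<zeta> x * va x)\<^sup>2 \<partial>BM r'))"
  proof (rule sum_mono)
    fix j :: 3
    have c1: "contU (\<lambda>x. vM x * (vG x * (\<zeta> x ^ 3 * va x)))" "contU (\<lambda>x. vM x * (\<zeta> x * va x)\<^sup>2)"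
      by (intro continuous_intros cont)+
    have "(\<integral>x. \<Phi> j x * pd j h x \<partial>BM r') + (\<integral>x. pd j (\<Phi> j) x * h x \<partial>BM r') = 0"
      using zero[of j] BM_int_add[OF continuous_on_mult[OF cont(5)[of j] ch(2)[of j]] continuous_on_mult[OF cont(6)[of j] ch(1)], of r'] by simp
    then have "(\<integral>x. pd j (\<Phi> j) x * h x \<partial>BM r') \<le> \<bar>\<integral>x. \<Phi> j x * pd j h x \<partial>BM r'\<bar>" by linarith
    also have "\<dots> \<le> (\<integral>x. 2 * (vM x * (vG x * (\<zeta> x ^ 3 * va x))) + (3 * N) * (vM x * (\<zeta> x * va x)\<^sup>2) \<partial>BM r')"
    proof (rule BM_abs_le)
      fix x
      have 1: "\<bar>\<zeta> x ^ 3 * (2 * \<bar>g x\<bar> * pd j g x)\<bar> \<le> \<zeta> x ^ 3 * (2 * va x * vG x)"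
      proof -
        have "\<bar>\<zeta> x ^ 3 * (2 * \<bar>g x\<bar> * pd j g x)\<bar> = \<zeta> x ^ 3 * ((2 * \<bar>g x\<bar>) * \<bar>pd j g x\<bar>)" using z(2)[of x] by (simp add: abs_mult)
        also have "\<dots> \<le> \<zeta> x ^ 3 * ((2 * va x) * vG x)" using z(2)[of x] by (intro mult_left_mono mult_mono le) auto
        finally show ?thesis by simp
      qed
      have 2: "\<bar>3 * \<zeta> x ^ 2 * pd j \<zeta> x * (g x * \<bar>g x\<bar>)\<bar> \<le> (3 * \<zeta> x ^ 2 * N) * (va x * va x)"
      proof -
        have "\<bar>3 * \<zeta> x ^ 2 * pd j \<zeta> x * (g x * \<bar>g x\<bar>)\<bar> = (3 * \<zeta> x ^ 2) * \<bar>pd j \<zeta> x\<bar> * (\<bar>g x\<bar> * \<bar>g x\<bar>)" by (simp add: abs_mult)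
        also have "\<dots> \<le> (3 * \<zeta> x ^ 2) * N * (va x * va x)" using N by (intro mult_mono mult_left_mono z(4) le) auto
        finally show ?thesis .
      qed
      have "\<bar>\<Phi> j x * pd j h x\<bar> \<le> vM x * (\<zeta> x ^ 3 * (2 * va x * vG x) + (3 * \<zeta> x ^ 2 * N) * (va x * va x))"
        unfolding abs_mult ph by (intro mult_mono le order_trans[OF abs_triangle_ineq] add_mono 1 2) auto
      then show "\<bar>\<Phi> j x * pd j h x\<bar> \<le> 2 * (vM x * (vG x * (\<zeta> x ^ 3 * va x))) + (3 * N) * (vM x * (\<zeta> x * va x)\<^sup>2)"
        by (simp add: power_mult_distrib power2_eq_square algebra_simps)
    qed (intro continuous_on_mult cont ch, intro continuous_on_add continuous_on_mult[OF continuous_on_const] c1)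
    also have "\<dots> = 2 * (\<integral>x. vM x * (vG x * (\<zeta> x ^ 3 * va x)) \<partial>BM r') + 3 * N * (\<integral>x. vM x * (\<zeta> x * va x)\<^sup>2 \<partial>BM r')"
      by (subst BM_int_add) (intro continuous_on_mult[OF continuous_on_const] c1, intro continuous_on_mult[OF continuous_on_const] c1, simp)
    finally show "(\<integral>x. pd j (\<Phi> j) x * h x \<partial>BM r') \<le> 2 * (\<integral>x. vM x * (vG x * (\<zeta> x ^ 3 * va x)) \<partial>BM r') + 3 * N * (\<integral>x. vM x * (\<zeta> x * va x)\<^sup>2 \<partial>BM r')" .
  qed
  finally show ?thesis by simp
qed

text \<open>Collects the six components. The cutoff term is split by Hoelder into L^3 and L^(3/2);
  it is quadratic in the L^3 norm against a cubic left side, hence of lower order.\<close>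

lemma cubic_estimate:
  assumes r': "r' \<le> 2" and d: "0 < d" and s: "3 \<le> s"
    and z: "smooth3 \<zeta>" "\<And>x. 0 \<le> \<zeta> x" "\<And>x. norm x > r' \<Longrightarrow> \<zeta> x = 0" "\<And>i x. \<bar>pd i \<zeta> x\<bar> \<le> 32 * cutC / d ^ 5" and d1: "d \<le> 1"
  shows "Ln r' 3 (\<lambda>x. \<zeta> x * va x) ^ 3 \<le> lC * ((\<integral>x. vM x * (vG x * (\<zeta> x ^ 3 * va x)) \<partial>BM r') + Ln r' s vM * (Ln r' 3 (\<lambda>x. \<zeta> x * va x))\<^sup>2 / d ^ 5)"
proof -
  define N where "N = 32 * cutC / d ^ 5"
  have N: "N \<ge> 0" using constC_pos d by (simp add: N_def)
  define Y where "Y = Ln r' 3 (\<lambda>x. \<zeta> x * va x)"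
  define m where "m = Ln r' s vM"
  define I where "I = (\<integral>x. vM x * (vG x * (\<zeta> x ^ 3 * va x)) \<partial>BM r')"
  have cz: "contU \<zeta>" by (rule smooth3_cont[OF z(1)])
  have cY: "contU (\<lambda>x. \<zeta> x * va x)" by (intro continuous_intros cz)
  have I0: "I \<ge> 0" unfolding I_def using z by (intro BM_nonneg mult_nonneg_nonneg) auto
  have K: "(\<integral>x. vM x * (\<zeta> x * va x)\<^sup>2 \<partial>BM r') \<le> volc * m * Y\<^sup>2"
  proof -
    have "(\<integral>x. vM x * (\<zeta> x * va x)\<^sup>2 \<partial>BM r') = (\<integral>x. \<bar>vM x * ((\<zeta> x * va x) * (\<zeta> x * va x))\<bar> \<partial>BM r')"
      by (intro BM_cong) (simp add: power2_eq_square abs_mult z(2))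
    also have "\<dots> \<le> Ln r' 3 vM * Ln r' (3/2) (\<lambda>x. (\<zeta> x * va x) * (\<zeta> x * va x))"
      by (rule Holder_BM) (auto intro!: continuous_intros cz)
    also have "\<dots> \<le> (volc * m) * (Y * Y)"
      unfolding m_def Y_def using r' s volc_ge_1 by (intro mult_mono Ln_le_Ln Ln_mult cont_v cY) auto
    finally show ?thesis by (simp add: power2_eq_square)
  qed
  define B where "B = 6 * I + 9 * N * (volc * m * Y\<^sup>2)"
  have B0: "B \<ge> 0" using I0 N volc_ge_1 by (simp add: B_def m_def)
  have comp: "Ln r' 3 (\<lambda>x. \<zeta> x * g x) \<le> B powr (1/3)"
    if "smooth3 g" "\<And>j. smooth3 (\<Phi> j)" "\<And>x. (\<Sum>j\<in>UNIV. pd j (\<Phi> j) x) = g x" "\<And>x. \<bar>g x\<bar> \<le> va x" "\<And>j x. \<bar>pd j g x\<bar> \<le> vG x" "\<And>j x. \<bar>\<Phi> j x\<bar> \<le> vM x" for g \<Phi>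
  proof -
    have "(\<integral>x. \<bar>\<zeta> x * g x\<bar> ^ 3 \<partial>BM r') \<le> 6 * I + 9 * N * (\<integral>x. vM x * (\<zeta> x * va x)\<^sup>2 \<partial>BM r')"
      unfolding I_def by (rule cubic_component[OF that z(1,2,3) _ N]) (use z(4) in \<open>simp_all add: N_def\<close>)
    also have "\<dots> \<le> B" unfolding B_def using N by (intro add_left_mono mult_left_mono K) auto
    finally show ?thesis using B0 by (subst Ln_le_iff) (auto simp: powr_powr)
  qed
  have "Y \<le> 6 * B powr (1/3)"
    unfolding Y_def
  proof (rule Ln_va_le[OF cz z(2)])
    show "Ln r' 3 (\<lambda>x. \<zeta> x * U k x) \<le> B powr (1/3)" for k
      by (rule comp[of "U k" "F k"]) (auto intro: smU smF divF le_v)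
    show "Ln r' 3 (\<lambda>x. \<zeta> x * b k x) \<le> B powr (1/3)" for k
      by (rule comp[of "b k" "H k"]) (auto intro: smb smH divH le_v)
  qed simp
  then have "Y ^ 3 \<le> (6 * B powr (1/3)) ^ 3" by (intro power_mono) (auto simp: Y_def)
  also have "\<dots> = 216 * B"
  proof -
    have "(B powr (1/3)) ^ 3 = (B powr (1/3)) powr 3" by simp
    also have "\<dots> = B" unfolding powr_powr using B0 by simp
    finally show ?thesis by (simp add: power_mult_distrib)
  qed
  also have "\<dots> \<le> lC * (I + m * Y\<^sup>2 / d ^ 5)"
  proof -
    have mY: "0 \<le> m * Y\<^sup>2 / d ^ 5" using d by (simp add: m_def)
    have "B = 6 * I + 288 * cutC * volc * (m * Y\<^sup>2 / d ^ 5)" by (simp add: B_def N_def)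
    also have "\<dots> \<le> (6 + 288 * cutC * volc) * I + (6 + 288 * cutC * volc) * (m * Y\<^sup>2 / d ^ 5)"
      using constC_pos volc_ge_1 I0 mY by (intro add_mono mult_right_mono) auto
    finally have "B \<le> (6 + 288 * cutC * volc) * (I + m * Y\<^sup>2 / d ^ 5)" by (simp only: distrib_left)
    then have "216 * B \<le> 216 * ((6 + 288 * cutC * volc) * (I + m * Y\<^sup>2 / d ^ 5))" by (rule mult_left_mono) simp
    then show ?thesis unfolding lC_def by (simp only: mult.assoc)
  qed
  finally show ?thesis by (simp add: Y_def I_def m_def)
qed

text \<open>With \<zeta>^2 a derivative falling on the cutoff still leaves a factor \<zeta>, so the
  error is measured by the same L^3 norm of \<zeta> times the fields that
  \<open>cubic_estimate\<close> controls; no larger ball is needed.\<close>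

lemma sobolev_estimate:
  assumes r': "r' \<le> 2" and d: "0 < d" "d \<le> 1"
    and z: "smooth3 \<zeta>" "\<And>x. 0 \<le> \<zeta> x" "\<And>x. \<zeta> x \<le> 1" "\<And>x. norm x > r' \<Longrightarrow> \<zeta> x = 0" "\<And>i x. \<bar>pd i \<zeta> x\<bar> \<le> 32 * cutC / d ^ 5"
  shows "Ln r' 6 (\<lambda>x. \<zeta> x ^ 2 * va x) \<le> sC / d ^ 5 * (Ln r' 2 vG + Ln r' 3 (\<lambda>x. \<zeta> x * va x))"
proof -
  define N where "N = 32 * cutC / d ^ 5"
  have N: "N \<ge> 0" using constC_pos d by (simp add: N_def)
  define Y where "Y = Ln r' 3 (\<lambda>x. \<zeta> x * va x)"
  define A where "A = Ln r' 2 vG"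
  have AY: "A \<ge> 0" "Y \<ge> 0" by (auto simp: A_def Y_def)
  have cz: "contU \<zeta>" by (rule smooth3_cont[OF z(1)])
  have comp: "Ln r' 6 (\<lambda>x. \<zeta> x ^ 2 * g x) \<le> 12 * (A + 2 * N * volc * Y)"
    if g: "smooth3 g" "\<And>x. \<bar>g x\<bar> \<le> va x" "\<And>j x. \<bar>pd j g x\<bar> \<le> vG x" for g
  proof -
    have p: "pd i (\<lambda>x. \<zeta> x ^ 2 * g x) x = \<zeta> x ^ 2 * pd i g x + (\<zeta> x * g x) * (2 * pd i \<zeta> x)" for i x
    proof -
      have "pd i (\<lambda>x. \<zeta> x * (\<zeta> x * g x)) x = \<zeta> x * (\<zeta> x * pd i g x + pd i \<zeta> x * g x) + pd i \<zeta> x * (\<zeta> x * g x)"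
        using z(1) g(1) by (subst pd_mult) (auto simp: pd_mult intro!: smooth3_D smooth3_mult)
      then show ?thesis by (simp add: power2_eq_square algebra_simps)
    qed
    have cg: "contU g" "contU (pd i g)" "contU (pd i \<zeta>)" for i by (intro smooth3_cont smooth3_pd g z)+
    have "Ln r' 6 (\<lambda>x. \<zeta> x ^ 2 * g x) \<le> 4 * (\<Sum>i\<in>UNIV. Ln r' 2 (pd i (\<lambda>x. \<zeta> x ^ 2 * g x)))"
      by (rule sobolev[where r=r']) (auto intro!: smooth3_mult smooth3_power z g simp: z)
    also have "\<dots> \<le> 4 * (\<Sum>i\<in>(UNIV::3 set). A + 2 * N * (volc * Y))"
    proof (intro mult_left_mono sum_mono)
      fix i :: 3
      have "Ln r' 2 (pd i (\<lambda>x. \<zeta> x ^ 2 * g x)) = Ln r' 2 (\<lambda>x. \<zeta> x ^ 2 * pd i g x + (\<zeta> x * g x) * (2 * pd i \<zeta> x))"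
        by (rule Ln_cong) (simp add: p)
      also have "\<dots> \<le> Ln r' 2 (\<lambda>x. \<zeta> x ^ 2 * pd i g x) + Ln r' 2 (\<lambda>x. (\<zeta> x * g x) * (2 * pd i \<zeta> x))"
        by (rule Ln_add) (auto intro!: continuous_intros cg cz)
      also have "Ln r' 2 (\<lambda>x. \<zeta> x ^ 2 * pd i g x) \<le> A"
        unfolding A_def
      proof (rule Ln_mono)
        fix x
        have "\<bar>\<zeta> x ^ 2\<bar> * \<bar>pd i g x\<bar> \<le> 1 * vG x" using z(2)[of x] z(3)[of x] by (intro mult_mono g) (auto simp: power_le_one)
        then show "\<bar>\<zeta> x ^ 2 * pd i g x\<bar> \<le> \<bar>vG x\<bar>" by (simp add: abs_mult)
      qed (auto intro!: continuous_intros cg cz)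
      also have "Ln r' 2 (\<lambda>x. (\<zeta> x * g x) * (2 * pd i \<zeta> x)) \<le> (2 * N) * Ln r' 2 (\<lambda>x. \<zeta> x * g x)"
      proof (rule Ln_bmult)
        show "\<bar>2 * pd i \<zeta> x\<bar> \<le> 2 * N" for x
          using mult_left_mono[OF z(5)[of i x], of 2] by (simp add: N_def abs_mult)
      qed (auto intro!: continuous_intros cg cz)
      also have "\<dots> \<le> (2 * N) * (volc * Y)"
      proof (rule mult_left_mono)
        have "Ln r' 2 (\<lambda>x. \<zeta> x * g x) \<le> Ln r' 2 (\<lambda>x. \<zeta> x * va x)"
          by (rule Ln_mono) (use z(2) g(2) in \<open>auto intro!: continuous_intros cg cz mult_left_mono simp: abs_mult\<close>)
        also have "\<dots> \<le> volc * Y" unfolding Y_def using r' by (intro Ln_le_Ln) (auto intro!: continuous_intros cz)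
        finally show "Ln r' 2 (\<lambda>x. \<zeta> x * g x) \<le> volc * Y" .
      qed (use N in auto)
      finally show "Ln r' 2 (pd i (\<lambda>x. \<zeta> x ^ 2 * g x)) \<le> A + 2 * N * (volc * Y)" by simp
    qed auto
    finally show ?thesis by (simp add: algebra_simps)
  qed
  have "Ln r' 6 (\<lambda>x. \<zeta> x ^ 2 * va x) \<le> 6 * (12 * (A + 2 * N * volc * Y))"
    by (rule Ln_va_le; (rule comp)?) (auto intro!: continuous_intros cz intro: smU smb le_v simp: z)
  also have "\<dots> = 72 * (A + 64 * cutC * volc / d ^ 5 * Y)" by (simp add: N_def)
  also have "\<dots> \<le> 72 * ((1 + 64 * cutC * volc) / d ^ 5 * (A + Y))"
  proof (rule mult_left_mono)
    have "1 \<le> 1 / d ^ 5" using d power_le_one[of d 5] by simp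
    moreover have p: "0 \<le> 64 * cutC * volc / d ^ 5" using constC_pos volc_ge_1 d by auto
    ultimately have "1 \<le> (1 + 64 * cutC * volc) / d ^ 5" by (simp add: add_divide_distrib)
    moreover have "64 * cutC * volc / d ^ 5 \<le> (1 + 64 * cutC * volc) / d ^ 5" using d by (simp add: divide_right_mono)
    ultimately have "1 * A + 64 * cutC * volc / d ^ 5 * Y \<le> (1 + 64 * cutC * volc) / d ^ 5 * A + (1 + 64 * cutC * volc) / d ^ 5 * Y"
      using AY by (intro add_mono mult_right_mono)
    then show "A + 64 * cutC * volc / d ^ 5 * Y \<le> (1 + 64 * cutC * volc) / d ^ 5 * (A + Y)" by (simp add: distrib_left)
  qed simp
  also have "\<dots> = sC / d ^ 5 * (A + Y)"
    unfolding sC_def by (simp only: times_divide_eq_right times_divide_eq_left mult.assoc)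
  finally show ?thesis by (simp only: A_def Y_def)
qed

end

text \<open>If y^2 is the larger term, then y \<le> 2 K. If the other term is larger and e \<le> y,
  it is at most 2 y^2, so y \<le> 4 K. If y < e, it is at most 2 e^(1+\<theta>) y^(1-\<theta>), and
  dividing by y^(1-\<theta>) gives y^(2+\<theta>) \<le> 4 K e^(1+\<theta>).\<close>

lemma cubic_absorb:
  fixes y e K \<theta> :: real
  assumes y: "1 \<le> y" and e: "1 \<le> e" and K: "1 \<le> K" and \<theta>: "0 \<le> \<theta>" "\<theta> < 1"
    and le: "y ^ 3 \<le> K * (e * (e + y) powr \<theta> * y powr (1 - \<theta>) + y\<^sup>2)"
  shows "y \<le> 4 * K * e powr ((1 + \<theta>) / (2 + \<theta>))"
proof -
  let ?b = "(1 + \<theta>) / (2 + \<theta>)"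
  have eb: "1 \<le> e powr ?b" using e \<theta> by (simp add: ge_one_powr_ge_zero)
  have fin: "y \<le> 4 * K * e powr ?b" if "y \<le> 4 * K"
  proof -
    have "4 * K * 1 \<le> 4 * K * e powr ?b" by (rule mult_left_mono[OF eb]) (use K in simp)
    then show ?thesis using that by linarith
  qed
  have pm: "y powr a * y powr b = y powr (a + b)" for a b by (simp add: powr_add)
  show ?thesis
  proof (cases "e * (e + y) powr \<theta> * y powr (1 - \<theta>) \<le> y\<^sup>2")
    case True
    then have "y ^ 3 \<le> K * (y\<^sup>2 + y\<^sup>2)" using le K by (meson add_right_mono mult_left_mono order_trans zero_le_one)
    then have "y\<^sup>2 * y \<le> y\<^sup>2 * (2 * K)" by (simp add: power2_eq_square power3_eq_cube mult_ac)
    then have "y \<le> 2 * K" using y by simp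
    then show ?thesis using fin K by simp
  next
    case False
    then have "K * (e * (e + y) powr \<theta> * y powr (1 - \<theta>) + y\<^sup>2) \<le> K * (2 * (e * (e + y) powr \<theta> * y powr (1 - \<theta>)))"
      using K by (intro mult_left_mono) linarith+
    then have y3: "y ^ 3 \<le> 2 * K * (e * ((e + y) powr \<theta> * y powr (1 - \<theta>)))" using le by (simp add: mult_ac)
    show ?thesis
    proof (cases "e \<le> y")
      case True
      have "(e + y) powr \<theta> \<le> (2 * y) powr \<theta>" using True y e \<theta> by (intro powr_mono2) auto
      also have "\<dots> = 2 powr \<theta> * y powr \<theta>" by (rule powr_mult)
      also have "\<dots> \<le> 2 * y powr \<theta>" using powr_mono[of \<theta> 1 2] \<theta> by (intro mult_right_mono) auto
      finally have "(e + y) powr \<theta> * y powr (1 - \<theta>) \<le> 2 * y powr \<theta> * y powr (1 - \<theta>)" by (intro mult_right_mono) auto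
      also have "\<dots> = 2 * y" using y pm[of \<theta> "1 - \<theta>"] by simp
      finally have "e * ((e + y) powr \<theta> * y powr (1 - \<theta>)) \<le> y * (2 * y)"
        by (rule mult_mono[OF True]) (use y in auto)
      then have "2 * K * (e * ((e + y) powr \<theta> * y powr (1 - \<theta>))) \<le> 2 * K * (y * (2 * y))" using K by (intro mult_left_mono) auto
      then have "y\<^sup>2 * y \<le> y\<^sup>2 * (4 * K)" using y3 by (simp add: power2_eq_square power3_eq_cube mult_ac)
      then have "y \<le> 4 * K" using y by simp
      then show ?thesis by (rule fin)
    next
      case False
      have "(e + y) powr \<theta> \<le> (2 * e) powr \<theta>" using False y e \<theta> by (intro powr_mono2) auto
      also have "\<dots> = 2 powr \<theta> * e powr \<theta>" by (rule powr_mult)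
      also have "\<dots> \<le> 2 * e powr \<theta>" using powr_mono[of \<theta> 1 2] \<theta> by (intro mult_right_mono) auto
      finally have "e * ((e + y) powr \<theta> * y powr (1 - \<theta>)) \<le> e * (2 * e powr \<theta> * y powr (1 - \<theta>))" using e by (intro mult_left_mono mult_right_mono) auto
      then have "y ^ 3 \<le> 2 * K * (e * (2 * e powr \<theta> * y powr (1 - \<theta>)))" using y3 K by (smt (verit) mult_left_mono)
      also have "\<dots> = 4 * K * (e powr (1 + \<theta>) * y powr (1 - \<theta>))" using e powr_add[of e 1 \<theta>] by (simp add: mult_ac)
      finally have "y powr (2 + \<theta>) * y powr (1 - \<theta>) \<le> 4 * K * e powr (1 + \<theta>) * y powr (1 - \<theta>)"
        using y pm[of "2 + \<theta>" "1 - \<theta>"] by (simp add: mult_ac)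
      then have "y powr (2 + \<theta>) \<le> 4 * K * e powr (1 + \<theta>)" using y by simp
      then have "(y powr (2 + \<theta>)) powr (1 / (2 + \<theta>)) \<le> (4 * K * e powr (1 + \<theta>)) powr (1 / (2 + \<theta>))"
        using \<theta> by (intro powr_mono2) auto
      also have "\<dots> = (4 * K) powr (1 / (2 + \<theta>)) * e powr ?b" by (simp add: powr_mult powr_powr)
      also have "\<dots> \<le> (4 * K) powr 1 * e powr ?b" using K \<theta> by (intro mult_right_mono powr_mono) auto
      finally show ?thesis using y K \<theta> by (simp add: powr_powr)
    qed
  qed
qed

text \<open>The exponents match by design: the L^6 norm of order n^3 with weight \<theta>, the L^3
  norm of order n^4 with weight 1 - \<theta>, and the surplus n^\<theta> in the potential bound make
  exactly n^4.\<close>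

lemma interpolation_weight:
  fixes n \<theta> :: real
  assumes n: "0 < n"
  shows "(n ^ 3) powr \<theta> * (n ^ 4) powr (1 - \<theta>) * n powr \<theta> = n ^ 4"
proof -
  have "(n ^ 3) powr \<theta> = (n powr 3) powr \<theta>" "(n ^ 4) powr (1 - \<theta>) = (n powr 4) powr (1 - \<theta>)" using n by simp_all
  then have "(n ^ 3) powr \<theta> * (n ^ 4) powr (1 - \<theta>) * n powr \<theta> = n powr (3 * \<theta> + 4 * (1 - \<theta>) + \<theta>)"
    by (simp only: powr_powr powr_add)
  also have "3 * \<theta> + 4 * (1 - \<theta>) + \<theta> = 4" by simp
  finally show ?thesis using n by simp
qed

context unit_sol
begin

text \<open>Chosen once per pair of radii so that \<open>vY\<close> and \<open>vS\<close> are
  functions of the radii. It equals 1 up to the radius \<open>r'1\<close> of \<open>master\<close>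
  and uses the last quarter of the layer.\<close>

definition zt :: "real \<Rightarrow> real \<Rightarrow> real^3 \<Rightarrow> real" where
  "zt r r' = (SOME \<zeta>. is_cutoff (r + 3 * (r' - r) / 4) ((r' - r) / 4) \<zeta>)"

lemma zt:
  fixes r r' :: real
  assumes "1 \<le> r" "r < r'" "r' \<le> 2"
  shows "smooth3 (zt r r')" "0 \<le> zt r r' x" "zt r r' x \<le> 1" "norm x \<le> r + 3 * (r' - r) / 4 \<Longrightarrow> zt r r' x = 1"
    "norm x > r' \<Longrightarrow> zt r r' x = 0" "\<bar>pd i (zt r r') x\<bar> \<le> 32 * cutC / (r' - r) ^ 5"
proof -
  have "\<exists>\<zeta>. is_cutoff (r + 3 * (r' - r) / 4) ((r' - r) / 4) \<zeta>"
    by (rule cutoff_exists) (use assms in \<open>simp_all add: field_simps\<close>)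
  then have c: "is_cutoff (r + 3 * (r' - r) / 4) ((r' - r) / 4) (zt r r')" unfolding zt_def by (rule someI_ex)
  have e: "r + 3 * (r' - r) / 4 + (r' - r) / 4 = r'" by (simp add: field_simps)
  have b: "216 * 4 ^ 5 * bumpC / ((r' - r) / 4) ^ 5 = 32 * cutC / (r' - r) ^ 5" by (simp add: cutC_def power_divide)
  show "smooth3 (zt r r')" "0 \<le> zt r r' x" "zt r r' x \<le> 1" "norm x \<le> r + 3 * (r' - r) / 4 \<Longrightarrow> zt r r' x = 1"
    "norm x > r' \<Longrightarrow> zt r r' x = 0" "\<bar>pd i (zt r r') x\<bar> \<le> 32 * cutC / (r' - r) ^ 5"
    using c unfolding is_cutoff_def e b by blast+
qed

definition vY :: "real \<Rightarrow> real \<Rightarrow> real" where "vY r r' = Ln r' 3 (\<lambda>x. zt r r' x * va x)"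
definition vS :: "real \<Rightarrow> real \<Rightarrow> real" where "vS r r' = Ln r' 6 (\<lambda>x. zt r r' x ^ 2 * va x)"

lemma vYS_nonneg [simp]: "0 \<le> vY r r'" "0 \<le> vS r r'" by (auto simp: vY_def vS_def)

lemma vS_le:
  assumes "1 \<le> r" "r < r'" "r' \<le> 2"
  shows "vS r r' \<le> sC / (r' - r) ^ 5 * (Ln r' 2 vG + vY r r')"
  unfolding vS_def vY_def by (rule sobolev_estimate) (use assms zt[OF assms] in auto)

text \<open>\<open>q\<close> satisfies 1/2 = 1/s + 1/q, and 6/s - 1 is the weight of L^6 when L^q is
  interpolated with L^3. The range 3 < s \<le> 6 is what places this weight in [0,1).\<close>

lemma theta_exponents:
  fixes s q :: real
  assumes s: "3 < s" "s \<le> 6" and q: "q = 2 * s / (s - 2)"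
  shows "2 - 6 / q = 6 / s - 1" "6 / q - 1 = 1 - (6 / s - 1)" "3 \<le> q" "q \<le> 6" "0 \<le> 6 / s - 1" "6 / s - 1 < 1"
  using s unfolding q by (auto simp: field_simps)

lemma Qz_le:
  assumes r: "1 \<le> r" "r < r'" "r' \<le> 2" and q: "3 \<le> q" "q \<le> 6" and Y: "vY r r' \<le> Y" "0 < Y" and S: "vS r r' \<le> S" "0 < S"
  shows "Ln r' q (\<lambda>x. zt r r' x ^ 3 * va x) \<le> 2 * (S powr (2 - 6 / q) * Y powr (6 / q - 1))"
proof (rule Ln_interpolation[where f="\<lambda>x. zt r r' x * va x" and g="\<lambda>x. zt r r' x ^ 2 * va x"])
  note z = zt[OF r]
  have c: "contU (zt r r')" by (rule smooth3_cont[OF z(1)])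
  show "contU (\<lambda>x. zt r r' x ^ 3 * va x)" "contU (\<lambda>x. zt r r' x * va x)" "contU (\<lambda>x. zt r r' x ^ 2 * va x)"
    by (intro continuous_intros c)+
  show "\<bar>zt r r' x ^ 3 * va x\<bar> \<le> \<bar>zt r r' x * va x\<bar>" for x
    using z(2,3)[of x] power_decreasing[of 1 3 "zt r r' x"] by (simp add: abs_mult mult_right_mono)
  show "\<bar>zt r r' x ^ 3 * va x\<bar> \<le> \<bar>zt r r' x ^ 2 * va x\<bar>" for x
    using z(2,3)[of x] power_decreasing[of 2 3 "zt r r' x"] by (simp add: abs_mult mult_right_mono)
qed (use q Y S in \<open>auto simp: vY_def vS_def\<close>)

lemma cubic_integral_le:
  assumes r: "1 \<le> r" "r < r'" "r' \<le> 2" and s: "3 < s" "s \<le> 6" and q: "q = 2 * s / (s - 2)"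
  shows "(\<integral>x. vM x * (vG x * (zt r r' x ^ 3 * va x)) \<partial>BM r') \<le> Ln r' 2 vG * (Ln r' s vM * Ln r' q (\<lambda>x. zt r r' x ^ 3 * va x))"
proof -
  note z = zt[OF r]
  have c: "contU (zt r r')" by (rule smooth3_cont[OF z(1)])
  have qq: "1 / 2 = 1 / s + 1 / q" "0 < q" unfolding q using s by (auto simp: field_simps)
  have "(\<integral>x. vM x * (vG x * (zt r r' x ^ 3 * va x)) \<partial>BM r') = (\<integral>x. \<bar>vG x * (vM x * (zt r r' x ^ 3 * va x))\<bar> \<partial>BM r')"
    by (intro BM_cong) (simp add: abs_mult z(2) mult_ac)
  also have "\<dots> \<le> Ln r' 2 vG * Ln r' 2 (\<lambda>x. vM x * (zt r r' x ^ 3 * va x))"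
    by (rule Holder2) (intro continuous_intros c)+
  also have "\<dots> \<le> Ln r' 2 vG * (Ln r' s vM * Ln r' q (\<lambda>x. zt r r' x ^ 3 * va x))"
    using s qq by (intro mult_left_mono Ln_mult continuous_intros c) auto
  finally show ?thesis .
qed

text \<open>Sobolev and interpolation bounds inserted into \<open>cubic_estimate\<close> give an
  inequality in the normalised norm y alone, which \<open>cubic_absorb\<close> solves. With \<theta>
  = 6/s - 1 the exponent (1+\<theta>)/(2+\<theta>) becomes 6/(s+6), which is below 2/3.\<close>

lemma vY_bound:
  assumes r: "1 \<le> r" "r < r'" "r' \<le> 2" and s: "3 < s" "s \<le> 6" and n: "0 < n" "n \<le> 1" and e: "1 \<le> e" and M: "1 \<le> M"
    and A: "Ln r' 2 vG \<le> n ^ 3 * e" and m: "Ln r' s vM \<le> M * n ^ 5 * n powr (6 / s - 1)"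
    and K: "K = 2 * lC * M * sC / (r' - r) ^ 5"
  shows "vY r r' \<le> n ^ 4 * (4 * K * e powr (6 / (s + 6)))"
proof -
  define \<theta> where "\<theta> = 6 / s - 1"
  define q where "q = 2 * s / (s - 2)"
  define d where "d = r' - r"
  have d: "0 < d" "d \<le> 1" using r by (auto simp: d_def)
  note te = theta_exponents[OF s q_def, folded \<theta>_def]
  \<comment> \<open>The lower cap 1 is required by \<open>cubic_absorb\<close>; when it is attained,
    the cubic inequality holds because K and e are at least 1.\<close>
  define y where "y = max (vY r r' / n ^ 4) 1"
  have y: "1 \<le> y" "vY r r' \<le> n ^ 4 * y" using n by (auto simp: y_def field_simps max_def split: if_splits)
  define c5 where "c5 = sC / d ^ 5"
  have d5: "1 \<le> 1 / d ^ 5" using d power_le_one[of d 5] by simp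
  have "sC * 1 \<le> sC * (1 / d ^ 5)" using d5 lsC_ge_1 by (intro mult_left_mono) auto
  then have c5: "1 \<le> c5" using lsC_ge_1 by (simp add: c5_def)
  define m' where "m' = M * n ^ 5 * n powr \<theta>"
  have m': "Ln r' s vM \<le> m'" "0 \<le> m'" using m M n by (auto simp: m'_def \<theta>_def)
  have S: "vS r r' \<le> n ^ 3 * (c5 * (e + y))"
  proof -
    have "vS r r' \<le> c5 * (Ln r' 2 vG + vY r r')" using vS_le[OF r] by (simp add: c5_def d_def)
    also have "\<dots> \<le> c5 * (n ^ 3 * e + n ^ 3 * y)"
    proof (intro mult_left_mono add_mono A)
      have "n ^ 4 * y \<le> n ^ 3 * y" using n y power_decreasing[of 3 4 n] by (intro mult_right_mono) auto
      then show "vY r r' \<le> n ^ 3 * y" using y by linarith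
    qed (use c5 in auto)
    finally show ?thesis by (simp add: algebra_simps)
  qed
  have Sp: "0 < n ^ 3 * (c5 * (e + y))" and Yp: "0 < n ^ 4 * y" using n c5 e y by auto
  let ?Q = "Ln r' q (\<lambda>x. zt r r' x ^ 3 * va x)"
  have Q: "?Q \<le> 2 * ((n ^ 3 * (c5 * (e + y))) powr \<theta> * (n ^ 4 * y) powr (1 - \<theta>))"
    using Qz_le[OF r te(3,4) y(2) Yp S Sp] unfolding te(1,2) .
  have Qm: "m' * (2 * ((n ^ 3 * (c5 * (e + y))) powr \<theta> * (n ^ 4 * y) powr (1 - \<theta>))) \<le> n ^ 9 * (2 * M * c5 * ((e + y) powr \<theta> * y powr (1 - \<theta>)))"
  proof -
    have "m' * (2 * ((n ^ 3 * (c5 * (e + y))) powr \<theta> * (n ^ 4 * y) powr (1 - \<theta>))) =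
        n ^ 5 * ((n ^ 3) powr \<theta> * (n ^ 4) powr (1 - \<theta>) * n powr \<theta>) * (2 * M * c5 powr \<theta> * ((e + y) powr \<theta> * y powr (1 - \<theta>)))"
      by (simp add: m'_def powr_mult mult_ac)
    also have "\<dots> = n ^ 9 * (2 * M * c5 powr \<theta> * ((e + y) powr \<theta> * y powr (1 - \<theta>)))" unfolding interpolation_weight[OF n(1)] by simp
    also have "\<dots> \<le> n ^ 9 * (2 * M * c5 powr 1 * ((e + y) powr \<theta> * y powr (1 - \<theta>)))"
      using n M c5 te by (intro mult_left_mono mult_right_mono powr_mono) auto
    finally show ?thesis using c5 by simp
  qed
  have I: "(\<integral>x. vM x * (vG x * (zt r r' x ^ 3 * va x)) \<partial>BM r') \<le> n ^ 12 * (2 * M * c5 * (e * (e + y) powr \<theta> * y powr (1 - \<theta>)))"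
  proof -
    have "(\<integral>x. vM x * (vG x * (zt r r' x ^ 3 * va x)) \<partial>BM r') \<le> Ln r' 2 vG * (Ln r' s vM * ?Q)"
      by (rule cubic_integral_le[OF r s q_def])
    also have "\<dots> \<le> (n ^ 3 * e) * (m' * (2 * ((n ^ 3 * (c5 * (e + y))) powr \<theta> * (n ^ 4 * y) powr (1 - \<theta>))))"
      using n e m' by (intro mult_mono A Q m'(1)) auto
    also have "\<dots> \<le> (n ^ 3 * e) * (n ^ 9 * (2 * M * c5 * ((e + y) powr \<theta> * y powr (1 - \<theta>))))"
      using n e by (intro mult_left_mono Qm) auto
    finally show ?thesis by (simp add: mult_ac power_add[symmetric])
  qed
  have "vY r r' ^ 3 \<le> lC * ((\<integral>x. vM x * (vG x * (zt r r' x ^ 3 * va x)) \<partial>BM r') + Ln r' s vM * (vY r r')\<^sup>2 / d ^ 5)"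
    unfolding vY_def by (rule cubic_estimate) (use r s d zt[OF r] in \<open>auto simp: d_def\<close>)
  also have "\<dots> \<le> lC * (n ^ 12 * (2 * M * c5 * (e * (e + y) powr \<theta> * y powr (1 - \<theta>))) + n ^ 12 * (2 * M * c5 * y\<^sup>2))"
  proof (intro mult_left_mono add_mono I)
    have "m' \<le> M * n ^ 5 * 1" unfolding m'_def using M n te by (intro mult_left_mono) (auto intro!: powr_le1)
    then have "Ln r' s vM * (vY r r')\<^sup>2 \<le> (M * n ^ 5) * (n ^ 4 * y)\<^sup>2"
      using m' y n M by (intro mult_mono power_mono) auto
    also have "\<dots> = n ^ 13 * (M * y\<^sup>2)" by (simp add: power_mult_distrib power_mult[symmetric] mult_ac power_add[symmetric])
    also have "\<dots> \<le> n ^ 12 * (M * y\<^sup>2)" using n M power_decreasing[of 12 13 n] by (intro mult_right_mono) auto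
    finally have "Ln r' s vM * (vY r r')\<^sup>2 / d ^ 5 \<le> n ^ 12 * (M * y\<^sup>2) * (1 / d ^ 5)" using d by (simp add: divide_right_mono)
    also have "\<dots> \<le> n ^ 12 * (M * y\<^sup>2) * (2 * c5)"
    proof (rule mult_left_mono)
      have "1 * (1 / d ^ 5) \<le> (2 * sC) * (1 / d ^ 5)" using lsC_ge_1 d by (intro mult_right_mono) auto
      then show "1 / d ^ 5 \<le> 2 * c5" by (simp add: c5_def)
    qed (use n M in auto)
    finally show "Ln r' s vM * (vY r r')\<^sup>2 / d ^ 5 \<le> n ^ 12 * (2 * M * c5 * y\<^sup>2)" by (simp add: mult_ac)
  qed (use lsC_ge_1 in auto)
  also have "\<dots> = n ^ 12 * (K * (e * (e + y) powr \<theta> * y powr (1 - \<theta>) + y\<^sup>2))"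
    unfolding K c5_def d_def[symmetric] by (simp add: algebra_simps)
  finally have Y3: "vY r r' ^ 3 \<le> n ^ 12 * (K * (e * (e + y) powr \<theta> * y powr (1 - \<theta>) + y\<^sup>2))" .
  have K1: "1 \<le> K"
  proof -
    have "1 * 1 * 1 * 1 \<le> (2 * lC) * M * sC * (1 / d ^ 5)" using lsC_ge_1 M d5 by (intro mult_mono) auto
    then show ?thesis by (simp add: K d_def)
  qed
  have "y ^ 3 \<le> K * (e * (e + y) powr \<theta> * y powr (1 - \<theta>) + y\<^sup>2)"
  proof (cases "y = 1")
    case True
    then have "1 * 1 \<le> K * (e * (e + y) powr \<theta> * y powr (1 - \<theta>) + y\<^sup>2)" using K1 e by (intro mult_mono) auto
    then show ?thesis using True by simp
  next
    case False
    then have "vY r r' = n ^ 4 * y" using n by (auto simp: y_def max_def split: if_splits)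
    then have "n ^ 12 * y ^ 3 \<le> n ^ 12 * (K * (e * (e + y) powr \<theta> * y powr (1 - \<theta>) + y\<^sup>2))"
      using Y3 by (simp add: power_mult_distrib power_mult[symmetric])
    then show ?thesis using n by simp
  qed
  from cubic_absorb[OF y(1) e K1 te(5,6) this]
  have "y \<le> 4 * K * e powr ((1 + \<theta>) / (2 + \<theta>))" .
  also have "(1 + \<theta>) / (2 + \<theta>) = 6 / (s + 6)" using s by (simp add: \<theta>_def field_simps)
  finally have "n ^ 4 * y \<le> n ^ 4 * (4 * K * e powr (6 / (s + 6)))" using n by (intro mult_left_mono) auto
  then show ?thesis using y by linarith
qed

text \<open>\<open>master\<close> with \<delta> = l n^2, the scale at which the viscous cost of the
  corrector and the convective error of the mollification both have order n^12. After division by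
  \<nu> = n^6 a common n^6 is left; only the Hall term keeps an explicit negative power of
  n.\<close>

lemma unit_energy:
  assumes r: "1 \<le> r" "r < r'" "r' \<le> 2" and s: "3 < s" "s \<le> 6" and n: "0 < n" "n \<le> 1" "\<nu> = n ^ 6" and e: "1 \<le> e" and M: "1 \<le> M"
    and A: "Ln r' 2 vG \<le> n ^ 3 * e" and m: "Ln r' s vM \<le> M * n ^ 5 * n powr (6 / s - 1)"
    and Y: "vY r r' \<le> n ^ 4 * y" "0 < y" and S: "vS r r' \<le> n ^ 3 * \<sigma>" "0 < \<sigma>"
    and l: "0 < l" "l * n\<^sup>2 \<le> (r' - r) / 16"
    and Z: "Z = Ln (r + 3 * (r' - r) / 4) 4 vb"
  shows "(Ln r 2 vG)\<^sup>2 \<le> n ^ 6 * (mC / (r' - r) ^ 9 * ((1 + M) * e * y + y ^ 3 + M * e / l + l * n\<^sup>2 * e\<^sup>2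
      + 2 * M * e * (\<sigma> powr (6 / s - 1) * y powr (1 - (6 / s - 1))) + l * y * e\<^sup>2 + e * Z\<^sup>2 / n ^ 3))"
proof -
  define \<theta> where "\<theta> = 6 / s - 1"
  define q where "q = 2 * s / (s - 2)"
  define d where "d = r' - r"
  define r'1 where "r'1 = r + 3 * d / 4"
  have d: "0 < d" "d \<le> 1" using r by (auto simp: d_def)
  have r'1: "r'1 \<le> r'" using r by (simp add: r'1_def d_def field_simps)
  note te = theta_exponents[OF s q_def, folded \<theta>_def]
  note z = zt[OF r]
  have cz: "contU (zt r r')" by (rule smooth3_cont[OF z(1)])
  define A' where "A' = Ln r' 2 vG"
  define m' where "m' = Ln r' s vM"
  define X where "X = Ln r'1 3 va"
  define Q where "Q = Ln r'1 q va"
  define \<delta> where "\<delta> = l * n\<^sup>2"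
  have \<delta>: "0 < \<delta>" "\<delta> \<le> d / 16" using l n by (auto simp: \<delta>_def d_def)
  have nn: "0 \<le> A'" "0 \<le> m'" "0 \<le> X" "0 \<le> Q" by (auto simp: A'_def m'_def X_def Q_def)
  have XY: "X \<le> n ^ 4 * y"
  proof -
    have "X = Ln r'1 3 (\<lambda>x. zt r r' x * va x)" unfolding X_def by (rule Ln_cong) (simp add: z(4) r'1_def d_def)
    also have "\<dots> \<le> vY r r'" unfolding vY_def using r'1 by (intro Ln_radius_mono continuous_intros cz) auto
    finally show ?thesis using Y by linarith
  qed
  have QQ: "Q \<le> 2 * ((n ^ 3 * \<sigma>) powr \<theta> * (n ^ 4 * y) powr (1 - \<theta>))"
  proof -
    have "Q = Ln r'1 q (\<lambda>x. zt r r' x ^ 3 * va x)" unfolding Q_def by (rule Ln_cong) (simp add: z(4) r'1_def d_def)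
    also have "\<dots> \<le> Ln r' q (\<lambda>x. zt r r' x ^ 3 * va x)" using r'1 te by (intro Ln_radius_mono continuous_intros cz) auto
    also have "\<dots> \<le> 2 * ((n ^ 3 * \<sigma>) powr \<theta> * (n ^ 4 * y) powr (1 - \<theta>))"
      using Qz_le[OF r te(3,4) Y(1) _ S(1)] n Y S unfolding te(1,2) by simp
    finally show ?thesis .
  qed
  have mm: "m' \<le> M * n ^ 5"
  proof -
    have "m' \<le> M * n ^ 5 * n powr \<theta>" using m by (simp add: m'_def \<theta>_def)
    also have "\<dots> \<le> M * n ^ 5 * 1" using M n te by (intro mult_left_mono) (auto intro!: powr_le1)
    finally show ?thesis by simp
  qed
  have A3: "A' \<le> n ^ 3 * e" using A by (simp add: A'_def)
  have t1: "n ^ 6 * A' * X \<le> n ^ 12 * (e * y)"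
  proof -
    have "n ^ 6 * A' * X \<le> n ^ 6 * (n ^ 3 * e) * (n ^ 4 * y)" using n e nn by (intro mult_mono A3 XY) auto
    also have "\<dots> = n ^ 13 * (e * y)" by (simp add: mult_ac power_add[symmetric])
    also have "\<dots> \<le> n ^ 12 * (e * y)" using n e Y power_decreasing[of 12 13 n] by (intro mult_right_mono) auto
    finally show ?thesis .
  qed
  have t2: "X ^ 3 \<le> n ^ 12 * y ^ 3"
    using power_mono[OF XY nn(3), of 3] by (simp add: power_mult_distrib power_mult[symmetric])
  have t3: "n ^ 6 * A' * (m' / \<delta>) \<le> n ^ 12 * (M * e / l)"
  proof -
    have "n ^ 6 * A' * (m' / \<delta>) \<le> n ^ 6 * (n ^ 3 * e) * (M * n ^ 5 / \<delta>)"
      using n e nn \<delta> by (intro mult_mono A3 divide_right_mono mm) auto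
    also have "\<dots> = n ^ 12 * (M * e / l)" using n l by (simp add: \<delta>_def field_simps power_add[symmetric])
    finally show ?thesis .
  qed
  have t4: "n ^ 6 * A' * (\<delta> * A') \<le> n ^ 12 * (l * n\<^sup>2 * e\<^sup>2)"
  proof -
    have "n ^ 6 * A' * (\<delta> * A') \<le> n ^ 6 * (n ^ 3 * e) * (\<delta> * (n ^ 3 * e))"
      using n e nn \<delta> by (intro mult_mono A3) auto
    also have "\<dots> = n ^ 12 * (l * n\<^sup>2 * e\<^sup>2)" by (simp add: \<delta>_def power2_eq_square[of e] mult_ac power_add[symmetric])
    finally show ?thesis .
  qed
  have t5: "A' * m' * Q \<le> n ^ 12 * (2 * M * e * (\<sigma> powr \<theta> * y powr (1 - \<theta>)))"
  proof -
    have "A' * m' * Q \<le> (n ^ 3 * e) * (M * n ^ 5 * n powr \<theta>) * (2 * ((n ^ 3 * \<sigma>) powr \<theta> * (n ^ 4 * y) powr (1 - \<theta>)))"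
      using n e nn M m by (intro mult_mono A3 QQ) (auto simp: m'_def \<theta>_def)
    also have "\<dots> = n ^ 8 * ((n ^ 3) powr \<theta> * (n ^ 4) powr (1 - \<theta>) * n powr \<theta>) * (2 * M * e * (\<sigma> powr \<theta> * y powr (1 - \<theta>)))"
      by (simp add: powr_mult mult_ac power_add[symmetric])
    also have "\<dots> = n ^ 12 * (2 * M * e * (\<sigma> powr \<theta> * y powr (1 - \<theta>)))" unfolding interpolation_weight[OF n(1)] by (simp add: power_add[symmetric])
    finally show ?thesis .
  qed
  have t6: "A' * X * (\<delta> * A') \<le> n ^ 12 * (l * y * e\<^sup>2)"
  proof -
    have "A' * X * (\<delta> * A') \<le> (n ^ 3 * e) * (n ^ 4 * y) * (\<delta> * (n ^ 3 * e))"
      using n e nn \<delta> Y by (intro mult_mono A3 XY) auto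
    also have "\<dots> = n ^ 12 * (l * y * e\<^sup>2)" by (simp add: \<delta>_def power2_eq_square[of e] mult_ac power_add[symmetric])
    finally show ?thesis .
  qed
  have t7: "A' * X * m' \<le> n ^ 12 * (M * e * y)"
  proof -
    have "A' * X * m' \<le> (n ^ 3 * e) * (n ^ 4 * y) * (M * n ^ 5)" using n e nn Y by (intro mult_mono A3 XY mm) auto
    also have "\<dots> = n ^ 12 * (M * e * y)" by (simp add: mult_ac power_add[symmetric])
    finally show ?thesis .
  qed
  have t8: "n ^ 6 * A' * Z\<^sup>2 \<le> n ^ 12 * (e * Z\<^sup>2 / n ^ 3)"
  proof -
    have "n ^ 6 * A' * Z\<^sup>2 \<le> n ^ 6 * (n ^ 3 * e) * Z\<^sup>2" using n e nn by (intro mult_right_mono mult_left_mono A3) auto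
    also have "\<dots> = n ^ 12 * (e * Z\<^sup>2 / n ^ 3)" using n by (simp add: field_simps power_add[symmetric])
    finally show ?thesis .
  qed
  define T where "T = (1 + M) * e * y + y ^ 3 + M * e / l + l * n\<^sup>2 * e\<^sup>2 + 2 * M * e * (\<sigma> powr \<theta> * y powr (1 - \<theta>)) + l * y * e\<^sup>2 + e * Z\<^sup>2 / n ^ 3"
  have "n ^ 6 * (Ln r 2 vG)\<^sup>2 \<le> mC / d ^ 9 * (\<nu> * A' * X + X ^ 3 + \<nu> * A' * (m' / \<delta> + \<delta> * A') + A' * m' * Q + A' * X * (\<delta> * A' + m') + \<nu> * A' * Z\<^sup>2)"
    using master[OF r d_def \<delta> s(1) q_def r'1_def] n(3) by (simp add: A'_def m'_def X_def Q_def Z r'1_def d_def)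
  also have "\<dots> \<le> mC / d ^ 9 * (n ^ 12 * T)"
  proof (rule mult_left_mono)
    show "\<nu> * A' * X + X ^ 3 + \<nu> * A' * (m' / \<delta> + \<delta> * A') + A' * m' * Q + A' * X * (\<delta> * A' + m') + \<nu> * A' * Z\<^sup>2 \<le> n ^ 12 * T"
      unfolding n(3) T_def distrib_left distrib_right
      using t1 t2 t3 t4 t5 t6 t7 t8 by (simp add: mult.assoc)
  qed (use mC_pos d in auto)
  also have "\<dots> = n ^ 6 * (n ^ 6 * (mC / d ^ 9 * T))" by (simp add: mult_ac power_add[symmetric])
  finally have "(Ln r 2 vG)\<^sup>2 \<le> n ^ 6 * (mC / d ^ 9 * T)" by (rule mult_left_le_imp_le) (use n in simp)
  then show ?thesis unfolding T_def \<theta>_def d_def .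
qed

end

text \<open>\<open>k0\<close> is the constant of \<open>vY_bound\<close> without its power of the
  layer width. \<open>w0\<close> is the square of 1/(8 (mC + 1)), so that a bound of Z^4 by n^6 e^2
  \<open>w0\<close> times d^18 makes the Hall term at most e^2/8. \<open>j0\<close> and
  \<open>t0\<close> fix the two thresholds used for this in \<open>stage1\<close>.\<close>

definition "k0 M = 2 * lC * M * sC"
definition "c2 M = mC * ((1 + M) * (4 * k0 M) + 64 * k0 M ^ 3 + 10 * M * k0 M * sC + 80 * M * k0 M * (mC + 1))"
definition "w0 = 1 / (64 * (mC + 1)\<^sup>2)"
definition "j0 M = 2 * (5 * k0 M * sC) ^ 3 / sqrt w0"
definition "t0 M = w0 / (256 * k0 M ^ 3)"

lemma k0_ge: "1 \<le> M \<Longrightarrow> 2 \<le> k0 M"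
proof -
  assume M: "1 \<le> M"
  have "2 * 1 * 1 * 1 \<le> 2 * lC * M * sC" using M lsC_ge_1 by (intro mult_mono) auto
  then show ?thesis by (simp add: k0_def)
qed

lemma c2_pos: "1 \<le> M \<Longrightarrow> 0 < c2 M"
  using k0_ge[of M] mC_pos lsC_ge_1 by (auto simp: c2_def intro!: mult_pos_pos add_pos_nonneg)

lemma w0: "0 < w0" "w0 \<le> 1"
proof -
  have "1 \<le> (mC + 1)\<^sup>2" using mC_pos by (intro one_le_power) auto
  then have "1 \<le> 64 * (mC + 1)\<^sup>2" by linarith
  then show "0 < w0" "w0 \<le> 1" by (auto simp: w0_def divide_le_eq)
qed

text \<open>Small values are paid for by L^3 and large ones by L^6; only the middle range calls on
  L^p. The exponent 4 - p may have either sign, so the powers at both endpoints are added.\<close>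

lemma quartic_split:
  fixes h L1 L2 p :: real
  assumes h: "0 \<le> h" and L: "0 < L1" "L1 \<le> L2" and p: "0 < p"
  shows "h ^ 4 \<le> L1 * h ^ 3 + h ^ 6 / L2\<^sup>2 + (L1 powr (4 - p) + L2 powr (4 - p)) * h powr p"
proof -
  have nn: "0 \<le> L1 * h ^ 3" "0 \<le> h ^ 6 / L2\<^sup>2" "0 \<le> (L1 powr (4 - p) + L2 powr (4 - p)) * h powr p" using h L by auto
  consider "h \<le> L1" | "L2 \<le> h" | "L1 < h" "h < L2" by linarith
  then show ?thesis
  proof cases
    case 1
    then have "h * h ^ 3 \<le> L1 * h ^ 3" using h by (intro mult_right_mono) auto
    then have "h ^ 4 \<le> L1 * h ^ 3" by (simp add: power_Suc[symmetric] del: power_Suc)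
    then show ?thesis using nn by linarith
  next
    case 2
    then have "L2\<^sup>2 \<le> h\<^sup>2" using L by (intro power_mono) auto
    then have "h ^ 4 * L2\<^sup>2 \<le> h ^ 4 * h\<^sup>2" using h by (intro mult_left_mono) auto
    then have "h ^ 4 \<le> h ^ 6 / L2\<^sup>2" using L by (simp add: field_simps power_add[symmetric])
    then show ?thesis using nn by linarith
  next
    case 3
    then have hp: "h > 0" using L by linarith
    have "h powr (4 - p) \<le> L1 powr (4 - p) + L2 powr (4 - p)"
    proof (cases "4 - p \<ge> 0")
      case True
      then have "h powr (4 - p) \<le> L2 powr (4 - p)" using 3 hp by (intro powr_mono2) auto
      then show ?thesis by (smt (verit) powr_ge_zero)
    next
      case False
      then have "h powr (4 - p) \<le> L1 powr (4 - p)" using 3 L by (intro powr_mono2') auto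
      then show ?thesis by (smt (verit) powr_ge_zero)
    qed
    then have "h powr (4 - p) * h powr p \<le> (L1 powr (4 - p) + L2 powr (4 - p)) * h powr p" by (intro mult_right_mono) auto
    then have "h ^ 4 \<le> (L1 powr (4 - p) + L2 powr (4 - p)) * h powr p" using hp by (simp add: powr_add[symmetric])
    then show ?thesis using nn by linarith
  qed
qed

context unit_sol
begin

lemma vS_bound:
  assumes r: "1 \<le> r" "r < r'" "r' \<le> 2" and s: "3 < s" "s \<le> 6" and n: "0 < n" "n \<le> 1" and e: "1 \<le> e" and M: "1 \<le> M"
    and A: "Ln r' 2 vG \<le> n ^ 3 * e" and m: "Ln r' s vM \<le> M * n ^ 5 * n powr (6 / s - 1)"
    and K: "K = k0 M / (r' - r) ^ 5"
  shows "vS r r' \<le> n ^ 3 * (5 * K * (sC / (r' - r) ^ 5) * e)" "vY r r' \<le> n ^ 4 * (4 * K * e powr (6 / (s + 6)))" "1 \<le> K" "1 \<le> sC / (r' - r) ^ 5"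
proof -
  define d where "d = r' - r"
  have d: "0 < d" "d \<le> 1" using r by (auto simp: d_def)
  have d5: "1 \<le> 1 / d ^ 5" using d power_le_one[of d 5] by simp
  have "1 * 1 \<le> k0 M * (1 / d ^ 5)" using d5 k0_ge[OF M] by (intro mult_mono) auto
  then show K1: "1 \<le> K" by (simp add: K d_def)
  have "1 * 1 \<le> sC * (1 / d ^ 5)" using d5 lsC_ge_1 by (intro mult_mono) auto
  then show c5: "1 \<le> sC / (r' - r) ^ 5" by (simp add: d_def)
  show Y: "vY r r' \<le> n ^ 4 * (4 * K * e powr (6 / (s + 6)))"
    by (rule vY_bound[OF r s n e M A m]) (simp add: K k0_def)
  have "e powr (6 / (s + 6)) \<le> e powr 1" using e s by (intro powr_mono) auto
  then have ye: "4 * K * e powr (6 / (s + 6)) \<le> 4 * K * e" using e K1 by (intro mult_left_mono) auto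
  have "vS r r' \<le> sC / (r' - r) ^ 5 * (Ln r' 2 vG + vY r r')" by (rule vS_le[OF r])
  also have "\<dots> \<le> sC / (r' - r) ^ 5 * (n ^ 3 * (K * e) + n ^ 3 * (4 * K * e))"
  proof (intro mult_left_mono add_mono)
    have "n ^ 3 * (1 * e) \<le> n ^ 3 * (K * e)" using n e K1 by (intro mult_left_mono mult_right_mono) auto
    then show "Ln r' 2 vG \<le> n ^ 3 * (K * e)" using A by simp
    have "n ^ 4 * (4 * K * e powr (6 / (s + 6))) \<le> n ^ 3 * (4 * K * e)"
      using n e K1 ye power_decreasing[of 3 4 n] by (intro mult_mono) auto
    then show "vY r r' \<le> n ^ 3 * (4 * K * e)" using Y by linarith
  qed (use c5 in linarith)
  also have "\<dots> = n ^ 3 * (5 * K * (sC / (r' - r) ^ 5) * e)" by (simp add: algebra_simps)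
  finally show "vS r r' \<le> n ^ 3 * (5 * K * (sC / (r' - r) ^ 5) * e)" .
qed

text \<open>All non-Hall terms are brought to the single subquadratic power e^(3 bt), apart from
  \<epsilon> e^2. Choosing \<open>l\<close> proportional to e^(-bt) makes l y e^2 a small multiple
  of e^2; the price M e / l is then of order e^(1 + bt), at most e^(3 bt) because bt \<ge>
  1/2.\<close>

lemma energy_bound:
  assumes r: "1 \<le> r" "r < r'" "r' \<le> 2" and s: "3 < s" "s \<le> 6" and n: "0 < n" "n \<le> 1" "\<nu> = n ^ 6" and e: "1 \<le> e" and M: "1 \<le> M"
    and A: "Ln r' 2 vG \<le> n ^ 3 * e" and m: "Ln r' s vM \<le> M * n ^ 5 * n powr (6 / s - 1)"
    and \<epsilon>: "0 < \<epsilon>" "\<epsilon> \<le> 1" and d: "d = r' - r" and Z: "Z = Ln (r + 3 * d / 4) 4 vb" and bt: "bt = 6 / (s + 6)"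
  shows "(Ln r 2 vG)\<^sup>2 \<le> n ^ 6 * (c2 M / (\<epsilon> * d ^ 24) * e powr (3 * bt) + \<epsilon> * e\<^sup>2 + mC / d ^ 9 * (e * Z\<^sup>2 / n ^ 3))"
proof -
  define \<theta> where "\<theta> = 6 / s - 1"
  have dp: "0 < d" "d \<le> 1" using r d by auto
  define K where "K = k0 M / d ^ 5"
  define c5 where "c5 = sC / d ^ 5"
  note vs = vS_bound[OF r s n(1,2) e M A m K_def[unfolded d], folded bt d, folded c5_def]
  have K1: "1 \<le> K" by (rule vs(3))
  have c51: "1 \<le> c5" by (rule vs(4))
  define y where "y = 4 * K * e powr bt"
  define \<sigma> where "\<sigma> = 5 * K * c5 * e"
  have btb: "1/2 \<le> bt" "bt < 2/3" using s by (auto simp: bt field_simps)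
  have eb: "1 \<le> e powr bt" using e btb by (simp add: ge_one_powr_ge_zero)
  have p: "0 < y" "0 < \<sigma>" using K1 c51 e eb by (auto simp: y_def \<sigma>_def)
  define ee where "ee = \<epsilon> * d ^ 10 / (80 * (mC + 1))"
  have d10: "d ^ 10 \<le> d" using dp power_decreasing[of 1 10 d] by simp
  have ee: "0 < ee" "ee \<le> d / 16"
  proof -
    show "0 < ee" using \<epsilon> dp mC_pos by (simp add: ee_def)
    have "ee = (\<epsilon> * d ^ 10) * (1 / (80 * (mC + 1)))" by (simp add: ee_def)
    also have "\<dots> \<le> (1 * d) * (1 / 16)" using \<epsilon> dp d10 mC_pos by (intro mult_mono) (auto simp: divide_le_cancel field_simps)
    finally show "ee \<le> d / 16" by simp
  qed
  define l where "l = ee / (K * e powr bt)"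
  have Ke: "1 \<le> K * e powr bt" using mult_mono[of 1 K 1 "e powr bt"] K1 eb by simp
  have l: "0 < l" "l \<le> ee" using ee Ke by (auto simp: l_def field_simps)
  have ln: "l * n\<^sup>2 \<le> d / 16"
  proof -
    have "l * n\<^sup>2 \<le> l * 1" using n l power_le_one[of n 2] by (intro mult_left_mono) auto
    then show ?thesis using l ee by linarith
  qed
  have ue: "(Ln r 2 vG)\<^sup>2 \<le> n ^ 6 * (mC / d ^ 9 * ((1 + M) * e * y + y ^ 3 + M * e / l + l * n\<^sup>2 * e\<^sup>2
      + 2 * M * e * (\<sigma> powr \<theta> * y powr (1 - \<theta>)) + l * y * e\<^sup>2 + e * Z\<^sup>2 / n ^ 3))"
    unfolding \<theta>_def d
    by (rule unit_energy[OF r s n e M A m]) (use vs(1,2) p l ln in \<open>auto simp: y_def \<sigma>_def d Z\<close>)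
  define E3 where "E3 = e powr (3 * bt)"
  have E3: "e * e powr bt \<le> E3"
  proof -
    have "e * e powr bt = e powr (1 + bt)" using e powr_add[of e 1 bt] by simp
    also have "\<dots> \<le> E3" unfolding E3_def using e btb by (intro powr_mono) auto
    finally show ?thesis .
  qed
  have E30: "0 \<le> E3" by (simp add: E3_def)
  have te: "0 \<le> \<theta>" "\<theta> < 1" using s by (auto simp: \<theta>_def field_simps)
  \<comment> \<open>The interpolated convective term has exactly the same homogeneity in e as the
    cubic flux.\<close>
  have te3: "1 + \<theta> + bt * (1 - \<theta>) = 3 * bt"
  proof -
    have "1 + \<theta> + bt * (1 - \<theta>) = 6 / s + 6 / (s + 6) * (2 - 6 / s)" by (simp add: \<theta>_def bt)
    also have "\<dots> = 3 * (6 / (s + 6))" using s by (simp add: divide_simps)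
    finally show ?thesis by (simp add: bt)
  qed
  have t1: "(1 + M) * e * y \<le> (1 + M) * (4 * K) * E3"
    using mult_left_mono[OF E3, of "(1 + M) * (4 * K)"] M K1 by (simp add: y_def mult_ac)
  have t2: "y ^ 3 = 64 * K ^ 3 * E3"
  proof -
    have "(e powr bt) ^ 3 = (e powr bt) powr 3" using e by simp
    also have "\<dots> = E3" unfolding powr_powr E3_def by (simp add: mult.commute)
    finally show ?thesis by (simp add: y_def power_mult_distrib)
  qed
  have t3: "M * e / l \<le> M * K / ee * E3"
  proof -
    have "M * e / l = (M * K / ee) * (e * e powr bt)" using ee K1 by (simp add: l_def mult_ac)
    also have "\<dots> \<le> (M * K / ee) * E3" using M K1 ee by (intro mult_left_mono E3) auto
    finally show ?thesis .
  qed
  have t4: "l * n\<^sup>2 * e\<^sup>2 \<le> ee * e\<^sup>2"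
  proof (rule mult_right_mono)
    have "l * n\<^sup>2 \<le> l * 1" using n l power_le_one[of n 2] by (intro mult_left_mono) auto
    then show "l * n\<^sup>2 \<le> ee" using l by linarith
  qed simp
  have t5: "2 * M * e * (\<sigma> powr \<theta> * y powr (1 - \<theta>)) \<le> 10 * M * K * c5 * E3"
  proof -
    let ?c = "5 * K * c5"
    have c1: "4 * K \<le> ?c" using K1 c51 mult_left_mono[of 1 c5 "5 * K"] by simp
    have "\<sigma> powr \<theta> * y powr (1 - \<theta>) = ?c powr \<theta> * (4 * K) powr (1 - \<theta>) * (e powr \<theta> * (e powr bt) powr (1 - \<theta>))"
      by (simp add: \<sigma>_def y_def powr_mult mult_ac)
    also have "\<dots> \<le> ?c powr \<theta> * ?c powr (1 - \<theta>) * (e powr \<theta> * (e powr bt) powr (1 - \<theta>))"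
      using c1 K1 te by (intro mult_right_mono mult_left_mono powr_mono2) auto
    also have "?c powr \<theta> * ?c powr (1 - \<theta>) = ?c" using K1 c51 powr_add[of ?c \<theta> "1 - \<theta>"] by simp
    also have "e powr \<theta> * (e powr bt) powr (1 - \<theta>) = e powr (\<theta> + bt * (1 - \<theta>))" by (simp add: powr_powr powr_add)
    finally have "2 * M * e * (\<sigma> powr \<theta> * y powr (1 - \<theta>)) \<le> 2 * M * e * (?c * e powr (\<theta> + bt * (1 - \<theta>)))"
      using M e by (intro mult_left_mono) auto
    also have "\<dots> = 10 * M * K * c5 * (e powr 1 * e powr (\<theta> + bt * (1 - \<theta>)))" using e by (simp add: mult_ac)
    also have "e powr 1 * e powr (\<theta> + bt * (1 - \<theta>)) = E3" unfolding powr_add[symmetric] E3_def te3[symmetric] by (simp add: add.assoc)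
    finally show ?thesis .
  qed
  have t6: "l * y * e\<^sup>2 = 4 * ee * e\<^sup>2" using K1 eb by (simp add: l_def y_def)
  define T where "T = (1 + M) * (4 * K) + 64 * K ^ 3 + M * K / ee + 10 * M * K * c5"
  have "(1 + M) * e * y + y ^ 3 + M * e / l + l * n\<^sup>2 * e\<^sup>2 + 2 * M * e * (\<sigma> powr \<theta> * y powr (1 - \<theta>)) + l * y * e\<^sup>2 + e * Z\<^sup>2 / n ^ 3
     \<le> T * E3 + 5 * ee * e\<^sup>2 + e * Z\<^sup>2 / n ^ 3"
  proof -
    have "T * E3 = (1 + M) * (4 * K) * E3 + 64 * K ^ 3 * E3 + M * K / ee * E3 + 10 * M * K * c5 * E3"
      by (simp add: T_def distrib_right)
    then show ?thesis using t1 t2 t3 t4 t5 t6 by linarith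
  qed
  then have "(Ln r 2 vG)\<^sup>2 \<le> n ^ 6 * (mC / d ^ 9 * (T * E3 + 5 * ee * e\<^sup>2 + e * Z\<^sup>2 / n ^ 3))"
    using n mC_pos dp by (intro order_trans[OF ue] mult_left_mono) auto
  also have "\<dots> \<le> n ^ 6 * (c2 M / (\<epsilon> * d ^ 24) * E3 + \<epsilon> * e\<^sup>2 + mC / d ^ 9 * (e * Z\<^sup>2 / n ^ 3))"
  proof (rule mult_left_mono)
    have "mC / d ^ 9 * (5 * ee) \<le> \<epsilon>"
    proof -
      have "mC / d ^ 9 * (5 * (\<epsilon> * (d ^ 9 * d) / (80 * (mC + 1)))) = \<epsilon> * (d * (mC / (16 * (mC + 1))))" using dp mC_pos by (simp add: divide_simps)
      then have "mC / d ^ 9 * (5 * ee) = \<epsilon> * (d * (mC / (16 * (mC + 1))))" using power_add[of d 9 1] by (simp add: ee_def)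
      also have "\<dots> \<le> \<epsilon> * (1 * 1)" using \<epsilon> dp mC_pos by (intro mult_left_mono mult_mono) (auto simp: field_simps)
      finally show ?thesis by simp
    qed
    then have 1: "mC / d ^ 9 * (5 * ee) * e\<^sup>2 \<le> \<epsilon> * e\<^sup>2" by (intro mult_right_mono) auto
    have T: "mC / d ^ 9 * T \<le> c2 M / (\<epsilon> * d ^ 24)"
    proof -
      \<comment> \<open>Every loss is at most d^(-15), reached by K^3; with the d^(-9) of
        \<open>master\<close> this explains d^24.\<close>
      have i: "1 / d ^ k \<le> 1 / (\<epsilon> * d ^ 15)" if "k \<le> 15" for k
      proof (rule divide_left_mono)
        have "\<epsilon> * d ^ 15 \<le> 1 * d ^ k" using \<epsilon> dp power_decreasing[OF that, of d] by (intro mult_mono) auto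
        then show "\<epsilon> * d ^ 15 \<le> d ^ k" by simp
      qed (use \<epsilon> dp in auto)
      have k: "2 \<le> k0 M" by (rule k0_ge[OF M])
      have "T = ((1 + M) * (4 * k0 M)) * (1 / d ^ 5) + (64 * k0 M ^ 3) * (1 / d ^ 15) + (80 * M * k0 M * (mC + 1)) * (1 / (\<epsilon> * d ^ 15)) + (10 * M * k0 M * sC) * (1 / d ^ 10)"
        using dp \<epsilon> mC_pos by (simp add: T_def K_def c5_def ee_def power_divide power_mult[symmetric] power_add[symmetric] field_simps)
      also have "\<dots> \<le> ((1 + M) * (4 * k0 M)) * (1 / (\<epsilon> * d ^ 15)) + (64 * k0 M ^ 3) * (1 / (\<epsilon> * d ^ 15)) + (80 * M * k0 M * (mC + 1)) * (1 / (\<epsilon> * d ^ 15)) + (10 * M * k0 M * sC) * (1 / (\<epsilon> * d ^ 15))"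
        using M k lsC_ge_1 by (intro add_mono mult_left_mono i order_refl) auto
      finally have "mC / d ^ 9 * T \<le> mC / d ^ 9 * (((1 + M) * (4 * k0 M)) * (1 / (\<epsilon> * d ^ 15)) + (64 * k0 M ^ 3) * (1 / (\<epsilon> * d ^ 15)) + (80 * M * k0 M * (mC + 1)) * (1 / (\<epsilon> * d ^ 15)) + (10 * M * k0 M * sC) * (1 / (\<epsilon> * d ^ 15)))"
        using mC_pos dp by (intro mult_left_mono) auto
      also have "\<dots> = c2 M / (\<epsilon> * d ^ 24)"
        by (simp add: c2_def add_divide_distrib distrib_left mult_ac power_add[symmetric])
      finally show ?thesis .
    qed
    have 2: "mC / d ^ 9 * T * E3 \<le> c2 M / (\<epsilon> * d ^ 24) * E3" by (rule mult_right_mono[OF T E30])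
    show "mC / d ^ 9 * (T * E3 + 5 * ee * e\<^sup>2 + e * Z\<^sup>2 / n ^ 3) \<le> c2 M / (\<epsilon> * d ^ 24) * E3 + \<epsilon> * e\<^sup>2 + mC / d ^ 9 * (e * Z\<^sup>2 / n ^ 3)"
      unfolding distrib_left mult.assoc[symmetric] using 1 2 by (simp add: mult.assoc)
  qed (use n in auto)
  finally show ?thesis by (simp add: E3_def)
qed

text \<open>At exponent 4 the interpolation between L^3 and L^6 has both weights equal to 1/2. No
  hypothesis on the oscillation of the field enters.\<close>

lemma hall_Z:
  assumes r: "1 \<le> r" "r < r'" "r' \<le> 2" and Y: "vY r r' \<le> Y" "0 < Y" and S: "vS r r' \<le> S" "0 < S"
  shows "(Ln (r + 3 * (r' - r) / 4) 4 vb)\<^sup>2 \<le> 4 * (S * Y)"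
proof -
  note z = zt[OF r]
  have c: "contU (zt r r')" by (rule smooth3_cont[OF z(1)])
  have r'1: "r + 3 * (r' - r) / 4 \<le> r'" using r by (simp add: field_simps)
  have "Ln (r + 3 * (r' - r) / 4) 4 vb \<le> Ln (r + 3 * (r' - r) / 4) 4 (\<lambda>x. zt r r' x ^ 3 * va x)"
    by (rule Ln_mono) (use z(4) le_v in \<open>auto intro!: continuous_intros c\<close>)
  also have "\<dots> \<le> Ln r' 4 (\<lambda>x. zt r r' x ^ 3 * va x)" by (intro Ln_radius_mono r'1 continuous_intros c) auto
  also have "\<dots> \<le> 2 * (S powr (2 - 6 / 4) * Y powr (6 / 4 - 1))" by (rule Qz_le[OF r _ _ Y S]) auto
  finally have "(Ln (r + 3 * (r' - r) / 4) 4 vb)\<^sup>2 \<le> (2 * (S powr (1/2) * Y powr (1/2)))\<^sup>2" by (intro power_mono) auto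
  also have "\<dots> = 4 * (S * Y)" using S Y by (simp add: power_mult_distrib powr_half_sqrt)
  finally show ?thesis .
qed

text \<open>The Hall term by interpolation only. Its coefficient n^4 e^bt is small exactly when the
  energy is far below R^\<gamma>, so this form serves once the growth bound is known.\<close>

lemma stage2:
  assumes s: "3 < s" "s \<le> 6" and n: "0 < n" "n \<le> 1" "\<nu> = n ^ 6" and e: "1 \<le> e" and M: "1 \<le> M"
    and A: "Ln 2 2 vG \<le> n ^ 3 * e" and m: "Ln 2 s vM \<le> M * n ^ 5 * n powr (6 / s - 1)"
    and \<epsilon>: "0 < \<epsilon>" "\<epsilon> \<le> 1" and bt: "bt = 6 / (s + 6)"
  shows "(Ln 1 2 vG)\<^sup>2 \<le> n ^ 6 * (c2 M / \<epsilon> * e powr (3 * bt) + \<epsilon> * e\<^sup>2 + 80 * mC * (k0 M)\<^sup>2 * sC * (n ^ 4 * e powr bt) * e\<^sup>2)"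
proof -
  define Z where "Z = Ln (1 + 3 * (2 - 1) / 4) 4 vb"
  have r: "(1::real) \<le> 1" "1 < (2::real)" "(2::real) \<le> 2" by auto
  note vs = vS_bound[OF r s n(1,2) e M A m refl, folded bt]
  have k: "2 \<le> k0 M" by (rule k0_ge[OF M])
  have "Z\<^sup>2 \<le> 4 * ((n ^ 3 * (5 * k0 M * sC * e)) * (n ^ 4 * (4 * k0 M * e powr bt)))"
    unfolding Z_def by (rule hall_Z[OF r]) (use vs k lsC_ge_1 n e in auto)
  then have "e * Z\<^sup>2 / n ^ 3 \<le> e * (4 * ((n ^ 3 * (5 * k0 M * sC * e)) * (n ^ 4 * (4 * k0 M * e powr bt)))) / n ^ 3"
    using e n by (intro divide_right_mono mult_left_mono) auto
  also have "\<dots> = n ^ 3 * (80 * (k0 M)\<^sup>2 * sC * (n ^ 4 * e powr bt) * e\<^sup>2) / n ^ 3" by (simp only: power2_eq_square mult_ac numeral_times_numeral) simp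
  also have "\<dots> = 80 * (k0 M)\<^sup>2 * sC * (n ^ 4 * e powr bt) * e\<^sup>2" using n by simp
  finally have "mC * (e * Z\<^sup>2 / n ^ 3) \<le> mC * (80 * (k0 M)\<^sup>2 * sC * (n ^ 4 * e powr bt) * e\<^sup>2)" using mC_pos by (intro mult_left_mono) auto
  moreover have "(Ln 1 2 vG)\<^sup>2 \<le> n ^ 6 * (c2 M / (\<epsilon> * 1 ^ 24) * e powr (3 * bt) + \<epsilon> * e\<^sup>2 + mC / 1 ^ 9 * (e * Z\<^sup>2 / n ^ 3))"
    by (rule energy_bound[OF r s n e M A m \<epsilon> _ _ bt]) (auto simp: Z_def)
  ultimately show ?thesis using n
    by (elim order_trans) (intro mult_left_mono; simp add: mult_ac)
qed

text \<open>One absorption step above the threshold. \<open>g\<close> marks the critical size, n^4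
  g^bt = 1. The L^4 norm of the magnetic field is cut into low, middle and high values, the middle
  one being the sole use of the bound on \<bar>b\<bar>^p. The factor d^(-N) in the lower bound for
  e^2 pays for all losses in the layer width and has the shape required by
  \<open>absorb_iteration\<close>.\<close>

lemma stage1:
  assumes r: "1 \<le> r" "r < r'" "r' \<le> 2" and s: "3 < s" "s \<le> 6" and n: "0 < n" "n \<le> 1" "\<nu> = n ^ 6" and e: "1 \<le> e" and M: "1 \<le> M"
    and A: "Ln r' 2 vG \<le> n ^ 3 * e" and m: "Ln r' s vM \<le> M * n ^ 5 * n powr (6 / s - 1)"
    and d: "d = r' - r" and bt: "bt = 6 / (s + 6)" and p: "3 < p" and W: "0 \<le> W"
    and Bp: "(\<integral>x. vb x powr p \<partial>BM 2) \<le> W * (n ^ 6 * g\<^sup>2) powr (p - 3)"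
    and g: "0 < g" "n ^ 4 * g powr bt = 1" and \<sigma>: "0 < \<sigma>" "\<sigma> \<le> 1"
    and N: "24 \<le> N * ((2 - 3 * bt) / 2)" "57 \<le> N * (p - 3)" "33 * p + 18 \<le> N"
    and eg: "\<sigma> * g\<^sup>2 * d powr (- N) \<le> e\<^sup>2" and big: "64 * c2 M \<le> (\<sigma> * g\<^sup>2) powr ((2 - 3 * bt) / 2)"
    and W1: "W * (4 * j0 M) \<le> w0 * \<sigma> powr (p - 3)" and W2: "W * 4 \<le> w0 * \<sigma> * (t0 M * \<sigma>) powr p"
  shows "(Ln r 2 vG)\<^sup>2 \<le> n ^ 6 * (e\<^sup>2 / 2)"
proof -
  have dp: "0 < d" "d \<le> 1" using r d by auto
  define K where "K = k0 M / d ^ 5"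
  define c5 where "c5 = sC / d ^ 5"
  define r'1 where "r'1 = r + 3 * d / 4"
  define Z where "Z = Ln r'1 4 vb"
  note vs = vS_bound[OF r s n(1,2) e M A m K_def[unfolded d], folded bt d, folded c5_def]
  have K1: "1 \<le> K" by (rule vs(3))
  have c51: "1 \<le> c5" by (rule vs(4))
  have k: "2 \<le> k0 M" by (rule k0_ge[OF M])
  have btb: "1/2 \<le> bt" "bt < 2/3" using s by (auto simp: bt field_simps)
  \<comment> \<open>The target is Z^4 \<le> n^6 e^2 w; the square root of \<open>w\<close> is d^9 /
    (8 (mC + 1)), which cancels mC / d^9.\<close>
  define w where "w = w0 * d ^ 18"
  have w: "0 < w" "w \<le> 1" using w0 dp mult_mono[of w0 1 "d ^ 18" 1] power_le_one[of d 18] by (auto simp: w_def)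
  \<comment> \<open>Ratio of critical to actual energy. It is at most d^N / \<sigma>, so each
    positive power of it supplies positive powers of d.\<close>
  define \<psi> where "\<psi> = (g / e)\<^sup>2"
  have \<psi>: "0 < \<psi>" using g e by (simp add: \<psi>_def)
  have ep: "0 < e" using e by simp
  have \<psi>le: "\<psi> \<le> d powr N / \<sigma>"
  proof -
    have "d powr N * (\<sigma> * g\<^sup>2 * d powr (- N)) \<le> d powr N * e\<^sup>2" by (intro mult_left_mono eg) auto
    then have "\<sigma> * g\<^sup>2 \<le> d powr N * e\<^sup>2" using dp by (simp add: powr_minus field_simps)
    then show ?thesis using \<sigma> ep by (simp add: \<psi>_def power_divide field_simps)
  qed
  have N0: "0 \<le> N" using N(3) p by simp
  have dN: "d powr N \<le> 1" using dp N0 by (simp add: powr_le1)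
  have \<psi>\<sigma>: "\<psi> \<le> 1 / \<sigma>" using \<psi>le dN \<sigma> by (meson divide_right_mono less_imp_le order_trans)
  \<comment> \<open>The assumption \<open>big\<close> supplies the constant and the first condition
    on N the power d^(-24): the threshold raised to (2 - 3 bt)/2 is at most e^(2 - 3 bt).\<close>
  have nh: "64 * c2 M / d ^ 24 * e powr (3 * bt) \<le> e\<^sup>2"
  proof -
    let ?a = "(2 - 3 * bt) / 2"
    have a: "0 \<le> ?a" using btb by simp
    have "64 * c2 M / d ^ 24 \<le> (\<sigma> * g\<^sup>2) powr ?a * d powr (- 24)"
    proof -
      have "d powr (- 24) = 1 / d ^ 24" using dp by (simp add: powr_minus divide_inverse)
      moreover have "64 * c2 M * (1 / d ^ 24) \<le> (\<sigma> * g\<^sup>2) powr ?a * (1 / d ^ 24)" using dp by (intro mult_right_mono big) auto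
      ultimately show ?thesis by simp
    qed
    also have "\<dots> \<le> (\<sigma> * g\<^sup>2) powr ?a * d powr (- (N * ?a))"
      using dp N(1) by (intro mult_left_mono powr_mono') auto
    also have "\<dots> = (\<sigma> * g\<^sup>2 * d powr (- N)) powr ?a" by (simp only: powr_mult powr_powr) simp
    also have "\<dots> \<le> (e\<^sup>2) powr ?a" using a \<sigma> g by (intro powr_mono2 eg) auto
    also have "\<dots> = e powr (2 - 3 * bt)"
    proof -
      have "(e\<^sup>2) powr ?a = (e powr 2) powr ?a" using ep by simp
      also have "\<dots> = e powr (2 * ?a)" by (rule powr_powr)
      also have "2 * ?a = 2 - 3 * bt" by simp
      finally show ?thesis .
    qed
    finally have "64 * c2 M / d ^ 24 * e powr (3 * bt) \<le> e powr (2 - 3 * bt) * e powr (3 * bt)" by (intro mult_right_mono) auto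
    also have "\<dots> = e\<^sup>2" using ep by (simp add: powr_add[symmetric])
    finally show ?thesis .
  qed
  \<comment> \<open>Solves 64 K^3 \<tau> / \<sigma> = w / 4, so that the low values cost at most a
    quarter of the target; 33 = 18 + 15 from \<open>w\<close> and K^3.\<close>
  define \<tau> where "\<tau> = t0 M * \<sigma> * d ^ 33"
  \<comment> \<open>Solves J^2 = 4 (5 K c5)^6 / w, so that the high values cost a quarter of the
    target; 39 = 30 + 9 from (K c5)^3 and the root of \<open>w\<close>.\<close>
  define J where "J = j0 M / d ^ 39"
  have t0: "0 < t0 M" "t0 M \<le> 1"
  proof -
    have "1 \<le> 256 * k0 M ^ 3" using one_le_power[of "k0 M" 3] k by linarith
    then show "0 < t0 M" "t0 M \<le> 1" using w0 k by (auto simp: t0_def divide_le_eq_1 simp del: power_eq_0_iff)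
  qed
  have \<tau>: "0 < \<tau>" "\<tau> \<le> \<sigma>"
  proof -
    show "0 < \<tau>" using t0 \<sigma> dp by (simp add: \<tau>_def)
    have "t0 M * \<sigma> * d ^ 33 \<le> 1 * \<sigma> * 1" using t0 \<sigma> dp by (intro mult_mono) (auto intro: power_le_one)
    then show "\<tau> \<le> \<sigma>" by (simp add: \<tau>_def)
  qed
  have Jeq: "J = 2 * (5 * K * c5) ^ 3 / sqrt w"
  proof -
    have "sqrt w = sqrt w0 * d ^ 9"
      using dp real_sqrt_abs[of "d ^ 9"] by (simp add: w_def real_sqrt_mult power_mult[symmetric])
    then have "2 * (5 * K * c5) ^ 3 / sqrt w = 2 * (5 * k0 M * sC) ^ 3 / sqrt w0 * (1 / (d ^ 30 * d ^ 9))"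
      by (simp add: K_def c5_def power_mult_distrib power_divide power_mult[symmetric] power_add[symmetric])
    also have "\<dots> = J" by (simp add: J_def j0_def power_add[symmetric])
    finally show ?thesis by simp
  qed
  have J: "1 \<le> J"
  proof -
    have "1 \<le> (5 * K * c5) ^ 3" using K1 c51 mult_mono[of 1 K 1 c5] by (intro one_le_power) (simp add: mult.assoc)
    moreover have "sqrt w \<le> 1" "0 < sqrt w" using w by auto
    ultimately have "1 * sqrt w \<le> 2 * (5 * K * c5) ^ 3" by linarith
    then show ?thesis unfolding Jeq using \<open>0 < sqrt w\<close> by (intro iffD2[OF pos_le_divide_eq])
  qed
  \<comment> \<open>The low cut is a small multiple of n^6 g^2, the critical amplitude R^(\<gamma> -
    1); the high cut is a large multiple of n^6 e^2. They are ordered because \<psi> is at most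
    1/\<sigma>.\<close>
  define L1 where "L1 = \<tau> * (n ^ 6 * g\<^sup>2)"
  define L2 where "L2 = J * (n ^ 6 * e\<^sup>2)"
  have L1: "0 < L1" using \<tau> n g by (simp add: L1_def)
  have L12: "L1 \<le> L2"
  proof -
    have "\<tau> * g\<^sup>2 \<le> \<sigma> * g\<^sup>2" using \<tau> by (intro mult_right_mono) auto
    also have "\<dots> \<le> e\<^sup>2" using \<psi>\<sigma> \<sigma> ep by (simp add: \<psi>_def power_divide field_simps)
    also have "\<dots> \<le> J * e\<^sup>2" using mult_right_mono[OF J, of "e\<^sup>2"] by simp
    finally have "n ^ 6 * (\<tau> * g\<^sup>2) \<le> n ^ 6 * (J * e\<^sup>2)" using n by (intro mult_left_mono) auto
    then show ?thesis by (simp add: L1_def L2_def mult_ac)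
  qed
  note z = zt[OF r]
  have cz: "contU (zt r r')" by (rule smooth3_cont[OF z(1)])
  have r'1r': "r'1 \<le> r'" using r by (simp add: r'1_def d field_simps)
  \<comment> \<open>The square of the cutoff serves all norms: it is the power occurring in
    \<open>vS\<close>, and it is at most the first power occurring in \<open>vY\<close>.\<close>
  define h where "h x = zt r r' x ^ 2 * vb x" for x
  have ch: "contU h" unfolding h_def by (intro continuous_intros cz)
  have h0: "0 \<le> h x" for x unfolding h_def using z(2) by simp
  have Z4: "Z ^ 4 \<le> (\<integral>x. h x ^ 4 \<partial>BM r')"
  proof -
    have "Z \<le> Ln r' 4 h"
    proof -
      have "Z = Ln r'1 4 h" unfolding Z_def by (rule Ln_cong) (simp add: h_def z(4) r'1_def d)
      also have "\<dots> \<le> Ln r' 4 h" by (intro Ln_radius_mono ch r'1r') auto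
      finally show ?thesis .
    qed
    then have "Z ^ 4 \<le> Ln r' 4 h ^ 4" by (intro power_mono) (auto simp: Z_def)
    then show ?thesis using Ln_nat_powr[of 4 r' h] by simp
  qed
  have i3: "(\<integral>x. h x ^ 3 \<partial>BM r') \<le> n ^ 12 * (64 * K ^ 3 * e powr (3 * bt))"
  proof -
    have "(\<integral>x. h x ^ 3 \<partial>BM r') = Ln r' 3 h ^ 3" using Ln_nat_powr[of 3 r' h] h0 by simp
    also have "\<dots> \<le> (n ^ 4 * (4 * K * e powr bt)) ^ 3"
    proof (rule power_mono)
      have "Ln r' 3 h \<le> vY r r'" unfolding vY_def
      proof (rule Ln_mono)
        show "\<bar>h x\<bar> \<le> \<bar>zt r r' x * va x\<bar>" for x
          unfolding h_def abs_mult using z(2,3)[of x] power_decreasing[of 1 2 "zt r r' x"] le_v(4)[of x] by (intro mult_mono) auto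
      qed (auto intro!: continuous_intros cz ch)
      then show "Ln r' 3 h \<le> n ^ 4 * (4 * K * e powr bt)" using vs(2) by linarith
    qed simp
    also have "\<dots> = n ^ 12 * (64 * K ^ 3 * (e powr bt) ^ 3)" by (simp add: power_mult_distrib power_mult[symmetric])
    also have "(e powr bt) ^ 3 = e powr (3 * bt)"
    proof -
      have "(e powr bt) ^ 3 = (e powr bt) powr 3" using ep by simp
      then show ?thesis by (simp add: powr_powr mult.commute)
    qed
    finally show ?thesis .
  qed
  have i6: "(\<integral>x. h x ^ 6 \<partial>BM r') \<le> (n ^ 3 * (5 * K * c5 * e)) ^ 6"
  proof -
    have "(\<integral>x. h x ^ 6 \<partial>BM r') = Ln r' 6 h ^ 6" using Ln_nat_powr[of 6 r' h] h0 by simp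
    also have "\<dots> \<le> (n ^ 3 * (5 * K * c5 * e)) ^ 6"
    proof (rule power_mono)
      have "Ln r' 6 h \<le> vS r r'" unfolding vS_def
        by (rule Ln_mono) (use le_v(4) in \<open>auto intro!: continuous_intros cz ch mult_left_mono simp: h_def abs_mult\<close>)
      then show "Ln r' 6 h \<le> n ^ 3 * (5 * K * c5 * e)" using vs(1) by linarith
    qed simp
    finally show ?thesis .
  qed
  have ip: "(\<integral>x. h x powr p \<partial>BM r') \<le> W * (n ^ 6 * g\<^sup>2) powr (p - 3)"
  proof -
    have cp: "contU (\<lambda>x. vb x powr p)" using cont_powr[of UNIV vb p] p by (simp add: cont_v)
    have chp: "contU (\<lambda>x. h x powr p)" using cont_powr[OF ch, of p] p h0 by simp
    have "(\<integral>x. h x powr p \<partial>BM r') \<le> (\<integral>x. vb x powr p \<partial>BM r')"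
    proof (rule BM_mono[OF chp cp])
      fix x
      have "h x \<le> 1 * vb x" unfolding h_def using z(2,3)[of x] by (intro mult_right_mono) (auto intro: power_le_one)
      then show "h x powr p \<le> vb x powr p" using h0 p by (intro powr_mono2) auto
    qed
    also have "\<dots> \<le> (\<integral>x. vb x powr p \<partial>BM 2)" using r by (intro BM_subset cp) auto
    finally show ?thesis using Bp by linarith
  qed
  have split: "(\<integral>x. h x ^ 4 \<partial>BM r') \<le> L1 * (\<integral>x. h x ^ 3 \<partial>BM r') + (\<integral>x. h x ^ 6 \<partial>BM r') / L2\<^sup>2 + (L1 powr (4 - p) + L2 powr (4 - p)) * (\<integral>x. h x powr p \<partial>BM r')"
  proof -
    have chp: "contU (\<lambda>x. h x powr p)" using cont_powr[OF ch, of p] p h0 by simp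
    have c3: "contU (\<lambda>x. L1 * h x ^ 3)" "contU (\<lambda>x. (1 / L2\<^sup>2) * h x ^ 6)" "contU (\<lambda>x. (L1 powr (4 - p) + L2 powr (4 - p)) * h x powr p)"
      by (intro continuous_on_mult continuous_on_const continuous_on_power ch chp)+
    have "(\<integral>x. h x ^ 4 \<partial>BM r') \<le> (\<integral>x. (L1 * h x ^ 3 + (1 / L2\<^sup>2) * h x ^ 6) + (L1 powr (4 - p) + L2 powr (4 - p)) * h x powr p \<partial>BM r')"
    proof (rule BM_mono)
      fix x show "h x ^ 4 \<le> (L1 * h x ^ 3 + (1 / L2\<^sup>2) * h x ^ 6) + (L1 powr (4 - p) + L2 powr (4 - p)) * h x powr p"
        using quartic_split[OF h0 L1 L12, of p x] p by simp
    qed (intro continuous_on_power ch, intro continuous_on_add c3)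
    also have "\<dots> = L1 * (\<integral>x. h x ^ 3 \<partial>BM r') + (1 / L2\<^sup>2) * (\<integral>x. h x ^ 6 \<partial>BM r') + (L1 powr (4 - p) + L2 powr (4 - p)) * (\<integral>x. h x powr p \<partial>BM r')"
      by (subst BM_int_add[OF continuous_on_add[OF c3(1,2)] c3(3)], subst BM_int_add[OF c3(1,2)]) simp
    finally show ?thesis by simp
  qed
  \<comment> \<open>A quarter of the target for each of four contributions: low, high, and the two
    endpoint powers of the middle range.\<close>
  define F where "F = n ^ 6 * e\<^sup>2 * w / 4"
  have F0: "0 < n ^ 6 * e\<^sup>2" using n ep by simp
  have b1: "L1 * (n ^ 12 * (64 * K ^ 3 * e powr (3 * bt))) \<le> F"
  proof -
    have n12: "n ^ 12 = g powr (- (3 * bt))"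
    proof -
      have "n ^ 4 = g powr (- bt)" using g by (simp add: powr_minus field_simps)
      then have "(n ^ 4) ^ 3 = (g powr (- bt)) powr 3" using g by simp
      then show ?thesis by (simp add: powr_powr power_mult[symmetric] mult.commute)
    qed
    have q: "g\<^sup>2 * n ^ 12 * e powr (3 * bt) = e\<^sup>2 * \<psi> powr ((2 - 3 * bt) / 2)"
    proof -
      define x where "x = 2 - 3 * bt"
      have "\<psi> powr (x / 2) = ((g / e) powr 2) powr (x / 2)" using g ep by (simp add: \<psi>_def)
      also have "\<dots> = (g / e) powr (2 * (x / 2))" by (rule powr_powr)
      also have "\<dots> = (g / e) powr x" by simp
      also have "\<dots> = g powr x * e powr (- x)" by (simp only: powr_divide powr_minus) (simp only: divide_inverse)
      also have "g powr x = g powr 2 * g powr (- (3 * bt))" unfolding powr_add[symmetric] by (simp add: x_def)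
      also have "e powr (- x) = e powr (3 * bt) * e powr (- 2)" unfolding powr_add[symmetric] by (simp add: x_def)
      finally have 1: "\<psi> powr (x / 2) = (g powr 2 * g powr (- (3 * bt))) * (e powr (3 * bt) * e powr (- 2))" .
      have 2: "g powr 2 = g\<^sup>2" "e powr (- 2) = 1 / e\<^sup>2" using g(1) ep by (auto simp: powr_minus divide_inverse)
      have 3: "\<psi> powr ((2 - 3 * bt) / 2) = g\<^sup>2 * n ^ 12 * (e powr (3 * bt) / e\<^sup>2)" using 1 unfolding 2 n12 x_def by simp
      show ?thesis unfolding 3 using ep by simp
    qed
    have "\<psi> powr ((2 - 3 * bt) / 2) \<le> (1 / \<sigma>) powr ((2 - 3 * bt) / 2)" using \<psi> \<psi>\<sigma> btb by (intro powr_mono2) auto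
    also have "\<dots> \<le> (1 / \<sigma>) powr 1" using \<sigma> btb by (intro powr_mono) auto
    finally have \<psi>2: "\<psi> powr ((2 - 3 * bt) / 2) \<le> 1 / \<sigma>" using \<sigma> by simp
    have "L1 * (n ^ 12 * (64 * K ^ 3 * e powr (3 * bt))) = (\<tau> * 64 * K ^ 3 * n ^ 6) * (g\<^sup>2 * n ^ 12 * e powr (3 * bt))" by (simp add: L1_def)
    also have "\<dots> \<le> (\<tau> * 64 * K ^ 3 * n ^ 6) * (e\<^sup>2 * (1 / \<sigma>))" unfolding q using \<tau> K1 n by (intro mult_left_mono \<psi>2) auto
    also have "\<dots> = F"
    proof -
      have "\<tau> * 64 * K ^ 3 = w0 * \<sigma> * (k0 M ^ 3 / k0 M ^ 3) * (d ^ 33 / d ^ 15) / 4"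
        by (simp add: \<tau>_def t0_def K_def power_divide power_mult[symmetric])
      also have "d ^ 33 / d ^ 15 = d ^ 18"
      proof -
        have "d ^ 33 / d ^ 15 = d ^ 15 * d ^ 18 / d ^ 15" by (simp only: power_add[symmetric]) simp
        also have "\<dots> = d ^ 18" by (rule nonzero_mult_div_cancel_left) (use dp in simp)
        finally show ?thesis .
      qed
      also have "k0 M ^ 3 / k0 M ^ 3 = 1" using k by simp
      finally have "\<tau> * 64 * K ^ 3 = w0 * \<sigma> * d ^ 18 / 4" by simp
      then show ?thesis using \<sigma> by (simp only:) (simp add: F_def w_def)
    qed
    finally show ?thesis .
  qed
  have b2: "(n ^ 3 * (5 * K * c5 * e)) ^ 6 / L2\<^sup>2 \<le> F"
  proof -
    have "J\<^sup>2 = 4 * (5 * K * c5) ^ 6 / w" using w by (simp add: Jeq power_divide power_mult_distrib power_mult[symmetric])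
    then have "L2\<^sup>2 = 4 * (5 * K * c5) ^ 6 / w * (n ^ 12 * e ^ 4)" by (simp add: L2_def power_mult_distrib power_mult[symmetric])
    moreover have "(n ^ 3 * (5 * K * c5 * e)) ^ 6 = (5 * K * c5) ^ 6 * (n ^ 18 * e ^ 6)" by (simp add: power_mult_distrib power_mult[symmetric])
    ultimately have "(n ^ 3 * (5 * K * c5 * e)) ^ 6 / L2\<^sup>2 = ((5 * K * c5) ^ 6 * (n ^ 18 * e ^ 6)) / (4 * (5 * K * c5) ^ 6 / w * (n ^ 12 * e ^ 4))" by simp
    also have "\<dots> = (n ^ 18 * e ^ 6) / (n ^ 12 * e ^ 4) * w / 4" using K1 c51 w by simp
    also have "(n ^ 18 * e ^ 6) / (n ^ 12 * e ^ 4) = n ^ 6 * e\<^sup>2"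
    proof -
      have "(n ^ 18 * e ^ 6) / (n ^ 12 * e ^ 4) = ((n ^ 12 * e ^ 4) * (n ^ 6 * e\<^sup>2)) / (n ^ 12 * e ^ 4)" by (simp add: power_add[symmetric] mult_ac)
      also have "\<dots> = n ^ 6 * e\<^sup>2" by (rule nonzero_mult_div_cancel_left) (use n ep in simp)
      finally show ?thesis .
    qed
    finally show ?thesis by (simp add: F_def)
  qed
  \<comment> \<open>As p > 3 and J \<ge> 1, J^(4-p) is at most J. The 57 = 39 + 18 powers of d cover
    the size of J and the target, and \<open>W1\<close> covers the constants.\<close>
  have b3: "L2 powr (4 - p) * (W * (n ^ 6 * g\<^sup>2) powr (p - 3)) \<le> F"
  proof -
    have q: "(n ^ 6 * e\<^sup>2) powr (4 - p) * (n ^ 6 * g\<^sup>2) powr (p - 3) = n ^ 6 * e\<^sup>2 * \<psi> powr (p - 3)"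
    proof -
      have "n ^ 6 * g\<^sup>2 = (n ^ 6 * e\<^sup>2) * \<psi>" using ep by (simp add: \<psi>_def power_divide)
      then have "(n ^ 6 * e\<^sup>2) powr (4 - p) * (n ^ 6 * g\<^sup>2) powr (p - 3) = ((n ^ 6 * e\<^sup>2) powr (4 - p) * (n ^ 6 * e\<^sup>2) powr (p - 3)) * \<psi> powr (p - 3)"
        by (simp only: powr_mult mult.assoc)
      also have "(n ^ 6 * e\<^sup>2) powr (4 - p) * (n ^ 6 * e\<^sup>2) powr (p - 3) = (n ^ 6 * e\<^sup>2) powr 1" unfolding powr_add[symmetric] by simp
      finally show ?thesis using F0 by simp
    qed
    have "J powr (4 - p) \<le> J powr 1" using J p by (intro powr_mono) auto
    then have J4: "J powr (4 - p) \<le> J" using J by simp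
    have \<psi>p: "\<psi> powr (p - 3) \<le> d ^ 57 * (1 / \<sigma> powr (p - 3))"
    proof -
      have "\<psi> powr (p - 3) \<le> (d powr N / \<sigma>) powr (p - 3)" using \<psi> p by (intro powr_mono2 \<psi>le) auto
      also have "\<dots> = d powr (N * (p - 3)) / \<sigma> powr (p - 3)" by (simp add: powr_divide powr_powr)
      also have "\<dots> \<le> d powr 57 / \<sigma> powr (p - 3)" using dp N(2) by (intro divide_right_mono powr_mono') auto
      finally show ?thesis using dp by simp
    qed
    have d57: "d ^ 57 / d ^ 39 = d ^ 18"
    proof -
      have "d ^ 57 / d ^ 39 = d ^ 39 * d ^ 18 / d ^ 39" by (simp only: power_add[symmetric]) simp
      also have "\<dots> = d ^ 18" by (rule nonzero_mult_div_cancel_left) (use dp in simp)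
      finally show ?thesis .
    qed
    have "L2 powr (4 - p) * (W * (n ^ 6 * g\<^sup>2) powr (p - 3)) = W * J powr (4 - p) * ((n ^ 6 * e\<^sup>2) powr (4 - p) * (n ^ 6 * g\<^sup>2) powr (p - 3))"
      by (simp add: L2_def powr_mult mult_ac)
    also have "\<dots> \<le> W * J * (n ^ 6 * e\<^sup>2 * (d ^ 57 * (1 / \<sigma> powr (p - 3))))"
      unfolding q using W J F0 by (intro mult_mono mult_left_mono J4 \<psi>p) auto
    also have "\<dots> = (W * (4 * j0 M)) * (n ^ 6 * e\<^sup>2 * d ^ 18 * (1 / \<sigma> powr (p - 3))) / 4"
      unfolding d57[symmetric] by (simp add: J_def)
    also have "\<dots> \<le> (w0 * \<sigma> powr (p - 3)) * (n ^ 6 * e\<^sup>2 * d ^ 18 * (1 / \<sigma> powr (p - 3))) / 4"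
      using dp n by (intro divide_right_mono mult_right_mono W1) auto
    also have "\<dots> = F" using \<sigma> by (simp add: F_def w_def)
    finally show ?thesis .
  qed
  \<comment> \<open>For p > 4 the small factor \<tau> enters with a negative power, so \<tau>^(-p)
    is used as a bound in all cases; its d^(-33 p) is compensated by the third condition on
    N.\<close>
  have b4: "L1 powr (4 - p) * (W * (n ^ 6 * g\<^sup>2) powr (p - 3)) \<le> F"
  proof -
    have G0: "0 < n ^ 6 * g\<^sup>2" using n g by simp
    have q: "L1 powr (4 - p) * (n ^ 6 * g\<^sup>2) powr (p - 3) = \<tau> powr (4 - p) * (n ^ 6 * g\<^sup>2)"
    proof -
      have "L1 powr (4 - p) * (n ^ 6 * g\<^sup>2) powr (p - 3) = \<tau> powr (4 - p) * ((n ^ 6 * g\<^sup>2) powr (4 - p) * (n ^ 6 * g\<^sup>2) powr (p - 3))"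
        by (simp only: L1_def powr_mult mult.assoc)
      also have "(n ^ 6 * g\<^sup>2) powr (4 - p) * (n ^ 6 * g\<^sup>2) powr (p - 3) = (n ^ 6 * g\<^sup>2) powr 1" unfolding powr_add[symmetric] by simp
      finally show ?thesis using G0 by simp
    qed
    have ge: "n ^ 6 * g\<^sup>2 \<le> n ^ 6 * e\<^sup>2 * (d powr (33 * p + 18) / \<sigma>)"
    proof -
      have "\<psi> \<le> d powr (33 * p + 18) / \<sigma>"
        using \<psi>le dp N(3) \<sigma> powr_mono'[of "33 * p + 18" N d] by (smt (verit) divide_right_mono)
      then have "(n ^ 6 * e\<^sup>2) * \<psi> \<le> (n ^ 6 * e\<^sup>2) * (d powr (33 * p + 18) / \<sigma>)" using F0 by (intro mult_left_mono) auto
      then show ?thesis using ep by (simp add: \<psi>_def power_divide)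
    qed
    have tp: "\<tau> powr (4 - p) \<le> \<tau> powr (- p)" using \<tau> \<sigma> by (intro powr_mono') auto
    have \<tau>p: "\<tau> powr (- p) = 1 / (t0 M * \<sigma>) powr p * d powr (- (33 * p))"
    proof -
      have "d ^ 33 = d powr 33" using dp by simp
      then have "\<tau> powr (- p) = (t0 M * \<sigma>) powr (- p) * (d powr 33) powr (- p)" by (simp only: \<tau>_def powr_mult)
      also have "(d powr 33) powr (- p) = d powr (- (33 * p))" by (simp add: powr_powr)
      finally show ?thesis by (simp add: powr_minus divide_inverse)
    qed
    have "L1 powr (4 - p) * (W * (n ^ 6 * g\<^sup>2) powr (p - 3)) = W * (\<tau> powr (4 - p) * (n ^ 6 * g\<^sup>2))"
      unfolding q[symmetric] by simp
    also have "\<dots> \<le> W * (\<tau> powr (- p) * (n ^ 6 * e\<^sup>2 * (d powr (33 * p + 18) / \<sigma>)))"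
      using W n by (intro mult_left_mono mult_mono tp ge) auto
    also have "\<dots> = (W * 4) * (1 / (t0 M * \<sigma>) powr p * (n ^ 6 * e\<^sup>2 * ((d powr (- (33 * p)) * d powr (33 * p + 18)) / \<sigma>))) / 4"
      unfolding \<tau>p by (simp add: mult_ac)
    also have "d powr (- (33 * p)) * d powr (33 * p + 18) = d ^ 18" unfolding powr_add[symmetric] using dp by simp
    also have "(W * 4) * (1 / (t0 M * \<sigma>) powr p * (n ^ 6 * e\<^sup>2 * (d ^ 18 / \<sigma>))) / 4 \<le>
        (w0 * \<sigma> * (t0 M * \<sigma>) powr p) * (1 / (t0 M * \<sigma>) powr p * (n ^ 6 * e\<^sup>2 * (d ^ 18 / \<sigma>))) / 4"
      using dp n \<sigma> by (intro divide_right_mono mult_right_mono W2) auto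
    also have "\<dots> = F" using \<sigma> t0 by (simp add: F_def w_def)
    finally show ?thesis .
  qed
  have Z4F: "Z ^ 4 \<le> n ^ 6 * e\<^sup>2 * w"
  proof -
    have "L1 * (\<integral>x. h x ^ 3 \<partial>BM r') \<le> F" using L1 by (intro order_trans[OF mult_left_mono[OF i3] b1]) auto
    moreover have "(\<integral>x. h x ^ 6 \<partial>BM r') / L2\<^sup>2 \<le> F" by (intro order_trans[OF divide_right_mono[OF i6] b2]) auto
    moreover have "(L1 powr (4 - p) + L2 powr (4 - p)) * (\<integral>x. h x powr p \<partial>BM r') \<le> F + F"
    proof -
      have "(L1 powr (4 - p) + L2 powr (4 - p)) * (\<integral>x. h x powr p \<partial>BM r') \<le> (L1 powr (4 - p) + L2 powr (4 - p)) * (W * (n ^ 6 * g\<^sup>2) powr (p - 3))"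
        by (intro mult_left_mono ip) auto
      also have "\<dots> \<le> F + F" unfolding distrib_right by (intro add_mono b3 b4)
      finally show ?thesis .
    qed
    ultimately have "Z ^ 4 \<le> 4 * F" using Z4 split by linarith
    then show ?thesis by (simp add: F_def)
  qed
  have "Z\<^sup>2 \<le> n ^ 3 * e * (d ^ 9 / (8 * (mC + 1)))"
  proof (rule power2_le_imp_le)
    have "(Z\<^sup>2)\<^sup>2 = Z ^ 4" by (simp add: power_mult[symmetric])
    also have "\<dots> \<le> n ^ 6 * e\<^sup>2 * w" by (rule Z4F)
    also have "\<dots> = (n ^ 3 * e * (d ^ 9 / (8 * (mC + 1))))\<^sup>2"
    proof -
      have "w = (d ^ 9 / (8 * (mC + 1)))\<^sup>2"
        by (simp only: w_def w0_def power_divide power_mult_distrib power_mult[symmetric]) simp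
      then show ?thesis by (simp only: power_mult_distrib) (simp add: power_mult[symmetric])
    qed
    finally show "(Z\<^sup>2)\<^sup>2 \<le> (n ^ 3 * e * (d ^ 9 / (8 * (mC + 1))))\<^sup>2" .
  qed (use n ep dp mC_pos in auto)
  then have "mC / d ^ 9 * (e * Z\<^sup>2 / n ^ 3) \<le> mC / d ^ 9 * (e * (n ^ 3 * e * (d ^ 9 / (8 * (mC + 1)))) / n ^ 3)"
    using mC_pos dp n ep by (intro mult_left_mono divide_right_mono) auto
  also have "\<dots> = e\<^sup>2 * (mC / (8 * (mC + 1)))" using n dp by (simp add: power2_eq_square)
  also have "\<dots> \<le> e\<^sup>2 * (1 / 8)" using mC_pos by (intro mult_left_mono) (auto simp: field_simps)
  finally have hall: "mC / d ^ 9 * (e * Z\<^sup>2 / n ^ 3) \<le> e\<^sup>2 / 8" by simp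
  have "(Ln r 2 vG)\<^sup>2 \<le> n ^ 6 * (c2 M / (1 / 8 * d ^ 24) * e powr (3 * bt) + 1 / 8 * e\<^sup>2 + mC / d ^ 9 * (e * Z\<^sup>2 / n ^ 3))"
    by (rule energy_bound[OF r s n e M A m _ _ d _ bt]) (auto simp: Z_def r'1_def)
  also have "\<dots> \<le> n ^ 6 * (e\<^sup>2 / 8 + e\<^sup>2 / 8 + e\<^sup>2 / 8)"
  proof (intro mult_left_mono add_mono hall)
    show "c2 M / (1 / 8 * d ^ 24) * e powr (3 * bt) \<le> e\<^sup>2 / 8" using nh by simp
  qed (use n in auto)
  also have "\<dots> \<le> n ^ 6 * (e\<^sup>2 / 2)" using n by (intro mult_left_mono) auto
  finally show ?thesis .
qed

end

section \<open>Smallness of the L^3 norm when the tail energy is small\<close>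

lemma emeasure_cball3:
  assumes "0 \<le> \<delta>" shows "emeasure lborel (cball (0::real^3) \<delta>) = ennreal (unit_ball_vol 3 * \<delta> ^ 3)"
  unfolding emeasure_cball[OF assms] by simp

lemma BM_ball_support:
  fixes f :: "real^3 \<Rightarrow> real"
  assumes f: "contU f" "\<And>x. 0 \<le> f x" "\<And>x. f x \<le> 1" "\<And>x. \<delta> < norm x \<Longrightarrow> f x = 0" and d: "0 \<le> \<delta>"
  shows "(\<integral>x. f x \<partial>BM r) \<le> unit_ball_vol 3 * \<delta> ^ 3"
proof -
  have "ennreal (\<integral>x. f x \<partial>BM r) = (\<integral>\<^sup>+x. indicator (cball 0 r) x * ennreal (f x) \<partial>lborel)" by (rule nn_integral_BM[symmetric, OF f(1,2)])
  also have "\<dots> \<le> (\<integral>\<^sup>+x. indicator (cball (0::real^3) \<delta>) x \<partial>lborel)"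
  proof (intro nn_integral_mono)
    fix x :: "real^3"
    show "indicator (cball 0 r) x * ennreal (f x) \<le> indicator (cball 0 \<delta>) x"
      using f(2,3)[of x] f(4)[of x] by (cases "norm x \<le> \<delta>") (auto simp: indicator_def)
  qed
  also have "\<dots> = emeasure lborel (cball (0::real^3) \<delta>)" by simp
  also have "\<dots> = ennreal (unit_ball_vol 3 * \<delta> ^ 3)" by (rule emeasure_cball3[OF d])
  finally show ?thesis using d by (simp add: unit_ball_vol_nonneg)
qed

context unit_sol
begin

text \<open>\<kappa> corresponds to a fixed ball in the original variables. Away from it the
  gradient enters only through the tail of the energy. Near it the fields are bounded by constants,
  and Hoelder against the tiny volume provides a power of the radius.\<close>

lemma cubic_split:
  assumes r: "1 \<le> r" "r < r'" "r' \<le> 2" and s: "3 < s" "s \<le> 6" and q: "q = 2 * s / (s - 2)"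
    and k: "0 < \<kappa>" "\<kappa> \<le> r'" and G0: "\<And>x. norm x \<le> 2 * \<kappa> \<Longrightarrow> vG x \<le> G0" and a0: "\<And>x. norm x \<le> 2 * \<kappa> \<Longrightarrow> va x \<le> a0"
  shows "(\<integral>x. vM x * (vG x * (zt r r' x ^ 3 * va x)) \<partial>BM r') \<le>
    sqrt ((Ln r' 2 vG)\<^sup>2 - (Ln \<kappa> 2 vG)\<^sup>2) * (Ln r' s vM * Ln r' q (\<lambda>x. zt r r' x ^ 3 * va x))
    + G0 * a0 * (Ln r' s vM * (unit_ball_vol 3 * (2 * \<kappa>) ^ 3) powr (1 - 1 / s))"
proof -
  note z = zt[OF r]
  have c: "contU (zt r r')" by (rule smooth3_cont[OF z(1)])
  \<comment> \<open>A Lipschitz ramp from 0 at radius \<kappa> to 1 at 2 \<kappa>. Continuity is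
    enough since it is never differentiated.\<close>
  define \<omega> where "\<omega> x = max 0 (min 1 (norm x / \<kappa> - 1))" for x :: "real^3"
  have cx: "contU \<omega>" unfolding \<omega>_def using k by (intro continuous_intros) auto
  have x01: "0 \<le> \<omega> x" "\<omega> x \<le> 1" for x by (auto simp: \<omega>_def)
  have xin: "\<omega> x = 0" if "norm x \<le> \<kappa>" for x
  proof -
    have "norm x / \<kappa> \<le> 1" using that k by (simp add: pos_divide_le_eq)
    then show ?thesis by (simp add: \<omega>_def)
  qed
  have xout: "\<omega> x = 1" if "2 * \<kappa> < norm x" for x
  proof -
    have "2 < norm x / \<kappa>" using that k by (simp add: pos_less_divide_eq)
    then show ?thesis by (simp add: \<omega>_def)
  qed
  have qq: "1 / 2 = 1 / s + 1 / q" "0 < q" unfolding q using s by (auto simp: field_simps)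
  have G0n: "0 \<le> G0" using k by (intro order_trans[OF v_nonneg(3) G0[of 0]]) simp
  have tail: "Ln r' 2 (\<lambda>x. \<omega> x * vG x) \<le> sqrt ((Ln r' 2 vG)\<^sup>2 - (Ln \<kappa> 2 vG)\<^sup>2)"
  proof (rule real_le_rsqrt)
    have c2: "contU (\<lambda>x. (\<omega> x * vG x)\<^sup>2)" "contU (\<lambda>x. (1 - (\<omega> x)\<^sup>2) * (vG x)\<^sup>2)" by (intro continuous_intros cx)+
    have "(Ln \<kappa> 2 vG)\<^sup>2 = (\<integral>x. (1 - (\<omega> x)\<^sup>2) * (vG x)\<^sup>2 \<partial>BM \<kappa>)"
      unfolding Ln_2[OF cont_v(3)] by (rule BM_cong) (simp add: xin)
    also have "\<dots> \<le> (\<integral>x. (1 - (\<omega> x)\<^sup>2) * (vG x)\<^sup>2 \<partial>BM r')"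
      by (rule BM_subset[OF c2(2) k(2)]) (use x01 in \<open>auto simp: power_le_one\<close>)
    finally have "(\<integral>x. (\<omega> x * vG x)\<^sup>2 \<partial>BM r') + (Ln \<kappa> 2 vG)\<^sup>2 \<le> (\<integral>x. (\<omega> x * vG x)\<^sup>2 + (1 - (\<omega> x)\<^sup>2) * (vG x)\<^sup>2 \<partial>BM r')"
      by (simp add: BM_int_add[OF c2])
    also have "\<dots> = (Ln r' 2 vG)\<^sup>2" unfolding Ln_2[OF cont_v(3)] by (rule BM_cong) (simp add: algebra_simps power_mult_distrib)
    finally show "(Ln r' 2 (\<lambda>x. \<omega> x * vG x))\<^sup>2 \<le> (Ln r' 2 vG)\<^sup>2 - (Ln \<kappa> 2 vG)\<^sup>2"
      by (subst Ln_2) (auto intro!: continuous_intros cx)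
  qed
  have outer: "(\<integral>x. \<bar>(\<omega> x * vG x) * (vM x * (zt r r' x ^ 3 * va x))\<bar> \<partial>BM r') \<le>
      sqrt ((Ln r' 2 vG)\<^sup>2 - (Ln \<kappa> 2 vG)\<^sup>2) * (Ln r' s vM * Ln r' q (\<lambda>x. zt r r' x ^ 3 * va x))"
  proof -
    have "(\<integral>x. \<bar>(\<omega> x * vG x) * (vM x * (zt r r' x ^ 3 * va x))\<bar> \<partial>BM r') \<le> Ln r' 2 (\<lambda>x. \<omega> x * vG x) * Ln r' 2 (\<lambda>x. vM x * (zt r r' x ^ 3 * va x))"
      by (rule Holder2) (intro continuous_intros c cx)+
    also have "\<dots> \<le> sqrt ((Ln r' 2 vG)\<^sup>2 - (Ln \<kappa> 2 vG)\<^sup>2) * (Ln r' s vM * Ln r' q (\<lambda>x. zt r r' x ^ 3 * va x))"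
    proof (rule mult_mono[OF tail])
      show "Ln r' 2 (\<lambda>x. vM x * (zt r r' x ^ 3 * va x)) \<le> Ln r' s vM * Ln r' q (\<lambda>x. zt r r' x ^ 3 * va x)"
        using s qq by (intro Ln_mult continuous_intros c) auto
      show "0 \<le> sqrt ((Ln r' 2 vG)\<^sup>2 - (Ln \<kappa> 2 vG)\<^sup>2)" using tail Ln_nonneg order_trans by blast
    qed simp
    finally show ?thesis .
  qed
  have c1: "contU (\<lambda>x. 1 - \<omega> x)" by (intro continuous_intros cx)
  have inner: "(\<integral>x. \<bar>vM x * (1 - \<omega> x)\<bar> \<partial>BM r') \<le> Ln r' s vM * (unit_ball_vol 3 * (2 * \<kappa>) ^ 3) powr (1 - 1 / s)"
  proof -
    define t where "t = s / (s - 1)"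
    have t: "1 < t" "1 / s + 1 / t = 1" "1 / t = 1 - 1 / s" using s by (auto simp: t_def field_simps)
    have "(\<integral>x. \<bar>vM x * (1 - \<omega> x)\<bar> \<partial>BM r') \<le> Ln r' s vM * Ln r' t (\<lambda>x. 1 - \<omega> x)"
      by (rule Holder_BM) (use s t in \<open>auto intro!: continuous_intros cx\<close>)
    also have "Ln r' t (\<lambda>x. 1 - \<omega> x) \<le> (unit_ball_vol 3 * (2 * \<kappa>) ^ 3) powr (1 / t)"
      unfolding Ln_def
    proof (rule powr_mono2)
      show "(\<integral>x. \<bar>1 - \<omega> x\<bar> powr t \<partial>BM r') \<le> unit_ball_vol 3 * (2 * \<kappa>) ^ 3"
      proof (rule BM_ball_support[OF cont_powr[OF c1]])
        show "\<bar>1 - \<omega> x\<bar> powr t \<le> 1" for x using x01[of x] t by (intro powr_le1) auto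
        show "\<bar>1 - \<omega> x\<bar> powr t = 0" if "2 * \<kappa> < norm x" for x using xout[OF that] by simp
      qed (use t k in auto)
    qed (use t s in \<open>auto intro: BM_nonneg\<close>)
    finally show ?thesis by (simp add: t(3) mult_left_mono)
  qed
  have "(\<integral>x. vM x * (vG x * (zt r r' x ^ 3 * va x)) \<partial>BM r') \<le>
      (\<integral>x. \<bar>(\<omega> x * vG x) * (vM x * (zt r r' x ^ 3 * va x))\<bar> + G0 * a0 * \<bar>vM x * (1 - \<omega> x)\<bar> \<partial>BM r')"
  proof (rule BM_mono)
    fix x :: "real^3"
    have z3: "zt r r' x ^ 3 \<le> 1" "0 \<le> zt r r' x ^ 3" using z(2,3)[of x] by (auto intro: power_le_one)
    have "(1 - \<omega> x) * (vG x * (zt r r' x ^ 3 * va x)) \<le> (1 - \<omega> x) * (G0 * a0)"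
    proof (cases "norm x \<le> 2 * \<kappa>")
      case True
      have "zt r r' x ^ 3 * va x \<le> 1 * a0" using z3 a0[OF True] by (intro mult_mono) auto
      then have "vG x * (zt r r' x ^ 3 * va x) \<le> G0 * a0" using G0[OF True] G0n z3 by (intro mult_mono) auto
      then show ?thesis using x01 by (intro mult_left_mono) auto
    qed (simp add: xout)
    then have "vM x * ((1 - \<omega> x) * (vG x * (zt r r' x ^ 3 * va x))) \<le> vM x * ((1 - \<omega> x) * (G0 * a0))" by (rule mult_left_mono[OF _ v_nonneg(4)])
    then have "vM x * (vG x * (zt r r' x ^ 3 * va x)) \<le> (\<omega> x * vG x) * (vM x * (zt r r' x ^ 3 * va x)) + G0 * a0 * (vM x * (1 - \<omega> x))"
      by (simp add: algebra_simps)
    also have "\<dots> = \<bar>(\<omega> x * vG x) * (vM x * (zt r r' x ^ 3 * va x))\<bar> + G0 * a0 * \<bar>vM x * (1 - \<omega> x)\<bar>"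
      using x01[of x] z3 by (simp add: abs_mult)
    finally show "vM x * (vG x * (zt r r' x ^ 3 * va x)) \<le> \<bar>(\<omega> x * vG x) * (vM x * (zt r r' x ^ 3 * va x))\<bar> + G0 * a0 * \<bar>vM x * (1 - \<omega> x)\<bar>" .
  qed (intro continuous_intros c cx)+
  also have "\<dots> = (\<integral>x. \<bar>(\<omega> x * vG x) * (vM x * (zt r r' x ^ 3 * va x))\<bar> \<partial>BM r') + G0 * a0 * (\<integral>x. \<bar>vM x * (1 - \<omega> x)\<bar> \<partial>BM r')"
    by (subst BM_int_add) (auto intro!: continuous_intros c cx)
  also have "\<dots> \<le> sqrt ((Ln r' 2 vG)\<^sup>2 - (Ln \<kappa> 2 vG)\<^sup>2) * (Ln r' s vM * Ln r' q (\<lambda>x. zt r r' x ^ 3 * va x))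
    + G0 * a0 * (Ln r' s vM * (unit_ball_vol 3 * (2 * \<kappa>) ^ 3) powr (1 - 1 / s))"
  proof (rule add_mono[OF outer mult_left_mono[OF inner]])
    show "0 \<le> G0 * a0" using G0n k by (intro mult_nonneg_nonneg order_trans[OF v_nonneg(1) a0[of 0]]) auto
  qed
  finally show ?thesis .
qed

text \<open>All three contributions can be made small: the first with \<delta>, the others with n.
  The exponent 4 - 12/s of the near field is positive because s > 3.\<close>

lemma vY_small:
  assumes s: "3 < s" "s \<le> 6" and n: "0 < n" "n \<le> 1" and e: "1 \<le> e" and M: "1 \<le> M"
    and A: "Ln 2 2 vG \<le> n ^ 3 * e" and m: "Ln 2 s vM \<le> M * n ^ 5 * n powr (6 / s - 1)"
    and k: "0 < R0" "R0 * n ^ 6 \<le> 2"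
    and G0: "\<And>x. norm x \<le> 2 * (R0 * n ^ 6) \<Longrightarrow> vG x \<le> G0 / n ^ 6" and a0: "\<And>x. norm x \<le> 2 * (R0 * n ^ 6) \<Longrightarrow> va x \<le> a0"
    and tail: "(Ln 2 2 vG)\<^sup>2 - (Ln (R0 * n ^ 6) 2 vG)\<^sup>2 \<le> n ^ 6 * \<delta>" and \<delta>: "0 \<le> \<delta>"
    and Y0: "Y0 = 4 * k0 M * e powr (6 / (s + 6))" and S0: "S0 = 5 * k0 M * sC * e"
  shows "vY 1 2 ^ 3 \<le> n ^ 12 * (lC * (2 * M * (S0 powr (6 / s - 1) * Y0 powr (1 - (6 / s - 1))) * sqrt \<delta>
    + G0 * a0 * M * (unit_ball_vol 3 * (2 * R0) ^ 3) powr (1 - 1 / s) * n powr (4 - 12 / s) + M * Y0\<^sup>2 * n))"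
proof -
  define \<theta> where "\<theta> = 6 / s - 1"
  define q where "q = 2 * s / (s - 2)"
  note te = theta_exponents[OF s q_def, folded \<theta>_def]
  have r: "(1::real) \<le> 1" "1 < (2::real)" "(2::real) \<le> 2" by auto
  have vs: "vS 1 2 \<le> n ^ 3 * S0" "vY 1 2 \<le> n ^ 4 * Y0"
    using vS_bound[OF r s n e M A m refl] by (auto simp: S0 Y0 mult_ac)
  have kp: "2 \<le> k0 M" by (rule k0_ge[OF M])
  have p: "0 < S0" "0 < Y0" using kp e lsC_ge_1 by (auto simp: S0 Y0)
  define m' where "m' = M * n ^ 5 * n powr \<theta>"
  have m': "Ln 2 s vM \<le> m'" "0 \<le> m'" using m M n by (auto simp: m'_def \<theta>_def)
  have pos: "0 < n ^ 3 * S0" "0 < n ^ 4 * Y0" using p n by auto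
  have Q: "Ln 2 q (\<lambda>x. zt 1 2 x ^ 3 * va x) \<le> 2 * ((n ^ 3 * S0) powr \<theta> * (n ^ 4 * Y0) powr (1 - \<theta>))"
    using Qz_le[OF r te(3,4) vs(2) pos(2) vs(1) pos(1)] unfolding te(1,2) .
  have Qm: "m' * (2 * ((n ^ 3 * S0) powr \<theta> * (n ^ 4 * Y0) powr (1 - \<theta>))) = n ^ 9 * (2 * M * (S0 powr \<theta> * Y0 powr (1 - \<theta>)))"
  proof -
    have "m' * (2 * ((n ^ 3 * S0) powr \<theta> * (n ^ 4 * Y0) powr (1 - \<theta>))) =
        n ^ 5 * ((n ^ 3) powr \<theta> * (n ^ 4) powr (1 - \<theta>) * n powr \<theta>) * (2 * M * (S0 powr \<theta> * Y0 powr (1 - \<theta>)))"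
      by (simp add: m'_def powr_mult mult_ac)
    also have "\<dots> = n ^ 9 * (2 * M * (S0 powr \<theta> * Y0 powr (1 - \<theta>)))" unfolding interpolation_weight[OF n(1)] by simp
    finally show ?thesis .
  qed
  have sq: "sqrt ((Ln 2 2 vG)\<^sup>2 - (Ln (R0 * n ^ 6) 2 vG)\<^sup>2) \<le> n ^ 3 * sqrt \<delta>"
  proof -
    have "sqrt ((Ln 2 2 vG)\<^sup>2 - (Ln (R0 * n ^ 6) 2 vG)\<^sup>2) \<le> sqrt (n ^ 6 * \<delta>)" using tail by simp
    also have "sqrt (n ^ 6 * \<delta>) = sqrt ((n ^ 3)\<^sup>2) * sqrt \<delta>" by (simp only: real_sqrt_mult power_mult[symmetric]) simp
    also have "sqrt ((n ^ 3)\<^sup>2) = n ^ 3" by (rule real_sqrt_unique) (use n in auto)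
    finally show ?thesis .
  qed
  have t1: "sqrt ((Ln 2 2 vG)\<^sup>2 - (Ln (R0 * n ^ 6) 2 vG)\<^sup>2) * (Ln 2 s vM * Ln 2 q (\<lambda>x. zt 1 2 x ^ 3 * va x)) \<le> n ^ 12 * (2 * M * (S0 powr \<theta> * Y0 powr (1 - \<theta>)) * sqrt \<delta>)"
  proof -
    have "sqrt ((Ln 2 2 vG)\<^sup>2 - (Ln (R0 * n ^ 6) 2 vG)\<^sup>2) * (Ln 2 s vM * Ln 2 q (\<lambda>x. zt 1 2 x ^ 3 * va x)) \<le> (n ^ 3 * sqrt \<delta>) * (m' * (2 * ((n ^ 3 * S0) powr \<theta> * (n ^ 4 * Y0) powr (1 - \<theta>))))"
      using n m' \<delta> by (intro mult_mono sq Q m'(1)) auto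
    also have "\<dots> = n ^ 12 * (2 * M * (S0 powr \<theta> * Y0 powr (1 - \<theta>)) * sqrt \<delta>)"
      unfolding Qm by (simp add: mult_ac power_add[symmetric])
    finally show ?thesis .
  qed
  have t2: "G0 / n ^ 6 * a0 * (Ln 2 s vM * (unit_ball_vol 3 * (2 * (R0 * n ^ 6)) ^ 3) powr (1 - 1 / s))
      \<le> n ^ 12 * (G0 * a0 * M * (unit_ball_vol 3 * (2 * R0) ^ 3) powr (1 - 1 / s) * n powr (4 - 12 / s))"
  proof -
    have "0 \<le> G0 / n ^ 6" using k n by (intro order_trans[OF v_nonneg(3) G0[of 0]]) simp
    moreover have "0 \<le> a0" using k n by (intro order_trans[OF v_nonneg(1) a0[of 0]]) simp
    ultimately have 1: "G0 / n ^ 6 * a0 * (Ln 2 s vM * (unit_ball_vol 3 * (2 * (R0 * n ^ 6)) ^ 3) powr (1 - 1 / s))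
       \<le> G0 / n ^ 6 * a0 * (m' * (unit_ball_vol 3 * (2 * (R0 * n ^ 6)) ^ 3) powr (1 - 1 / s))"
      by (intro mult_left_mono mult_right_mono m' mult_nonneg_nonneg) auto
    have 2: "(unit_ball_vol 3 * (2 * (R0 * n ^ 6)) ^ 3) powr (1 - 1 / s) = (unit_ball_vol 3 * (2 * R0) ^ 3) powr (1 - 1 / s) * n powr (18 - 18 / s)"
    proof -
      have "unit_ball_vol 3 * (2 * (R0 * n ^ 6)) ^ 3 = (unit_ball_vol 3 * (2 * R0) ^ 3) * n powr 18"
        using n by (simp add: power_mult_distrib power_mult[symmetric])
      moreover have "(n powr 18) powr (1 - 1 / s) = n powr (18 - 18 / s)" by (simp add: powr_powr algebra_simps)
      ultimately show ?thesis by (simp only: powr_mult)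
    qed
    \<comment> \<open>Powers of n in the near field: -6 from the rescaled gradient, 5 + \<theta>
      from the potential and 18 (1 - 1/s) from the volume of a ball of radius of order n^6.\<close>
    have 3: "n ^ 5 / n ^ 6 * n powr \<theta> * n powr (18 - 18 / s) = n ^ 12 * n powr (4 - 12 / s)"
    proof -
      have "n ^ 5 / n ^ 6 = n powr (- 1)" using n power_add[of n 5 1] by (simp add: powr_minus divide_inverse)
      then have "n ^ 5 / n ^ 6 * n powr \<theta> * n powr (18 - 18 / s) = n powr (- 1 + \<theta> + (18 - 18 / s))" by (simp only: powr_add)
      also have "- 1 + \<theta> + (18 - 18 / s) = 12 + (4 - 12 / s)" by (simp add: \<theta>_def)
      also have "n powr (12 + (4 - 12 / s)) = n powr 12 * n powr (4 - 12 / s)" by (rule powr_add)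
      also have "n powr 12 = n ^ 12" using n by simp
      finally show ?thesis .
    qed
    have "G0 / n ^ 6 * a0 * (m' * (unit_ball_vol 3 * (2 * (R0 * n ^ 6)) ^ 3) powr (1 - 1 / s))
       = G0 * a0 * M * (unit_ball_vol 3 * (2 * R0) ^ 3) powr (1 - 1 / s) * (n ^ 5 / n ^ 6 * n powr \<theta> * n powr (18 - 18 / s))"
      unfolding 2 by (simp add: m'_def mult_ac)
    then show ?thesis using 1 unfolding 3 by (simp only: mult_ac)
  qed
  have t3: "Ln 2 s vM * (vY 1 2)\<^sup>2 \<le> n ^ 12 * (M * Y0\<^sup>2 * n)"
  proof -
    have "m' \<le> M * n ^ 5 * 1" unfolding m'_def using M n te by (intro mult_left_mono) (auto intro!: powr_le1)
    then have "Ln 2 s vM * (vY 1 2)\<^sup>2 \<le> (M * n ^ 5) * (n ^ 4 * Y0)\<^sup>2"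
      using m' vs n M by (intro mult_mono power_mono) auto
    also have "\<dots> = n ^ 12 * (M * Y0\<^sup>2 * n)"
      using power_add[of n 12 1] by (simp add: power_mult_distrib power_mult[symmetric] mult_ac power_add[symmetric])
    finally show ?thesis .
  qed
  have k': "0 < R0 * n ^ 6" using k n by simp
  have "vY 1 2 ^ 3 \<le> lC * ((\<integral>x. vM x * (vG x * (zt 1 2 x ^ 3 * va x)) \<partial>BM 2) + Ln 2 s vM * (vY 1 2)\<^sup>2 / 1 ^ 5)"
    unfolding vY_def by (rule cubic_estimate) (use s zt[OF r] in auto)
  also have "\<dots> \<le> lC * ((n ^ 12 * (2 * M * (S0 powr \<theta> * Y0 powr (1 - \<theta>)) * sqrt \<delta>)
      + n ^ 12 * (G0 * a0 * M * (unit_ball_vol 3 * (2 * R0) ^ 3) powr (1 - 1 / s) * n powr (4 - 12 / s))) + n ^ 12 * (M * Y0\<^sup>2 * n))"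
    using t3 lsC_ge_1 cubic_split[OF r s q_def k' k(2) G0 a0]
    by (intro mult_left_mono add_mono order_trans[OF _ add_mono[OF t1 t2]]) auto
  finally show ?thesis unfolding \<theta>_def[symmetric] by (simp only: distrib_left mult_ac add_ac)
qed

text \<open>Here y remains a free parameter instead of being replaced by a power of e: every term
  carries a positive power of y, except one made small by large l and one made small by small
  n.\<close>

lemma energy_small:
  assumes s: "3 < s" "s \<le> 6" and n: "0 < n" "n \<le> 1" "\<nu> = n ^ 6" and e: "1 \<le> e" and M: "1 \<le> M"
    and A: "Ln 2 2 vG \<le> n ^ 3 * e" and m: "Ln 2 s vM \<le> M * n ^ 5 * n powr (6 / s - 1)"
    and Y: "vY 1 2 \<le> n ^ 4 * y" "0 < y" and l: "0 < l" "l * n\<^sup>2 \<le> 1 / 16" and S0: "S0 = 5 * k0 M * sC * e"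
  shows "(Ln 1 2 vG)\<^sup>2 \<le> n ^ 6 * (mC * ((1 + M) * e * y + y ^ 3 + M * e / l + l * n\<^sup>2 * e\<^sup>2
      + 2 * M * e * (S0 powr (6 / s - 1) * y powr (1 - (6 / s - 1))) + l * y * e\<^sup>2 + 4 * e * S0 * y * n ^ 4))"
proof -
  have r: "(1::real) \<le> 1" "1 < (2::real)" "(2::real) \<le> 2" by auto
  define Z where "Z = Ln (1 + 3 * (2 - 1) / 4) 4 vb"
  have S: "vS 1 2 \<le> n ^ 3 * S0" using vS_bound(1)[OF r s n(1,2) e M A m refl] by (simp add: S0 mult_ac)
  have kp: "2 \<le> k0 M" by (rule k0_ge[OF M])
  have p: "0 < S0" using kp e lsC_ge_1 by (auto simp: S0)
  have "Z\<^sup>2 \<le> 4 * ((n ^ 3 * S0) * (n ^ 4 * y))" unfolding Z_def by (rule hall_Z[OF r Y(1) _ S]) (use n p Y in auto)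
  then have "e * Z\<^sup>2 / n ^ 3 \<le> e * (4 * ((n ^ 3 * S0) * (n ^ 4 * y))) / n ^ 3" using n e by (intro divide_right_mono mult_left_mono) auto
  also have "\<dots> = 4 * e * S0 * y * n ^ 4" using n by simp
  finally have Z: "e * Z\<^sup>2 / n ^ 3 \<le> 4 * e * S0 * y * n ^ 4" .
  have "(Ln 1 2 vG)\<^sup>2 \<le> n ^ 6 * (mC / (2 - 1) ^ 9 * ((1 + M) * e * y + y ^ 3 + M * e / l + l * n\<^sup>2 * e\<^sup>2
      + 2 * M * e * (S0 powr (6 / s - 1) * y powr (1 - (6 / s - 1))) + l * y * e\<^sup>2 + e * Z\<^sup>2 / n ^ 3))"
    by (rule unit_energy[OF r s n e M A m Y S p l(1)]) (use l in \<open>auto simp: Z_def\<close>)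
  also have "\<dots> \<le> n ^ 6 * (mC / (2 - 1) ^ 9 * ((1 + M) * e * y + y ^ 3 + M * e / l + l * n\<^sup>2 * e\<^sup>2
      + 2 * M * e * (S0 powr (6 / s - 1) * y powr (1 - (6 / s - 1))) + l * y * e\<^sup>2 + 4 * e * S0 * y * n ^ 4))"
    using n mC_pos by (intro mult_left_mono add_left_mono Z) auto
  finally show ?thesis by simp
qed

section \<open>From mean oscillation to the full L^p norm of the magnetic field\<close>

definition oscb :: "real^3 \<Rightarrow> real^3 \<Rightarrow> real" where "oscb c x = norm ((\<chi> k. b k x) - c)"

lemma contU_oscb: "contU (oscb c)"
  unfolding oscb_def[abs_def] by (intro continuous_intros smooth3_cont smb)

text \<open>The constant \<open>c\<close> is controlled by testing with a cutoff: the integral of b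
  \<eta> is minus that of the potential against the gradient of \<eta>, hence bounded by the
  potential, and it differs from c times the integral of \<eta> only by the oscillation.\<close>

lemma mean_bound:
  assumes s: "1 \<le> s" and p: "1 < p"
  shows "Ln 2 p vb \<le> (1 + Ln 2 p (\<lambda>x. 1) * (3 * ((3 * (216 * 4 ^ 5 * bumpC) * volc + volc) / unit_ball_vol 3))) * (Ln 2 s vM + Ln 2 p (oscb c))"
proof -
  obtain \<eta> where h: "is_cutoff 1 1 \<eta>" using cutoff_exists[of 1 1] by auto
  define C where "C = 216 * 4 ^ 5 * bumpC"
  have h1: "smooth3 \<eta>" "\<And>x. 0 \<le> \<eta> x" "\<And>x. \<eta> x \<le> 1" "\<And>x. norm x \<le> 1 \<Longrightarrow> \<eta> x = 1" "\<And>x. 2 < norm x \<Longrightarrow> \<eta> x = 0" "\<And>i x. \<bar>pd i \<eta> x\<bar> \<le> C"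
    using h by (auto simp: is_cutoff_def C_def)
  have ch: "contU \<eta>" by (rule smooth3_cont[OF h1(1)])
  have V: "unit_ball_vol 3 \<le> (\<integral>x. \<eta> x \<partial>BM 2)"
  proof -
    have "ennreal (unit_ball_vol 3) = emeasure lborel (cball (0::real^3) 1)" by (subst emeasure_cball3) simp_all
    also have "\<dots> = (\<integral>\<^sup>+x. indicator (cball (0::real^3) 1) x \<partial>lborel)" by simp
    also have "\<dots> \<le> (\<integral>\<^sup>+x. indicator (cball 0 2) x * ennreal (\<eta> x) \<partial>lborel)"
      by (intro nn_integral_mono) (auto simp: indicator_def h1(4))
    also have "\<dots> = ennreal (\<integral>x. \<eta> x \<partial>BM 2)" by (rule nn_integral_BM[OF ch h1(2)])
    finally show ?thesis by (simp add: BM_nonneg h1(2))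
  qed
  have Vp: "0 < unit_ball_vol (3::real)" by simp
  have C0: "0 \<le> C" using h1(6)[of 1 0] by linarith
  define T where "T = Ln 2 s vM + Ln 2 p (oscb c)"
  have c: "\<bar>c $ i\<bar> \<le> (3 * C * volc + volc) / unit_ball_vol 3 * T" for i
  proof -
    have cb: "contU (b i)" by (rule smooth3_cont[OF smb])
    have cp: "contU (pd j \<eta>)" for j by (rule smooth3_cont[OF smooth3_pd[OF h1(1)]])
    have cH: "contU (H i j)" "contU (pd j (H i j))" for j by (auto intro!: smooth3_cont smH smooth3_pd)
    have "(\<integral>x. b i x * \<eta> x \<partial>BM 2) = (\<integral>x. (\<Sum>j\<in>UNIV. pd j (H i j) x * \<eta> x) \<partial>BM 2)"
      by (rule BM_cong) (simp add: divH[symmetric] sum_distrib_right)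
    also have "\<dots> = (\<Sum>j\<in>UNIV. \<integral>x. pd j (H i j) x * \<eta> x \<partial>BM 2)"
      by (rule BM_int_sum) (intro continuous_intros cH ch)
    also have "\<dots> = (\<Sum>j\<in>UNIV. - (\<integral>x. H i j x * pd j \<eta> x \<partial>BM 2))"
      using integral_pd_by_parts[OF smH h1(1,5), of 2] by simp
    finally have eq: "(\<integral>x. b i x * \<eta> x \<partial>BM 2) = (\<Sum>j\<in>UNIV. - (\<integral>x. H i j x * pd j \<eta> x \<partial>BM 2))" .
    have "\<bar>- (\<integral>x. H i j x * pd j \<eta> x \<partial>BM 2)\<bar> \<le> C * (volc * Ln 2 s vM)" for j
    proof -
      have "\<bar>\<integral>x. H i j x * pd j \<eta> x \<partial>BM 2\<bar> \<le> (\<integral>x. C * vM x \<partial>BM 2)"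
      proof (rule BM_abs_le)
        show "\<bar>H i j x * pd j \<eta> x\<bar> \<le> C * vM x" for x
          unfolding abs_mult using mult_mono[OF le_v(8)[of i j x] h1(6)[of j x]] by (simp add: mult.commute)
      qed (intro continuous_intros cH cp)+
      also have "\<dots> = C * Ln 2 1 vM" by (simp add: Ln_def BM_nonneg)
      also have "\<dots> \<le> C * (volc * Ln 2 s vM)" using C0 s by (intro mult_left_mono Ln_le_Ln continuous_intros) auto
      finally show ?thesis by simp
    qed
    from sum3_le[where f="\<lambda>j. - (\<integral>x. H i j x * pd j \<eta> x \<partial>BM 2)", OF this]
    have 1: "\<bar>\<integral>x. b i x * \<eta> x \<partial>BM 2\<bar> \<le> 3 * (C * (volc * Ln 2 s vM))" unfolding eq .
    have 2: "\<bar>\<integral>x. (b i x - c $ i) * \<eta> x \<partial>BM 2\<bar> \<le> volc * Ln 2 p (oscb c)"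
    proof -
      have "\<bar>\<integral>x. (b i x - c $ i) * \<eta> x \<partial>BM 2\<bar> \<le> (\<integral>x. oscb c x \<partial>BM 2)"
      proof (rule BM_abs_le)
        show "\<bar>(b i x - c $ i) * \<eta> x\<bar> \<le> oscb c x" for x
        proof -
          have "\<bar>b i x - c $ i\<bar> \<le> oscb c x" using component_le_norm_cart[of "(\<chi> k. b k x) - c" i] by (simp add: oscb_def)
          then have "\<bar>b i x - c $ i\<bar> * \<bar>\<eta> x\<bar> \<le> oscb c x * 1" using h1(2,3)[of x] by (intro mult_mono) (auto simp: oscb_def)
          then show ?thesis by (simp add: abs_mult)
        qed
      qed (intro continuous_intros cb ch contU_oscb)+
      also have "\<dots> = Ln 2 1 (oscb c)" by (simp add: Ln_def BM_nonneg oscb_def)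
      also have "\<dots> \<le> volc * Ln 2 p (oscb c)" using p by (intro Ln_le_Ln contU_oscb) auto
      finally show ?thesis .
    qed
    have "c $ i * (\<integral>x. \<eta> x \<partial>BM 2) = (\<integral>x. b i x * \<eta> x \<partial>BM 2) - (\<integral>x. (b i x - c $ i) * \<eta> x \<partial>BM 2)"
    proof -
      have "(\<integral>x. b i x * \<eta> x \<partial>BM 2) - (\<integral>x. (b i x - c $ i) * \<eta> x \<partial>BM 2) = (\<integral>x. b i x * \<eta> x - (b i x - c $ i) * \<eta> x \<partial>BM 2)"
        by (rule BM_int_diff[symmetric]) (intro continuous_intros cb ch)+
      also have "\<dots> = (\<integral>x. c $ i * \<eta> x \<partial>BM 2)" by (rule BM_cong) (simp add: algebra_simps)
      finally show ?thesis by simp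
    qed
    then have "\<bar>c $ i\<bar> * (\<integral>x. \<eta> x \<partial>BM 2) \<le> 3 * (C * (volc * Ln 2 s vM)) + volc * Ln 2 p (oscb c)"
      using 1 2 V Vp by (simp add: abs_mult flip: abs_mult_pos)
    moreover have "\<bar>c $ i\<bar> * unit_ball_vol 3 \<le> \<bar>c $ i\<bar> * (\<integral>x. \<eta> x \<partial>BM 2)" by (intro mult_left_mono V) auto
    moreover have "3 * (C * (volc * Ln 2 s vM)) + volc * Ln 2 p (oscb c) \<le> (3 * C * volc + volc) * T"
      using C0 volc_ge_1 by (simp add: T_def algebra_simps)
    ultimately show ?thesis using Vp by (simp add: pos_le_divide_eq)
  qed
  have nc: "norm c \<le> 3 * ((3 * C * volc + volc) / unit_ball_vol 3 * T)"
    using order_trans[OF norm_le_l1_cart[of c] sum_mono[OF c]] by simp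
  have "Ln 2 p vb \<le> Ln 2 p (\<lambda>x. oscb c x + norm c * 1)"
  proof (rule Ln_mono)
    show "\<bar>vb x\<bar> \<le> \<bar>oscb c x + norm c * 1\<bar>" for x
    proof -
      have "vb x = norm (\<chi> k. b k x)" by (simp add: vb_def norm_vec_def L2_set_def)
      then show ?thesis using norm_triangle_ineq[of "(\<chi> k. b k x) - c" c] by (simp add: oscb_def)
    qed
  qed (use p in \<open>auto intro!: continuous_intros contU_oscb\<close>)
  also have "\<dots> \<le> Ln 2 p (oscb c) + Ln 2 p (\<lambda>x. norm c * 1)" using p by (intro Ln_add contU_oscb) auto
  also have "Ln 2 p (\<lambda>x. norm c * 1) = norm c * Ln 2 p (\<lambda>x. 1)" using p by (subst Ln_cmult) auto
  also have "Ln 2 p (oscb c) + norm c * Ln 2 p (\<lambda>x. 1) \<le> T + (3 * ((3 * C * volc + volc) / unit_ball_vol 3 * T)) * Ln 2 p (\<lambda>x. 1)"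
    by (intro add_mono mult_right_mono nc) (auto simp: T_def)
  finally show ?thesis unfolding T_def C_def by (simp add: algebra_simps)
qed

end

section \<open>Iteration and scaling\<close>

text \<open>Consider the supremum S of (2 - r)^N f(r), finite thanks to \<open>D\<close>. Steps
  proportional to the remaining distance multiply the weight by 2/3, so the gain 1/2 still yields
  the factor 3/4 < 1 and S is absorbed. Blow-up of the threshold like the step to the power -N is
  exactly compensated by the weight.\<close>

lemma absorb_iteration:
  fixes f :: "real \<Rightarrow> real"
  assumes f0: "\<And>r. 0 \<le> f r" and fD: "\<And>r. r \<le> 2 \<Longrightarrow> f r \<le> D" and N: "0 < N" and T: "1 \<le> T"
    and step: "\<And>r r' e. 1 \<le> r \<Longrightarrow> r < r' \<Longrightarrow> r' \<le> 2 \<Longrightarrow> 1 \<le> e \<Longrightarrow> f r' \<le> e\<^sup>2 \<Longrightarrow> T * (r' - r) powr (- N) \<le> e\<^sup>2 \<Longrightarrow> f r \<le> e\<^sup>2 / 2"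
  shows "f 1 \<le> T * (1 - (2/3) powr (1 / N)) powr (- N)"
proof -
  \<comment> \<open>Chosen so that (1 - \<gamma>)^N = 2/3.\<close>
  define \<gamma> where "\<gamma> = 1 - (2/3 :: real) powr (1 / N)"
  have "(2/3 :: real) powr (1 / N) < 1 powr (1 / N)" using N by (intro powr_less_mono2) auto
  then have l: "0 < \<gamma>" "\<gamma> < 1" by (auto simp: \<gamma>_def)
  have lN: "(1 - \<gamma>) powr N = 2/3" using N by (simp add: \<gamma>_def powr_powr)
  define g where "g r = (2 - r) powr N * f r" for r
  define S where "S = (SUP r\<in>{1..<2}. g r)"
  have D0: "0 \<le> D" using f0[of 1] fD[of 1] by simp
  have bdd: "bdd_above (g ` {1..<2})"
  proof (rule bdd_aboveI2)
    fix r :: real assume r: "r \<in> {1..<2}"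
    have "g r \<le> 1 * D" unfolding g_def using r N by (intro mult_mono fD f0 powr_le1) auto
    then show "g r \<le> D" by simp
  qed
  have le: "g r \<le> S" if "1 \<le> r" "r < 2" for r unfolding S_def using that by (intro cSUP_upper bdd) auto
  have S0: "0 \<le> S" using le[of 1] f0[of 1] by (auto simp: g_def)
  have st: "g r \<le> max (3 / 4 * S) (T * \<gamma> powr (- N) / 2)" if r: "1 \<le> r" "r < 2" for r
  proof -
    define d where "d = \<gamma> * (2 - r)"
    have d: "0 < d" "d \<le> 1" using l r mult_mono[of \<gamma> 1 "2 - r" 1] by (auto simp: d_def)
    have dr: "d < 2 - r" using l r by (simp add: d_def)
    \<comment> \<open>The least value admissible in \<open>step\<close>. Either the energy term wins
      and 3/4 S appears, or the threshold wins and the bound is explicit.\<close>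
    define e2 where "e2 = max (f (r + d)) (T * d powr (- N))"
    have "1 * 1 \<le> T * d powr (- N)"
    proof (rule mult_mono[OF T])
      show "1 \<le> d powr (- N)" using d N powr_mono'[of "- N" 0 d] by simp
    qed (use T in auto)
    then have e2: "1 \<le> e2" by (simp add: e2_def)
    have sq: "(sqrt e2)\<^sup>2 = e2" using e2 by simp
    have "f r \<le> (sqrt e2)\<^sup>2 / 2"
      using r d dr e2 by (intro step[of r "r + d"]) (auto simp: sq, auto simp: e2_def)
    then have "g r \<le> (2 - r) powr N * (e2 / 2)" unfolding g_def sq by (intro mult_left_mono) auto
    also have "\<dots> \<le> max (3 / 4 * S) (T * \<gamma> powr (- N) / 2)"
    proof (cases "e2 = f (r + d)")
      case True
      have "2 - (r + d) = (1 - \<gamma>) * (2 - r)" by (simp add: d_def algebra_simps)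
      then have "g (r + d) = (2/3) * ((2 - r) powr N * e2)" using lN r l True by (simp add: g_def powr_mult)
      then show ?thesis using le[of "r + d"] d r dr by simp
    next
      case False
      then have "e2 = T * d powr (- N)" by (auto simp: e2_def max_def split: if_splits)
      then have "(2 - r) powr N * (e2 / 2) = T * \<gamma> powr (- N) / 2 * ((2 - r) powr N * (2 - r) powr (- N))"
        using l r by (simp add: d_def powr_mult)
      also have "(2 - r) powr N * (2 - r) powr (- N) = 1" using r by (simp add: powr_minus)
      finally show ?thesis by simp
    qed
    finally show ?thesis .
  qed
  define X where "X = max (3 / 4 * S) (T * \<gamma> powr (- N) / 2)"
  have "S \<le> X" unfolding S_def by (rule cSUP_least) (use st in \<open>auto simp: X_def\<close>)
  moreover have "0 \<le> T * \<gamma> powr (- N)" using T by simp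
  ultimately have "S \<le> T * \<gamma> powr (- N)" using S0 unfolding X_def by (auto simp: max_def split: if_splits)
  then show ?thesis using le[of 1] by (simp add: g_def \<gamma>_def)
qed

text \<open>After k doublings the factor 16^(-k) meets cubic growth 8^k, so the remainder tends to 0
  and only the geometric sum of \<open>C0\<close> is left.\<close>

lemma dyadic_bounded:
  fixes E :: "real \<Rightarrow> real"
  assumes R0: "1 \<le> R0" and C0: "0 \<le> C0" and step: "\<And>x. R0 \<le> x \<Longrightarrow> E x \<le> C0 + E (2 * x) / 16" and cub: "\<And>x. R0 \<le> x \<Longrightarrow> E x \<le> x ^ 3"
    and x: "R0 \<le> x"
  shows "E x \<le> 2 * C0"
proof -
  have it: "E x \<le> 2 * C0 * (1 - (1/16) ^ k) + (1/16) ^ k * E (2 ^ k * x)" for k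
  proof (induction k)
    case (Suc k)
    have "1 * x \<le> 2 ^ k * x" using R0 x by (intro mult_right_mono) auto
    then have "E (2 ^ k * x) \<le> C0 + E (2 * (2 ^ k * x)) / 16" using x by (intro step) auto
    then have "(1/16) ^ k * E (2 ^ k * x) \<le> (1/16) ^ k * (C0 + E (2 ^ Suc k * x) / 16)" by (intro mult_left_mono) (auto simp: mult_ac)
    moreover have "0 \<le> C0 * (1/16 :: real) ^ k" using C0 by simp
    ultimately show ?case using Suc by (simp add: algebra_simps)
  qed auto
  have bd: "E x \<le> 2 * C0 + x ^ 3 * (1/2) ^ k" for k
  proof -
    have "1 * x \<le> 2 ^ k * x" using R0 x by (intro mult_right_mono) auto
    then have "E (2 ^ k * x) \<le> (2 ^ k * x) ^ 3" using x by (intro cub) auto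
    then have "(1/16) ^ k * E (2 ^ k * x) \<le> (1/16) ^ k * ((2 ^ k * x) ^ 3)" by (intro mult_left_mono) auto
    also have "\<dots> = x ^ 3 * ((1/16) ^ k * (2 ^ k) ^ 3)" by (simp add: power_mult_distrib)
    also have "(1/16) ^ k * (2 ^ k) ^ 3 = (1/2 :: real) ^ k"
    proof -
      have "((2::real) ^ k) ^ 3 = (2 ^ 3) ^ k" by (simp only: power_mult[symmetric] mult.commute)
      then show ?thesis by (simp add: power_mult_distrib[symmetric])
    qed
    finally have "(1/16) ^ k * E (2 ^ k * x) \<le> x ^ 3 * (1/2) ^ k" .
    moreover have "2 * C0 * (1 - (1/16) ^ k) \<le> 2 * C0 * 1" using C0 by (intro mult_left_mono) auto
    ultimately show ?thesis using it[of k] by linarith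
  qed
  have "(\<lambda>k. 2 * C0 + x ^ 3 * (1/2) ^ k) \<longlonglongrightarrow> 2 * C0 + x ^ 3 * 0"
    by (intro tendsto_intros LIMSEQ_power_zero) auto
  then have "(\<lambda>k. 2 * C0 + x ^ 3 * (1/2) ^ k) \<longlonglongrightarrow> 2 * C0" by simp
  then show ?thesis by (rule LIMSEQ_le_const) (use bd in auto)
qed

section \<open>Passing from the original to the unit scale\<close>

lemma BM_scale:
  assumes h: "contU h" and R: "0 < R"
  shows "(\<integral>x. h x \<partial>BM (R * r)) = R ^ 3 * (\<integral>x. h (R *\<^sub>R x) \<partial>BM r)"
proof -
  have "(\<integral>x. h x \<partial>BM (R * r)) = (\<integral>x. indicator (cball 0 (R * r)) x * h x \<partial>lborel)"
    unfolding BM_def by (subst integral_restrict_space) auto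
  also have "\<dots> = \<bar>R\<bar> ^ 3 * (\<integral>x. indicator (cball 0 (R * r)) (0 + R *\<^sub>R x) * h (0 + R *\<^sub>R x) \<partial>lborel)"
    by (rule integral_affine3) (use R in \<open>auto intro!: borel_measurable_times borel_measurable_indicator borel_measurable_continuous_onI[OF h]\<close>)
  also have "(\<integral>x. indicator (cball 0 (R * r)) (0 + R *\<^sub>R x) * h (0 + R *\<^sub>R x) \<partial>lborel) = (\<integral>x. indicator (cball 0 r) x * h (R *\<^sub>R x) \<partial>lborel)"
    by (rule Bochner_Integration.integral_cong) (use R in \<open>auto simp: indicator_def\<close>)
  also have "\<dots> = (\<integral>x. h (R *\<^sub>R x) \<partial>BM r)" unfolding BM_def by (subst integral_restrict_space) auto
  finally show ?thesis using R by simp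
qed

text \<open>Connects the measure on a closed ball with the gauge integral over an open ball that
  defines \<open>mean_osc\<close>; the strict inequality puts the closed ball inside the open
  one.\<close>

lemma BM_le_HK:
  fixes h :: "real^3 \<Rightarrow> real"
  assumes h: "contU h" "\<And>x. 0 \<le> h x" and r: "r < t"
  shows "(\<integral>x. h x \<partial>BM r) \<le> integral (ball 0 t) h"
proof -
  have I: "set_integrable lborel (cball 0 t) h"
    using borel_integrable_compact[of "cball 0 t" h] continuous_on_subset[OF h(1)] by (auto simp: set_integrable_def)
  have i: "set_integrable lborel (ball 0 t) h" by (rule set_integrable_subset[OF I]) auto
  have c: "set_integrable lborel (cball 0 r) h" by (rule set_integrable_subset[OF I]) (use r in auto)
  have "(\<integral>x. h x \<partial>BM r) = set_lebesgue_integral lborel (cball 0 r) h"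
    unfolding BM_def set_lebesgue_integral_def by (subst integral_restrict_space) auto
  also have "\<dots> = integral (cball 0 r) h" by (rule set_borel_integral_eq_integral(2)[OF c])
  also have "\<dots> \<le> integral (ball 0 t) h"
    by (rule integral_subset_le) (use r h set_borel_integral_eq_integral(1)[OF i] set_borel_integral_eq_integral(1)[OF c] in auto)
  finally show ?thesis .
qed

text \<open>Volume of the ball of radius 3. Means are taken over radius 3 R because the closed ball
  of radius 2 R, on which norms are needed, lies inside that open ball.\<close>

definition vq :: real where "vq = 27 * unit_ball_vol 3"

lemma mean_osc_scaled:
  fixes f :: "real^3 \<Rightarrow> 'b::euclidean_space"
  assumes f: "continuous_on UNIV f" and q: "1 \<le> q" and R: "0 < R"
  shows "Ln 2 q (\<lambda>x. norm (f (R *\<^sub>R x) - ball_mean f (3 * R))) \<le> vq powr (1 / q) * mean_osc f (3 * R) q"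
proof -
  define h where "h x = norm (f x - ball_mean f (3 * R)) powr q" for x
  have ch: "contU h" unfolding h_def using cont_powr[of UNIV "\<lambda>x. norm (f x - ball_mean f (3 * R))" q] q continuous_on_norm[OF continuous_on_diff[OF f continuous_on_const]] by simp
  have V: "measure lebesgue (ball (0::real^3) (3 * R)) = vq * R ^ 3"
  proof -
    have "measure lebesgue (ball (0::real^3) (3 * R)) = measure lborel (ball (0::real^3) (3 * R))" by simp
    also have "\<dots> = unit_ball_vol 3 * (3 * R) ^ 3" using content_ball[of "3 * R" "0::real^3"] R by simp
    finally show ?thesis by (simp add: vq_def power_mult_distrib)
  qed
  have vp: "0 < vq" by (simp add: vq_def)
  define I where "I = integral (ball 0 (3 * R)) h"
  have "R ^ 3 * (\<integral>x. h (R *\<^sub>R x) \<partial>BM 2) = (\<integral>x. h x \<partial>BM (R * 2))" by (rule BM_scale[OF ch R, symmetric])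
  also have "\<dots> \<le> I" unfolding I_def by (rule BM_le_HK[OF ch]) (use R in \<open>auto simp: h_def\<close>)
  finally have 1: "(\<integral>x. h (R *\<^sub>R x) \<partial>BM 2) \<le> I / R ^ 3" using R by (simp add: field_simps)
  have I0: "0 \<le> I" using order_trans[OF BM_nonneg BM_le_HK[OF ch, of R "3 * R"]] R by (auto simp: I_def h_def)
  have "Ln 2 q (\<lambda>x. norm (f (R *\<^sub>R x) - ball_mean f (3 * R))) = (\<integral>x. h (R *\<^sub>R x) \<partial>BM 2) powr (1 / q)" by (simp add: Ln_def h_def)
  also have "\<dots> \<le> (I / R ^ 3) powr (1 / q)" using q by (intro powr_mono2 1) (auto simp: h_def intro: BM_nonneg)
  also have "I / R ^ 3 = vq * (1 / (vq * R ^ 3) * I)" using vp R by simp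
  also have "\<dots> powr (1 / q) = vq powr (1 / q) * (1 / (vq * R ^ 3) * I) powr (1 / q)" by (rule powr_mult)
  finally show ?thesis by (simp add: mean_osc_def V I_def h_def[abs_def])
qed

lemma pd_scaled:
  fixes f :: "real^3 \<Rightarrow> real"
  assumes "smooth3 f" shows "pd i (\<lambda>x. f (R *\<^sub>R x)) = (\<lambda>x. R * pd i f (R *\<^sub>R x))"
  using pd_affine[of f 0 R _ i] assms by (auto simp: fun_eq_iff)

lemma smooth3_scaled: "smooth3 f \<Longrightarrow> smooth3 (\<lambda>x. f (R *\<^sub>R x))"
  using smooth3_affine[of f 0 R] by simp

lemma pd_scaled_cmult:
  fixes f :: "real^3 \<Rightarrow> real"
  assumes "smooth3 f" shows "pd i (\<lambda>x. c * f (R *\<^sub>R x)) = (\<lambda>x. c * (R * pd i f (R *\<^sub>R x)))"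
proof
  fix x show "pd i (\<lambda>x. c * f (R *\<^sub>R x)) x = c * (R * pd i f (R *\<^sub>R x))"
    using pd_cmult[of "\<lambda>x. f (R *\<^sub>R x)" x i c] smooth3_scaled[OF assms, of R] by (simp add: pd_scaled[OF assms])
qed

locale hall_mhd =
  fixes u B :: "real^3 \<Rightarrow> real^3" and P :: "real^3 \<Rightarrow> real" and \<Phi> \<Psi> :: "real^3 \<Rightarrow> real^3^3"
  assumes su: "smooth3 u" and sB: "smooth3 B" and sP: "smooth3 P" and sF: "smooth3 \<Phi>" and sG: "smooth3 \<Psi>"
    and eu: "- lap u x + adv u u x = - grad P x + adv B B x"
    and eB: "- lap B x + adv u B x = adv B u x + curl (\<lambda>y. cross3 (curl B y) (B y)) x"
    and du: "divg u x = 0" and dB: "divg B x = 0"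
    and dF: "rowdiv \<Phi> x = u x" and dG: "rowdiv \<Psi> x = B x"
begin

definition US :: "real \<Rightarrow> 3 \<Rightarrow> real^3 \<Rightarrow> real" where "US R k x = u (R *\<^sub>R x) $ k"
definition BS :: "real \<Rightarrow> 3 \<Rightarrow> real^3 \<Rightarrow> real" where "BS R k x = B (R *\<^sub>R x) $ k"
text \<open>Subtracting the mean does not affect the divergence, and 1/R compensates the chain rule,
  so the row divergence is again the scaled velocity.\<close>

definition FS :: "real \<Rightarrow> 3 \<Rightarrow> 3 \<Rightarrow> real^3 \<Rightarrow> real" where "FS R i j x = 1 / R * (\<Phi> (R *\<^sub>R x) $ i $ j - ball_mean \<Phi> (3 * R) $ i $ j)"
definition HS :: "real \<Rightarrow> 3 \<Rightarrow> 3 \<Rightarrow> real^3 \<Rightarrow> real" where "HS R i j x = 1 / R * (\<Psi> (R *\<^sub>R x) $ i $ j - ball_mean \<Psi> (3 * R) $ i $ j)"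
definition E :: "real \<Rightarrow> real" where
  "E t = (\<integral>x. (\<Sum>k\<in>UNIV. \<Sum>i\<in>UNIV. (pd i (\<lambda>y. u y $ k) x)\<^sup>2 + (pd i (\<lambda>y. B y $ k) x)\<^sup>2) \<partial>BM t)"

lemma cs: "smooth3 (\<lambda>y. u y $ k)" "smooth3 (\<lambda>y. B y $ k)" "smooth3 (\<lambda>y. \<Phi> y $ i $ j)" "smooth3 (\<lambda>y. \<Psi> y $ i $ j)"
  by (rule smooth3_component[OF su] smooth3_component[OF sB] smooth3_component[OF smooth3_component[OF sF]] smooth3_component[OF smooth3_component[OF sG]])+

lemma pdS: "pd i (US R k) = (\<lambda>x. R * pd i (\<lambda>y. u y $ k) (R *\<^sub>R x))" "pd i (BS R k) = (\<lambda>x. R * pd i (\<lambda>y. B y $ k) (R *\<^sub>R x))"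
  unfolding US_def[abs_def] BS_def[abs_def] by (intro pd_scaled[OF cs(1)] pd_scaled[OF cs(2)])+

lemma pdFS:
  assumes R: "0 < R"
  shows "pd l (FS R i j) x = pd l (\<lambda>y. \<Phi> y $ i $ j) (R *\<^sub>R x)" "pd l (HS R i j) x = pd l (\<lambda>y. \<Psi> y $ i $ j) (R *\<^sub>R x)"
proof -
  have g: "pd l (\<lambda>x. 1 / R * (f (R *\<^sub>R x) - c)) x = pd l f (R *\<^sub>R x)" if f: "smooth3 f" for f :: "real^3 \<Rightarrow> real" and c
  proof -
    have "smooth3 (\<lambda>y. f y - c)" by (intro smooth3_diff smooth3_const f)
    from pd_scaled_cmult[OF this, of l "1 / R" R] have "pd l (\<lambda>x. 1 / R * (f (R *\<^sub>R x) - c)) x = pd l (\<lambda>y. f y - c) (R *\<^sub>R x)" using R by (simp add: fun_eq_iff)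
    also have "\<dots> = pd l f (R *\<^sub>R x)" by (subst pd_diff) (use f in auto)
    finally show ?thesis .
  qed
  show "pd l (FS R i j) x = pd l (\<lambda>y. \<Phi> y $ i $ j) (R *\<^sub>R x)" "pd l (HS R i j) x = pd l (\<lambda>y. \<Psi> y $ i $ j) (R *\<^sub>R x)"
    unfolding FS_def[abs_def] HS_def[abs_def] by (intro g[OF cs(3)] g[OF cs(4)])+
qed

lemma curl_eq: "curl f x $ k = curlc (\<lambda>k y. f y $ k) k x"
  using exhaust_3[of k] by (auto simp: curl_def curlc_def)

lemma hall_eq: "(\<lambda>k y. cross3 (curl B y) (B y) $ k) = hallF (\<lambda>k y. B y $ k)"
proof (intro ext)
  fix k y show "cross3 (curl B y) (B y) $ k = hallF (\<lambda>k y. B y $ k) k y"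
    using exhaust_3[of k] by (auto simp: cross3_def hallF_def crossc_def curl_eq)
qed

text \<open>Amplitudes are not rescaled. Multiplying the equations by R turns each first-order term
  into one in the new variable, while the second-order terms, Hall term included, are left with 1/R.
  The Hall term thus has the same small coefficient as the viscosity.\<close>

lemma unit_scaled:
  assumes R: "0 < R"
  shows "unit_sol (1 / R) (US R) (BS R) (\<lambda>x. P (R *\<^sub>R x)) (FS R) (HS R)"
proof
  have sh: "smooth3 (hallF (\<lambda>k y. B y $ k) k)" for k by (rule smooth3_hallF) (rule cs)
  show "0 < 1 / R" using R by simp
  show "smooth3 (US R k)" "smooth3 (BS R k)" "smooth3 (\<lambda>x. P (R *\<^sub>R x))" for k
    unfolding US_def[abs_def] BS_def[abs_def] by (intro smooth3_scaled[OF cs(1)] smooth3_scaled[OF cs(2)] smooth3_scaled[OF sP])+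
  show "smooth3 (FS R i j)" "smooth3 (HS R i j)" for i j
    unfolding FS_def[abs_def] HS_def[abs_def] by (intro smooth3_mult smooth3_const smooth3_diff smooth3_scaled[OF cs(3)] smooth3_scaled[OF cs(4)])+
  fix k and x :: "real^3"
  let ?y = "R *\<^sub>R x"
  have lin1: "(\<Sum>i\<in>UNIV. R * (R * f i)) = R * (R * sum f UNIV)" for f :: "3 \<Rightarrow> real" by (simp add: sum_distrib_left)
  have lin2: "(\<Sum>i\<in>UNIV. g i * (R * f i)) = R * (\<Sum>i\<in>UNIV. g i * f i)" for f g :: "3 \<Rightarrow> real" by (simp add: sum_distrib_left mult_ac)
  have p2: "pd i (pd i (US R k)) x = R * (R * pd i (pd i (\<lambda>y. u y $ k)) ?y)" "pd i (pd i (BS R k)) x = R * (R * pd i (pd i (\<lambda>y. B y $ k)) ?y)" for i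
    unfolding pdS by (subst pd_scaled_cmult, intro smooth3_pd cs, simp)+
  have pP: "pd k (\<lambda>x. P (R *\<^sub>R x)) x = R * pd k P ?y" by (simp add: pd_scaled[OF sP])
  have "- (\<Sum>i\<in>UNIV. pd i (pd i (\<lambda>y. u y $ k)) ?y) + (\<Sum>i\<in>UNIV. u ?y $ i * pd i (\<lambda>y. u y $ k) ?y) = - pd k P ?y + (\<Sum>i\<in>UNIV. B ?y $ i * pd i (\<lambda>y. B y $ k) ?y)"
    using arg_cong[OF eu[of ?y], of "\<lambda>v. v $ k"] by (simp add: lap_def adv_def grad_def)
  from arg_cong[OF this, of "\<lambda>t. R * t"]
  show "- (1 / R) * (\<Sum>i\<in>UNIV. pd i (pd i (US R k)) x) + (\<Sum>i\<in>UNIV. US R i x * pd i (US R k) x) = - pd k (\<lambda>x. P (R *\<^sub>R x)) x + (\<Sum>i\<in>UNIV. BS R i x * pd i (BS R k) x)"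
    unfolding p2 pP unfolding pdS US_def BS_def lin1 lin2 using R by (simp add: algebra_simps)
  have hs: "hallF (BS R) j = (\<lambda>x. R * hallF (\<lambda>k y. B y $ k) j (R *\<^sub>R x))" for j
    by (auto simp: fun_eq_iff hallF_def crossc_def curlc_def pdS BS_def algebra_simps)
  have ch: "curlc (hallF (BS R)) k x = R * (R * curlc (hallF (\<lambda>k y. B y $ k)) k ?y)"
    unfolding curlc_def hs pd_scaled_cmult[OF sh] by (simp add: algebra_simps)
  have "- (\<Sum>i\<in>UNIV. pd i (pd i (\<lambda>y. B y $ k)) ?y) + (\<Sum>i\<in>UNIV. u ?y $ i * pd i (\<lambda>y. B y $ k) ?y) = (\<Sum>i\<in>UNIV. B ?y $ i * pd i (\<lambda>y. u y $ k) ?y) + curlc (hallF (\<lambda>k y. B y $ k)) k ?y"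
    using arg_cong[OF eB[of ?y], of "\<lambda>v. v $ k"] by (simp add: lap_def adv_def curl_eq hall_eq)
  from arg_cong[OF this, of "\<lambda>t. R * t"]
  show "- (1 / R) * (\<Sum>i\<in>UNIV. pd i (pd i (BS R k)) x) + (\<Sum>i\<in>UNIV. US R i x * pd i (BS R k) x) = (\<Sum>i\<in>UNIV. BS R i x * pd i (US R k) x) + 1 / R * curlc (hallF (BS R)) k x"
    unfolding p2 ch unfolding pdS US_def BS_def lin1 lin2 using R by (simp add: algebra_simps)
  show "(\<Sum>i\<in>UNIV. pd i (US R i) x) = 0" "(\<Sum>i\<in>UNIV. pd i (BS R i) x) = 0"
    using du[of ?y] dB[of ?y] by (simp_all add: pdS divg_def sum_distrib_left[symmetric])
  fix i
  show "(\<Sum>j\<in>UNIV. pd j (FS R i j) x) = US R i x" "(\<Sum>j\<in>UNIV. pd j (HS R i j) x) = BS R i x"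
    using arg_cong[OF dF[of ?y], of "\<lambda>v. v $ i"] arg_cong[OF dG[of ?y], of "\<lambda>v. v $ i"] by (simp_all add: pdFS[OF R] rowdiv_def US_def BS_def)
qed

lemma E_cont: "contU (\<lambda>x. \<Sum>k\<in>UNIV. \<Sum>i\<in>UNIV. (pd i (\<lambda>y. u y $ k) x)\<^sup>2 + (pd i (\<lambda>y. B y $ k) x)\<^sup>2)"
  by (intro continuous_intros smooth3_cont smooth3_pd cs)

lemma E_nonneg: "0 \<le> E t" unfolding E_def by (intro BM_nonneg sum_nonneg add_nonneg_nonneg) auto

lemma E_mono: "t \<le> t' \<Longrightarrow> E t \<le> E t'"
  unfolding E_def by (rule BM_subset[OF E_cont]) (auto intro!: sum_nonneg)

lemma energy_scaled:
  assumes R: "0 < R"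
  shows "(Ln r 2 (unit_sol.vG (US R) (BS R)))\<^sup>2 = E (r * R) / R"
proof -
  interpret unit_sol "1 / R" "US R" "BS R" "\<lambda>x. P (R *\<^sub>R x)" "FS R" "HS R" by (rule unit_scaled[OF R])
  let ?g = "\<lambda>x. \<Sum>k\<in>UNIV. \<Sum>i\<in>UNIV. (pd i (\<lambda>y. u y $ k) x)\<^sup>2 + (pd i (\<lambda>y. B y $ k) x)\<^sup>2"
  have "(Ln r 2 vG)\<^sup>2 = (\<integral>x. R\<^sup>2 * ?g (R *\<^sub>R x) \<partial>BM r)"
    unfolding Ln_2[OF cont_v(3)] vG_sq by (simp add: pdS power_mult_distrib distrib_left sum_distrib_left)
  also have "\<dots> = R\<^sup>2 * (\<integral>x. ?g (R *\<^sub>R x) \<partial>BM r)" by simp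
  also have "\<dots> = R\<^sup>2 * (E (R * r) / R ^ 3)" using BM_scale[OF E_cont R, of r] R by (simp add: E_def)
  also have "\<dots> = E (r * R) / R" using R by (simp add: power2_eq_square power3_eq_cube mult.commute)
  finally show ?thesis .
qed

lemma potential_scaled:
  assumes R: "0 < R" and s: "1 < s"
  shows "Ln 2 s (unit_sol.vM (FS R) (HS R)) \<le> vq powr (1 / s) * (mean_osc \<Phi> (3 * R) s + mean_osc \<Psi> (3 * R) s) / R"
proof -
  interpret unit_sol "1 / R" "US R" "BS R" "\<lambda>x. P (R *\<^sub>R x)" "FS R" "HS R" by (rule unit_scaled[OF R])
  define f where "f x = norm (\<Phi> (R *\<^sub>R x) - ball_mean \<Phi> (3 * R))" for x
  define g where "g x = norm (\<Psi> (R *\<^sub>R x) - ball_mean \<Psi> (3 * R))" for x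
  have c: "contU f" "contU g" unfolding f_def[abs_def] g_def[abs_def]
    by (intro continuous_intros continuous_on_compose2[OF smooth3_cont[OF sF, of UNIV]] continuous_on_compose2[OF smooth3_cont[OF sG, of UNIV]]; auto)+
  have nm: "norm A ^ 2 = (\<Sum>i\<in>UNIV. \<Sum>j\<in>UNIV. (A $ i $ j)\<^sup>2)" for A :: "real^3^3"
    by (simp add: norm_vec_def L2_set_def sum_nonneg)
  have "vM x \<le> 1 / R * (f x + g x)" for x
  proof -
    have "(vM x)\<^sup>2 = (1 / R)\<^sup>2 * ((f x)\<^sup>2 + (g x)\<^sup>2)"
      unfolding vM_def f_def g_def nm by (subst real_sqrt_pow2, intro sum_nonneg add_nonneg_nonneg zero_le_power2) (simp add: FS_def HS_def power_mult_distrib sum.distrib sum_distrib_left distrib_left power_divide)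
    also have "\<dots> \<le> (1 / R)\<^sup>2 * (f x + g x)\<^sup>2"
      by (intro mult_left_mono) (auto simp: power2_sum f_def g_def)
    finally have "(vM x)\<^sup>2 \<le> (1 / R * (f x + g x))\<^sup>2" by (simp only: power_mult_distrib)
    then show ?thesis by (rule power2_le_imp_le) (use R in \<open>auto simp: f_def g_def\<close>)
  qed
  then have "\<bar>vM x\<bar> \<le> \<bar>1 / R * (f x + g x)\<bar>" for x using v_nonneg(4)[of x] by (smt (verit))
  then have "Ln 2 s vM \<le> Ln 2 s (\<lambda>x. 1 / R * (f x + g x))"
    using s by (intro Ln_mono continuous_intros c) auto
  also have "\<dots> = 1 / R * Ln 2 s (\<lambda>x. f x + g x)" using R s by (subst Ln_cmult) (auto intro!: continuous_intros c)
  also have "\<dots> \<le> 1 / R * (vq powr (1 / s) * mean_osc \<Phi> (3 * R) s + vq powr (1 / s) * mean_osc \<Psi> (3 * R) s)"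
  proof (rule mult_left_mono)
    have "Ln 2 s (\<lambda>x. f x + g x) \<le> Ln 2 s f + Ln 2 s g" by (rule Ln_add[OF c s])
    also have "\<dots> \<le> vq powr (1 / s) * mean_osc \<Phi> (3 * R) s + vq powr (1 / s) * mean_osc \<Psi> (3 * R) s"
      unfolding f_def[abs_def] g_def[abs_def] using s R
      by (intro add_mono mean_osc_scaled smooth3_cont sF sG) auto
    finally show "Ln 2 s (\<lambda>x. f x + g x) \<le> vq powr (1 / s) * mean_osc \<Phi> (3 * R) s + vq powr (1 / s) * mean_osc \<Psi> (3 * R) s" .
  qed (use R in auto)
  finally show ?thesis using R by (simp add: field_simps)
qed

lemma field_scaled:
  assumes R: "0 < R" and p: "1 < p"
  shows "Ln 2 p (unit_sol.oscb (BS R) (ball_mean B (3 * R))) \<le> vq powr (1 / p) * mean_osc B (3 * R) p"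
proof -
  interpret unit_sol "1 / R" "US R" "BS R" "\<lambda>x. P (R *\<^sub>R x)" "FS R" "HS R" by (rule unit_scaled[OF R])
  have "(\<chi> k. BS R k x) = B (R *\<^sub>R x)" for x by (simp add: BS_def vec_eq_iff)
  then have "oscb (ball_mean B (3 * R)) = (\<lambda>x. norm (B (R *\<^sub>R x) - ball_mean B (3 * R)))" by (simp add: oscb_def fun_eq_iff)
  then show ?thesis using mean_osc_scaled[OF smooth3_cont[OF sB] _ R, of p] p by simp
qed

end

section \<open>Decay of the Dirichlet energy\<close>

lemma eventually_le_powr: "0 < a \<Longrightarrow> eventually (\<lambda>R::real. X \<le> R powr a) at_top"
proof (rule eventually_at_top_linorderI)
  fix R assume a: "0 < a" and R: "\<bar>X\<bar> powr (1 / a) \<le> R"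
  have "X \<le> (\<bar>X\<bar> powr (1 / a)) powr a" using a by (simp add: powr_powr)
  also have "\<dots> \<le> R powr a" using a R by (intro powr_mono2) auto
  finally show "X \<le> R powr a" .
qed

lemma tendsto_powr_neg_at_top: "0 < a \<Longrightarrow> ((\<lambda>R::real. R powr (- a)) \<longlongrightarrow> 0) at_top"
  by (rule tendsto_neg_powr) (auto intro: filterlim_ident)

lemma BM_zero_imp_zero:
  assumes h: "contU h" "\<And>x. 0 \<le> h x" and z: "\<And>t. (\<integral>x. h x \<partial>BM t) = 0"
  shows "h x = 0"
proof -
  let ?c = "cbox (x - One) (x + One)"
  obtain t where "?c \<subseteq> ball 0 t" using bounded_subset_ballD[OF bounded_cbox[of "x - One" "x + One"], of 0] by auto
  then have t: "?c \<subseteq> cball 0 t" by (rule order_trans[OF _ ball_subset_cball])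
  have I: "h integrable_on ?c" by (rule integrable_continuous) (rule continuous_on_subset[OF h(1)], simp)
  have i: "set_integrable lborel (cball 0 t) h"
    using borel_integrable_compact[of "cball 0 t" h] continuous_on_subset[OF h(1)] by (auto simp: set_integrable_def)
  have "integral ?c h \<le> integral (cball 0 t) h"
    by (rule integral_subset_le[OF t I set_borel_integral_eq_integral(1)[OF i]]) (use h(2) in auto)
  also have "\<dots> = set_lebesgue_integral lborel (cball 0 t) h" by (rule set_borel_integral_eq_integral(2)[OF i, symmetric])
  also have "\<dots> = 0" using z[of t] unfolding BM_def set_lebesgue_integral_def by (subst (asm) integral_restrict_space) auto
  finally have "integral ?c h = 0" using integral_nonneg[OF I h(2)] by linarith
  then have "(h has_integral 0) ?c" using I by (metis integrable_integral)
  moreover have x: "x \<in> box (x - One) (x + One)" by (auto simp: mem_box inner_diff_left inner_add_left)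
  moreover have "x \<in> ?c" using x box_subset_cbox by blast
  moreover have "continuous_on ?c h" by (rule continuous_on_subset[OF h(1)]) simp
  ultimately show ?thesis using has_integral_0_cbox_imp_0[of "x - One" "x + One" h x] h(2) by blast
qed

locale hall_growth = hall_mhd +
  fixes s p C :: real
  assumes s: "3 < s" "s \<le> 6" and C: "0 < C" and p: "3 < p"
    and osc: "\<And>r. 1 < r \<Longrightarrow> mean_osc \<Phi> r s + mean_osc \<Psi> r s \<le> C * r powr (1/3 - 1/s)"
    and oscB: "(\<lambda>r. mean_osc B r p) \<in> o[at_top](\<lambda>r. r powr (((2 * s) / 3 + 1) * (1 / 3 - 1 / p)))"
begin

text \<open>The sixth root makes all scales integral powers: viscosity nn^6, gradient norm nn^3, L^3
  norm nn^4. \<open>gam\<close> is defined by nn^4 e^bt = 1 at e^2 = R^gam, and \<open>tau\<close>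
  is the exponent of the oscillation hypothesis.\<close>

definition nn :: "real \<Rightarrow> real" where "nn R = R powr (- (1 / 6))"
definition MM :: real where "MM = max 1 (vq powr (1 / s) * C * 3 powr (1/3 - 1/s))"
definition bt :: real where "bt = 6 / (s + 6)"
definition gam :: real where "gam = 2 * (s + 6) / 9"
definition tau :: real where "tau = (2 * s / 3 + 1) * (1 / 3 - 1 / p)"
abbreviation (input) "GGS R \<equiv> unit_sol.vG (US R) (BS R)"
abbreviation (input) "MMS R \<equiv> unit_sol.vM (FS R) (HS R)"
abbreviation (input) "YYS R \<equiv> unit_sol.vY (US R) (BS R) 1 2"

lemma nn: "1 \<le> R \<Longrightarrow> 0 < nn R" "1 \<le> R \<Longrightarrow> nn R \<le> 1" "1 \<le> R \<Longrightarrow> nn R ^ 6 = 1 / R"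
proof -
  assume R: "1 \<le> R"
  show "0 < nn R" using R by (simp add: nn_def)
  show "nn R \<le> 1" using R powr_mono[of "- (1/6)" 0 R] by (simp add: nn_def)
  have "nn R ^ 6 = nn R powr 6" using R by (simp add: nn_def)
  also have "\<dots> = R powr (- (1 / 6) * 6)" unfolding nn_def by (rule powr_powr)
  also have "- (1 / 6) * 6 = (- 1 :: real)" by simp
  also have "R powr (- 1) = 1 / R" using R by (simp add: powr_minus_divide)
  finally show "nn R ^ 6 = 1 / R" .
qed

lemma nn_tendsto: "(nn \<longlongrightarrow> 0) at_top"
  unfolding nn_def[abs_def] by (rule tendsto_powr_neg_at_top) simp

lemma MM1: "1 \<le> MM" by (simp add: MM_def)

lemma bt_bounds: "1/2 \<le> bt" "bt < 2/3" "0 < gam" "gam < 3" "gam * (bt / 2) = 2/3" "0 < tau"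
proof -
  show "1/2 \<le> bt" "bt < 2/3" "0 < gam" "gam < 3" using s by (auto simp: bt_def gam_def field_simps)
  show "gam * (bt / 2) = 2/3" using s by (simp add: bt_def gam_def divide_simps)
  show "0 < tau" unfolding tau_def using s p by (intro mult_pos_pos) (auto simp: field_simps)
qed

lemma sol: "1 \<le> R \<Longrightarrow> unit_sol (1 / R) (US R) (BS R) (\<lambda>x. P (R *\<^sub>R x)) (FS R) (HS R)"
  by (rule unit_scaled) simp

lemma energy_n: "1 \<le> R \<Longrightarrow> (Ln r 2 (GGS R))\<^sup>2 = nn R ^ 6 * E (r * R)"
  by (simp add: energy_scaled nn)

lemma energy_n_le:
  assumes R: "1 \<le> R" and e: "0 \<le> e" "E (r * R) \<le> e\<^sup>2"
  shows "Ln r 2 (GGS R) \<le> nn R ^ 3 * e"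
proof (rule power2_le_imp_le)
  have "(Ln r 2 (GGS R))\<^sup>2 \<le> nn R ^ 6 * e\<^sup>2" unfolding energy_n[OF R] using nn(1)[OF R] e by (intro mult_left_mono) auto
  then show "(Ln r 2 (GGS R))\<^sup>2 \<le> (nn R ^ 3 * e)\<^sup>2" by (simp add: power_mult_distrib power_mult[symmetric])
qed (use nn(1)[OF R] e in auto)

text \<open>R^(1/3 - 1/s) / R is nn^(4 + 6/s), split as 5 + (6/s - 1) to expose the interpolation
  weight.\<close>

lemma potential_n:
  assumes R: "1 \<le> R" shows "Ln 2 s (MMS R) \<le> MM * nn R ^ 5 * nn R powr (6 / s - 1)"
proof -
  have "Ln 2 s (MMS R) \<le> vq powr (1 / s) * (mean_osc \<Phi> (3 * R) s + mean_osc \<Psi> (3 * R) s) / R"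
    using R s by (intro potential_scaled) auto
  also have "\<dots> \<le> vq powr (1 / s) * (C * (3 * R) powr (1/3 - 1/s)) / R"
    using R by (intro divide_right_mono mult_left_mono osc) auto
  also have "\<dots> = (vq powr (1 / s) * C * 3 powr (1/3 - 1/s)) * (R powr (1/3 - 1/s) * (1 / R))" by (simp add: powr_mult)
  also have "\<dots> \<le> MM * (R powr (1/3 - 1/s) * (1 / R))" using R by (intro mult_right_mono) (auto simp: MM_def)
  also have "R powr (1/3 - 1/s) * (1 / R) = nn R ^ 5 * nn R powr (6 / s - 1)"
  proof -
    have "nn R ^ 5 * nn R powr (6 / s - 1) = nn R powr 5 * nn R powr (6 / s - 1)" using nn(1)[OF R] by simp
    also have "\<dots> = nn R powr (4 + 6 / s)" unfolding powr_add[symmetric] by simp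
    also have "\<dots> = R powr (- (1 / 6) * (4 + 6 / s))" unfolding nn_def by (rule powr_powr)
    also have "- (1 / 6) * (4 + 6 / s) = (1/3 - 1/s) + - 1" using s by (simp add: field_simps)
    also have "R powr ((1/3 - 1/s) + - 1) = R powr (1/3 - 1/s) * R powr (- 1)" by (rule powr_add)
    also have "R powr (- 1) = 1 / R" using R by (simp add: powr_minus_divide)
    finally show ?thesis by simp
  qed
  finally show ?thesis by simp
qed

definition KB :: real where
  "KB = 1 + Ln 2 p (\<lambda>x. 1) * (3 * ((3 * (216 * 4 ^ 5 * bumpC) * volc + volc) / unit_ball_vol 3))"
text \<open>The vanishing factor in the L^p bound of the magnetic field. The oscillation part tends
  to 0 by hypothesis, and the contribution of the mean, controlled by the potential, because
  \<open>tau\<close> is positive.\<close>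

definition WW :: "real \<Rightarrow> real" where
  "WW R = (\<bar>KB\<bar> * (MM * R powr (- tau) + vq powr (1 / p) * mean_osc B (3 * R) p * R powr (- tau))) powr p"

lemma mean_osc_nonneg: "0 \<le> mean_osc f r q" by (simp add: mean_osc_def)

lemma WW_tendsto: "(WW \<longlongrightarrow> 0) at_top"
proof -
  have 3: "filterlim (\<lambda>R::real. 3 * R) at_top at_top" by (rule filterlim_tendsto_pos_mult_at_top[OF tendsto_const _ filterlim_ident]) simp
  have "((\<lambda>r. mean_osc B r p / r powr tau) \<longlongrightarrow> 0) at_top"
    using smalloD_tendsto[OF oscB] by (simp add: tau_def)
  from filterlim_compose[OF this 3] have "((\<lambda>R. mean_osc B (3 * R) p / (3 * R) powr tau) \<longlongrightarrow> 0) at_top" .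
  then have "((\<lambda>R. 3 powr tau * (mean_osc B (3 * R) p / (3 * R) powr tau)) \<longlongrightarrow> 3 powr tau * 0) at_top" by (intro tendsto_intros)
  moreover have "3 powr tau * (mean_osc B (3 * R) p / (3 * R) powr tau) = mean_osc B (3 * R) p * R powr (- tau)" for R
    by (simp add: powr_mult powr_minus divide_inverse)
  ultimately have t: "((\<lambda>R. mean_osc B (3 * R) p * R powr (- tau)) \<longlongrightarrow> 0) at_top" by simp
  have "((\<lambda>R. \<bar>KB\<bar> * (MM * R powr (- tau) + vq powr (1 / p) * (mean_osc B (3 * R) p * R powr (- tau)))) \<longlongrightarrow> \<bar>KB\<bar> * (MM * 0 + vq powr (1 / p) * 0)) at_top"
    by (intro tendsto_intros t tendsto_powr_neg_at_top bt_bounds)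
  then have "((\<lambda>R. \<bar>KB\<bar> * (MM * R powr (- tau) + vq powr (1 / p) * mean_osc B (3 * R) p * R powr (- tau))) \<longlongrightarrow> 0) at_top"
    by (simp add: mult.assoc)
  then show ?thesis unfolding WW_def[abs_def]
  proof (rule tendsto_zero_powrI[OF _ tendsto_const])
    have "0 \<le> \<bar>KB\<bar> * (MM * R powr (- tau) + vq powr (1 / p) * mean_osc B (3 * R) p * R powr (- tau))" for R
      using MM1 by (intro mult_nonneg_nonneg add_nonneg_nonneg mean_osc_nonneg) auto
    then show "eventually (\<lambda>R. 0 \<le> \<bar>KB\<bar> * (MM * R powr (- tau) + vq powr (1 / p) * mean_osc B (3 * R) p * R powr (- tau))) at_top"
      by (intro always_eventually allI)
  qed (use p in auto)
qed

definition gg :: "real \<Rightarrow> real" where "gg R = R powr (gam / 2)"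

lemma gg: assumes R: "1 \<le> R" shows "0 < gg R" "(gg R)\<^sup>2 = R powr gam" "nn R ^ 4 * gg R powr bt = 1" "nn R ^ 6 * (gg R)\<^sup>2 = R powr (gam - 1)"
proof -
  show "0 < gg R" using R by (simp add: gg_def)
  have "(gg R)\<^sup>2 = gg R powr 2" using R by (simp add: gg_def)
  also have "\<dots> = R powr (gam / 2 * 2)" unfolding gg_def by (rule powr_powr)
  finally show g2: "(gg R)\<^sup>2 = R powr gam" by simp
  have "nn R ^ 4 = nn R powr 4" using nn(1)[OF R] by simp
  also have "\<dots> = R powr (- (1 / 6) * 4)" unfolding nn_def by (rule powr_powr)
  finally have n4: "nn R ^ 4 = R powr (- (2 / 3))" by simp
  have "gg R powr bt = R powr (gam / 2 * bt)" unfolding gg_def by (rule powr_powr)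
  also have "gam / 2 * bt = 2 / 3" using bt_bounds(5) by simp
  finally show "nn R ^ 4 * gg R powr bt = 1" unfolding n4 using R by (simp add: powr_minus)
  show "nn R ^ 6 * (gg R)\<^sup>2 = R powr (gam - 1)" unfolding nn(3)[OF R] g2 using R by (simp add: powr_diff)
qed

lemma field_n:
  assumes R: "1 \<le> R"
  shows "(\<integral>x. unit_sol.vb (BS R) x powr p \<partial>BM 2) \<le> WW R * (nn R ^ 6 * (gg R)\<^sup>2) powr (p - 3)"
proof -
  interpret S: unit_sol "1 / R" "US R" "BS R" "\<lambda>x. P (R *\<^sub>R x)" "FS R" "HS R" by (rule sol[OF R])
  have p1: "1 < p" "0 < p" using p by auto
  have R0: "0 < R" using R by simp
  define mo where "mo = mean_osc B (3 * R) p"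
  have mo: "0 \<le> mo" by (simp add: mo_def mean_osc_nonneg)
  have "Ln 2 s S.vM \<le> MM * nn R ^ 5 * nn R powr (6 / s - 1)" by (rule potential_n[OF R])
  also have "\<dots> \<le> MM * 1 * 1" using nn[OF R] MM1 s by (intro mult_mono power_le_one powr_le1) auto
  finally have m: "Ln 2 s S.vM \<le> MM" by simp
  have "Ln 2 p S.vb \<le> KB * (Ln 2 s S.vM + Ln 2 p (S.oscb (ball_mean B (3 * R))))"
    unfolding KB_def using s p by (intro S.mean_bound) auto
  also have "\<dots> \<le> \<bar>KB\<bar> * (Ln 2 s S.vM + Ln 2 p (S.oscb (ball_mean B (3 * R))))" by (intro mult_right_mono) auto
  also have "\<dots> \<le> \<bar>KB\<bar> * (MM + vq powr (1 / p) * mo)"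
    unfolding mo_def by (intro mult_left_mono add_mono m field_scaled[OF R0 p1(1)]) auto
  also have "\<dots> = \<bar>KB\<bar> * (MM * R powr (- tau) + vq powr (1 / p) * mo * R powr (- tau)) * R powr tau"
    using R by (simp add: algebra_simps powr_minus)
  finally have L: "Ln 2 p S.vb \<le> \<bar>KB\<bar> * (MM * R powr (- tau) + vq powr (1 / p) * mo * R powr (- tau)) * R powr tau" .
  have "(\<integral>x. S.vb x powr p \<partial>BM 2) = Ln 2 p S.vb powr p" by (simp add: Ln_powr p1)
  also have "\<dots> \<le> (\<bar>KB\<bar> * (MM * R powr (- tau) + vq powr (1 / p) * mo * R powr (- tau)) * R powr tau) powr p"
    using p1 by (intro powr_mono2 L) auto
  also have "\<dots> = WW R * (R powr tau) powr p" unfolding WW_def mo_def by (rule powr_mult)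
  also have "(R powr tau) powr p = (R powr (gam - 1)) powr (p - 3)"
  proof -
    \<comment> \<open>The growth exponent assumed for the oscillation is the one that turns the p-th
      power into the critical amplitude R^(gam - 1) to the power p - 3.\<close>
    have "tau * p = (gam - 1) * (p - 3)" using p1 by (simp add: tau_def gam_def field_simps)
    then show ?thesis by (simp add: powr_powr)
  qed
  finally show ?thesis unfolding gg(4)[OF R] .
qed

text \<open>\<open>stage1\<close> is the step hypothesis of \<open>absorb_iteration\<close> with
  threshold \<sigma> R^gam. The iteration constant \<kappa> depends on N alone, so \<sigma> can be
  chosen after it.\<close>

lemma E_growth:
  assumes \<delta>: "0 < \<delta>"
  shows "eventually (\<lambda>R. E R \<le> \<delta> * R powr gam) at_top"
proof -
  define a where "a = (2 - 3 * bt) / 2"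
  have a: "0 < a" using bt_bounds by (simp add: a_def)
  \<comment> \<open>The three conditions on N in \<open>stage1\<close>: absorption of the non-Hall
    terms, and the two endpoint terms of the middle range.\<close>
  define N where "N = max (24 / a) (max (57 / (p - 3)) (33 * p + 18))"
  have N: "24 \<le> N * a" "57 \<le> N * (p - 3)" "33 * p + 18 \<le> N"
  proof -
    have "24 / a \<le> N" "57 / (p - 3) \<le> N" by (auto simp: N_def)
    then show "24 \<le> N * a" "57 \<le> N * (p - 3)" using a p by (auto simp: pos_divide_le_eq)
  qed (simp add: N_def)
  have N0: "0 < N" using N(3) p by linarith
  define \<kappa> where "\<kappa> = (1 - (2/3 :: real) powr (1 / N)) powr (- N)"
  have "(2/3 :: real) powr (1 / N) < 1 powr (1 / N)" using N0 by (intro powr_less_mono2) auto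
  then have \<kappa>: "0 < \<kappa>" using N0 by (simp add: \<kappa>_def)
  define \<sigma> where "\<sigma> = min 1 (\<delta> / \<kappa>)"
  have \<sigma>: "0 < \<sigma>" "\<sigma> \<le> 1" "\<sigma> * \<kappa> \<le> \<delta>"
  proof -
    have "\<sigma> \<le> \<delta> / \<kappa>" by (simp add: \<sigma>_def)
    then show "\<sigma> * \<kappa> \<le> \<delta>" using \<kappa> by (simp add: pos_le_divide_eq)
  qed (use \<delta> \<kappa> in \<open>auto simp: \<sigma>_def\<close>)
  have k0p: "0 < k0 MM" using k0_ge[OF MM1] by linarith
  have t0p: "0 < t0 MM" using k0p w0 by (simp add: t0_def)
  have e1: "eventually (\<lambda>R. WW R * (4 * j0 MM) < w0 * \<sigma> powr (p - 3)) at_top"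
    using tendsto_mult_left_zero[OF WW_tendsto] w0 \<sigma> by (intro order_tendstoD(2)) auto
  have e2: "eventually (\<lambda>R. WW R * 4 < w0 * \<sigma> * (t0 MM * \<sigma>) powr p) at_top"
    using tendsto_mult_left_zero[OF WW_tendsto] w0 \<sigma> t0p by (intro order_tendstoD(2)) auto
  have e3: "eventually (\<lambda>R. max 1 ((64 * c2 MM) powr (1 / a)) / \<sigma> \<le> R powr gam) at_top"
    by (rule eventually_le_powr[OF bt_bounds(3)])
  show ?thesis using e1 e2 e3 eventually_ge_at_top[of 1]
  proof eventually_elim
    case (elim R)
    note R = \<open>1 \<le> R\<close>
    interpret S: unit_sol "1 / R" "US R" "BS R" "\<lambda>x. P (R *\<^sub>R x)" "FS R" "HS R" by (rule sol[OF R])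
    define T where "T = \<sigma> * (gg R)\<^sup>2"
    have Tm: "max 1 ((64 * c2 MM) powr (1 / a)) \<le> T"
      using elim(3) \<sigma> by (simp add: T_def gg(2)[OF R] pos_divide_le_eq mult.commute)
    have big: "64 * c2 MM \<le> T powr a"
    proof -
      have "64 * c2 MM = ((64 * c2 MM) powr (1 / a)) powr a" using a c2_pos[OF MM1] by (simp add: powr_powr)
      also have "\<dots> \<le> T powr a" using a Tm by (intro powr_mono2) auto
      finally show ?thesis .
    qed
    have "E (1 * R) \<le> T * \<kappa>" unfolding \<kappa>_def
    proof (rule absorb_iteration[where f="\<lambda>r. E (r * R)" and D="E (2 * R)"])
      show "E (r * R) \<le> E (2 * R)" if "r \<le> 2" for r using that R by (intro E_mono) auto
      show "1 \<le> T" using Tm by simp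
      fix r r' e :: real
      assume r: "1 \<le> r" "r < r'" "r' \<le> 2" and e: "1 \<le> e" "E (r' * R) \<le> e\<^sup>2" "T * (r' - r) powr (- N) \<le> e\<^sup>2"
      have A: "Ln r' 2 S.vG \<le> nn R ^ 3 * e" using e by (intro energy_n_le R) auto
      have m: "Ln r' s S.vM \<le> MM * nn R ^ 5 * nn R powr (6 / s - 1)"
        using s r by (intro order_trans[OF Ln_radius_mono[OF S.cont_v(4), of s r' 2] potential_n[OF R]]) auto
      have "(Ln r 2 S.vG)\<^sup>2 \<le> nn R ^ 6 * (e\<^sup>2 / 2)"
        by (rule S.stage1[OF r s nn(1,2)[OF R] nn(3)[OF R, symmetric] e(1) MM1 A m refl bt_def p _ field_n[OF R] gg(1,3)[OF R] \<sigma>(1,2) N(1)[unfolded a_def] N(2,3)])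
          (use e(3) big elim in \<open>auto simp: T_def a_def WW_def\<close>)
      then show "E (r * R) \<le> e\<^sup>2 / 2" unfolding energy_n[OF R] using nn(1)[OF R] by simp
    qed (rule E_nonneg N0)+
    also have "T * \<kappa> = (\<sigma> * \<kappa>) * R powr gam" by (simp add: T_def gg(2)[OF R])
    also have "\<dots> \<le> \<delta> * R powr gam" using \<sigma> by (intro mult_right_mono) auto
    finally show ?case by simp
  qed
qed

text \<open>With the growth bound at a suitably small factor the Hall coefficient in
  \<open>stage2\<close> is at most 1/64, and the resulting recursion over doubled radii is solved by
  \<open>dyadic_bounded\<close>. Growth below R^3 is available since gam < 3.\<close>

lemma E_bounded: "\<exists>D. \<forall>R. E R \<le> D"
proof -
  define K2 where "K2 = 80 * mC * (k0 MM)\<^sup>2 * sC"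
  have k0p: "0 < k0 MM" using k0_ge[OF MM1] by linarith
  have K2: "0 < K2" using k0p mC_pos lsC_ge_1 by (auto simp: K2_def)
  define c where "c = 64 * c2 MM"
  have c: "0 < c" using c2_pos[OF MM1] by (simp add: c_def)
  define b where "b = 2 - 3 * bt"
  have b: "0 < b" using bt_bounds by (simp add: b_def)
  define T where "T = max 1 ((64 * c) powr (1 / b))"
  have T1: "1 \<le> T" by (simp add: T_def)
  \<comment> \<open>Young's inequality for the subquadratic power: 3 bt < 2, and for e above T the
    excess e^(2 - 3 bt) beats the constant.\<close>
  have young: "c * e powr (3 * bt) \<le> e\<^sup>2 / 64 + c * T\<^sup>2" if e: "1 \<le> e" for e
  proof (cases "e \<le> T")
    case True
    have "e powr (3 * bt) \<le> e powr 2" using e bt_bounds by (intro powr_mono) auto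
    also have "\<dots> \<le> T\<^sup>2" using e True by (simp add: power_mono)
    finally have "c * e powr (3 * bt) \<le> c * T\<^sup>2" using c by (intro mult_left_mono) auto
    then show ?thesis using zero_le_power2[of e] by linarith
  next
    case False
    have "64 * c = ((64 * c) powr (1 / b)) powr b" using b c by (simp add: powr_powr)
    also have "\<dots> \<le> e powr b" using False b by (intro powr_mono2) (auto simp: T_def)
    finally have "64 * c * e powr (3 * bt) \<le> e powr b * e powr (3 * bt)" by (intro mult_right_mono) auto
    also have "\<dots> = e\<^sup>2" using e by (simp add: powr_add[symmetric] b_def)
    finally have "c * e powr (3 * bt) \<le> e\<^sup>2 / 64" by simp
    moreover have "0 \<le> c * T\<^sup>2" using c by simp
    ultimately show ?thesis by linarith
  qed
  \<comment> \<open>The radius is doubled, which costs 2^(2/3) \<le> 2; hence 128 in order to reach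
    1/64.\<close>
  define \<delta> where "\<delta> = (1 / (128 * K2)) powr (2 / bt)"
  have \<delta>: "0 < \<delta>" "\<delta> powr (bt / 2) = 1 / (128 * K2)" using K2 bt_bounds by (auto simp: \<delta>_def powr_powr)
  have 2: "filterlim (\<lambda>R::real. 2 * R) at_top at_top" by (rule filterlim_tendsto_pos_mult_at_top[OF tendsto_const _ filterlim_ident]) simp
  have "eventually (\<lambda>R. E (2 * R) \<le> \<delta> * (2 * R) powr gam) at_top"
    by (rule eventually_compose_filterlim[OF E_growth[OF \<delta>(1)] 2])
  moreover have "eventually (\<lambda>R. 1 / \<delta> \<le> (2 * R) powr gam) at_top"
    by (rule eventually_compose_filterlim[OF eventually_le_powr[OF bt_bounds(3)] 2])
  moreover have "eventually (\<lambda>R. E R \<le> 1 * R powr gam) at_top" by (rule E_growth) simp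
  ultimately have "eventually (\<lambda>R. E (2 * R) \<le> \<delta> * (2 * R) powr gam \<and> 1 / \<delta> \<le> (2 * R) powr gam \<and> E R \<le> 1 * R powr gam) at_top"
    by eventually_elim auto
  then obtain R1 where R1: "\<And>R. R1 \<le> R \<Longrightarrow> E (2 * R) \<le> \<delta> * (2 * R) powr gam \<and> 1 / \<delta> \<le> (2 * R) powr gam \<and> E R \<le> 1 * R powr gam"
    by (auto simp: eventually_at_top_linorder)
  define R0 where "R0 = max 1 R1"
  define C0 where "C0 = 1 + c * T\<^sup>2"
  have bd: "E R \<le> 2 * C0" if "R0 \<le> R" for R
  proof (rule dyadic_bounded[OF _ _ _ _ that])
    show "1 \<le> R0" by (simp add: R0_def)
    show "0 \<le> C0" using c by (simp add: C0_def)
    show "E x \<le> x ^ 3" if x: "R0 \<le> x" for x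
    proof -
      have "E x \<le> x powr gam" using R1[of x] x by (simp add: R0_def)
      also have "\<dots> \<le> x powr 3" using x bt_bounds by (intro powr_mono) (auto simp: R0_def)
      finally show ?thesis using x by (simp add: R0_def)
    qed
    fix R assume R0: "R0 \<le> R"
    then have R: "1 \<le> R" by (simp add: R0_def)
    note h = R1[of R]
    interpret S: unit_sol "1 / R" "US R" "BS R" "\<lambda>x. P (R *\<^sub>R x)" "FS R" "HS R" by (rule sol[OF R])
    define e where "e = sqrt (max 1 (E (2 * R)))"
    have e: "1 \<le> e" "e\<^sup>2 = max 1 (E (2 * R))" by (auto simp: e_def)
    have A: "Ln 2 2 S.vG \<le> nn R ^ 3 * e" using e by (intro energy_n_le R) auto
    have "nn R ^ 6 * E (1 * R) \<le> nn R ^ 6 * (c2 MM / (1 / 64) * e powr (3 * bt) + 1 / 64 * e\<^sup>2 + 80 * mC * (k0 MM)\<^sup>2 * sC * (nn R ^ 4 * e powr bt) * e\<^sup>2)"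
      unfolding energy_n[OF R, symmetric]
      by (rule S.stage2[OF s nn(1,2)[OF R] nn(3)[OF R, symmetric] e(1) MM1 A potential_n[OF R] _ _ bt_def]) auto
    then have E: "E R \<le> c * e powr (3 * bt) + e\<^sup>2 / 64 + K2 * (nn R ^ 4 * e powr bt) * e\<^sup>2"
      using nn(1)[OF R] by (simp add: c_def K2_def)
    have "e\<^sup>2 \<le> \<delta> * (2 * R) powr gam"
      using h R0 \<delta>(1) unfolding e(2) by (auto simp: R0_def pos_divide_le_eq mult.commute)
    then have "(e\<^sup>2) powr (bt / 2) \<le> (\<delta> * (2 * R) powr gam) powr (bt / 2)" using bt_bounds by (intro powr_mono2) auto
    also have "\<dots> = 1 / (128 * K2) * (2 * R) powr (2/3)" by (simp only: powr_mult[of \<delta>] \<delta>(2) powr_powr bt_bounds(5))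
    also have "(e\<^sup>2) powr (bt / 2) = e powr bt"
    proof -
      have "(e\<^sup>2) powr (bt / 2) = (e powr 2) powr (bt / 2)" using e by simp
      then show ?thesis by (simp only: powr_powr) simp
    qed
    finally have eb: "e powr bt \<le> 1 / (128 * K2) * (2 * R) powr (2/3)" .
    have "nn R ^ 4 * (2 * R) powr (2/3) \<le> 2"
    proof -
      have "nn R ^ 4 = nn R powr 4" using nn(1)[OF R] by simp
      also have "\<dots> = R powr (- (1 / 6) * 4)" unfolding nn_def by (rule powr_powr)
      finally have "nn R ^ 4 * (2 * R) powr (2/3) = 2 powr (2/3)" using R by (simp add: powr_mult powr_minus)
      also have "\<dots> \<le> 2 powr 1" by (intro powr_mono) auto
      finally show ?thesis by simp
    qed
    moreover have "K2 * nn R ^ 4 * e powr bt \<le> K2 * nn R ^ 4 * (1 / (128 * K2) * (2 * R) powr (2/3))"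
      using K2 nn(1)[OF R] by (intro mult_left_mono eb) auto
    moreover have "K2 * nn R ^ 4 * (1 / (128 * K2) * (2 * R) powr (2/3)) = (nn R ^ 4 * (2 * R) powr (2/3)) / 128" using K2 by simp
    ultimately have "K2 * (nn R ^ 4 * e powr bt) \<le> 1 / 64" by (simp add: mult.assoc)
    then have "K2 * (nn R ^ 4 * e powr bt) * e\<^sup>2 \<le> 1 / 64 * e\<^sup>2" by (intro mult_right_mono) auto
    \<comment> \<open>One share e^2/64 each from the non-Hall terms, from \<epsilon> and from the
      Hall term; 3/64 is below the 1/16 allowed in \<open>dyadic_bounded\<close>.\<close>
    then have "E R \<le> 3 / 64 * e\<^sup>2 + c * T\<^sup>2" using E young[OF e(1)] by linarith
    also have "\<dots> \<le> C0 + E (2 * R) / 16" unfolding e(2) C0_def using E_nonneg[of "2 * R"] by (auto simp: max_def)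
    finally show "E R \<le> C0 + E (2 * R) / 16" .
  qed
  have "E R \<le> 2 * C0" for R using E_mono[of R "max R R0"] bd[of "max R R0"] by simp
  then show ?thesis by blast
qed

text \<open>A bounded monotone energy has arbitrarily small tails. The order of choices matters:
  \<delta> from y, then R0 from \<delta>, then bounds of the fixed solution on radius 2 R0, and
  finally R large.\<close>

lemma Y_small:
  assumes y: "0 < y"
  shows "eventually (\<lambda>R. YYS R \<le> nn R ^ 4 * y) at_top"
proof -
  obtain D where D: "\<And>R. E R \<le> D" using E_bounded by blast
  define e where "e = sqrt (max 1 D)"
  have e: "1 \<le> e" "\<And>R. E R \<le> e\<^sup>2" using D by (auto simp: e_def intro: order_trans[OF D])
  define Y0 where "Y0 = 4 * k0 MM * e powr (6 / (s + 6))"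
  define S0 where "S0 = 5 * k0 MM * sC * e"
  define c1 where "c1 = 2 * MM * (S0 powr (6 / s - 1) * Y0 powr (1 - (6 / s - 1)))"
  have c1: "0 \<le> c1" using MM1 by (simp add: c1_def)
  \<comment> \<open>Leaves the far-field contribution below half of y^3; c1 + 1 avoids division by
    zero.\<close>
  define \<delta> where "\<delta> = (y ^ 3 / (2 * lC * (c1 + 1)))\<^sup>2"
  have lc: "0 < 2 * lC * (c1 + 1)" using lsC_ge_1 c1 by (intro mult_pos_pos) auto
  have q: "0 < y ^ 3 / (2 * lC * (c1 + 1))" using y by (intro divide_pos_pos lc) auto
  have sd: "sqrt \<delta> = y ^ 3 / (2 * lC * (c1 + 1))" unfolding \<delta>_def real_sqrt_abs by (rule abs_of_pos[OF q])
  have \<delta>: "0 < \<delta>" unfolding \<delta>_def by (rule zero_less_power[OF q])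
  have lt: "lC * (c1 * sqrt \<delta>) < y ^ 3"
  proof -
    have "lC * (c1 * sqrt \<delta>) = (c1 / (c1 + 1)) * (y ^ 3 / 2)" using lsC_ge_1 unfolding sd by (simp add: mult.assoc)
    also have "\<dots> \<le> 1 * (y ^ 3 / 2)" using c1 y by (intro mult_right_mono) auto
    also have "\<dots> < y ^ 3" using y by simp
    finally show ?thesis .
  qed
  \<comment> \<open>R0 is a radius at which the energy is within \<delta> of its supremum.\<close>
  obtain R0 where R0: "0 < R0" "\<And>R. E R \<le> E R0 + \<delta>"
  proof -
    define S where "S = (SUP R. E R)"
    have bdd: "bdd_above (range E)" using D by (intro bdd_aboveI2) auto
    have "S - \<delta> < S" using \<delta> by simp
    then obtain R where R: "S - \<delta> < E R" unfolding S_def using less_cSUP_iff[OF _ bdd] by (metis UNIV_not_empty UNIV_I)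
    have "E R' \<le> E (max R 1) + \<delta>" for R'
      using cSUP_upper[OF UNIV_I bdd, of R'] R E_mono[of R "max R 1"] by (simp add: S_def)
    then show ?thesis by (intro that[of "max R 1"]) auto
  qed
  \<comment> \<open>The solution at scale 1 provides near-field bounds independent of R.\<close>
  interpret S1: unit_sol "1 / 1" "US 1" "BS 1" "\<lambda>x. P (1 *\<^sub>R x)" "FS 1" "HS 1" by (rule sol) simp
  obtain G0 where G0: "\<And>x. norm x \<le> 2 * R0 \<Longrightarrow> S1.vG x \<le> G0"
  proof -
    have "bounded (S1.vG ` cball 0 (2 * R0))" by (intro compact_imp_bounded compact_continuous_image continuous_intros) auto
    then show ?thesis using that by (fastforce simp: bounded_iff)
  qed
  obtain a0 where a0: "\<And>x. norm x \<le> 2 * R0 \<Longrightarrow> S1.va x \<le> a0"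
  proof -
    have "bounded (S1.va ` cball 0 (2 * R0))" by (intro compact_imp_bounded compact_continuous_image continuous_intros) auto
    then show ?thesis using that by (fastforce simp: bounded_iff)
  qed
  define c3 where "c3 = G0 * a0 * MM * (unit_ball_vol 3 * (2 * R0) ^ 3) powr (1 - 1 / s)"
  define h where "h R = lC * (c1 * sqrt \<delta> + c3 * nn R powr (4 - 12 / s) + MM * Y0\<^sup>2 * nn R)" for R
  have "((\<lambda>R. nn R powr (4 - 12 / s)) \<longlongrightarrow> 0) at_top"
    by (rule tendsto_zero_powrI[OF nn_tendsto tendsto_const]) (use s in \<open>auto simp: nn_def field_simps\<close>)
  then have "(h \<longlongrightarrow> lC * (c1 * sqrt \<delta> + c3 * 0 + MM * Y0\<^sup>2 * 0)) at_top"
    unfolding h_def[abs_def] by (intro tendsto_intros nn_tendsto)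
  then have "eventually (\<lambda>R. h R < y ^ 3) at_top" using lt by (intro order_tendstoD(2)) auto
  then show ?thesis using eventually_ge_at_top[of "max 1 R0"]
  proof eventually_elim
    case (elim R)
    then have R: "1 \<le> R" "R0 \<le> R" by auto
    interpret S: unit_sol "1 / R" "US R" "BS R" "\<lambda>x. P (R *\<^sub>R x)" "FS R" "HS R" by (rule sol[OF R(1)])
    have n6: "nn R ^ 6 = 1 / R" by (rule nn[OF R(1)])
    have k: "R0 * nn R ^ 6 \<le> 2" unfolding n6 using R by (simp add: divide_le_eq)
    have nx: "norm (R *\<^sub>R x) \<le> 2 * R0" if "norm x \<le> 2 * (R0 * nn R ^ 6)" for x :: "real^3"
      using that R unfolding n6 by (simp add: field_simps)
    have G: "S.vG x \<le> G0 / nn R ^ 6" if "norm x \<le> 2 * (R0 * nn R ^ 6)" for x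
    proof -
      have "S.vG x = R * S1.vG (R *\<^sub>R x)"
        unfolding S.vG_def S1.vG_def pdS using R
        by (simp add: power_mult_distrib sum_distrib_left[symmetric] distrib_left[symmetric] real_sqrt_mult)
      also have "\<dots> \<le> R * G0" using R by (intro mult_left_mono G0 nx that) auto
      finally show ?thesis unfolding n6 using R by (simp add: mult.commute)
    qed
    have a: "S.va x \<le> a0" if "norm x \<le> 2 * (R0 * nn R ^ 6)" for x
      using a0[OF nx[OF that]] by (simp add: S.va_def S1.va_def US_def BS_def)
    have A: "Ln 2 2 S.vG \<le> nn R ^ 3 * e" using e by (intro energy_n_le R) auto
    have tl: "(Ln 2 2 S.vG)\<^sup>2 - (Ln (R0 * nn R ^ 6) 2 S.vG)\<^sup>2 \<le> nn R ^ 6 * \<delta>"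
    proof -
      have "R0 * nn R ^ 6 * R = R0" using R by (simp add: n6)
      then show ?thesis unfolding energy_n[OF R(1)] \<open>R0 * nn R ^ 6 * R = R0\<close> using mult_left_mono[OF R0(2)[of "2 * R"], of "nn R ^ 6"] nn(1)[OF R(1)]
        by (simp add: algebra_simps)
    qed
    have "S.vY 1 2 ^ 3 \<le> nn R ^ 12 * h R" unfolding h_def c1_def c3_def
      by (rule S.vY_small[OF s nn(1,2)[OF R(1)] e(1) MM1 A potential_n[OF R(1)] R0(1) k G a tl _ Y0_def S0_def]) (use \<delta> in auto)
    also have "\<dots> \<le> nn R ^ 12 * y ^ 3" using elim nn(1)[OF R(1)] by (intro mult_left_mono) auto
    also have "\<dots> = (nn R ^ 4 * y) ^ 3" by (simp add: power_mult_distrib power_mult[symmetric])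
    finally show ?case by (rule power_le_imp_le_base[of _ 2, simplified]) (use y nn(1)[OF R(1)] in auto)
  qed
qed

text \<open>Only now is \<open>l\<close> independent of the radius: it is first taken large, then y
  small, then R large; monotonicity carries the bound back to the given t.\<close>

lemma E_zero: "E t = 0"
proof -
  have "E t \<le> \<epsilon>" if \<epsilon>: "0 < \<epsilon>" for \<epsilon>
  proof -
    obtain D where D: "\<And>R. E R \<le> D" using E_bounded by blast
    define e where "e = sqrt (max 1 D)"
    have e: "1 \<le> e" "\<And>R. E R \<le> e\<^sup>2" using D by (auto simp: e_def intro: order_trans[OF D])
    define S0 where "S0 = 5 * k0 MM * sC * e"
    define \<theta> where "\<theta> = 6 / s - 1"
    have \<theta>: "\<theta> < 1" using s by (simp add: \<theta>_def field_simps)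
    have k0p: "0 < k0 MM" using k0_ge[OF MM1] by linarith
    have S0: "0 < S0" using k0p lsC_ge_1 e by (simp add: S0_def)
    \<comment> \<open>Makes the viscous cost of the corrector equal to \<epsilon>/4.\<close>
    define l where "l = 4 * mC * MM * e / \<epsilon>"
    have l: "0 < l" using mC_pos MM1 e \<epsilon> by (auto simp: l_def)
    have l2: "mC * (MM * e / l) = \<epsilon> / 4" using l mC_pos MM1 e \<epsilon> by (simp add: l_def)
    define h where "h y = mC * ((1 + MM) * e * y + y ^ 3 + 2 * MM * e * (S0 powr \<theta> * y powr (1 - \<theta>)) + l * y * e\<^sup>2 + 4 * e * S0 * y)" for y
    have id0: "((\<lambda>y::real. y) \<longlongrightarrow> 0) (at_right 0)" by (rule tendsto_ident_at)
    have "((\<lambda>y::real. y powr (1 - \<theta>)) \<longlongrightarrow> 0) (at_right 0)"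
      by (rule tendsto_zero_powrI[OF id0 tendsto_const]) (use \<theta> in \<open>auto simp: eventually_at_right_less intro: eventually_mono[OF eventually_at_right_less[of 0]]\<close>)
    then have "(h \<longlongrightarrow> mC * ((1 + MM) * e * 0 + 0 ^ 3 + 2 * MM * e * (S0 powr \<theta> * 0) + l * 0 * e\<^sup>2 + 4 * e * S0 * 0)) (at_right 0)"
      unfolding h_def[abs_def] by (intro tendsto_intros id0)
    then have "eventually (\<lambda>y. h y < \<epsilon> / 4) (at_right 0)" using \<epsilon> by (intro order_tendstoD(2)) auto
    then have "eventually (\<lambda>y. h y < \<epsilon> / 4 \<and> 0 < y) (at_right 0)" using eventually_at_right_less[of 0] by eventually_elim auto
    then obtain y where y: "h y < \<epsilon> / 4" "0 < y" using eventually_happens'[OF trivial_limit_at_right_real] by blast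
    have n2: "((\<lambda>R. l * (nn R)\<^sup>2) \<longlongrightarrow> l * 0\<^sup>2) at_top" by (intro tendsto_intros nn_tendsto)
    have "eventually (\<lambda>R. l * (nn R)\<^sup>2 < 1 / 16) at_top" using n2 by (intro order_tendstoD(2)) auto
    moreover have "eventually (\<lambda>R. mC * e\<^sup>2 * (l * (nn R)\<^sup>2) < \<epsilon> / 4) at_top"
      using tendsto_mult_left[OF n2, of "mC * e\<^sup>2"] \<epsilon> by (intro order_tendstoD(2)) auto
    moreover note Y_small[OF y(2)] eventually_ge_at_top[of "max 1 t"]
    ultimately have "eventually (\<lambda>R::real. E t \<le> \<epsilon>) at_top"
    proof eventually_elim
      case (elim R)
      then have R: "1 \<le> R" "t \<le> R" by auto
      interpret S: unit_sol "1 / R" "US R" "BS R" "\<lambda>x. P (R *\<^sub>R x)" "FS R" "HS R" by (rule sol[OF R(1)])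
      have A: "Ln 2 2 S.vG \<le> nn R ^ 3 * e" using e by (intro energy_n_le R) auto
      have "nn R ^ 6 * E (1 * R) \<le> nn R ^ 6 * (mC * ((1 + MM) * e * y + y ^ 3 + MM * e / l + l * (nn R)\<^sup>2 * e\<^sup>2
          + 2 * MM * e * (S0 powr (6 / s - 1) * y powr (1 - (6 / s - 1))) + l * y * e\<^sup>2 + 4 * e * S0 * y * nn R ^ 4))"
        unfolding energy_n[OF R(1), symmetric]
        by (rule S.energy_small[OF s nn(1,2)[OF R(1)] nn(3)[OF R(1), symmetric] e(1) MM1 A potential_n[OF R(1)] elim(3) y(2) l _ S0_def]) (use elim in auto)
      then have "E R \<le> mC * ((1 + MM) * e * y + y ^ 3 + MM * e / l + l * (nn R)\<^sup>2 * e\<^sup>2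
          + 2 * MM * e * (S0 powr \<theta> * y powr (1 - \<theta>)) + l * y * e\<^sup>2 + 4 * e * S0 * y * nn R ^ 4)"
        unfolding \<theta>_def using nn(1)[OF R(1)] by simp
      also have "\<dots> \<le> mC * ((1 + MM) * e * y + y ^ 3 + MM * e / l + l * (nn R)\<^sup>2 * e\<^sup>2
          + 2 * MM * e * (S0 powr \<theta> * y powr (1 - \<theta>)) + l * y * e\<^sup>2 + 4 * e * S0 * y * 1)"
        using mC_pos e S0 y nn[OF R(1)] by (intro mult_left_mono add_left_mono) (auto intro: power_le_one)
      also have "\<dots> = h y + mC * (MM * e / l) + mC * e\<^sup>2 * (l * (nn R)\<^sup>2)" by (simp add: h_def distrib_left mult_ac)
      also have "\<dots> \<le> \<epsilon>" unfolding l2 using y elim \<epsilon> by linarith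
      finally show ?case using E_mono[OF R(2)] by simp
    qed
    then show ?thesis by simp
  qed
  then have "E t \<le> 0" by (rule field_le_epsilon[of _ 0, simplified])
  then show ?thesis using E_nonneg[of t] by simp
qed

lemma gradients_zero: "pd i (\<lambda>y. u y $ k) x = 0" "pd i (\<lambda>y. B y $ k) x = 0"
proof -
  have nn0: "0 \<le> (\<Sum>i\<in>UNIV. (pd i (\<lambda>y. u y $ k) x)\<^sup>2 + (pd i (\<lambda>y. B y $ k) x)\<^sup>2)" for k :: 3 by (auto intro!: sum_nonneg)
  have "(\<Sum>k\<in>UNIV. \<Sum>i\<in>UNIV. (pd i (\<lambda>y. u y $ k) x)\<^sup>2 + (pd i (\<lambda>y. B y $ k) x)\<^sup>2) = 0"
    by (rule BM_zero_imp_zero[OF E_cont]) (use E_zero in \<open>auto simp: E_def intro!: sum_nonneg\<close>)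
  then have "(\<Sum>i\<in>UNIV. (pd i (\<lambda>y. u y $ k) x)\<^sup>2 + (pd i (\<lambda>y. B y $ k) x)\<^sup>2) = 0"
    using nn0 by (subst (asm) sum_nonneg_eq_0_iff) auto
  then have "(pd i (\<lambda>y. u y $ k) x)\<^sup>2 + (pd i (\<lambda>y. B y $ k) x)\<^sup>2 = 0"
    by (subst (asm) sum_nonneg_eq_0_iff) auto
  then show "pd i (\<lambda>y. u y $ k) x = 0" "pd i (\<lambda>y. B y $ k) x = 0" by (auto simp: sum_power2_eq_zero_iff)
qed

lemma zero_grad_const:
  fixes f :: "real^3 \<Rightarrow> real"
  assumes "smooth3 f" "\<And>i x. pd i f x = 0" shows "f x = f 0"
proof -
  have "(f has_derivative (\<lambda>h. 0)) (at x)" for x using has_derivative_pd[of f x] assms by simp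
  then show ?thesis by (metis has_derivative_zero_unique[of UNIV] UNIV_I convex_UNIV has_derivative_at_withinI)
qed

text \<open>Vanishing gradients leave constant fields. Constants keep the same L^3 norm on the unit
  ball at every scale, while \<open>Y_small\<close> forces it to tend to 0.\<close>

theorem trivial: "u x = 0" "B x = 0"
proof -
  have cu: "u x $ k = u 0 $ k" "B x $ k = B 0 $ k" for x k
    by (rule zero_grad_const[OF cs(1)], rule gradients_zero, rule zero_grad_const[OF cs(2)], rule gradients_zero)
  define a where "a = sqrt (\<Sum>k\<in>UNIV. (u 0 $ k)\<^sup>2 + (B 0 $ k)\<^sup>2)"
  have a0: "0 \<le> a" by (auto simp: a_def intro!: sum_nonneg)
  define v where "v = (\<integral>x. (1::real) \<partial>BM 1)"
  have v: "0 < v"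
  proof -
    have "ennreal v = (\<integral>\<^sup>+x. indicator (cball (0::real^3) 1) x * ennreal 1 \<partial>lborel)" unfolding v_def by (rule nn_integral_BM[of "\<lambda>_. 1" 1, symmetric]) auto
    also have "\<dots> = ennreal (unit_ball_vol 3)" using emeasure_cball3[of 1] by simp
    finally show ?thesis by (simp add: v_def BM_nonneg)
  qed
  \<comment> \<open>On the unit ball the cutoff equals 1, so the scaled L^3 norm there is that of
    the constant; the bound uses nn \<le> 1.\<close>
  have le: "a ^ 3 * v \<le> y ^ 3" if y: "0 < y" for y
  proof -
    obtain R where R: "1 \<le> R" "YYS R \<le> nn R ^ 4 * y"
      using eventually_happens'[OF _ eventually_conj[OF eventually_ge_at_top[of 1] Y_small[OF y]]] by (auto simp: trivial_limit_at_top_linorder)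
    interpret S: unit_sol "1 / R" "US R" "BS R" "\<lambda>x. P (R *\<^sub>R x)" "FS R" "HS R" by (rule sol[OF R(1)])
    have va: "S.va x = a" for x by (simp add: S.va_def a_def US_def BS_def cu[of "R *\<^sub>R x"])
    have r: "(1::real) \<le> 1" "1 < (2::real)" "(2::real) \<le> 2" by auto
    have c: "contU (\<lambda>x. S.zt 1 2 x * S.va x)" by (intro continuous_intros smooth3_cont[OF S.zt(1)[OF r]])
    have "a ^ 3 * v = (\<integral>x. \<bar>S.zt 1 2 x * S.va x\<bar> ^ 3 \<partial>BM 1)"
    proof -
      have "(\<integral>x. \<bar>S.zt 1 2 x * S.va x\<bar> ^ 3 \<partial>BM 1) = (\<integral>x. a ^ 3 * 1 \<partial>BM 1)"
        by (rule BM_cong) (use S.zt(4)[OF r] a0 in \<open>simp add: va\<close>)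
      then show ?thesis by (simp add: v_def)
    qed
    also have "\<dots> \<le> (\<integral>x. \<bar>S.zt 1 2 x * S.va x\<bar> ^ 3 \<partial>BM 2)" by (rule BM_subset) (auto intro!: continuous_intros c)
    also have "\<dots> = S.vY 1 2 ^ 3" using Ln_nat_powr[of 3 2 "\<lambda>x. S.zt 1 2 x * S.va x"] by (simp add: S.vY_def)
    also have "\<dots> \<le> (1 * y) ^ 3"
      using y nn[OF R(1)] by (intro power_mono order_trans[OF R(2)] mult_right_mono) (auto intro: power_le_one)
    finally show ?thesis by simp
  qed
  have "a = 0"
  proof (rule ccontr)
    assume "a \<noteq> 0"
    then have "0 < a ^ 3 * v" using a0 v by simp
    define y where "y = root 3 (a ^ 3 * v / 2)"
    have "y ^ 3 = a ^ 3 * v / 2" "0 < y" using \<open>0 < a ^ 3 * v\<close> by (auto simp: y_def)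
    then show False using le[of y] \<open>0 < a ^ 3 * v\<close> by linarith
  qed
  then have "(\<Sum>k\<in>UNIV. (u 0 $ k)\<^sup>2 + (B 0 $ k)\<^sup>2) = 0" by (simp add: a_def)
  then have "(u 0 $ k)\<^sup>2 + (B 0 $ k)\<^sup>2 = 0" for k by (subst (asm) sum_nonneg_eq_0_iff) auto
  then have z: "u 0 $ k = 0" "B 0 $ k = 0" for k by (auto simp: sum_power2_eq_zero_iff)
  have "u x $ k = 0" "B x $ k = 0" for k by (rule trans[OF cu(1) z(1)], rule trans[OF cu(2) z(2)])
  then show "u x = 0" "B x = 0" by (auto simp: vec_eq_iff)
qed

end

theorem theorem1p2:
  fixes u B :: "real^3 \<Rightarrow> real^3" and P :: "real^3 \<Rightarrow> real"
    and \<Phi> \<Psi> :: "real^3 \<Rightarrow> real^3^3" and s p C :: real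
  assumes "smooth3 u" "smooth3 B" "smooth3 P" "smooth3 \<Phi>" "smooth3 \<Psi>"
    and "\<forall>x. - lap u x + adv u u x = - grad P x + adv B B x"
    and "\<forall>x. - lap B x + adv u B x = adv B u x + curl (\<lambda>y. cross3 (curl B y) (B y)) x"
    and "\<forall>x. divg u x = 0" "\<forall>x. divg B x = 0"
    and "\<forall>x. rowdiv \<Phi> x = u x" "\<forall>x. rowdiv \<Psi> x = B x"
    and "3 < s" "s \<le> 6" "C > 0"
    and "\<forall>r>1. mean_osc \<Phi> r s + mean_osc \<Psi> r s \<le> C * r powr (1/3 - 1/s)"
    and "p > 3"
    and "(\<lambda>r. mean_osc B r p) \<in> o[at_top](\<lambda>r. r powr (((2 * s) / 3 + 1) * (1 / 3 - 1 / p)))"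
  shows "(\<forall>x. u x = 0) \<and> (\<forall>x. B x = 0)"
proof -
  interpret hall_growth u B P \<Phi> \<Psi> s p C by standard (use assms in auto)
  show ?thesis using trivial by blast
qed

end
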